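(* The gate $\mathrm{Or}$, which maps $|x\rangle|y\rangle\mapsto|x\rangle|y\oplus g(x)\rangle$ for $x\in\{0,1\}^n$, $y\in\{0,1\}$, with $g(x)=1$ if and only if $|x|>0$, belongs to $\mathrm{R\text{-}QNC}_{\mathrm f}^0$. In particular, $\mathrm{Or}$ can be approximated with one-sided error $\frac1n$ in constant depth and size $O(n^2\log n)$ (by quantum circuits with fan-out).
   Context: $|x|$ denotes the Hamming weight of a bit string $x$, and $n$ is the length of the input $x$. A quantum circuit is a sequence of quantum gates ordered into layers; gates in one layer are applied in parallel. The size of a gate is the number of qubits it acts on, the depth of a circuit is its number of layers, and its size is the total size of all its gates. Besides input/output qubits, a circuit may use ancilla qubits initialised to $|0\rangle$. The (unbounded) fan-out gate maps $|y_1\rangle\cdots|y_k\rangle|x\rangle\mapsto|y_1\oplus x\rangle\cdots|y_k\oplus x\rangle|x\rangle$, for any $k$, and counts as one gate. Circuits with fan-out use fan-out gates together with gates from a fixed universal basis (the Hadamard gate, a rotation by an irrational multiple of $\pi$, and the controlled-not gate). Circuit families are uniform: a description of the circuit for each input size is generated by a log-space Turing machine. $\mathrm{R\text{-}QNC}_{\mathrm f}^0$ is the class of operators approximated with one-sided polynomially small error by uniform families of quantum circuits with fan-out, of constant depth and polynomial size, over the fixed basis. One-sided error $\varepsilon$ for a Boolean function $g$ means that for one of the two values of $g(x)$ the measured output is correct with certainty, and for the other value it is correct with probability at least $1-\varepsilon$. *)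

theory Defs
  imports Complex_Main "HOL-Library.Landau_Symbols"
begin

section \<open>Quantum states, gates and circuits\<close>

text \<open>
  A computational basis state, and likewise a bit string, is written as the set of the positions
  that carry a 1; the Hamming weight is then the cardinality. A state is its amplitude function.
  Qubits are numbered from 0. For input length \<open>n\<close>, qubits \<open>0, \<dots>, n - 1\<close> hold \<open>x\<close>, qubit \<open>n\<close>
  holds \<open>y\<close>, and all higher qubits are ancillas.
\<close>

type_synonym qstate = "nat set \<Rightarrow> complex"

definition ket :: "nat set \<Rightarrow> qstate" where
  "ket S = (\<lambda>T. if T = S then 1 else 0)"

text \<open>
  \<open>CNot c t\<close> has control \<open>c\<close> and target \<open>t\<close>. \<open>FanOut c ts\<close> adds qubit \<open>c\<close> onto every qubit in \<open>ts\<close>.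
\<close>

datatype gate = Had nat | Rot nat | CNot nat nat | FanOut nat "nat list"

fun gate_qubits :: "gate \<Rightarrow> nat list" where
  "gate_qubits (Had q) = [q]"
| "gate_qubits (Rot q) = [q]"
| "gate_qubits (CNot c t) = [c, t]"
| "gate_qubits (FanOut c ts) = c # ts"

text \<open>
  The rotation is \<open>diag(1, exp(i\<theta>))\<close>. The basis permutations underlying \<open>CNot\<close> and \<open>FanOut\<close> are
  involutions, so no inverse appears in the amplitude formulas.
\<close>

fun apply_gate :: "real \<Rightarrow> gate \<Rightarrow> qstate \<Rightarrow> qstate" where
  "apply_gate \<theta> (Had q) \<psi> =
     (\<lambda>S. if q \<in> S then (\<psi> (S - {q}) - \<psi> S) / complex_of_real (sqrt 2)
          else (\<psi> S + \<psi> (insert q S)) / complex_of_real (sqrt 2))"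
| "apply_gate \<theta> (Rot q) \<psi> = (\<lambda>S. if q \<in> S then cis \<theta> * \<psi> S else \<psi> S)"
| "apply_gate \<theta> (CNot c t) \<psi> = (\<lambda>S. \<psi> (if c \<in> S then sym_diff S {t} else S))"
| "apply_gate \<theta> (FanOut c ts) \<psi> = (\<lambda>S. \<psi> (if c \<in> S then sym_diff S (set ts) else S))"

type_synonym layer = "gate list"

record circuit =
  num_qubits :: nat
  layers :: "layer list"

text \<open>
  Gates in one layer act on pairwise disjoint sets of qubits, so that they commute and the order in
  which they are listed is immaterial.
\<close>

definition valid_layer :: "nat \<Rightarrow> layer \<Rightarrow> bool" where
  "valid_layer N L \<longleftrightarrow>
     distinct (concat (map gate_qubits L)) \<and> set (concat (map gate_qubits L)) \<subseteq> {..<N}"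

definition valid_circuit :: "nat \<Rightarrow> circuit \<Rightarrow> bool" where
  "valid_circuit n C \<longleftrightarrow>
     n + 1 \<le> num_qubits C \<and> (\<forall>L\<in>set (layers C). valid_layer (num_qubits C) L)"

definition depth :: "circuit \<Rightarrow> nat" where
  "depth C = length (layers C)"

definition circuit_size :: "circuit \<Rightarrow> nat" where
  "circuit_size C = (\<Sum>g\<leftarrow>concat (layers C). length (gate_qubits g))"

definition run_circuit :: "real \<Rightarrow> circuit \<Rightarrow> qstate \<Rightarrow> qstate" where
  "run_circuit \<theta> C = fold (apply_gate \<theta>) (concat (layers C))"

text \<open>
  The probability that the circuit, started in the basis state \<open>w \<subseteq> {..n}\<close> of the input/output qubits
  with all ancillas in state 0, yields \<open>w'\<close> when the input/output qubits are measured.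
\<close>

definition outcome_prob :: "real \<Rightarrow> circuit \<Rightarrow> nat \<Rightarrow> nat set \<Rightarrow> nat set \<Rightarrow> real" where
  "outcome_prob \<theta> C n w w' =
     (\<Sum>S \<in> {S. S \<subseteq> {..<num_qubits C} \<and> S \<inter> {..n} = w'}. (cmod (run_circuit \<theta> C (ket w) S))\<^sup>2)"


section \<open>Log-space uniformity\<close>

text \<open>
  A multi-tape Turing machine with a read-only input tape holding \<open>1\<^sup>n\<close> between end markers,
  one-way infinite work tapes, and a write-only output. States and work symbols are natural numbers
  below \<open>num_states\<close> and \<open>num_symbols\<close>. State 0 is initial, symbol 0 is the blank, and the machine has
  halted once it enters the state \<open>num_states\<close>. The output alphabet \<open>'o\<close> is a parameter.
\<close>

datatype input_cell = LeftEnd | InputOne | RightEnd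

definition input_at :: "nat \<Rightarrow> nat \<Rightarrow> input_cell" where
  "input_at n p = (if p = 0 then LeftEnd else if p \<le> n then InputOne else RightEnd)"

datatype direction = MoveLeft | Stay | MoveRight

fun move :: "direction \<Rightarrow> nat \<Rightarrow> nat" where
  "move MoveLeft p = p - 1"
| "move Stay p = p"
| "move MoveRight p = p + 1"

text \<open>
  From the state, the input cell and the scanned work symbols, \<open>trans\<close> determines the next state, the
  move on the input tape, what to write and where to move on each work tape, and at most one output
  symbol.
\<close>

record 'o machine =
  num_states :: nat
  num_symbols :: nat
  num_tapes :: nat
  trans :: "nat \<Rightarrow> input_cell \<Rightarrow> nat list \<Rightarrow> nat \<times> direction \<times> (nat \<times> direction) list \<times> 'o option"

definition valid_machine :: "'o machine \<Rightarrow> bool" where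
  "valid_machine M \<longleftrightarrow>
     0 < num_states M \<and> 0 < num_symbols M \<and>
     (\<forall>q a ss. q < num_states M \<and> length ss = num_tapes M \<and> set ss \<subseteq> {..<num_symbols M} \<longrightarrow>
        (case trans M q a ss of (q', d, acts, e) \<Rightarrow>
           q' \<le> num_states M \<and> length acts = num_tapes M \<and> fst ` set acts \<subseteq> {..<num_symbols M}))"

text \<open>A work tape is given by its head position and its contents.\<close>

record 'o config =
  state :: nat
  input_pos :: nat
  work :: "(nat \<times> (nat \<Rightarrow> nat)) list"
  written :: "'o list"

definition initial_config :: "'o machine \<Rightarrow> 'o config" where
  "initial_config M =
     \<lparr>state = 0, input_pos = 0, work = replicate (num_tapes M) (0, \<lambda>_. 0), written = []\<rparr>"

definition step :: "'o machine \<Rightarrow> nat \<Rightarrow> 'o config \<Rightarrow> 'o config" where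
  "step M n c =
     (if num_states M \<le> state c then c
      else case trans M (state c) (input_at n (input_pos c)) (map (\<lambda>(p, t). t p) (work c)) of
        (q, d, acts, e) \<Rightarrow>
          \<lparr>state = q,
           input_pos = min (n + 1) (move d (input_pos c)),
           work = map2 (\<lambda>(p, t) (s, d'). (move d' p, t(p := s))) (work c) acts,
           written = written c @ (case e of None \<Rightarrow> [] | Some s \<Rightarrow> [s])\<rparr>)"

definition config_at :: "'o machine \<Rightarrow> nat \<Rightarrow> nat \<Rightarrow> 'o config" where
  "config_at M n t = (step M n ^^ t) (initial_config M)"

definition generates :: "'o machine \<Rightarrow> nat \<Rightarrow> 'o list \<Rightarrow> bool" where
  "generates M n s \<longleftrightarrow>
     (\<exists>t. num_states M \<le> state (config_at M n t) \<and> written (config_at M n t) = s)"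

text \<open>The number of work-tape cells ever visited; it is finite on inputs on which \<open>M\<close> halts.\<close>

definition space_used :: "'o machine \<Rightarrow> nat \<Rightarrow> nat" where
  "space_used M n = card {(i, p). i < num_tapes M \<and> (\<exists>t. p = fst (work (config_at M n t) ! i))}"

definition log_space_computable :: "(nat \<Rightarrow> 'o list) \<Rightarrow> bool" where
  "log_space_computable f \<longleftrightarrow>
     (\<exists>M. valid_machine M \<and> (\<forall>n. generates M n (f n)) \<and>
          (\<lambda>n. real (space_used M n)) \<in> O(\<lambda>n. ln (real n)))"

text \<open>
  Circuits are described by words over a finite alphabet, with numbers in unary. In a description of
  polynomial length the qubits can always be numbered by polynomially bounded numbers, so this
  choice does not affect which functions have log-space uniform circuits.
\<close>

datatype token = Tally | EndNumber | HadT | RotT | CNotT | FanOutT | EndLayer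

definition describe_nat :: "nat \<Rightarrow> token list" where
  "describe_nat k = replicate k Tally @ [EndNumber]"

fun describe_gate :: "gate \<Rightarrow> token list" where
  "describe_gate (Had q) = HadT # describe_nat q"
| "describe_gate (Rot q) = RotT # describe_nat q"
| "describe_gate (CNot c t) = CNotT # describe_nat c @ describe_nat t"
| "describe_gate (FanOut c ts) = FanOutT # describe_nat c @ concat (map describe_nat ts)"

definition describe_layer :: "layer \<Rightarrow> token list" where
  "describe_layer L = concat (map describe_gate L) @ [EndLayer]"

definition describe_circuit :: "circuit \<Rightarrow> token list" where
  "describe_circuit C = describe_nat (num_qubits C) @ concat (map describe_layer (layers C))"

definition uniform_family :: "(nat \<Rightarrow> circuit) \<Rightarrow> bool" where
  "uniform_family C \<longleftrightarrow>
     (\<forall>n. valid_circuit n (C n)) \<and> log_space_computable (\<lambda>n. describe_circuit (C n))"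


section \<open>Approximation with one-sided error\<close>

text \<open>
  A family of Boolean functions is a \<open>g\<close> such that \<open>g n\<close> is applied to bit strings \<open>x \<subseteq> {..<n}\<close>.
  \<open>xor_value g n\<close> is the map \<open>(x, y) \<mapsto> (x, y \<oplus> g(x))\<close> on basis states, which leaves qubits above \<open>n\<close>
  alone, and \<open>xor_gate g n\<close> is the corresponding operator. As the map is an involution, it can be
  applied directly to the argument of the amplitude function.
\<close>

definition xor_value :: "(nat \<Rightarrow> nat set \<Rightarrow> bool) \<Rightarrow> nat \<Rightarrow> nat set \<Rightarrow> nat set" where
  "xor_value g n w = (if g n (w \<inter> {..<n}) then sym_diff w {n} else w)"

definition xor_gate :: "(nat \<Rightarrow> nat set \<Rightarrow> bool) \<Rightarrow> nat \<Rightarrow> qstate \<Rightarrow> qstate" where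
  "xor_gate g n \<psi> = (\<lambda>S. \<psi> (xor_value g n S))"

text \<open>
  The value \<open>v\<close> of \<open>g\<close> for which the circuits never err is the same for all input lengths.
\<close>

definition one_sided_error ::
    "real \<Rightarrow> (nat \<Rightarrow> circuit) \<Rightarrow> (nat \<Rightarrow> nat set \<Rightarrow> bool) \<Rightarrow> (nat \<Rightarrow> real) \<Rightarrow> bool" where
  "one_sided_error \<theta> C g \<epsilon> \<longleftrightarrow>
     (\<exists>v. \<forall>n\<ge>1. \<forall>w\<subseteq>{..n}.
        (g n (w \<inter> {..<n}) = v \<longrightarrow> outcome_prob \<theta> (C n) n w (xor_value g n w) = 1) \<and>
        (g n (w \<inter> {..<n}) \<noteq> v \<longrightarrow> outcome_prob \<theta> (C n) n w (xor_value g n w) \<ge> 1 - \<epsilon> n))"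

definition constant_depth :: "(nat \<Rightarrow> circuit) \<Rightarrow> bool" where
  "constant_depth C \<longleftrightarrow> (\<exists>d. \<forall>n. depth (C n) \<le> d)"

definition polynomial_size :: "(nat \<Rightarrow> circuit) \<Rightarrow> bool" where
  "polynomial_size C \<longleftrightarrow> (\<exists>k. (\<lambda>n. real (circuit_size (C n))) \<in> O(\<lambda>n. real n ^ k))"

definition polynomially_small :: "(nat \<Rightarrow> real) \<Rightarrow> bool" where
  "polynomially_small \<epsilon> \<longleftrightarrow> (\<exists>k\<ge>1. \<epsilon> \<in> O(\<lambda>n. 1 / real n ^ k))"

text \<open>The class is taken over the basis whose rotation has angle \<open>\<theta>\<close>.\<close>

definition R_QNC_f0 :: "real \<Rightarrow> (nat \<Rightarrow> qstate \<Rightarrow> qstate) set" where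
  "R_QNC_f0 \<theta> =
     {xor_gate g | g. \<exists>C \<epsilon>. uniform_family C \<and> constant_depth C \<and> polynomial_size C \<and>
        polynomially_small \<epsilon> \<and> one_sided_error \<theta> C g \<epsilon>}"

definition or_fun :: "nat \<Rightarrow> nat set \<Rightarrow> bool" where
  "or_fun n x \<longleftrightarrow> card x > 0"

definition Or :: "nat \<Rightarrow> qstate \<Rightarrow> qstate" where
  "Or = xor_gate or_fun"

end

theory Submission
  imports Defs "HOL-Analysis.Analysis" "HOL-Real_Asymp.Real_Asymp" "Jordan_Normal_Form.Determinant"
begin

text \<open>The angle is free. The golden angle is taken for two algebraic facts:
  \<open>gph = cis golden_angle\<close> is a unit of degree 2 over \<rat>(sqrt 5), so that
  Liouville's inequality applies, and a nine-gate word inverts the rotation exactly up to a scalar,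
  as certainty on one side demands. Randomised parities reduce the or of n bits to that of m^3 bits,
  with m^3 of order log n; or gates of fan-in m on three levels do the rest. Such a gate is one
  round of amplitude amplification. Its phases are multiples of 2^h times the angle, and its failure
  amplitude is 1 - F*z^2/(4*2^L), where z is the squared distance of the phase from 1 and F/2^L is a
  tunable fraction. The obstacle is to find, in logarithmic space, a small multiplier with z at
  least about 2 or a z close to 4: the orbit of the angle under doubling must not come too near to
  0. For this the zero estimate serves to prove |gph^(2^j) - 1| \<ge> exp(-K*j^2). It is applied at
  j = m + 3, where j^2 must be of smaller order than log n; hence the cube root and the three
  levels.\<close>

unbundle no vec_syntax

section \<open>A zero estimate for exponential polynomials\<close>

lemma permutes_lessThan:
 fixes q :: "nat => nat" and k i :: nat
 shows "q permutes {0..<k} ==> i < k ==> q i < k"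
 by (metis atLeast0LessThan lessThan_iff permutes_in_image)

text \<open>A vector in the kernel of the transpose lists the coefficients of a polynomial of degree
  below \<open>k\<close> with \<open>k\<close> distinct roots.\<close>

lemma vandermonde_nonzero:
 fixes x :: "nat => complex"
 assumes "inj_on x {..<k}"
 shows "det (mat k k (%(i,c). x c^i)) ~= 0"
proof
 let ?V = "mat k k (%(i,c). x c^i)"
 assume "det ?V = 0"
 then have "det (transpose_mat ?V) = 0"
  by (subst det_transpose) auto
 then obtain v where v: "v \<in> carrier_vec k" "v ~= 0\<^sub>v k" "transpose_mat ?V *\<^sub>v v = 0\<^sub>v k"
  using det_0_iff_vec_prod_zero[of "transpose_mat ?V" k] by auto
 let ?p = "\<Sum>i<k. monom (v $ i) i"
 have root: "poly ?p (x c) = 0" if "c < k" for c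
 proof -
  have "(transpose_mat ?V *\<^sub>v v) $ c = 0" using v that by auto
  moreover have "(transpose_mat ?V *\<^sub>v v) $ c = (\<Sum>i<k. x c^i * v $ i)"
   using that v(1) by (auto simp: scalar_prod_def lessThan_atLeast0)
  ultimately show ?thesis by (simp add: poly_sum poly_monom mult.commute)
 qed
 have co: "coeff ?p i = v $ i" if "i < k" for i
  using that by (simp add: coeff_sum sum.delta)
 have "?p = 0"
 proof (rule ccontr)
  assume nz: "?p ~= 0"
  then have "k > 0" by (cases k) auto
  have "degree ?p <= k - 1"
   by (rule degree_sum_le) (auto intro: order.trans[OF degree_monom_le])
  moreover have "card (x ` {..<k}) <= card {z. poly ?p z = 0}"
   using root poly_roots_finite[OF nz] by (intro card_mono) auto
  moreover have "card (x ` {..<k}) = k" using assms by (simp add: card_image)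
  ultimately show False using card_poly_roots_bound[OF nz] \<open>k > 0\<close> by auto
 qed
 then have "v $ i = 0" if "i < k" for i using co[OF that] by simp
 then have "v = 0\<^sub>v k" using v(1) by (intro eq_vecI) auto
 with v(2) show False by simp
qed

text \<open>Shifting the points by one multiplies \<open>Y\<close> by \<open>t\<close>, so a nonzero polynomial with too many zeros
 yields a singular matrix of shifts at each of these zeros; its determinant is a polynomial in \<open>X\<close>
 whose leading coefficient is a Vandermonde determinant.\<close>
lemma zero_estimate:
 fixes p :: "nat => nat => complex" and t \<beta> :: complex
 assumes t: "t ~= 0" "!!k. 0 < k ==> t^k ~= 1"
  and inj: "inj_on (%(r,s). of_nat r + of_nat s * \<beta>) ({..<R - B} \<times> {..<S})"
  and zero: "!!r s. r < R ==> s < S ==>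
   (\<Sum>b<B. \<Sum>a<A. p a b*(of_nat r + of_nat s * \<beta>)^a*t^(b*r)) = 0"
  and big: "A*B < (R - B)*S"
  and ab: "a < A" "b < B"
 shows "p a b = 0"
proof (rule ccontr)
 assume nz: "p a b ~= 0"
 define P where "P b = (\<Sum>a<A. monom (p a b) a)" for b
 have coP: "coeff (P b) a = p a b" if "a < A" for a b
  using that by (simp add: P_def coeff_sum)
 have polyP: "poly (P b) x = (\<Sum>a<A. p a b*x^a)" for b x
  by (simp add: P_def poly_sum poly_monom)
 have degP: "degree (P b) < A" for b
 proof -
  have "degree (P b) <= A - 1"
   unfolding P_def by (rule degree_sum_le) (auto intro: order.trans[OF degree_monom_le])
  then show ?thesis using ab by auto
 qed
 \<comment> \<open>Only the \<open>b\<close> with \<open>P b\<close> nonzero give columns, since the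
   leading coefficients of the columns must not vanish.\<close>
 define bs where "bs = sorted_list_of_set {b. b < B & P b ~= 0}"
 define k where "k = length bs"
 have set_bs: "set bs = {b. b < B & P b ~= 0}" and dist: "distinct bs" by (auto simp: bs_def)
 have "b \<in> set bs" using nz coP[OF ab(1),of b] ab by (auto simp: set_bs)
 then have k0: "k > 0" by (auto simp: k_def)
 have kB: "k <= B"
 proof -
  have "card (set bs) <= card {..<B}" by (intro card_mono) (auto simp: set_bs)
  then show ?thesis using distinct_card[OF dist] by (simp add: k_def)
 qed
 have bsin: "bs ! c < B" "P (bs ! c) ~= 0" if "c < k" for c
  using that nth_mem[of c bs] by (auto simp: k_def set_bs)
 have sumbs: "(\<Sum>c<k. f (bs ! c)) = (\<Sum>b<B. f b)" if "!!b. P b = 0 ==> f b = 0" for f :: "nat => complex"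
 proof -
  have "(\<Sum>c<k. f (bs ! c)) = (\<Sum>b\<in>set bs. f b)"
   using dist by (simp add: k_def sum.distinct_set_conv_list sum_list_sum_nth lessThan_atLeast0)
  also have "... = (\<Sum>b<B. f b)"
   using that by (intro sum.mono_neutral_left) (auto simp: set_bs)
  finally show ?thesis .
 qed
 define Mf where "Mf i c = Polynomial.smult (t^(bs ! c*i)) (P (bs ! c) \<circ>\<^sub>p [:of_nat i,1:])" for i c
 define M where "M = mat k k (%(i,c). Mf i c)"
 have Mc: "M \<in> carrier_mat k k" by (simp add: M_def)
 define D where "D = det M"
 have polyMf: "poly (Mf i c) x = t^(bs ! c*i)*poly (P (bs ! c)) (x + of_nat i)" for i c x
  by (simp add: Mf_def poly_pcompose add.commute)
 have Mfnz: "Mf i c ~= 0" if "c < k" for i c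
  using bsin(2)[OF that] t(1) pcompose_eq_0_iff[of "[:of_nat i,1:]" "P (bs!c)"] by (simp add: Mf_def)
 have degMf: "degree (Mf i c) = degree (P (bs ! c))" for i c
  using t(1) by (simp add: Mf_def degree_pcompose)
 have lcMf: "lead_coeff (Mf i c) = t^(bs ! c*i)*lead_coeff (P (bs ! c))" for i c
  using lead_coeff_comp[of "[:of_nat i,1:]" "P (bs ! c)"] by (simp add: Mf_def lead_coeff_smult)
 \<comment> \<open>Pairing row \<open>i\<close> with the vector of the powers \<open>t^(b*r)\<close>
   gives the exponential polynomial at \<open>r + i\<close>. Since \<open>i < k\<close> and
   \<open>k \<le> B\<close>, the known zeros cover all rows when \<open>r < R - B\<close>.\<close>
 have root: "poly D (of_nat r + of_nat s * \<beta>) = 0" if rs: "r < R - B" "s < S" for r s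
 proof -
  let ?x = "of_nat r + of_nat s * \<beta>"
  let ?Mx = "mat k k (%(i,c). poly (Mf i c) ?x)"
  have "poly D ?x = det ?Mx"
   unfolding D_def det_def'[OF Mc] poly_sum
   by (subst det_def'[of _ k]) 
    (auto simp: poly_mult poly_prod M_def sign_def permutes_lessThan intro!: sum.cong prod.cong)
  moreover have "det ?Mx = 0"
  proof -
   let ?v = "vec k (%c. t^(bs ! c*r))"
   have "?Mx *\<^sub>v ?v = 0\<^sub>v k"
   proof (rule eq_vecI)
    fix i assume "i < dim_vec (0\<^sub>v k)"
    then have i: "i < k" by simp
    have "(?Mx *\<^sub>v ?v) $ i = (\<Sum>c<k. poly (Mf i c) ?x*t^(bs ! c*r))"
     using i by (auto simp: scalar_prod_def lessThan_atLeast0)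
    also have "... = (\<Sum>b<B. poly (P b) (?x + of_nat i)*t^(b*(r + i)))"
     by (subst sumbs[symmetric]) (auto simp: polyMf power_add algebra_simps)
    also have "... = (\<Sum>b<B. \<Sum>a<A. p a b*(of_nat (r + i) + of_nat s * \<beta>)^a*t^(b*(r + i)))"
     by (simp add: polyP sum_distrib_left sum_distrib_right algebra_simps)
    also have "... = 0" using rs i kB by (intro zero) auto
    finally show "(?Mx *\<^sub>v ?v) $ i = 0\<^sub>v k $ i" using i by simp
   qed auto
   moreover have "?v ~= 0\<^sub>v k"
   proof
    assume "?v = 0\<^sub>v k"
    then have "?v $ 0 = 0" using k0 by simp
    then show False using k0 t(1) by simp
   qed
   ultimately show ?thesis using det_0_iff_vec_prod_zero[of ?Mx k]
    by (metis mat_carrier vec_carrier)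
  qed
  ultimately show ?thesis by simp
 qed
 \<comment> \<open>The entries of one column differ only by a shift and a power of \<open>t\<close>,
   so they share their degree and every term of the Leibniz formula has the same degree
   \<open>m\<close>. The coefficients at \<open>m\<close> therefore add up to a determinant
   again.\<close>
 define m where "m = (\<Sum>c<k. degree (P (bs ! c)))"
 have trm: "degree (\<Prod>i = 0..<k. Mf i (q i)) = m &
   lead_coeff (\<Prod>i = 0..<k. Mf i (q i)) = (\<Prod>i=0..<k. t^(bs ! q i*i))*(\<Prod>c<k. lead_coeff (P (bs ! c)))"
  if q: "q permutes {0..<k}" for q
 proof -
  have "degree (\<Prod>i = 0..<k. Mf i (q i)) = (\<Sum>i = 0..<k. degree (P (bs ! q i)))"
   using q by (subst degree_prod_eq_sum_degree) (auto simp: degMf permutes_lessThan intro!: Mfnz)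
  also have "... = m"
   unfolding m_def using sum.permute[OF q,of "%c. degree (P (bs ! c))"]
   by (simp add: o_def lessThan_atLeast0)
  finally have 1: "degree (\<Prod>i = 0..<k. Mf i (q i)) = m" .
  have "(\<Prod>i=0..<k. lead_coeff (P (bs ! q i))) = (\<Prod>c<k. lead_coeff (P (bs ! c)))"
   using prod.permute[OF q,of "%c. lead_coeff (P (bs ! c))"] by (simp add: o_def lessThan_atLeast0)
  then show ?thesis using 1 by (auto simp: lead_coeff_prod lcMf prod.distrib)
 qed
 have "coeff D m = (\<Prod>c<k. lead_coeff (P (bs ! c)))*det (mat k k (%(i,c). (t^(bs ! c))^i))"
 proof -
  have "coeff D m = (\<Sum>q | q permutes {0..<k}. signof q*coeff (\<Prod>i = 0..<k. Mf i (q i)) m)"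
   unfolding D_def det_def'[OF Mc] coeff_sum
   by (intro sum.cong refl) (auto simp: M_def sign_def permutes_lessThan)
  also have "... = (\<Sum>q | q permutes {0..<k}. (\<Prod>c<k. lead_coeff (P (bs ! c))) *
    (signof q*(\<Prod>i=0..<k. (t^(bs ! q i))^i)))"
  proof (intro sum.cong refl)
   fix q assume "q \<in> {q. q permutes {0..<k}}"
   then have "coeff (\<Prod>i = 0..<k. Mf i (q i)) m
     = (\<Prod>i=0..<k. t^(bs ! q i*i))*(\<Prod>c<k. lead_coeff (P (bs ! c)))"
    using trm[of q] by auto
   then show "signof q*coeff (\<Prod>i = 0..<k. Mf i (q i)) m = (\<Prod>c<k. lead_coeff (P (bs ! c))) *
    (signof q*(\<Prod>i=0..<k. (t^(bs ! q i))^i))" unfolding power_mult by (simp add: mult_ac)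
  qed
  also have "... = (\<Prod>c<k. lead_coeff (P (bs ! c)))*det (mat k k (%(i,c). (t^(bs ! c))^i))"
   unfolding sum_distrib_left[symmetric]
   by (subst det_def'[of _ k]) (auto simp: permutes_lessThan intro!: sum.cong prod.cong arg_cong2[of _ _ _ _ "(*)"])
  finally show ?thesis .
 qed
 moreover have "(\<Prod>c<k. lead_coeff (P (bs ! c))) ~= 0" using bsin by auto
 moreover have "inj_on (%c. t^(bs ! c)) {..<k}"
 proof (rule linorder_inj_onI)
  fix c d assume "c < d" "c \<in> {..<k}" "d \<in> {..<k}"
  moreover have "sorted_wrt (<) bs" by (simp add: bs_def strict_sorted_list_of_set)
  ultimately have "bs ! c < bs ! d" by (auto simp: sorted_wrt_iff_nth_less k_def)
  then have "t^(bs ! d) = t^(bs ! c)*t^(bs ! d - bs ! c)" "t^(bs ! d - bs ! c) ~= 1"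
   using t(2) by (auto simp flip: power_add)
  then show "t^(bs ! c) ~= t^(bs ! d)" using t(1) by simp
 qed auto
 ultimately have D0: "coeff D m ~= 0" using vandermonde_nonzero by auto
 then have Dnz: "D ~= 0" by auto
 have mAB: "m <= A*B"
 proof -
  have "m <= (\<Sum>c<k. A)" unfolding m_def using degP by (intro sum_mono) (simp add: less_imp_le)
  also have "... <= A*B" using kB by simp
  finally show ?thesis .
 qed
 have "degree D <= m"
  unfolding D_def det_def'[OF Mc]
 proof (rule degree_sum_le)
  show "finite {q. q permutes {0..<k}}" by (simp add: finite_permutations)
  fix q assume q: "q \<in> {q. q permutes {0..<k}}"
  have "(\<Prod>i = 0..<k. M $$ (i,q i)) = (\<Prod>i = 0..<k. Mf i (q i))"
   using q by (auto simp: M_def permutes_lessThan intro!: prod.cong)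
  then show "degree (signof q*(\<Prod>i = 0..<k. M $$ (i,q i))) <= m"
   using trm[of q] q by (auto simp: sign_def)
 qed
 moreover have "card ((%(r,s). of_nat r + of_nat s * \<beta>) ` ({..<R - B} \<times> {..<S})) <= card {z. poly D z = 0}"
  using root poly_roots_finite[OF Dnz] by (intro card_mono) auto
 moreover have "card ((%(r,s). of_nat r + of_nat s * \<beta>) ` ({..<R - B} \<times> {..<S})) = (R - B)*S"
  using inj by (simp add: card_image)
 ultimately show False using card_poly_roots_bound[OF Dnz] mAB big by linarith
qed

section \<open>The golden angle and Liouville's inequality in \<int>[sqrt 5]\<close>

definition golden_angle :: real where
 "golden_angle = arccos ((sqrt 5 - 1)/2)"

abbreviation gph :: complex where "gph \<equiv> cis golden_angle"

lemma sqrt5_bounds: "2.2 < sqrt 5" "sqrt 5 < 2.3"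
 by (rule real_less_rsqrt,simp add: power2_eq_square) (rule real_less_lsqrt,auto simp: power2_eq_square)

lemma cos_golden: "cos golden_angle = (sqrt 5 - 1)/2"
 unfolding golden_angle_def using sqrt5_bounds by (intro cos_arccos) auto

lemma golden_angle_bounds: "1/2 < golden_angle" "golden_angle < 2"
proof -
 have pos: "0 < golden_angle" "golden_angle < pi"
  using arccos_lt_bounded[of "(sqrt 5 - 1)/2"] sqrt5_bounds by (auto simp: golden_angle_def)
 have "golden_angle < pi/2"
 proof (rule ccontr)
  assume "\<not> golden_angle < pi/2"
  then have "cos golden_angle <= cos (pi/2)" using pos by (intro cos_monotone_0_pi_le) auto
  then show False using sqrt5_bounds by (simp add: cos_golden)
 qed
 then show "golden_angle < 2" using pi_half_less_two by linarith
 have "sin golden_angle^2 = 1 - cos golden_angle^2" by (simp add: sin_squared_eq)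
 also have "... = (sqrt 5 - 1)/2"
  unfolding cos_golden power_divide power2_diff by (simp add: field_simps)
 finally have "sin golden_angle^2 > (1/2)^2" using sqrt5_bounds by (simp add: power2_eq_square)
 then have "sin golden_angle > 1/2"
  using pos by (intro power2_less_imp_less[of "1/2"]) (auto intro: sin_ge_zero)
 then show "1/2 < golden_angle" using sin_x_le_x[of golden_angle] pos by linarith
qed

text \<open>The trace \<open>t^k + t^{-k}\<close> and its conjugate under \<open>sqrt 5 \<mapsto> - sqrt 5\<close>.\<close>

fun trace_pair :: "nat => int \<times> int" where
 "trace_pair 0 = (2,0)"
| "trace_pair (Suc 0) = (-1,1)"
| "trace_pair (Suc (Suc k)) = (case trace_pair (Suc k) of (a,b) => case trace_pair k of (c,d) =>
   (5*b - a - c,a - b - d))"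

definition trace_val :: "real => nat => real" where
 "trace_val s k = of_int (fst (trace_pair k)) + of_int (snd (trace_pair k)) * s"

lemma trace_val_simps: "trace_val s 0 = 2" "trace_val s (Suc 0) = s - 1"
 by (auto simp: trace_val_def)

lemma trace_val_rec: "s * s = 5 ==> trace_val s (Suc (Suc k)) = (s - 1)*trace_val s (Suc k) - trace_val s k"
 by (auto simp: trace_val_def algebra_simps split: prod.splits)

lemma trace_val_cos: "trace_val (sqrt 5) k = 2*cos (real k*golden_angle)"
proof (induction k rule: induct_nat_012)
 case (ge2 k)
 have "cos (real (Suc (Suc k))*golden_angle) + cos (real k*golden_angle)
   = 2*cos (real (Suc k)*golden_angle)*cos golden_angle"
  by (simp add: cos_plus_cos algebra_simps add_divide_distrib)
 then show ?case using ge2 by (subst trace_val_rec) (auto simp: cos_golden algebra_simps)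
qed (auto simp: trace_val_simps cos_golden)

text \<open>The conjugate recursion multiplies by \<open>sqrt 5 + 1 < 3.3\<close> in absolute value
  and subtracts the value two steps back, and 3.3*4 + 1 \<le> 16.\<close>

lemma trace_conj_bound: "\<bar>trace_val (- sqrt 5) k\<bar> <= 2*4^k"
proof (induction k rule: induct_nat_012)
 case (ge2 k)
 have "\<bar>trace_val (- sqrt 5) (Suc (Suc k))\<bar> <= (sqrt 5 + 1) * \<bar>trace_val (- sqrt 5) (Suc k)\<bar> + \<bar>trace_val (- sqrt 5) k\<bar>"
 proof (subst trace_val_rec)
  have "\<bar>- sqrt 5 - 1\<bar> = sqrt 5 + 1" using sqrt5_bounds by linarith
  then show "\<bar>(- sqrt 5 - 1)*trace_val (- sqrt 5) (Suc k) - trace_val (- sqrt 5) k\<bar>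
    <= (sqrt 5 + 1) * \<bar>trace_val (- sqrt 5) (Suc k)\<bar> + \<bar>trace_val (- sqrt 5) k\<bar>"
   by (metis abs_mult abs_triangle_ineq4)
 qed simp
 also have "... <= 3.3*(2*4^Suc k) + 2*4^k"
  using ge2 sqrt5_bounds by (intro add_mono mult_mono) auto
 also have "... <= 2*4^Suc (Suc k)" by simp
 finally show ?case .
qed (use sqrt5_bounds in \<open>auto simp: trace_val_simps\<close>)

text \<open>This keeps \<open>gph\<close> from being a root of unity: \<open>gph^k = 1\<close>
  forces the trace 2, whose conjugate is again 2, while the conjugate traces grow. The correction at
  \<open>k = 0\<close> is there because the sequence starts with 2 and
  \<open>sqrt 5 + 1 < 4\<close>.\<close>

lemma trace_conj_growth: "2 * \<bar>trace_val (- sqrt 5) k\<bar> <= \<bar>trace_val (- sqrt 5) (Suc k)\<bar> + (if k = 0 then 1 else 0)"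
proof (induction k rule: induct_nat_012)
 case (ge2 k)
 have "(sqrt 5 + 1) * \<bar>trace_val (- sqrt 5) (Suc (Suc k))\<bar> = \<bar>trace_val (- sqrt 5) (Suc (Suc (Suc k))) + trace_val (- sqrt 5) (Suc k)\<bar>"
 proof -
  have "\<bar>- sqrt 5 - 1\<bar> = sqrt 5 + 1" using sqrt5_bounds by linarith
  moreover have "trace_val (- sqrt 5) (Suc (Suc (Suc k))) + trace_val (- sqrt 5) (Suc k)
    = (- sqrt 5 - 1)*trace_val (- sqrt 5) (Suc (Suc k))"
   using trace_val_rec[of "- sqrt 5" "Suc k"] by simp
  ultimately show ?thesis by (simp add: abs_mult)
 qed
 also have "... <= \<bar>trace_val (- sqrt 5) (Suc (Suc (Suc k)))\<bar> + \<bar>trace_val (- sqrt 5) (Suc k)\<bar>" by linarith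
 finally have "3 * \<bar>trace_val (- sqrt 5) (Suc (Suc k))\<bar> <= \<bar>trace_val (- sqrt 5) (Suc (Suc (Suc k)))\<bar> + \<bar>trace_val (- sqrt 5) (Suc k)\<bar>"
  using sqrt5_bounds mult_right_mono[of 3 "sqrt 5 + 1" "\<bar>trace_val (- sqrt 5) (Suc (Suc k))\<bar>"] by auto
 then show ?case using ge2 by simp
next
 case 1
 have "trace_val (- sqrt 5) (Suc (Suc 0)) = (- sqrt 5 - 1)*(- sqrt 5 - 1) - 2"
  by (subst trace_val_rec) (auto simp: trace_val_simps)
 also have "... = 4 + 2 * sqrt 5" by (simp add: algebra_simps)
 finally show ?case using sqrt5_bounds by (simp add: trace_val_simps)
qed (use sqrt5_bounds in \<open>auto simp: trace_val_simps\<close>)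

text \<open>Otherwise \<open>a^2 = 5*b^2\<close> with both sides nonzero, and 5 divides the left
  side to an even power but the right side to an odd one.\<close>

lemma int_sqrt5_eq_0:
 fixes a b :: int
 assumes "of_int a + of_int b * sqrt 5 = (0 :: real)"
 shows "a = 0 & b = 0"
proof (rule ccontr)
 assume "\<not> (a = 0 & b = 0)"
 then have b: "b ~= 0" using assms by auto
 have "(of_int a)\<^sup>2 = (of_int b)\<^sup>2*(5 :: real)"
  using assms by (simp add: eq_neg_iff_add_eq_0[symmetric] power_mult_distrib)
 then have eq: "a^2 = 5*b^2" by (metis (mono_tags,lifting) mult.commute of_int_eq_iff of_int_mult of_int_numeral of_int_power)
 then have a: "a ~= 0" using b by auto
 have p: "prime_elem (5 :: int)" by (intro prime_imp_prime_elem) (auto simp: prime_int_numeral_eq)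
 have "multiplicity 5 (a^2) = 2*multiplicity 5 a"
  by (intro prime_elem_multiplicity_power_distrib p a)
 moreover have "multiplicity 5 (5*b^2) = 1 + 2*multiplicity 5 b"
  using b p by (subst prime_elem_multiplicity_mult_distrib) (auto simp: prime_elem_multiplicity_power_distrib)
 ultimately have "2*multiplicity 5 a = 1 + 2*multiplicity 5 b" using eq by simp
 then show False by presburger
qed

text \<open>The product of the two conjugates is the integer \<open>a^2 - 5*b^2\<close>, which is
  nonzero because neither factor vanishes.\<close>

lemma int_sqrt5_lower:
 fixes a b :: int
 assumes "of_int a + of_int b * sqrt 5 ~= (0 :: real)"
 shows "1 <= \<bar>of_int a + of_int b * sqrt 5\<bar> * \<bar>of_int a - of_int b * sqrt 5 :: real\<bar>"
proof -
 have "of_int a - of_int b * sqrt 5 ~= (0::real)"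
  using int_sqrt5_eq_0[of a "-b"] assms by auto
 moreover have eq: "(of_int a + of_int b * sqrt 5)*(of_int a - of_int b * sqrt 5) = (of_int (a^2 - 5*b^2) :: real)"
  by (simp add: algebra_simps power2_eq_square)
 ultimately have "a^2 - 5*b^2 ~= 0" using assms by (metis mult_eq_0_iff of_int_eq_0_iff)
 then have "1 <= \<bar>of_int (a^2 - 5*b^2) :: real\<bar>" by (metis of_int_1_le_iff of_int_abs zero_less_abs_iff int_one_le_iff_zero_less)
 then show ?thesis using eq by (metis abs_mult)
qed

lemma gph_power_neq_1: "0 < k ==> gph^k ~= 1"
proof
 assume k: "0 < k" and "gph^k = 1"
 then have "cis (real k*golden_angle) = 1" by (metis Complex.DeMoivre)
 then have "cos (real k*golden_angle) = 1" by (metis cis.simps(1) one_complex.simps(1))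
 then have "trace_val (sqrt 5) k = 2" by (simp add: trace_val_cos)
 then have "of_int (fst (trace_pair k) - 2) + of_int (snd (trace_pair k)) * sqrt 5 = 0"
  by (simp add: trace_val_def)
 from int_sqrt5_eq_0[OF this] have "trace_val (- sqrt 5) k = 2" by (simp add: trace_val_def)
 moreover have "\<bar>trace_val (- sqrt 5) (Suc k)\<bar> > 2" for k
 proof (induction k)
  case (Suc k)
  then show ?case using trace_conj_growth[of "Suc k"] by simp
 qed (use sqrt5_bounds in \<open>simp add: trace_val_simps\<close>)
 ultimately show False using k by (metis Suc_pred abs_numeral less_irrefl)
qed

lemma golden_irrational: "golden_angle/pi \<notin> \<rat>"
proof
 assume "golden_angle/pi \<in> \<rat>"
 then obtain p q :: int where q: "q > 0" and "golden_angle/pi = of_int p/of_int q"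
  by (metis Rats_cases' of_int_0_less_iff)
 then have "golden_angle * of_int q = pi * of_int p" by (simp add: field_simps)
 then have "real (2*nat q)*golden_angle = 2*pi * of_int p" using q by (simp add: mult_ac)
 then have "gph^(2*nat q) = cis (2*pi * of_int p)" by (metis Complex.DeMoivre)
 also have "... = 1" by (rule cis_multiple_2pi) auto
 finally show False using gph_power_neq_1[of "2*nat q"] q by auto
qed

text \<open>The cross terms involve only traces, so the squared modulus lies in \<int>[sqrt 5];
  reading \<open>sqrt 5\<close> as a variable in this expression gives its conjugate.\<close>

lemma norm_sum_gph:
 fixes q :: "nat => int"
 shows "(cmod (\<Sum>i<D. of_int (q i)*gph^i))\<^sup>2
   = (\<Sum>i<D. of_int (q i)^2) + (\<Sum>i<D. \<Sum>k<i. of_int (q i*q k)*trace_val (sqrt 5) (i - k))"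
proof (induction D)
 case (Suc D)
 let ?s = "\<Sum>i<D. of_int (q i)*gph^i"
 have sq: "(cmod (x + y))\<^sup>2 = (cmod x)\<^sup>2 + (cmod y)\<^sup>2 + 2 * Re (x*cnj y)" for x y
  unfolding cmod_power2 by (simp add: power2_eq_square algebra_simps)
 have "(cmod (?s + of_int (q D)*gph^D))\<^sup>2
   = (cmod ?s)\<^sup>2 + of_int (q D)^2 + 2 * Re (?s*cnj (of_int (q D)*gph^D))"
  unfolding sq[of ?s] by (simp add: norm_mult norm_power)
 also have "2 * Re (?s*cnj (of_int (q D)*gph^D)) = (\<Sum>k<D. of_int (q D*q k)*trace_val (sqrt 5) (D - k))"
  unfolding sum_distrib_right Re_sum sum_distrib_left
 proof (rule sum.cong[OF refl])
  fix k assume "k \<in> {..<D}"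
  then have *: "gph^D = gph^k*gph^(D - k)" by (simp flip: power_add)
  have "gph^k*cnj (gph^k) = 1" by (metis complex_norm_square norm_cis norm_power of_real_1 one_power2 power_one)
  then have "gph^k*cnj (gph^D) = cnj (gph^(D - k))" by (simp add: * mult.assoc[symmetric])
  then have "Re (of_int (q k)*gph^k*cnj (of_int (q D)*gph^D)) = of_int (q k) * of_int (q D) * Re (cnj (gph^(D - k)))"
   by (simp add: mult_ac)
  also have "Re (cnj (gph^(D - k))) = cos (real (D - k)*golden_angle)" by (simp only: Complex.DeMoivre cnj.simps cis.simps)
  finally show "2 * Re (of_int (q k)*gph^k*cnj (of_int (q D)*gph^D)) = of_int (q D*q k)*trace_val (sqrt 5) (D - k)"
   by (simp add: trace_val_cos)
 qed
 finally show ?case using Suc by simp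
qed auto

text \<open>Liouville's inequality: the norm of the algebraic integer \<open>\<bar>Q(t)\<bar>\<^sup>2 \<in> \<int>[sqrt 5]\<close> is at least 1.\<close>
lemma liouville_gph:
 fixes q :: "nat => int"
 assumes "(\<Sum>i<D. of_int (q i)*gph^i) ~= 0"
 shows "1 <= cmod (\<Sum>i<D. of_int (q i)*gph^i)*(2^D*(\<Sum>i<D. \<bar>of_int (q i)\<bar>))"
proof -
 \<comment> \<open>\<open>V (sqrt 5)\<close> is the squared modulus and \<open>V (- sqrt 5)\<close>
   its conjugate; both come from the same integers \<open>a\<close> and \<open>b\<close>.\<close>
 define V where "V s = (\<Sum>i<D. of_int (q i)^2) + (\<Sum>i<D. \<Sum>k<i. of_int (q i*q k)*trace_val s (i - k))" for s :: real
 define a where "a = (\<Sum>i<D. q i^2) + (\<Sum>i<D. \<Sum>k<i. q i*q k*fst (trace_pair (i - k)))"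
 define b where "b = (\<Sum>i<D. \<Sum>k<i. q i*q k * snd (trace_pair (i - k)))"
 have V: "V s = of_int a + of_int b * s" for s
  by (simp add: V_def a_def b_def trace_val_def sum.distrib sum_distrib_left sum_distrib_right algebra_simps)
 let ?L = "\<Sum>i<D. \<bar>of_int (q i)\<bar> :: real"
 have V1: "V (sqrt 5) = (cmod (\<Sum>i<D. of_int (q i)*gph^i))\<^sup>2" by (simp add: V_def norm_sum_gph)
 \<comment> \<open>Every conjugate trace is at most \<open>2*4^D\<close>, and the square of the
   coefficient sum contains each mixed product twice.\<close>
 have V2: "\<bar>V (- sqrt 5)\<bar> <= 4^D*?L\<^sup>2"
 proof -
  have sq: "?L\<^sup>2 = (\<Sum>i<D. of_int (q i)^2) + (\<Sum>i<D. \<Sum>k<i. 2 * \<bar>of_int (q i*q k)\<bar>)"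
  proof -
   have "(\<Sum>i<d. \<bar>of_int (q i)\<bar>)\<^sup>2 = (\<Sum>i<d. of_int (q i)^2) + (\<Sum>i<d. \<Sum>k<i. 2 * \<bar>of_int (q i*q k)\<bar> :: real)" for d
   proof (induction d)
    case (Suc d)
    have "(\<Sum>k<d. 2 * \<bar>of_int (q d*q k)\<bar>) = 2*(\<Sum>k<d. \<bar>of_int (q k)\<bar> :: real) * \<bar>of_int (q d)\<bar>"
     by (simp add: sum_distrib_left sum_distrib_right abs_mult mult_ac)
    then show ?case using Suc by (simp add: power2_sum)
   qed auto
   then show ?thesis .
  qed
  have "\<bar>V (- sqrt 5)\<bar> <= \<bar>\<Sum>i<D. of_int (q i)^2\<bar> + \<bar>\<Sum>i<D. \<Sum>k<i. of_int (q i*q k)*trace_val (- sqrt 5) (i - k)\<bar>"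
   unfolding V_def by (rule abs_triangle_ineq)
  also have "\<bar>\<Sum>i<D. of_int (q i)^2\<bar> <= 4^D*(\<Sum>i<D. of_int (q i)^2 :: real)"
   using mult_right_mono[of 1 "4^D" "\<Sum>i<D. of_int (q i)^2 :: real"] by (simp add: sum_nonneg)
  also have "\<bar>\<Sum>i<D. \<Sum>k<i. of_int (q i*q k)*trace_val (- sqrt 5) (i - k)\<bar>
    <= (\<Sum>i<D. \<Sum>k<i. 4^D*(2 * \<bar>of_int (q i*q k)\<bar>))"
  proof (intro order.trans[OF sum_abs] sum_mono)
   fix i k assume ik: "i \<in> {..<D}" "k \<in> {..<i}"
   have "\<bar>trace_val (- sqrt 5) (i - k)\<bar> <= 2*4^(i - k)" by (rule trace_conj_bound)
   also have "... <= 2*4^D" using ik by (intro mult_left_mono power_increasing) auto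
   finally have "\<bar>of_int (q i*q k)\<bar> * \<bar>trace_val (- sqrt 5) (i - k)\<bar> <= \<bar>of_int (q i*q k)\<bar>*(2*4^D)"
    by (rule mult_left_mono) auto
   then show "\<bar>of_int (q i*q k)*trace_val (- sqrt 5) (i - k)\<bar> <= 4^D*(2 * \<bar>of_int (q i*q k)\<bar>)"
    by (simp add: abs_mult mult_ac)
  qed
  finally show ?thesis unfolding sq by (simp add: sum_distrib_left distrib_left)
 qed
 have "V (sqrt 5) ~= 0" using assms V1 by simp
 then have "1 <= \<bar>V (sqrt 5)\<bar> * \<bar>V (- sqrt 5)\<bar>"
  using int_sqrt5_lower[of a b] unfolding V by simp
 also have "... <= V (sqrt 5)*(4^D*?L\<^sup>2)"
  using V1 V2 by (intro mult_mono) auto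
 also have "... = (cmod (\<Sum>i<D. of_int (q i)*gph^i)*(2^D*?L))\<^sup>2"
  by (simp add: V1 power_mult_distrib power_mult[symmetric] mult.commute power2_eq_square power_mult_distrib[symmetric])
 finally show ?thesis
  by (metis one_power2 power2_le_imp_le mult_nonneg_nonneg norm_ge_zero sum_nonneg abs_ge_zero zero_le_power zero_le_numeral)
qed

section \<open>An auxiliary function with small integer coefficients\<close>

lemma exp_tail_bound:
 fixes z :: complex
 shows "cmod (exp z - (\<Sum>k<K. z^k/fact k)) <= exp (exp 1*cmod z - real K)"
proof -
 have s: "(%k. z^k/fact k) sums exp z"
  using exp_converges[of z] by (simp add: scaleR_conv_of_real field_simps)
 have "(%k. z^(k + K)/fact (k + K)) sums (exp z - (\<Sum>k<K. z^k/fact k))"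
  using sums_split_initial_segment[OF s,of K] by simp
 then have eq: "exp z - (\<Sum>k<K. z^k/fact k) = (\<Sum>k. z^(k + K)/fact (k + K))"
  by (simp add: sums_iff)
 define y where "y = exp 1*cmod z"
 have sy: "(%k. y^k/fact k) sums exp y"
  using exp_converges[of y] by (simp add: field_simps)
 have sy': "summable (%k. exp (- real K)*(y^(k + K)/fact (k + K)))"
  using sums_split_initial_segment[OF sy,of K] by (intro summable_mult) (auto simp: sums_iff)
 \<comment> \<open>For indices from \<open>K\<close> on, \<open>exp (real K)\<close> is at most the
   same power of \<open>exp 1\<close>. So the tail is dominated by \<open>exp (- real K)\<close>
   times the exponential series at \<open>exp 1*cmod z\<close>.\<close>
 have le: "cmod (z^(k + K)/fact (k + K)) <= exp (- real K)*(y^(k + K)/fact (k + K))" for k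
 proof -
  have "exp (real K) <= exp 1^(k + K)" by (simp add: exp_of_nat_mult[symmetric])
  then have "exp (real K)*cmod z^(k + K) <= y^(k + K)"
   by (simp add: y_def power_mult_distrib mult_right_mono)
  then show ?thesis
   by (simp add: norm_divide norm_power exp_minus field_simps)
 qed
 have "cmod (\<Sum>k. z^(k + K)/fact (k + K)) <= (\<Sum>k. exp (- real K)*(y^(k + K)/fact (k + K)))"
  by (rule norm_suminf_le[OF le sy'])
 also have "... = exp (- real K)*(exp y - (\<Sum>k<K. y^k/fact k))"
  using sums_split_initial_segment[OF sy,of K] by (subst suminf_mult) (auto simp: sums_iff)
 also have "... <= exp (- real K)*exp y"
  by (intro mult_left_mono) (auto simp: y_def sum_nonneg)
 finally show ?thesis unfolding eq by (simp add: y_def exp_diff exp_minus field_simps)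
qed

lemma power_over_fact_le_exp:
 fixes y :: real assumes "0 <= y" shows "y^k/fact k <= exp y"
proof -
 have sy: "(%k. y^k/fact k) sums exp y"
  using exp_converges[of y] by (simp add: field_simps)
 have "(\<Sum>i\<in>{k}. y^i/fact i) <= (\<Sum>i. y^i/fact i)"
  using sy assms by (intro sum_le_suminf) (auto simp: sums_iff)
 then show ?thesis using sy by (simp add: sums_iff)
qed

text \<open>Pigeonhole on the first \<open>T\<close> Taylor coefficients produces an exponential polynomial
 with small integer coefficients that is small on a whole interval.\<close>
lemma small_exponential_polynomial:
 fixes A B T H :: nat and \<rho> \<sigma> \<Theta> M :: real
 assumes \<rho>: "1 <= \<rho>" and \<sigma>: "0 < \<sigma>" and \<Theta>: "0 <= \<Theta>" "\<Theta> <= 2" and AT: "A <= T"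
  and M: "M = real (A*B*H) * \<rho>^A*exp (2*B * \<rho>)"
  and pig: "((nat \<lfloor>2*M/\<sigma>\<rfloor> + 1)^2)^T < (H + 1)^(A*B)"
 obtains p :: "nat => nat => int" where
  "!!a b. \<bar>p a b\<bar> <= int H" and "\<exists>a<A. \<exists>b<B. p a b ~= 0"
  and "!!x. 0 <= x ==> x <= \<rho> ==>
    cmod (\<Sum>b<B. \<Sum>a<A. of_int (p a b) * of_real x^a*cis (real b * \<Theta>*x))
    <= 2 * \<sigma>*real T + real (A*B*H) * \<rho>^A*exp (2*exp 1*B * \<rho> + A - T)"
proof -
 \<comment> \<open>\<open>cf l a b\<close> is the Taylor coefficient of order \<open>l\<close> of
   \<open>X^a*exp(\<i>*b*\<Theta>*X)\<close>.\<close>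
 define cf where "cf l a b = (if a <= l then (\<i>*(of_nat b * of_real \<Theta>))^(l - a)/fact (l - a) else 0)" for l a b :: nat
 \<comment> \<open>The factor \<open>\<rho>^l\<close> scales the coefficients so that small
   \<open>tau\<close> means small values for \<open>0 \<le> x \<le> \<rho>\<close>.\<close>
 define tau where "tau p l = (\<Sum>b<B. \<Sum>a<A. of_int (p a b)*cf l a b) * of_real (\<rho>^l)" for p :: "nat => nat => int" and l
 have M0: "0 <= M" using \<rho> by (simp add: M)
 have tau_bound: "cmod (tau p l) <= M" if p: "!!a b. \<bar>p a b\<bar> <= int H" for p l
 proof -
  have "cmod (tau p l) <= (\<Sum>b<B. \<Sum>a<A. real H*(\<rho>^A*exp (2*B * \<rho>)))"
   unfolding tau_def sum_distrib_right
  proof (intro sum_norm_le)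
   fix b a assume ab: "b \<in> {..<B}" "a \<in> {..<A}"
   have "cmod (cf l a b) * \<rho>^l <= \<rho>^A*exp (2*B * \<rho>)"
   proof (cases "a <= l")
    case True
    have "cmod (cf l a b) * \<rho>^l = \<rho>^a*((b * \<Theta> * \<rho>)^(l - a)/fact (l - a))"
     using True \<rho> \<Theta> by (simp add: cf_def norm_divide norm_power norm_mult power_mult_distrib power_add[symmetric])
    also have "... <= \<rho>^A*exp (2*B * \<rho>)"
    proof (intro mult_mono)
     have "real b * \<Theta> <= real B*2" using ab \<Theta> by (intro mult_mono) auto
     then have "real b * \<Theta> * \<rho> <= real B*2 * \<rho>" using \<rho> by (intro mult_right_mono) auto
     then have "exp (b * \<Theta> * \<rho>) <= exp (2*B * \<rho>)" by (simp add: mult.commute)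
     then show "(b * \<Theta> * \<rho>)^(l - a)/fact (l - a) <= exp (2*B * \<rho>)"
      by (rule order.trans[OF power_over_fact_le_exp,rotated]) (use \<Theta> \<rho> in auto)
    qed (use ab \<rho> \<Theta> in \<open>auto intro!: power_increasing\<close>)
    finally show ?thesis .
   qed (use \<rho> in \<open>auto simp: cf_def\<close>)
   moreover have "real_of_int \<bar>p a b\<bar> <= real H" using p[of a b] by linarith
   ultimately show "cmod (of_int (p a b)*cf l a b * of_real (\<rho>^l)) <= real H*(\<rho>^A*exp (2*B * \<rho>))"
    using \<rho> mult_mono[of "real_of_int \<bar>p a b\<bar>" "real H" "cmod (cf l a b) * \<rho>^l" "\<rho>^A*exp (2*B * \<rho>)"]
    by (simp add: norm_mult mult.assoc norm_power)
  qed
  also have "... = M" by (simp add: M)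
  finally show ?thesis .
 qed
 define G where "G = nat \<lfloor>2*M/\<sigma>\<rfloor>"
 \<comment> \<open>Real and imaginary parts between \<open>-M\<close> and \<open>M\<close> are
   sorted into cells of length \<open>\<sigma>\<close>. Equal cells for the first \<open>T\<close>
   coefficients leave differences of at most \<open>\<sigma>\<close> in each part.\<close>
 define box where "box r = nat \<lfloor>(r + M)/\<sigma>\<rfloor>" for r
 define X where "X = PiE ({..<A} \<times> {..<B}) (%_. {0..H})"
 define ex :: "(nat \<times> nat => nat) => nat => nat => int"
  where "ex f a b = (if a < A & b < B then int (f (a,b)) else 0)" for f a b
 define \<Phi> where "\<Phi> f = restrict (%l. (box (Re (tau (ex f) l)),box (Im (tau (ex f) l)))) {..<T}" for f
 have exb: "\<bar>ex f a b\<bar> <= int H" if "f \<in> X" for f a b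
  using that by (auto simp: X_def ex_def PiE_def Pi_def)
 have boxG: "box r \<in> {0..G}" if "\<bar>r\<bar> <= M" for r
 proof -
  have "\<lfloor>(r + M)/\<sigma>\<rfloor> <= \<lfloor>2*M/\<sigma>\<rfloor>"
   using that \<sigma> by (intro floor_mono divide_right_mono) auto
  then show ?thesis by (auto simp: box_def G_def)
 qed
 have "\<Phi> ` X \<subseteq> PiE {..<T} (%_. {0..G} \<times> {0..G})"
 proof (clarify)
  fix f assume "f \<in> X"
  then have "cmod (tau (ex f) l) <= M" for l by (intro tau_bound exb)
  then have "\<bar>Re (tau (ex f) l)\<bar> <= M" "\<bar>Im (tau (ex f) l)\<bar> <= M" for l
   using abs_Re_le_cmod abs_Im_le_cmod order.trans by blast+
  then show "\<Phi> f \<in> PiE {..<T} (%_. {0..G} \<times> {0..G})"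
   using boxG unfolding \<Phi>_def by auto
 qed
 moreover have "card (PiE {..<T} (%_. {0..G} \<times> {0..G})) = ((G + 1)^2)^T"
  by (simp add: card_PiE power2_eq_square)
 moreover have "finite (PiE {..<T} (%_. {0..G} \<times> {0..G}))" by (intro finite_PiE) auto
 ultimately have "card (\<Phi> ` X) <= ((G + 1)^2)^T" by (metis card_mono)
 moreover have "card X = (H + 1)^(A*B)" by (simp add: X_def card_PiE)
 ultimately have "card (\<Phi> ` X) < card X" using pig by (simp add: G_def)
 then have "\<not> inj_on \<Phi> X" using pigeonhole by blast
 then obtain f g where fg: "f \<in> X" "g \<in> X" "f ~= g" "\<Phi> f = \<Phi> g" by (auto simp: inj_on_def)
 define p where "p a b = ex f a b - ex g a b" for a b
 show thesis
 proof
  show "\<bar>p a b\<bar> <= int H" for a b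
   using fg by (auto simp: p_def ex_def X_def PiE_def Pi_def) (smt (verit) lessThan_iff of_nat_0_le_iff of_nat_mono)+
  show "\<exists>a<A. \<exists>b<B. p a b ~= 0"
  proof (rule ccontr)
   assume "\<not> (\<exists>a<A. \<exists>b<B. p a b ~= 0)"
   then have "f x = g x" if "x \<in> {..<A} \<times> {..<B}" for x using that by (auto simp: p_def ex_def)
   then have "f = g" using fg(1,2) unfolding X_def by (rule PiE_ext[rotated 2])
   with fg show False by simp
  qed
  have tau_diff: "tau p l = tau (ex f) l - tau (ex g) l" for l
   by (simp add: tau_def p_def algebra_simps sum_subtractf)
  have tau_small: "cmod (tau p l) <= 2 * \<sigma>" if "l < T" for l
  proof -
   have near: "\<bar>r - r'\<bar> <= \<sigma>" if "box r = box r'" "\<bar>r\<bar> <= M" "\<bar>r'\<bar> <= M" for r r'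
   proof -
    have nn: "0 <= \<lfloor>(r + M)/\<sigma>\<rfloor>" "0 <= \<lfloor>(r' + M)/\<sigma>\<rfloor>" using that \<sigma> by auto
    then have "\<lfloor>(r + M)/\<sigma>\<rfloor> = \<lfloor>(r' + M)/\<sigma>\<rfloor>" using that(1) unfolding box_def by (simp only: eq_nat_nat_iff[OF nn])
    then have "\<bar>(r + M)/\<sigma> - (r' + M)/\<sigma>\<bar> <= 1" by linarith
    then have "\<bar>(r - r')/\<sigma>\<bar> <= 1" by (simp add: diff_divide_distrib add_divide_distrib)
    then show ?thesis using \<sigma> by (simp add: abs_divide field_simps)
   qed
   have "\<Phi> f l = \<Phi> g l" using fg by simp
   then have b: "box (Re (tau (ex f) l)) = box (Re (tau (ex g) l))" "box (Im (tau (ex f) l)) = box (Im (tau (ex g) l))"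
    using that by (auto simp: \<Phi>_def)
   have "\<bar>Re (tau h l)\<bar> <= M" "\<bar>Im (tau h l)\<bar> <= M" if "h = ex f \<or> h = ex g" for h
    using tau_bound[of h l] that exb fg abs_Re_le_cmod[of "tau h l"] abs_Im_le_cmod[of "tau h l"] by fastforce+
   then have "\<bar>Re (tau p l)\<bar> <= \<sigma>" "\<bar>Im (tau p l)\<bar> <= \<sigma>" using near b by (auto simp: tau_diff)
   then show ?thesis using cmod_le[of "tau p l"] by linarith
  qed
  have pH: "real_of_int \<bar>p a b\<bar> <= real H" for a b
   using \<open>!!a b. \<bar>p a b\<bar> <= int H\<close>[of a b] by linarith
  fix x :: real assume x: "0 <= x" "x <= \<rho>"
  \<comment> \<open>The inner sum stops at \<open>T - a\<close>, so that together with
    \<open>x^a\<close> exactly the Taylor terms of order below \<open>T\<close> remain; by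
    \<open>AT\<close> the subtraction is not truncated.\<close>
  define tr where "tr a b = of_real x^a*(\<Sum>k<T - a. (\<i> * of_real (b * \<Theta>*x))^k/fact k)" for a b :: nat
  have tr: "tr a b = (\<Sum>l<T. cf l a b * of_real x^l)" if "a < A" for a b
  proof -
   have "(\<Sum>l<T. cf l a b * of_real x^l) = (\<Sum>l\<in>{a..<T}. cf l a b * of_real x^l)"
    by (intro sum.mono_neutral_right) (auto simp: cf_def)
   also have "... = (\<Sum>k<T - a. cf (k + a) a b * of_real x^(k + a))"
    using that AT by (intro sum.reindex_bij_witness[of _ "%k. k + a" "%l. l - a"]) auto
   also have "... = tr a b"
    unfolding tr_def sum_distrib_left by (intro sum.cong) (auto simp: cf_def power_add power_mult_distrib)
   finally show ?thesis ..
  qed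
  have "(\<Sum>b<B. \<Sum>a<A. of_int (p a b)*tr a b) = (\<Sum>b<B. \<Sum>a<A. \<Sum>l<T. of_int (p a b)*(cf l a b * of_real x^l))"
   by (intro sum.cong refl) (simp add: tr sum_distrib_left)
  also have "... = (\<Sum>b<B. \<Sum>l<T. \<Sum>a<A. of_int (p a b)*(cf l a b * of_real x^l))"
   by (intro sum.cong refl sum.swap)
  also have "... = (\<Sum>l<T. \<Sum>b<B. \<Sum>a<A. of_int (p a b)*(cf l a b * of_real x^l))"
   by (rule sum.swap)
  also have "... = (\<Sum>l<T. tau p l * of_real ((x/\<rho>)^l))"
  proof (intro sum.cong refl)
   fix l
   have "tau p l * of_real ((x/\<rho>)^l) = (\<Sum>b<B. \<Sum>a<A. of_int (p a b)*cf l a b) * of_real x^l"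
    using \<rho> by (simp add: tau_def power_divide)
   then show "(\<Sum>b<B. \<Sum>a<A. of_int (p a b)*(cf l a b * of_real x^l)) = tau p l * of_real ((x/\<rho>)^l)"
    by (simp add: sum_distrib_right mult.assoc)
  qed
  finally have eq: "(\<Sum>b<B. \<Sum>a<A. of_int (p a b)*tr a b) = (\<Sum>l<T. tau p l * of_real ((x/\<rho>)^l))" .
  have "cmod (\<Sum>l<T. tau p l * of_real ((x/\<rho>)^l)) <= (\<Sum>l<T. 2 * \<sigma>)"
  proof (rule sum_norm_le)
   fix l assume "l \<in> {..<T}"
   moreover have "(x/\<rho>)^l <= 1" using x \<rho> by (intro power_le_one) auto
   ultimately show "cmod (tau p l * of_real ((x/\<rho>)^l)) <= 2 * \<sigma>"
    using tau_small[of l] x \<rho> mult_mono[of "cmod (tau p l)" "2 * \<sigma>" "(x/\<rho>)^l" 1] \<sigma>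
    by (simp only: norm_mult norm_of_real) auto
  qed
  then have 1: "cmod (\<Sum>b<B. \<Sum>a<A. of_int (p a b)*tr a b) <= 2 * \<sigma>*T"
   unfolding eq by (simp add: mult_ac)
  have "cmod (\<Sum>b<B. \<Sum>a<A. of_int (p a b)*(of_real x^a*cis (real b * \<Theta>*x) - tr a b))
    <= (\<Sum>b<B. \<Sum>a<A. real H*(\<rho>^A*exp (2*exp 1*B * \<rho> + A - T)))"
  proof (intro sum_norm_le)
   fix b a assume ab: "b \<in> {..<B}" "a \<in> {..<A}"
   have "of_real x^a*cis (real b * \<Theta>*x) - tr a b = of_real x^a*(exp (\<i> * of_real (b * \<Theta>*x)) - (\<Sum>k<T - a. (\<i> * of_real (b * \<Theta>*x))^k/fact k))"
    by (simp add: tr_def cis_conv_exp algebra_simps)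
   then have "cmod (of_real x^a*cis (real b * \<Theta>*x) - tr a b)
     = x^a*cmod (exp (\<i> * of_real (b * \<Theta>*x)) - (\<Sum>k<T - a. (\<i> * of_real (b * \<Theta>*x))^k/fact k))"
    using x by (simp only: norm_mult norm_power norm_of_real abs_of_nonneg)
   also have "... <= x^a*exp (exp 1*cmod (\<i> * of_real (b * \<Theta>*x)) - real (T - a))"
    using x by (intro mult_left_mono exp_tail_bound) auto
   also have "... <= \<rho>^A*exp (2*exp 1*B * \<rho> + A - T)"
   proof (intro mult_mono)
    have "x^a <= \<rho>^a" using x by (intro power_mono) auto
    also have "... <= \<rho>^A" using ab \<rho> by (intro power_increasing) auto
    finally show "x^a <= \<rho>^A" .
    have "real b * \<Theta> <= real B*2" using ab \<Theta> by (intro mult_mono) auto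
    then have "real b * \<Theta>*x <= real B*2 * \<rho>" by (rule mult_mono) (use x in auto)
    then have "exp 1*(real b * \<Theta>*x) <= exp 1*(real B*2 * \<rho>)" by (intro mult_left_mono) auto
    moreover have "exp 1*(real B*2 * \<rho>) = 2*exp 1*B * \<rho>" by simp
    moreover have "cmod (\<i> * of_real (b * \<Theta>*x)) = real b * \<Theta>*x"
     using x \<Theta> by (simp only: norm_mult norm_ii norm_of_real) simp
    moreover have "real (T - a) = real T - real a" "real a <= real A" using ab AT by (auto simp: of_nat_diff)
    ultimately show "exp (exp 1*cmod (\<i> * of_real (b * \<Theta>*x)) - real (T - a)) <= exp (2*exp 1*B * \<rho> + A - T)"
     by (simp only: exp_le_cancel_iff)
   qed (use \<rho> x in auto)
   finally show "cmod (of_int (p a b)*(of_real x^a*cis (real b * \<Theta>*x) - tr a b)) <= real H*(\<rho>^A*exp (2*exp 1*B * \<rho> + A - T))"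
    using pH[of a b] by (simp only: norm_mult norm_of_int) (intro mult_mono,auto)
  qed
  also have "... = real (A*B*H) * \<rho>^A*exp (2*exp 1*B * \<rho> + A - T)" by simp
  finally have 2: "cmod (\<Sum>b<B. \<Sum>a<A. of_int (p a b)*(of_real x^a*cis (real b * \<Theta>*x) - tr a b)) <= real (A*B*H) * \<rho>^A*exp (2*exp 1*B * \<rho> + A - T)" .
  have "(\<Sum>b<B. \<Sum>a<A. of_int (p a b) * of_real x^a*cis (real b * \<Theta>*x))
   = (\<Sum>b<B. \<Sum>a<A. of_int (p a b)*tr a b) + (\<Sum>b<B. \<Sum>a<A. of_int (p a b)*(of_real x^a*cis (real b * \<Theta>*x) - tr a b))"
   by (simp add: sum.distrib[symmetric] algebra_simps)
  then show "cmod (\<Sum>b<B. \<Sum>a<A. of_int (p a b) * of_real x^a*cis (real b * \<Theta>*x))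
    <= 2 * \<sigma>*real T + real (A*B*H) * \<rho>^A*exp (2*exp 1*B * \<rho> + A - T)"
   using norm_triangle_mono[OF 1 2] by simp
 qed
qed

text \<open>Up to \<open>pi/3\<close> the derivative of \<open>sin x - x/2\<close> is nonnegative,
  as \<open>cos\<close> is at least 1/2 there; beyond,
  \<open>sin x \<ge> sqrt 3/2 \<ge> pi/4 \<ge> x/2\<close>.\<close>

lemma half_le_sin: "0 <= x ==> x <= pi/2 ==> x/2 <= sin (x :: real)"
proof -
 assume x: "0 <= x" "x <= pi/2"
 have inc: "y/2 <= sin y" if "0 <= y" "y <= pi/3" for y :: real
 proof -
  have "(%x. sin x - x/2) 0 <= (%x. sin x - x/2) y"
  proof (rule DERIV_nonneg_imp_nondecreasing[OF that(1)])
   fix u assume "0 <= u" "u <= y"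
   then have "cos (pi/3) <= cos u" using that pi_gt_zero by (intro cos_monotone_0_pi_le) auto
   then show "\<exists>z. ((%x. sin x - x/2) has_real_derivative z) (at u) & 0 <= z"
    by (intro exI[of _ "cos u - 1/2"]) (auto intro!: derivative_eq_intros simp: cos_60)
  qed
  then show ?thesis by simp
 qed
 show ?thesis
 proof (cases "x <= pi/3")
  case False
  have "sin (pi/3) <= sin x" using False x pi_gt_zero by (intro sin_monotone_2pi_le) auto
  moreover have "pi/4 <= sqrt 3/2"
  proof -
   have "1.6 <= sqrt 3" by (rule real_le_rsqrt) (simp add: power2_eq_square)
   moreover have "pi < 3.2" using pi_approx(2) by simp
   ultimately show ?thesis by simp
  qed
  ultimately show ?thesis using x by (simp add: sin_60)
 qed (use inc x in auto)
qed

lemma cis_minus_1_eq: "cmod (cis y - 1) = 2 * \<bar>sin (y/2)\<bar>"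
proof -
 have "cos y = 1 - 2 * sin (y/2)^2" using cos_double_sin[of "y/2"] by simp
 then have "(cmod (cis y - 1))\<^sup>2 = (2 * \<bar>sin (y/2)\<bar>)\<^sup>2"
  using sin_cos_squared_add[of y] by (simp add: cmod_power2 power2_diff power_mult_distrib)
 then show ?thesis by (metis abs_ge_zero mult_nonneg_nonneg norm_ge_zero power2_eq_iff_nonneg zero_le_numeral)
qed

lemma cis_minus_1_le: "cmod (cis y - 1) <= \<bar>y\<bar>"
 unfolding cis_minus_1_eq using abs_sin_x_le_abs_x[of "y/2"] by simp

lemma cis_minus_1_ge: "\<bar>y\<bar> <= pi ==> \<bar>y\<bar> <= 2*cmod (cis y - 1)"
proof -
 assume "\<bar>y\<bar> <= pi"
 then have "\<bar>y\<bar>/2/2 <= sin (\<bar>y\<bar>/2)" by (intro half_le_sin) auto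
 moreover have "\<bar>sin (y/2)\<bar> \<ge> sin (\<bar>y\<bar>/2)" by (cases "y \<ge> 0") auto
 ultimately show ?thesis unfolding cis_minus_1_eq by linarith
qed

text \<open>Evaluated at the points \<open>r + s c/d\<close>, the small exponential polynomial takes values close to
 algebraic numbers, which must vanish by Liouville's inequality.\<close>
lemma golden_measure_aux:
 fixes A B R S T H c d :: nat and \<rho> \<sigma> M y :: real
 assumes cd: "1 <= c" "1 <= d" "c*golden_angle = 2*pi*d + y"
  and \<rho>: "1 <= \<rho>" "R + S*(c/d) <= \<rho>" and \<sigma>: "0 < \<sigma>" and AT: "A <= T"
  and M: "M = real (A*B*H) * \<rho>^A*exp (2*B * \<rho>)"
  and pig: "((nat \<lfloor>2*M/\<sigma>\<rfloor> + 1)^2)^T < (H + 1)^(A*B)"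
  and RS: "A*B < (R - B)*S"
  and inj: "R * \<bar>y\<bar>*2^(R + 2) < 1"
  and small: "real d^A*(2 * \<sigma>*real T + real (A*B*H) * \<rho>^A*exp (2*exp 1*B * \<rho> + A - T)
     + real (A*B*H) * \<rho>^A*(B*S * \<bar>y\<bar>))*(2^(B * R)*(real (A*B*H)*(d * \<rho>)^A)) < 1"
 shows False
proof -
 obtain p :: "nat => nat => int" where pH: "!!a b. \<bar>p a b\<bar> <= int H"
  and pnz: "\<exists>a<A. \<exists>b<B. p a b ~= 0"
  and psm: "!!x. 0 <= x ==> x <= \<rho> ==>
    cmod (\<Sum>b<B. \<Sum>a<A. of_int (p a b) * of_real x^a*cis (real b*golden_angle*x))
    <= 2 * \<sigma>*real T + real (A*B*H) * \<rho>^A*exp (2*exp 1*B * \<rho> + A - T)"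
  using small_exponential_polynomial[OF \<rho>(1) \<sigma> _ _ AT M pig,of golden_angle] golden_angle_bounds by auto
 have pH': "real_of_int \<bar>p a b\<bar> <= real H" for a b using pH[of a b] by linarith
 define \<beta> where "\<beta> = real c/real d"
 have \<beta>0: "0 <= \<beta>" by (simp add: \<beta>_def)
 define v where "v r s = (\<Sum>b<B. \<Sum>a<A. of_int (p a b) * of_real (r + s * \<beta>)^a*gph^(b*r))" for r s :: nat
 have range: "0 <= r + s * \<beta>" "r + s * \<beta> <= \<rho>" if "r < R" "s < S" for r s :: nat
 proof -
  have "s * \<beta> <= S * \<beta>" using that \<beta>0 by (intro mult_right_mono) auto
  then show "r + s * \<beta> <= \<rho>" using that \<rho>(2) by (simp add: \<beta>_def)
 qed (simp add: \<beta>0)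
 have v_small: "cmod (v r s) <= 2 * \<sigma>*real T + real (A*B*H) * \<rho>^A*exp (2*exp 1*B * \<rho> + A - T)
     + real (A*B*H) * \<rho>^A*(B*S * \<bar>y\<bar>)" if rs: "r < R" "s < S" for r s
 proof -
  let ?x = "r + s * \<beta>"
  let ?F = "\<Sum>b<B. \<Sum>a<A. of_int (p a b) * of_real ?x^a*cis (real b*golden_angle*?x)"
  \<comment> \<open>Because \<open>\<beta>*golden_angle = 2*pi + y/d\<close>, adding multiples of
    \<open>\<beta>\<close> to the argument changes the exponentials only by a factor near 1 that
    carries \<open>y\<close>.\<close>
  have cis_eq: "cis (real b*golden_angle*?x) = gph^(b*r)*cis (b * s*y/d)" for b
  proof -
   have "real b*golden_angle*?x = b*r*golden_angle + (b * s)*(c*golden_angle)/d"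
    by (simp add: \<beta>_def algebra_simps)
   also have "... = b*r*golden_angle + (2*pi * of_int (int (b * s)) + b * s*y/d)"
    using cd(2) unfolding cd(3) by (simp add: field_simps)
   finally have "cis (real b*golden_angle*?x) = cis (b*r*golden_angle)*(cis (2*pi * of_int (int (b * s)))*cis (b * s*y/d))"
    by (simp only: cis_mult)
   also have "cis (2*pi * of_int (int (b * s))) = 1" by (rule cis_multiple_2pi) auto
   finally show ?thesis by (simp add: Complex.DeMoivre)
  qed
  have "cmod (?F - v r s) <= (\<Sum>b<B. \<Sum>a<A. real H*(\<rho>^A*(B*S * \<bar>y\<bar>)))"
   unfolding v_def sum_subtractf[symmetric]
  proof (intro sum_norm_le)
   fix b a assume ab: "b \<in> {..<B}" "a \<in> {..<A}"
   have "of_int (p a b) * of_real ?x^a*cis (real b*golden_angle*?x) - of_int (p a b) * of_real ?x^a*gph^(b*r)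
    = of_int (p a b)*(of_real ?x^a*(gph^(b*r)*(cis (b * s*y/d) - 1)))"
    unfolding cis_eq by (simp add: algebra_simps)
   then have "cmod (of_int (p a b) * of_real ?x^a*cis (real b*golden_angle*?x) - of_int (p a b) * of_real ?x^a*gph^(b*r))
    = real_of_int \<bar>p a b\<bar>*(?x^a*cmod (cis (b * s*y/d) - 1))"
    using range[OF rs] by (simp only: norm_mult norm_power norm_of_real norm_of_int norm_cis) simp
   also have "... <= real H*(\<rho>^A*(B*S * \<bar>y\<bar>))"
   proof (intro mult_mono pH')
    have "?x^a <= \<rho>^a" using range[OF rs] by (intro power_mono) auto
    also have "... <= \<rho>^A" using ab \<rho> by (intro power_increasing) auto
    finally show "?x^a <= \<rho>^A" .
    have "cmod (cis (b * s*y/d) - 1) <= \<bar>b * s*y/d\<bar>" by (rule cis_minus_1_le)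
    also have "... <= \<bar>b * s*y\<bar>"
     using cd(2) frac_le[of "\<bar>b * s*y\<bar>" "\<bar>b * s*y\<bar>" 1 "real d"] by (simp add: abs_divide)
    also have "... <= B*S * \<bar>y\<bar>" using ab rs by (auto simp: abs_mult intro!: mult_mono)
    finally show "cmod (cis (b * s*y/d) - 1) <= B*S * \<bar>y\<bar>" .
   qed (use range[OF rs] \<rho> in auto)
   finally show "cmod (of_int (p a b) * of_real ?x^a*cis (real b*golden_angle*?x) - of_int (p a b) * of_real ?x^a*gph^(b*r))
     <= real H*(\<rho>^A*(B*S * \<bar>y\<bar>))" .
  qed
  also have "... = real (A*B*H) * \<rho>^A*(B*S * \<bar>y\<bar>)" by simp
  finally have "cmod (?F - v r s) <= real (A*B*H) * \<rho>^A*(B*S * \<bar>y\<bar>)" .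
  moreover have "cmod (v r s) <= cmod ?F + cmod (?F - v r s)"
   using norm_triangle_ineq4[of ?F "?F - v r s"] by simp
  ultimately show ?thesis using psm[OF range[OF rs]] by linarith
 qed
 have v0: "v r s = 0" if rs: "r < R" "s < S" for r s
 proof (rule ccontr)
  assume nz: "v r s ~= 0"
  \<comment> \<open>Multiplication by \<open>d^A\<close> clears the denominators of the powers of
    \<open>\<beta>\<close>; \<open>q i\<close> collects the integer coefficients of the resulting
    polynomial in \<open>gph\<close>, of degree below \<open>B*R\<close>.\<close>
  define q where "q i = (\<Sum>b<B. \<Sum>a<A. if b*r = i then p a b*(int d^(A - a)*(int r*int d + int s*int c)^a) else 0)" for i
  have Q: "(\<Sum>i<B*R. of_int (q i)*gph^i) = of_nat d^A * v r s"
  proof -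
   have "(\<Sum>i<B*R. of_int (q i)*gph^i) = (\<Sum>i<B*R. \<Sum>b<B. \<Sum>a<A. if b*r = i then
      of_int (p a b*(int d^(A - a)*(int r*int d + int s*int c)^a))*gph^(b*r) else 0)"
    unfolding q_def of_int_sum sum_distrib_right by (intro sum.cong refl) auto
   also have "... = (\<Sum>b<B. \<Sum>i<B*R. \<Sum>a<A. if b*r = i then
      of_int (p a b*(int d^(A - a)*(int r*int d + int s*int c)^a))*gph^(b*r) else 0)"
    by (rule sum.swap)
   also have "... = (\<Sum>b<B. \<Sum>a<A. \<Sum>i<B*R. if b*r = i then
      of_int (p a b*(int d^(A - a)*(int r*int d + int s*int c)^a))*gph^(b*r) else 0)"
    by (intro sum.cong refl sum.swap)
   also have "... = (\<Sum>b<B. \<Sum>a<A. of_int (p a b*(int d^(A - a)*(int r*int d + int s*int c)^a))*gph^(b*r))"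
   proof (intro sum.cong refl)
    fix b assume "b \<in> {..<B}"
    then have "b*r < B * R" using rs by (intro mult_strict_mono) auto
    then show "(\<Sum>i<B*R. if b*r = i then of_int (p a b*(int d^(A - a)*(int r*int d + int s*int c)^a))*gph^(b*r) else 0)
     = of_int (p a b*(int d^(A - a)*(int r*int d + int s*int c)^a))*gph^(b*r)" for a
     by simp
   qed
   also have "... = (\<Sum>b<B. \<Sum>a<A. of_nat d^A*(of_int (p a b) * of_real (r + s * \<beta>)^a*gph^(b*r)))"
   proof (intro sum.cong refl)
    fix b a assume "a \<in> {..<A}"
    then have "of_nat d^A = (of_nat d^(A - a) * of_nat d^a :: complex)" by (simp flip: power_add)
    moreover have "of_nat d*(of_real (r + s * \<beta>)) = (of_nat r * of_nat d + of_nat s * of_nat c :: complex)"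
     using cd(2) by (simp add: \<beta>_def field_simps)
    then have "of_nat d^a * of_real (r + s * \<beta>)^a = (of_nat r * of_nat d + of_nat s * of_nat c :: complex)^a"
     by (metis power_mult_distrib)
    ultimately show "of_int (p a b*(int d^(A - a)*(int r*int d + int s*int c)^a))*gph^(b*r)
      = of_nat d^A*(of_int (p a b) * of_real (r + s * \<beta>)^a*gph^(b*r))"
     by (simp add: mult_ac)
   qed
   finally show ?thesis by (simp add: v_def sum_distrib_left)
  qed
  have L: "(\<Sum>i<B*R. \<bar>of_int (q i)\<bar>) <= real (A*B*H)*(d * \<rho>)^A"
  proof -
   have "(\<Sum>i<B*R. \<bar>of_int (q i)\<bar>) <= (\<Sum>i<B*R. \<Sum>b<B. \<Sum>a<A. if b*r = i then real H*(d * \<rho>)^A else 0)"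
   proof (rule sum_mono)
    fix i
    have "\<bar>of_int (q i) :: real\<bar> <= (\<Sum>b<B. \<Sum>a<A. \<bar>if b*r = i then of_int (p a b*(int d^(A - a)*(int r*int d + int s*int c)^a)) else 0\<bar>)"
     unfolding q_def of_int_sum
     by (rule order.trans[OF sum_abs],intro sum_mono order.trans[OF sum_abs]) auto
    also have "... <= (\<Sum>b<B. \<Sum>a<A. if b*r = i then real H*(d * \<rho>)^A else 0)"
    proof (intro sum_mono)
     fix b a assume a: "a \<in> {..<A}"
     have "real_of_int \<bar>p a b\<bar>*(real d^(A - a)*real (r*d + s*c)^a) <= real H*(d * \<rho>)^A"
     proof (intro mult_mono pH')
      have "real (r*d + s*c) = d*(r + s * \<beta>)" using cd(2) by (simp add: \<beta>_def field_simps)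
      also have "... <= d * \<rho>" using range[OF rs] by (intro mult_left_mono) auto
      finally have "real d^(A - a)*real (r*d + s*c)^a <= (d * \<rho>)^(A - a)*(d * \<rho>)^a"
       using \<rho> by (intro mult_mono power_mono) (auto simp: mult_le_cancel_left1)
      also have "... = (d * \<rho>)^A" using a by (simp flip: power_add)
      finally show "real d^(A - a)*real (r*d + s*c)^a <= (d * \<rho>)^A" .
     qed auto
     then show "\<bar>if b*r = i then of_int (p a b*(int d^(A - a)*(int r*int d + int s*int c)^a)) else 0\<bar>
       <= (if b*r = i then real H*(d * \<rho>)^A else 0)"
      by (simp add: abs_mult power_abs)
    qed
    finally show "\<bar>of_int (q i)\<bar> <= (\<Sum>b<B. \<Sum>a<A. if b*r = i then real H*(d * \<rho>)^A else 0)" .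
   qed
   also have "... = (\<Sum>b<B. \<Sum>i<B*R. \<Sum>a<A. if b*r = i then real H*(d * \<rho>)^A else 0)"
    by (rule sum.swap)
   also have "... = (\<Sum>b<B. \<Sum>a<A. \<Sum>i<B*R. if b*r = i then real H*(d * \<rho>)^A else 0)"
    by (intro sum.cong refl sum.swap)
   also have "... <= (\<Sum>b<B. \<Sum>a<A. real H*(d * \<rho>)^A)"
    using \<rho> by (intro sum_mono) auto
   also have "... = real (A*B*H)*(d * \<rho>)^A" by simp
   finally show ?thesis .
  qed
  have "(\<Sum>i<B*R. of_int (q i)*gph^i) ~= 0" using nz cd(2) by (simp add: Q)
  from liouville_gph[OF this]
  have "1 <= real d^A*cmod (v r s)*(2^(B * R)*(\<Sum>i<B*R. \<bar>of_int (q i)\<bar>))"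
   by (simp add: Q norm_mult norm_power)
  also have "... <= real d^A*(2 * \<sigma>*real T + real (A*B*H) * \<rho>^A*exp (2*exp 1*B * \<rho> + A - T)
     + real (A*B*H) * \<rho>^A*(B*S * \<bar>y\<bar>))*(2^(B * R)*(real (A*B*H)*(d * \<rho>)^A))"
   using L v_small[OF rs] \<sigma> \<rho> by (intro mult_mono) (auto intro!: sum_nonneg add_nonneg_nonneg)
  finally show False using small by linarith
 qed
 \<comment> \<open>Two coinciding points would put some \<open>gph^k\<close> with
   \<open>0 < k < R\<close> within \<open>R*\<bar>y\<bar>\<close> of 1. Liouville's inequality for
   \<open>X^k - 1\<close>, whose coefficients have absolute sum 2, contradicts this by
   \<open>inj\<close>.\<close>
 have no_small_k: False if k: "0 < k" "k < R" "real k*c*golden_angle = 2*pi*real l*c + k*y" for k l :: nat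
 proof -
  have "k*golden_angle = 2*pi * of_int (int l) + k*y/c"
   using k(3) cd(1) by (simp add: field_simps)
  then have "gph^k = cis (2*pi * of_int (int l))*cis (k*y/c)"
   by (simp only: Complex.DeMoivre cis_mult)
  also have "cis (2*pi * of_int (int l)) = 1" by (rule cis_multiple_2pi) auto
  finally have "cmod (gph^k - 1) <= \<bar>k*y/c\<bar>" using cis_minus_1_le[of "k*y/c"] by simp
  also have "... <= R * \<bar>y\<bar>"
  proof -
   have "\<bar>k*y/c\<bar> <= \<bar>k*y\<bar>"
    using cd(1) frac_le[of "\<bar>k*y\<bar>" "\<bar>k*y\<bar>" 1 "real c"] by (simp add: abs_divide)
   also have "... <= R * \<bar>y\<bar>" using k by (auto simp: abs_mult intro!: mult_right_mono)
   finally show ?thesis .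
  qed
  finally have up: "cmod (gph^k - 1) <= R * \<bar>y\<bar>" .
  define q where "q i = (if i = k then 1 else if i = 0 then -1 else 0 :: int)" for i
  have Q: "(\<Sum>i<Suc k. of_int (q i)*gph^i) = gph^k - 1"
  proof -
   have "(\<Sum>i<Suc k. of_int (q i)*gph^i) = (\<Sum>i<k. of_int (q i)*gph^i) + gph^k" by (simp add: q_def)
   also have "(\<Sum>i<k. of_int (q i)*gph^i) = (\<Sum>i\<in>{0}. of_int (q i)*gph^i)"
    using k by (intro sum.mono_neutral_right) (auto simp: q_def)
   finally show ?thesis using k by (simp add: q_def)
  qed
  have L: "(\<Sum>i<Suc k. \<bar>of_int (q i)\<bar>) = (2 :: real)"
  proof -
   have "(\<Sum>i<Suc k. \<bar>of_int (q i)\<bar>) = (\<Sum>i<k. \<bar>of_int (q i)\<bar>) + (1 :: real)" by (simp add: q_def)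
   also have "(\<Sum>i<k. \<bar>of_int (q i)\<bar> :: real) = (\<Sum>i\<in>{0}. \<bar>of_int (q i)\<bar>)"
    using k by (intro sum.mono_neutral_right) (auto simp: q_def)
   finally show ?thesis using k by (simp add: q_def)
  qed
  have "(\<Sum>i<Suc k. of_int (q i)*gph^i) ~= 0" using gph_power_neq_1[OF k(1)] by (simp only: Q) simp
  from liouville_gph[OF this] have "1 <= cmod (gph^k - 1)*2^(k + 2)"
   unfolding Q L by simp
  also have "... <= R * \<bar>y\<bar>*2^(R + 2)" using up k by (intro mult_mono power_increasing) auto
  finally show False using inj by simp
 qed
 have inj': "r = r' & s = s'" if "r < R" "r' <= r" "real r + s * \<beta> = r' + s' * \<beta>" for r r' s s' :: nat
 proof -
  have eq: "real (r - r') = (real s' - s) * \<beta>" using that by (simp add: algebra_simps of_nat_diff)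
  show ?thesis
  proof (cases "r = r'")
   case True
   then show ?thesis using that(3) cd by (auto simp: \<beta>_def)
  next
   case False
   then have pos: "0 < r - r'" using that by simp
   have "s < s'"
   proof (rule ccontr)
    assume "\<not> s < s'"
    then have "(real s' - s) * \<beta> <= 0" using \<beta>0 by (intro mult_nonpos_nonneg) auto
    with eq pos show False by linarith
   qed
   then have "real (r - r')*d = real (s' - s)*c" using eq cd(2) by (simp add: \<beta>_def of_nat_diff field_simps)
   then have "2*pi*(real (r - r')*d) = 2*pi*(real (s' - s)*c)" by simp
   then have "real (r - r')*c*golden_angle = 2*pi*real (s' - s)*c + real (r - r')*y"
    by (simp only: mult.assoc cd(3)) (simp add: algebra_simps)
   then show ?thesis using no_small_k[of "r - r'" "s' - s"] pos that(1) by (metis less_imp_diff_less)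
  qed
 qed
 have "p a b = 0" if ab: "a < A" "b < B" for a b
 proof -
  have "complex_of_int (p a b) = 0"
  proof (rule zero_estimate[where \<beta> = "of_real \<beta>" and R = R and S = S and t = gph and A = A and B = B and p = "%a b. of_int (p a b)"])
   show "gph ~= 0" by simp
   show "inj_on (%(r,s). of_nat r + of_nat s*complex_of_real \<beta>) ({..<R - B} \<times> {..<S})"
   proof -
    have "r = r' & s = s'" if a: "r < R - B" "r' < R - B"
     and eq: "of_nat r + of_nat s*complex_of_real \<beta> = of_nat r' + of_nat s'*complex_of_real \<beta>" for r s r' s'
    proof -
     have "complex_of_real (r + s * \<beta>) = complex_of_real (r' + s' * \<beta>)" using eq by simp
     then have "r + s * \<beta> = r' + s' * \<beta>" by (simp only: of_real_eq_iff)
     then show ?thesis using inj'[of r r' s s'] inj'[of r' r s' s] a by (cases "r' <= r") linarith+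
    qed
    then show ?thesis by (auto simp: inj_on_def)
   qed
   fix r s assume "r < R" "s < S"
   then show "(\<Sum>b<B. \<Sum>a<A. of_int (p a b)*(of_nat r + of_nat s*complex_of_real \<beta>)^a*gph^(b*r)) = 0"
    using v0[of r s] by (simp add: v_def)
  qed (use gph_power_neq_1 RS ab in auto)
  then show ?thesis by simp
 qed
 with pnz show False by auto
qed

text \<open>A failure at \<open>j\<close> brings \<open>2^j\<close> times the angle extremely close
  to a multiple of \<open>2*pi\<close>. As the logarithm of \<open>c = 2^j\<close> is of order
  \<open>j\<close>, the degrees \<open>A\<close>, \<open>B\<close> and \<open>R\<close> can be
  proportional to \<open>j\<close> and all exponents in the comparison proportional to
  \<open>j^2\<close>, which gives the bound its shape.\<close>

lemma golden_measure:
 "\<exists>K>0. \<forall>\<^sub>F j in sequentially. exp (- (K*real j^2)) <= cmod (gph^(2^j) - 1)"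
proof (intro exI conjI)
 \<comment> \<open>\<open>K1\<close> exceeds \<open>8400/ln 2\<close> for the pigeonhole count,
   \<open>K3\<close> exceeds \<open>K1^2 + K1\<close> for the zero estimate, and
   \<open>w = K1*K3\<close> turns \<open>B*R\<close> into \<open>w*j^2\<close>.\<close>
 define K1 K3 w :: nat where "K1 = 14000" and "K3 = 200000000" and "w = 2800000000000"
 show "0 < 11*real w" by (simp add: w_def)
 have "\<forall>\<^sub>F j in sequentially. 16*real K3*real j <= exp (real j)" unfolding K3_def by real_asymp
 moreover have "\<forall>\<^sub>F j in sequentially. real w*real K1*real j^2 <= exp (real j^2)"
  unfolding K1_def w_def by real_asymp
 moreover have "\<forall>\<^sub>F j in sequentially. 2 <= j" by (rule eventually_ge_at_top)
 ultimately show "\<forall>\<^sub>F j in sequentially. exp (- (11*real w*real j^2)) <= cmod (gph^(2^j) - 1)"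
 proof eventually_elim
  case (elim j)
  show ?case
  proof (rule ccontr)
   assume "\<not> ?thesis"
   then have sm: "cmod (gph^(2^j) - 1) < exp (- (11*real w*real j^2))" by simp
   define J where "J = real j^2"
   have J4: "4 <= J" using elim(3) power_mono[of 2 "real j" 2] by (simp add: J_def)
   \<comment> \<open>\<open>d^A\<close>, \<open>\<rho>^A\<close>, \<open>H\<close> and
     \<open>2^(B*R)\<close> are each at most \<open>exp(w*J)\<close>, while
     \<open>exp(2*B*\<rho>)\<close> is \<open>exp(32*w*J)\<close>. The 100 in \<open>T\<close> beats
     \<open>exp 1*32 < 88\<close> in the Taylor tail, and the exponents 7 of \<open>\<sigma>\<close>
     and 10 of \<open>y\<close> beat the factors from Liouville's inequality.\<close>
   define A B R T H :: nat where "A = w*j" and "B = K1*j" and "R = K3*j" and "T = 100*w*j^2" and "H = 2^(w*j^2)"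
   \<comment> \<open>The interval must contain all points \<open>r + s*c/d\<close>, and
     \<open>c/d \<le> 15\<close> bounds them by \<open>16*R\<close>.\<close>
   define \<rho> \<sigma> where "\<rho> = 16*real K3*real j" and "\<sigma> = exp (- (7*w*J))"
   define c :: nat where "c = 2^j"
   \<comment> \<open>With the nearest integer, \<open>\<bar>y\<bar> \<le> pi\<close>, so that the
     distance of \<open>gph^c\<close> from 1 controls \<open>y\<close>.\<close>
   define d0 where "d0 = round (c*golden_angle/(2*pi))"
   define y where "y = c*golden_angle - 2*pi*d0"
   define M where "M = real (A*B*H) * \<rho>^A*exp (2*B * \<rho>)"
   have wJ: "1 <= real w*J" using J4 by (simp add: w_def)
   have y_pi: "\<bar>y\<bar> <= pi"
   proof -
    have "\<bar>c*golden_angle/(2*pi) - d0\<bar> <= 1/2"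
     unfolding d0_def by (metis of_int_round_abs_le abs_minus_commute)
    then have "\<bar>c*golden_angle/(2*pi) - d0\<bar>*(2*pi) <= 1/2*(2*pi)"
     by (intro mult_right_mono) auto
    also have "\<bar>c*golden_angle/(2*pi) - d0\<bar>*(2*pi) = \<bar>(c*golden_angle/(2*pi) - d0)*(2*pi)\<bar>"
     by (simp add: abs_mult)
    also have "(c*golden_angle/(2*pi) - d0)*(2*pi) = y" by (simp add: y_def field_simps)
    finally show ?thesis by simp
   qed
   have "gph^c = cis (y + 2*pi * of_int d0)" by (simp add: Complex.DeMoivre y_def)
   also have "... = cis y*cis (2*pi * of_int d0)" by (simp only: cis_mult)
   also have "cis (2*pi * of_int d0) = 1" by (rule cis_multiple_2pi) auto
   finally have "\<bar>y\<bar> <= 2*cmod (gph^c - 1)" using cis_minus_1_ge[OF y_pi] by simp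
   also have "... <= exp 1*exp (- (11*w*J))"
    using sm exp_ge_add_one_self[of 1] by (intro mult_mono) (auto simp: c_def J_def)
   also have "... <= exp (- (10*w*J))" using wJ by (simp add: mult.commute flip: exp_add)
   finally have y_sm: "\<bar>y\<bar> <= exp (- (10*w*J))" .
   have "exp (- (10*w*J)) <= 1" by (simp add: J_def)
   then have y1: "\<bar>y\<bar> <= 1" using y_sm by linarith
   have c4: "4 <= c" using power_increasing[OF elim(3),of "2::nat"] by (simp add: c_def)
   have "2*pi*d0 = c*golden_angle - y" by (simp add: y_def)
   moreover have "c*golden_angle \<ge> 4*(1/2)" using c4 golden_angle_bounds by (intro mult_mono) auto
   ultimately have "0 < 2*pi*d0" using y1 by linarith
   then have d0: "1 <= d0" by (simp add: zero_less_mult_iff)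
   define d where "d = nat d0"
   have cd: "1 <= c" "1 <= d" "c*golden_angle = 2*pi*d + y" using c4 d0 by (auto simp: d_def y_def)
   have pi_b: "3 < pi" "pi < 3.15" using pi_gt3 pi_approx by auto
   have cd15: "c <= 15*real d"
   proof -
    have "c*(1/2) <= c*golden_angle" using golden_angle_bounds by (intro mult_left_mono) auto
    also have "... <= 2*pi*d + 1" using cd y1 by linarith
    also have "... <= 6.3*d + 1*d" using pi_b cd(2) by (intro add_mono mult_right_mono) auto
    finally show ?thesis by simp
   qed
   have dc: "real d <= c"
   proof -
    have "6*real d <= 2*pi*d" using pi_b by (intro mult_right_mono) auto
    also have "... <= c*golden_angle + 1" using cd y1 by linarith
    also have "... <= real c*2 + 1" using golden_angle_bounds by (intro add_mono mult_left_mono) auto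
    finally show ?thesis using c4 by simp
   qed
   have \<rho>1: "1 <= \<rho>" using elim(3) by (simp add: \<rho>_def K3_def)
   have \<rho>2: "R + R*(c/d) <= \<rho>"
   proof -
    have "c/d <= 15" using cd15 cd(2) by (simp add: divide_le_eq)
    then have "R*(c/d) <= real R*15" by (intro mult_left_mono) auto
    then show ?thesis by (simp add: \<rho>_def R_def)
   qed
   have e2: "2^k <= exp (real k)" for k
    using power_mono[of 2 "exp (1::real)" k] exp_ge_add_one_self[of "1::real"] by (simp flip: exp_of_nat_mult)
   have f1: "\<rho>^A <= exp (w*J)"
   proof -
    have "\<rho>^A <= exp (real j)^A" using elim(1) \<rho>1 by (intro power_mono) (auto simp: \<rho>_def)
    also have "... = exp (w*J)" by (simp add: A_def J_def power2_eq_square mult_ac flip: exp_of_nat_mult)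
    finally show ?thesis .
   qed
   have f2: "real (A*B) <= exp J" using elim(2) by (simp add: A_def B_def J_def power2_eq_square mult_ac)
   have f2': "real T <= exp J" 
   proof -
    have "real T <= real w*real K1*real j^2" by (simp add: T_def K1_def w_def)
    then show ?thesis using elim(2) by (simp add: J_def)
   qed
   have f2'': "real (B * R) <= exp J" 
   proof -
    have "real (B * R) <= real w*real K1*real j^2" by (simp add: B_def R_def K1_def K3_def w_def power2_eq_square)
    then show ?thesis using elim(2) by (simp add: J_def)
   qed
   have f3: "real H <= exp (w*J)" using e2[of "w*j^2"] by (simp add: H_def J_def)
   have f23: "real (A*B*H) * \<rho>^A <= exp (J + 2*w*J)"
   proof -
    have "real (A*B*H) * \<rho>^A <= (exp J*exp (w*J))*exp (w*J)"
     using f1 f2 f3 \<rho>1 unfolding of_nat_mult[of "A*B" H] by (intro mult_mono) auto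
    also have "... = exp (J + 2*w*J)" by (simp flip: exp_add)
    finally show ?thesis .
   qed
   have Br: "2*B * \<rho> = 32*w*J"
    by (simp add: B_def \<rho>_def J_def K1_def K3_def w_def power2_eq_square)
   have M_le: "M <= exp (J + 34*w*J)"
   proof -
    have "M <= exp (J + 2*w*J)*exp (32*w*J)"
     unfolding M_def Br[symmetric] using f23 by (intro mult_mono) auto
    also have "... = exp (J + 34*w*J)" by (simp flip: exp_add)
    finally show ?thesis .
   qed
   have AT: "A <= T"
   proof -
    have "w*j*1 <= w*j*(100*j)" using elim(3) by (intro mult_left_mono) auto
    then show ?thesis by (simp add: A_def T_def power2_eq_square)
   qed
   have pig: "((nat \<lfloor>2*M/\<sigma>\<rfloor> + 1)^2)^T < (H + 1)^(A*B)"
   proof -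
    have M0: "0 <= M" using \<rho>1 by (simp add: M_def)
    have "real (nat \<lfloor>2*M/\<sigma>\<rfloor> + 1) <= 2*M/\<sigma> + 1"
     using M0 by (simp add: \<sigma>_def)
    also have "... = 2*(M*exp (7*w*J)) + 1" by (simp add: \<sigma>_def exp_minus field_simps)
    also have "M*exp (7*w*J) <= exp (J + 34*w*J)*exp (7*w*J)"
     using M_le by (intro mult_right_mono) auto
    also have "... = exp (J + 41*w*J)" by (simp flip: exp_add)
    also have "2*exp (J + 41*w*J) + 1 <= exp 2*exp (J + 41*w*J)"
    proof -
     have "3 <= exp (2::real)" using exp_ge_add_one_self[of "2::real"] by simp
     then have "3*exp (J + 41*w*J) <= exp 2*exp (J + 41*w*J)" by (intro mult_right_mono) auto
     moreover have "1 <= exp (J + 41*w*J)" using J4 by simp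
     ultimately show ?thesis by linarith
    qed
    also have "... <= exp (42*w*J)" using J4 by (simp add: w_def flip: exp_add)
    finally have "real (nat \<lfloor>2*M/\<sigma>\<rfloor> + 1) <= exp (42*w*J)" by simp
    then have "(real (nat \<lfloor>2*M/\<sigma>\<rfloor> + 1)^2)^T <= (exp (42*w*J)^2)^T"
     by (intro power_mono) auto
    also have "... = exp (8400*w*J*(w*J))"
     by (simp add: T_def J_def flip: exp_of_nat_mult power_mult)
    also have "... < 2 powr (K1*w*J*(w*J))"
    proof -
     have "8400*w*J*(w*J) < ln 2*(K1*w*J*(w*J))"
     proof -
      have "8400 < ln 2*real K1" using ln2_ge_two_thirds by (simp add: K1_def)
      then have "8400*(w*J*(w*J)) < ln 2*real K1*(w*J*(w*J))"
       using wJ by (intro mult_strict_right_mono) auto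
      then show ?thesis by (simp add: mult_ac)
     qed
     then show ?thesis by (simp add: powr_def mult_ac)
    qed
    also have "... = real H^(A*B)"
    proof -
     have "real H^(A*B) = 2 powr (real (w*j^2*(A*B)))"
      unfolding powr_realpow[OF zero_less_numeral] by (simp add: H_def power_mult)
     also have "real (w*j^2*(A*B)) = K1*w*J*(w*J)"
      by (simp add: A_def B_def J_def power2_eq_square)
     finally show ?thesis ..
    qed
    also have "... <= real (H + 1)^(A*B)" by (intro power_mono) auto
    finally have "real (((nat \<lfloor>2*M/\<sigma>\<rfloor> + 1)^2)^T) < real ((H + 1)^(A*B))" by simp
    then show ?thesis by (simp only: of_nat_less_iff)
   qed
   have RS: "A*B < (R - B) * R"
   proof -
    have "R - B = 199986000*j" by (simp add: R_def B_def K1_def K3_def)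
    then show ?thesis using elim(3) by (simp add: A_def B_def R_def K1_def K3_def w_def)
   qed
   have inj: "R * \<bar>y\<bar>*2^(R + 2) < 1"
   proof -
    have B1: "1 <= B" using elim(3) by (simp add: B_def K1_def)
    have "real R <= real (B * R)" using B1 by (simp add: mult_le_cancel_right1)
    then have R: "real R <= exp J" using f2'' by linarith
    have "real R + 2 <= w*J"
    proof -
     have "real j <= J" using elim(3) by (simp add: J_def power2_eq_square mult_le_cancel_right1)
     then have "real R <= K3*J" unfolding R_def of_nat_mult by (rule mult_left_mono) simp
     then show ?thesis using J4 by (simp add: K3_def w_def)
    qed
    then have R2: "2^(R + 2) <= exp (w*J)" by (intro order.trans[OF e2]) simp
    have "R * \<bar>y\<bar>*2^(R + 2) <= exp J*exp (- (10*w*J))*exp (w*J)"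
     using R R2 y_sm by (intro mult_mono) auto
    also have "... = exp (J - 9*w*J)" by (simp flip: exp_add)
    also have "... < 1" using J4 by (simp add: w_def)
    finally show ?thesis .
   qed
   have small: "real d^A*(2 * \<sigma>*real T + real (A*B*H) * \<rho>^A*exp (2*exp 1*B * \<rho> + A - T)
     + real (A*B*H) * \<rho>^A*(B * R * \<bar>y\<bar>))*(2^(B * R)*(real (A*B*H)*(d * \<rho>)^A)) < 1"
   proof -
    have dA: "real d^A <= exp (w*J)"
    proof -
     have "real d^A <= real c^A" using dc by (intro power_mono) auto
     also have "... = 2^(j*A)" by (simp add: c_def power_mult)
     also have "... <= exp (real (j*A))" by (rule e2)
     also have "real (j*A) = w*J" by (simp add: A_def J_def power2_eq_square)
     finally show ?thesis .
    qed
    have t1: "2 * \<sigma>*real T <= exp (- (6*w*J))"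
    proof -
     have "2 * \<sigma>*real T <= exp 1 * \<sigma>*exp J"
      using f2' exp_ge_add_one_self[of "1::real"] by (intro mult_mono) (auto simp: \<sigma>_def)
     also have "... = exp (1 + J - 7*w*J)" by (simp add: \<sigma>_def flip: exp_add)
     also have "... <= exp (- (6*w*J))" using J4 by (simp add: w_def)
     finally show ?thesis .
    qed
    have t2: "real (A*B*H) * \<rho>^A*exp (2*exp 1*B * \<rho> + A - T) <= exp (- (6*w*J))"
    proof -
     have "2*exp 1*B * \<rho> = exp 1*(32*w*J)" using Br by (simp add: mult_ac)
     also have "... <= 2.72*(32*w*J)" using e_less_272 J4 by (intro mult_right_mono) auto
     also have "... <= 88*w*J" using J4 by simp
     finally have a: "2*exp 1*B * \<rho> <= 88*w*J" .
     have "real j <= J" using elim(3) by (simp add: J_def power2_eq_square mult_le_cancel_right1)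
     then have b: "real A <= w*J" unfolding A_def of_nat_mult by (rule mult_left_mono) simp
     have cc: "real T = 100*w*J" by (simp add: T_def J_def)
     have "real (A*B*H) * \<rho>^A*exp (2*exp 1*B * \<rho> + A - T) <= exp (J + 2*w*J)*exp (88*w*J + w*J - 100*w*J)"
     proof (rule mult_mono[OF f23])
      have "2*exp 1*B * \<rho> + A - T <= 88*w*J + w*J - 100*w*J" using a b cc by linarith
      then show "exp (2*exp 1*B * \<rho> + A - T) <= exp (88*w*J + w*J - 100*w*J)" by simp
     qed auto
     also have "... = exp (J - 9*w*J)" by (simp flip: exp_add)
     also have "... <= exp (- (6*w*J))" using J4 by (simp add: w_def)
     finally show ?thesis .
    qed
    have t3: "real (A*B*H) * \<rho>^A*(B * R * \<bar>y\<bar>) <= exp (- (6*w*J))"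
    proof -
     have "real (A*B*H) * \<rho>^A*(B * R * \<bar>y\<bar>) <= exp (J + 2*w*J)*(exp J*exp (- (10*w*J)))"
      using f23 f2'' y_sm by (intro mult_mono) auto
     also have "... = exp (2*J - 8*w*J)" by (simp flip: exp_add)
     also have "... <= exp (- (6*w*J))" using J4 by (simp add: w_def)
     finally show ?thesis .
    qed
    have t4: "2^(B * R)*(real (A*B*H)*(d * \<rho>)^A) <= exp (w*J)*(exp (J + 2*w*J)*exp (w*J))"
    proof (rule mult_mono)
     have "2^(B * R) <= exp (real (B * R))" by (rule e2)
     also have "real (B * R) = w*J" by (simp add: B_def R_def J_def K1_def K3_def w_def power2_eq_square)
     finally show "2^(B * R) <= exp (w*J)" .
     have "real (A*B*H)*(d * \<rho>)^A = real (A*B*H) * \<rho>^A*real d^A" by (simp add: power_mult_distrib mult_ac)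
     also have "... <= exp (J + 2*w*J)*exp (w*J)" using f23 dA by (intro mult_mono) auto
     finally show "real (A*B*H)*(d * \<rho>)^A <= exp (J + 2*w*J)*exp (w*J)" .
    qed (use \<rho>1 in auto)
    have "real d^A*(2 * \<sigma>*real T + real (A*B*H) * \<rho>^A*exp (2*exp 1*B * \<rho> + A - T)
     + real (A*B*H) * \<rho>^A*(B * R * \<bar>y\<bar>))*(2^(B * R)*(real (A*B*H)*(d * \<rho>)^A))
     <= exp (w*J)*(exp (- (6*w*J)) + exp (- (6*w*J)) + exp (- (6*w*J)))*(exp (w*J)*(exp (J + 2*w*J)*exp (w*J)))"
     by (intro mult_mono[OF mult_mono[OF dA add_mono[OF add_mono[OF t1 t2] t3]] t4])
      (use \<rho>1 in \<open>auto simp: \<sigma>_def\<close>)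
    also have "... = 3*exp (J - w*J)" by (simp flip: exp_add)
    also have "... <= exp 2*exp (J - w*J)" using exp_ge_add_one_self[of "2::real"] by (intro mult_right_mono) auto
    also have "... = exp (2 + J - w*J)" by (simp flip: exp_add)
    also have "... < 1" using J4 by (simp add: w_def)
    finally show ?thesis .
   qed
   show False
    by (rule golden_measure_aux[OF cd \<rho>1 \<rho>2 _ AT M_def pig RS inj small]) (simp add: \<sigma>_def)
  qed
 qed
qed

section \<open>Loop programs run by logarithmic-space Turing machines\<close>

datatype 'o com = Skip | Inc nat | Dec nat | Emit 'o | Seq "'o com" "'o com" | While nat "'o com" | Input | Start

text \<open>\<open>exec B c s s' w\<close>: from the register contents \<open>s\<close>, the program \<open>c\<close> ends with \<open>s'\<close>, writes \<open>w\<close>, and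
 no register ever exceeds \<open>B\<close>. \<open>Input\<close> and \<open>Start\<close> only serve to initialise the machine.\<close>
inductive exec :: "nat => 'o com => (nat => nat) => (nat => nat) => 'o list => bool" for B where
 Skip: "exec B Skip s s []"
| Inc: "s r < B ==> exec B (Inc r) s (s(r := s r + 1)) []"
| Dec: "exec B (Dec r) s (s(r := s r - 1)) []"
| Emit: "exec B (Emit a) s s [a]"
| Seq: "exec B c s s1 w1 ==> exec B d s1 s2 w2 ==> exec B (Seq c d) s s2 (w1 @ w2)"
| WhileF: "s r = 0 ==> exec B (While r c) s s []"
| WhileT: "s r ~= 0 ==> exec B c s s1 w1 ==> exec B (While r c) s1 s2 w2 ==> exec B (While r c) s s2 (w1 @ w2)"

fun regs :: "'o com => nat set" where
 "regs (Inc r) = {r}" | "regs (Dec r) = {r}" | "regs (Seq c d) = regs c Un regs d"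
| "regs (While r c) = insert r (regs c)" | "regs Input = {0}" | "regs _ = {}"

text \<open>Stages of one instruction: \<open>P0\<close> leaves the marker, \<open>P1\<close> runs
  to the digit that decides, \<open>P2\<close> and \<open>P3\<close> return to the marker.
  Decrements and loop tests need both return stages, to remember whether the register was
  nonzero.\<close>

datatype phase = P0 | P1 | P2 | P3

instance phase :: finite
proof
 have "UNIV = {P0,P1,P2,P3}" using phase.exhaust by auto
 then show "finite (UNIV :: phase set)" by (metis finite.simps)
qed

definition keep :: "nat list => (nat \<times> direction) list" where
 "keep ss = map (%s. (s,Stay)) ss"

text \<open>On the tapes, 3 marks the left end, 1 and 2 are the binary digits 0 and 1, least significant first.\<close>
fun tr :: "'o com list \<times> phase => input_cell => nat list =>
  ('o com list \<times> phase) \<times> direction \<times> (nat \<times> direction) list \<times> 'o option" where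
 "tr (Start # k,p) a ss = ((k,P0),Stay,map (%_. (3,Stay)) ss,None)"
| "tr (Input # k,p) a ss = (case a of LeftEnd => ((Input # k,P0),MoveRight,keep ss,None)
   | InputOne => ((Inc 0 # Input # k,P0),MoveRight,keep ss,None)
   | RightEnd => ((k,P0),Stay,keep ss,None))"
| "tr (Skip # k,p) a ss = ((k,P0),Stay,keep ss,None)"
| "tr (Emit x # k,p) a ss = ((k,P0),Stay,keep ss,Some x)"
| "tr (Seq c d # k,p) a ss = ((c # d # k,P0),Stay,keep ss,None)"
| "tr (Inc r # k,p) a ss = (case p of
   P0 => ((Inc r # k,P1),Stay,(keep ss)[r := (ss ! r,MoveRight)],None)
  | P1 => (if ss ! r = 2 then ((Inc r # k,P1),Stay,(keep ss)[r := (1,MoveRight)],None)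
      else ((Inc r # k,P2),Stay,(keep ss)[r := (2,MoveLeft)],None))
  | _ => (if ss ! r = 3 then ((k,P0),Stay,keep ss,None)
     else ((Inc r # k,P2),Stay,(keep ss)[r := (ss ! r,MoveLeft)],None)))"
| "tr (Dec r # k,p) a ss = (case p of
   P0 => ((Dec r # k,P1),Stay,(keep ss)[r := (ss ! r,MoveRight)],None)
  | P1 => (if ss ! r = 1 then ((Dec r # k,P1),Stay,(keep ss)[r := (1,MoveRight)],None)
      else if ss ! r = 2 then ((Dec r # k,P2),Stay,(keep ss)[r := (1,MoveLeft)],None)
      else ((Dec r # k,P3),Stay,(keep ss)[r := (ss ! r,MoveLeft)],None))
  | P2 => (if ss ! r = 3 then ((k,P0),Stay,keep ss,None)
      else ((Dec r # k,P2),Stay,(keep ss)[r := (2,MoveLeft)],None))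
  | P3 => (if ss ! r = 3 then ((k,P0),Stay,keep ss,None)
      else ((Dec r # k,P3),Stay,(keep ss)[r := (ss ! r,MoveLeft)],None)))"
| "tr (While r c # k,p) a ss = (case p of
   P0 => ((While r c # k,P1),Stay,(keep ss)[r := (ss ! r,MoveRight)],None)
  | P1 => (if ss ! r = 1 then ((While r c # k,P1),Stay,(keep ss)[r := (1,MoveRight)],None)
      else if ss ! r = 2 then ((While r c # k,P2),Stay,(keep ss)[r := (2,MoveLeft)],None)
      else ((While r c # k,P3),Stay,(keep ss)[r := (ss ! r,MoveLeft)],None))
  | P2 => (if ss ! r = 3 then ((c # While r c # k,P0),Stay,keep ss,None)
      else ((While r c # k,P2),Stay,(keep ss)[r := (ss ! r,MoveLeft)],None))
  | P3 => (if ss ! r = 3 then ((k,P0),Stay,keep ss,None)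
      else ((While r c # k,P3),Stay,(keep ss)[r := (ss ! r,MoveLeft)],None)))"
| "tr ([],p) a ss = (([],P0),Stay,keep ss,None)"

text \<open>The control state is a stack of pending programs. These are the stacks that arise while
  \<open>c\<close> runs above \<open>k\<close>; as they are finitely many, the control is
  finite.\<close>

fun stacks :: "'o com => 'o com list => 'o com list set" where
 "stacks (Seq c d) k = {Seq c d # k} Un stacks c (d # k) Un stacks d k"
| "stacks (While r c) k = {While r c # k} Un stacks c (While r c # k)"
| "stacks Input k = {Input # k,Inc 0 # Input # k}"
| "stacks c k = {c # k}"

lemma finite_stacks: "finite (stacks c k)"
 by (induction c k rule: stacks.induct) auto

lemma stacks_self: "c # k \<in> stacks c k"
 by (cases c) auto

lemma stacks_nonempty: "st \<in> stacks c k ==> st ~= []"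
 by (induction c k rule: stacks.induct) auto

lemma stacks_closed: "st \<in> stacks c k ==> fst (fst (tr (st,p) a ss)) \<in> insert k (stacks c k)"
proof (induction c k arbitrary: st rule: stacks.induct)
 case (1 c d k)
 then consider "st = Seq c d # k" | "st \<in> stacks c (d # k)" | "st \<in> stacks d k" by auto
 then show ?case
  using 1(1)[of st] 1(2)[of st] stacks_self[of d k] stacks_self[of c "d # k"] by cases auto
next
 case (2 r c k)
 then consider "st = While r c # k" | "st \<in> stacks c (While r c # k)" by auto
 then show ?case
  using 2(1)[of st] stacks_self[of c "While r c # k"] by cases (auto split: phase.split)
qed (auto split: phase.splits input_cell.splits if_splits)

definition digit :: "bool list => nat => nat" where
 "digit bs p = (if p = 0 then 3 else if p <= length bs then (if bs ! (p - 1) then 2 else 1) else 0)"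

fun bval :: "bool list => nat" where
 "bval [] = 0" | "bval (b # bs) = (if b then 1 else 0) + 2*bval bs"

fun binc :: "bool list => bool list" where
 "binc [] = [True]" | "binc (False # bs) = True # bs" | "binc (True # bs) = False # binc bs"

text \<open>The length is kept, so leading zeros may remain, and a word of value 0 is left as it is,
  in line with truncated subtraction.\<close>

fun bdec :: "bool list => bool list" where
 "bdec [] = []" | "bdec (True # bs) = False # bs" | "bdec (False # bs) = (if bval bs = 0 then False # bs else True # bdec bs)"

lemma bval_binc: "bval (binc bs) = bval bs + 1"
 by (induction bs rule: binc.induct) auto

lemma bval_bdec: "bval (bdec bs) = bval bs - 1"
 by (induction bs rule: bdec.induct) auto

lemma length_bdec: "length (bdec bs) = length bs"
 by (induction bs rule: bdec.induct) auto

lemma bval_append: "bval (xs @ ys) = bval xs + 2^length xs*bval ys"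
 by (induction xs) auto

lemma bval_replicate_True: "Suc (bval (replicate j True)) = 2^j"
 by (induction j) auto

lemma bval_replicate_False: "bval (replicate j False) = 0"
 by (induction j) auto

lemma binc_True: "binc (replicate j True @ bs) = replicate j False @ binc bs"
 by (induction j) auto

lemma bdec_False: "bval bs ~= 0 ==> bdec (replicate j False @ bs) = replicate j True @ bdec bs"
 by (induction j) (auto simp: bval_append)

lemma split_True: obtains j bs' where "bs = replicate j True @ bs'" "bs' = [] \<or> (\<exists>cs. bs' = False # cs)"
proof (induction bs arbitrary: thesis)
 case Nil then show ?case by (metis append_Nil replicate_0)
next
 case (Cons b bs)
 show ?case
 proof (cases b)
  case True
  obtain j bs' where "bs = replicate j True @ bs'" "bs' = [] \<or> (\<exists>cs. bs' = False # cs)" using Cons.IH by blast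
  then show ?thesis using Cons.prems[of "Suc j" bs'] True by auto
 next
  case False
  then show ?thesis using Cons.prems[of 0 "b # bs"] by auto
 qed
qed

lemma split_False: obtains j bs' where "bs = replicate j False @ bs'" "bs' = [] \<or> (\<exists>cs. bs' = True # cs)"
proof (induction bs arbitrary: thesis)
 case Nil then show ?case by (metis append_Nil replicate_0)
next
 case (Cons b bs)
 show ?case
 proof (cases b)
  case False
  obtain j bs' where "bs = replicate j False @ bs'" "bs' = [] \<or> (\<exists>cs. bs' = True # cs)" using Cons.IH by blast
  then show ?thesis using Cons.prems[of "Suc j" bs'] False by auto
 next
  case True
  then show ?thesis using Cons.prems[of 0 "b # bs"] by auto
 qed
qed

lemma digit_write: "(digit (xs @ bs))(Suc (length xs) := (if b then 2 else 1)) = digit (xs @ b # tl bs)"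
proof
 fix p
 consider "p = 0" | "0 < p" "p <= length xs" | "p = Suc (length xs)" | "Suc (length xs) < p" by linarith
 then show "((digit (xs @ bs))(Suc (length xs) := (if b then 2 else 1))) p = digit (xs @ b # tl bs) p"
 proof cases
  case 4
  then obtain q where q: "p = Suc (Suc (length xs)) + q" by (metis Suc_leI le_Suc_ex)
  show ?thesis unfolding q by (cases bs) (auto simp: digit_def nth_append)
 qed (auto simp: digit_def nth_append)
qed

lemma digit_pos_ne_3: "0 < p ==> digit bs p ~= 3"
 by (simp add: digit_def)

lemma digit_0: "digit bs 0 = 3"
 by (simp add: digit_def)

lemma digit_append: "digit (xs @ bs) (Suc (length xs)) = (case bs of [] => 0 | b # _ => if b then 2 else 1)"
 by (cases bs) (auto simp: digit_def nth_append)

text \<open>Since words may carry leading zeros, the current value does not bound the length. The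
  invariant records that the length was once forced by a value of at most \<open>B\<close>.\<close>

definition lenok :: "nat => bool list => bool" where
 "lenok B bs \<longleftrightarrow> bs = [] \<or> 2^(length bs - 1) <= B"

lemma lenok_length: "lenok B bs ==> B < 2^L ==> length bs <= L"
proof (rule ccontr)
 assume a: "lenok B bs" "B < 2^L" "\<not> length bs <= L"
 then have "2^(length bs - 1) <= B" by (auto simp: lenok_def)
 then have "2^(length bs - 1) < (2 :: nat)^L" using a(2) by (rule le_less_trans)
 then have "length bs - 1 < L" by simp
 with a(3) show False by simp
qed

text \<open>A word gets longer only if all its digits are ones, and then the new value is the power
  of two that the invariant asks for.\<close>

lemma lenok_binc: "lenok B bs ==> bval bs < B ==> lenok B (binc bs)"
proof -
 assume a: "lenok B bs" "bval bs < B"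
 obtain j bs' where bs: "bs = replicate j True @ bs'" "bs' = [] \<or> (\<exists>cs. bs' = False # cs)"
  by (rule split_True)
 show ?thesis
 proof (cases "bs' = []")
  case True
  then have "binc bs = replicate j False @ [True]" "bs = replicate j True"
   using bs(1) binc_True[of j "[]"] by simp_all
  then show ?thesis using a(2) bval_replicate_True[of j] by (simp add: lenok_def)
 next
  case False
  then obtain cs where "bs' = False # cs" using bs(2) by auto
  then show ?thesis using a(1) by (simp add: bs(1) binc_True lenok_def)
 qed
qed

lemma lenok_bdec: "lenok B bs ==> lenok B (bdec bs)"
 using length_bdec[of bs] by (auto simp: lenok_def)

text \<open>Every register is kept in binary on a tape of its own, so that polynomially bounded
  registers take logarithmic space. Register 0 receives the input length.\<close>

locale loop_machine =
 fixes main :: "'o com" and K :: nat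
 assumes K0: "0 < K" and regsK: "regs main \<subseteq> {..<K}"
begin

definition SS :: "('o com list \<times> phase) set" where
 "SS = (insert [Start,Input,main] (insert [Input,main] (insert [Inc 0,Input,main] (stacks main [])))) \<times> UNIV"

lemma finite_SS: "finite SS" unfolding SS_def by (auto simp: finite_stacks)

text \<open>Some numbering of the control states that gives 0 to the initial one, as the machine
  model prescribes.\<close>

definition stl :: "('o com list \<times> phase) list" where
 "stl = (SOME xs. distinct xs & set xs = SS & xs ! 0 = ([Start,Input,main],P0))"

lemma stl: "distinct stl" "set stl = SS" "stl ! 0 = ([Start,Input,main],P0)"
proof -
 obtain xs where xs: "distinct xs" "set xs = SS - {([Start,Input,main],P0)}"
  using finite_distinct_list[of "SS - {([Start,Input,main],P0)}"] finite_SS by auto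
 have "([Start,Input,main],P0) \<in> SS" by (simp add: SS_def)
 then have "\<exists>xs. distinct xs & set xs = SS & xs ! 0 = ([Start,Input,main],P0)"
  using xs by (intro exI[of _ "([Start,Input,main],P0) # xs"]) auto
 from someI_ex[OF this] show "distinct stl" "set stl = SS" "stl ! 0 = ([Start,Input,main],P0)"
  unfolding stl_def by auto
qed

text \<open>The empty stack is coded by the number of states, which is the halting state.\<close>

definition enc :: "'o com list \<times> phase => nat" where
 "enc st = (if fst st = [] then length stl else (LEAST i. i < length stl & stl ! i = st))"

definition M :: "'o machine" where
 "M = \<lparr>num_states = length stl,num_symbols = 4,num_tapes = K,
   trans = (%q a ss. case tr (stl ! q) a ss of (st,d,acts,e) => (enc st,d,acts,e))\<rparr>"

lemma nonempty_SS: "st \<in> SS ==> fst st ~= []"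
 by (auto simp: SS_def dest: stacks_nonempty)

lemma enc_SS: assumes "st \<in> SS" shows "enc st < length stl" "stl ! enc st = st"
proof -
 obtain i where "i < length stl & stl ! i = st" using assms stl(2) by (metis in_set_conv_nth)
 from LeastI[of "%i. i < length stl & stl ! i = st",OF this] nonempty_SS[OF assms]
 show "enc st < length stl" "stl ! enc st = st" by (auto simp: enc_def)
qed

lemma enc_start: "enc ([Start,Input,main],P0) = 0"
proof -
 have m: "([Start,Input,main],P0) \<in> SS" by (simp add: SS_def)
 then have "length stl > 0" using stl(2) by (metis length_pos_if_in_set)
 then show ?thesis using enc_SS[OF m] stl(1,3) nth_eq_iff_index_eq by metis
qed

lemma tr_closed: "st \<in> SS ==> fst (tr st a ss) \<in> SS \<or> fst (fst (tr st a ss)) = []"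
proof -
 assume st: "st \<in> SS"
 obtain x p where xp: "st = (x,p)" by (cases st)
 have "fst (fst (tr (x,p) a ss)) \<in> insert [] (fst ` SS)"
 proof (cases "x \<in> stacks main []")
  case True
  then show ?thesis using stacks_closed[OF True,of p a ss] by (force simp: SS_def)
 next
  case False
  then have "x = [Start,Input,main] \<or> x = [Input,main] \<or> x = [Inc 0,Input,main]"
   using st by (auto simp: xp SS_def)
  then show ?thesis using stacks_self[of main "[]"]
   by (force simp: SS_def split: input_cell.splits phase.splits if_splits)
 qed
 then show ?thesis by (cases "tr st a ss") (auto simp: xp SS_def)
qed

lemma regs_stacks: "st \<in> SS ==> hd (fst st) = Inc r \<or> hd (fst st) = Dec r \<or> hd (fst st) = While r c ==> r < K"
proof -
 have "st \<in> stacks d k ==> regs d \<subseteq> {..<K} ==> hd st = Inc r \<or> hd st = Dec r \<or> hd st = While r c ==> r < K"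
  for d k and st :: "'o com list" using K0 by (induction d k rule: stacks.induct) auto
 then show "st \<in> SS ==> hd (fst st) = Inc r \<or> hd (fst st) = Dec r \<or> hd (fst st) = While r c ==> r < K"
  using regsK K0 by (auto simp: SS_def)
qed

lemma acts_ok: "length ss = k ==> set ss \<subseteq> {..<4} ==>
  length (keep ss) = k & fst ` set (keep ss) \<subseteq> {..<4} & length ((keep ss)[r := (x,d)]) = k &
  (x < 4 --> fst ` set ((keep ss)[r := (x,d)]) \<subseteq> {..<4})"
proof -
 assume a: "length ss = k" "set ss \<subseteq> {..<4}"
 have 1: "fst ` set (keep ss) \<subseteq> {..<4}" using a(2) by (auto simp: keep_def)
 have "fst ` set ((keep ss)[r := (x,d)]) \<subseteq> insert x (fst ` set (keep ss))"
  using set_update_subset_insert[of "keep ss" r "(x,d)"] by force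
 then show ?thesis using 1 a(1) by (auto simp: keep_def)
qed

lemma valid_M: "valid_machine M"
 unfolding valid_machine_def
proof (intro conjI allI impI)
 have m: "([Start,Input,main],P0) \<in> SS" by (simp add: SS_def)
 then have "length stl > 0" using stl(2) by (metis length_pos_if_in_set)
 then show "0 < num_states M" by (simp add: M_def)
 show "0 < num_symbols M" by (simp add: M_def)
 fix q a ss assume "q < num_states M & length ss = num_tapes M & set ss \<subseteq> {..<num_symbols M}"
 then have q: "q < length stl" and l: "length ss = K" and s4: "set ss \<subseteq> {..<4}" by (auto simp: M_def)
 obtain st p where st: "stl ! q = (st,p)" by force
 have mem: "(st,p) \<in> SS" using q st stl(2) by (metis nth_mem)
 have "enc (fst (tr (st,p) a ss)) <= length stl"
  using tr_closed[OF mem,of a ss] enc_SS(1)[of "fst (tr (st,p) a ss)"] by (auto simp: enc_def)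
 moreover have "length (fst (snd (snd (tr (st,p) a ss)))) = K & fst ` set (fst (snd (snd (tr (st,p) a ss)))) \<subseteq> {..<4}"
 proof (cases "((st,p),a,ss)" rule: tr.cases)
  case (6 r k q a' ss')
  then have "r < K" using regs_stacks[OF mem] by auto
  then have "ss ! r < 4" using l s4 by (metis lessThan_iff nth_mem subsetD)
  then show ?thesis using 6 acts_ok[OF l s4] by (auto split: phase.splits)
 next
  case (7 r k q a' ss')
  then have "r < K" using regs_stacks[OF mem] by auto
  then have "ss ! r < 4" using l s4 by (metis lessThan_iff nth_mem subsetD)
  then show ?thesis using 7 acts_ok[OF l s4] by (auto split: phase.splits)
 next
  case (8 r c k q a' ss')
  then have "r < K" using regs_stacks[OF mem] by auto
  then have "ss ! r < 4" using l s4 by (metis lessThan_iff nth_mem subsetD)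
  then show ?thesis using 8 acts_ok[OF l s4] by (auto split: phase.splits)
 qed (use l s4 acts_ok[OF l s4] in \<open>auto split: input_cell.splits\<close>)
 ultimately show "case trans M q a ss of (q',d,acts,e) =>
   q' <= num_states M & length acts = num_tapes M & fst ` set acts \<subseteq> {..<num_symbols M}"
  by (cases "tr (st,p) a ss") (simp add: M_def st)
qed


definition cfg :: "'o com list \<times> phase => nat => (nat \<times> (nat => nat)) list => 'o list => 'o config" where
 "cfg st ip W out = \<lparr>state = enc st,input_pos = ip,work = W,written = out\<rparr>"

definition upd :: "(nat \<times> (nat => nat)) list => (nat \<times> direction) list => (nat \<times> (nat => nat)) list" where
 "upd W acts = map2 (%(p,t) (s,d'). (move d' p,t(p := s))) W acts"

definition scan :: "(nat \<times> (nat => nat)) list => nat list" where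
 "scan W = map (%(p,t). t p) W"

lemma step_cfg:
 assumes "st \<in> SS" "tr st (input_at n ip) (scan W) = (st',d,acts,e)"
 shows "step M n (cfg st ip W out) = cfg st' (min (n + 1) (move d ip)) (upd W acts)
   (out @ (case e of None => [] | Some s => [s]))"
 using enc_SS[OF assms(1)] assms(2)
 by (simp add: step_def cfg_def M_def upd_def scan_def)

lemma upd_keep: "upd W (keep (scan W)) = W"
 by (auto simp: upd_def keep_def scan_def intro!: nth_equalityI split: prod.splits)

lemma upd_keep_upd:
 assumes "r < length W" "W ! r = (p,t)"
 shows "upd W ((keep (scan W))[r := (x,d)]) = W[r := (move d p,t(p := x))]"
 using assms by (auto simp: upd_def keep_def scan_def nth_list_update intro!: nth_equalityI split: prod.splits)

definition heads_le :: "nat => 'o config => bool" where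
 "heads_le Lb c \<longleftrightarrow> length (work c) = K & (\<forall>i<K. fst (work c ! i) <= Lb)"

text \<open>The head positions are controlled at every intermediate time, because
  \<open>space_used\<close> counts all cells ever visited.\<close>

definition reach :: "nat => nat => 'o config => 'o config => bool" where
 "reach n Lb c c' \<longleftrightarrow> (\<exists>t. (step M n ^^ t) c = c' & (\<forall>u\<le>t. heads_le Lb ((step M n ^^ u) c)))"

lemma reach_refl: "heads_le Lb c ==> reach n Lb c c"
 unfolding reach_def by (intro exI[of _ 0]) auto

lemma reach_trans: "reach n Lb c c' ==> reach n Lb c' c'' ==> reach n Lb c c''"
proof -
 assume "reach n Lb c c'" "reach n Lb c' c''"
 then obtain t t' where t: "(step M n ^^ t) c = c'" "\<forall>u\<le>t. heads_le Lb ((step M n ^^ u) c)"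
  and t': "(step M n ^^ t') c' = c''" "\<forall>u\<le>t'. heads_le Lb ((step M n ^^ u) c')" by (auto simp: reach_def)
 have eq: "(step M n ^^ (u + t)) c = (step M n ^^ u) c'" for u using t(1) by (simp add: funpow_add)
 have "heads_le Lb ((step M n ^^ u) c)" if "u <= t' + t" for u
 proof (cases "u <= t")
  case False
  then show ?thesis using eq[of "u - t"] t'(2) that by simp
 qed (use t in auto)
 then show ?thesis unfolding reach_def using eq[of t'] t'(1) by (intro exI[of _ "t' + t"]) auto
qed

lemma reach_step: "step M n c = c' ==> heads_le Lb c ==> reach n Lb c' c'' ==> reach n Lb c c''"
proof -
 assume a: "step M n c = c'" "heads_le Lb c" "reach n Lb c' c''"
 then obtain t where t: "(step M n ^^ t) c' = c''" "\<forall>u\<le>t. heads_le Lb ((step M n ^^ u) c')" by (auto simp: reach_def)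
 have "heads_le Lb ((step M n ^^ u) c)" if "u <= Suc t" for u
  using that a t by (cases u) (auto simp: funpow_Suc_right simp del: funpow.simps(2))
 then show ?thesis unfolding reach_def using a t
  by (intro exI[of _ "Suc t"]) (auto simp: funpow_Suc_right simp del: funpow.simps(2))
qed

definition tapes :: "(nat => bool list) => (nat \<times> (nat => nat)) list" where
 "tapes bs = map (%i. (0,digit (bs i))) [0..<K]"

text \<open>The tapes with the head of tape \<open>r\<close> moved to cell \<open>p\<close> and its contents replaced.\<close>
definition tapes_at :: "(nat => bool list) => nat => nat => (nat => nat) => (nat \<times> (nat => nat)) list" where
 "tapes_at bs r p t = (tapes bs)[r := (p,t)]"

lemma tapes_at_0: "r < K ==> tapes_at bs r 0 (digit ds) = tapes (bs(r := ds))"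
 by (auto simp: tapes_at_def tapes_def nth_list_update intro!: nth_equalityI)

lemma tapes_tapes_at: "r < K ==> tapes bs = tapes_at bs r 0 (digit (bs r))"
 by (simp add: tapes_at_0)

lemma scan_at: "r < K ==> scan (tapes_at bs r p t) ! r = t p"
 by (simp add: scan_def tapes_at_def tapes_def)

lemma upd_at: "r < K ==> upd (tapes_at bs r p t) ((keep (scan (tapes_at bs r p t)))[r := (x,d)]) = tapes_at bs r (move d p) (t(p := x))"
 by (subst upd_keep_upd[where p = p and t = t]) (auto simp: tapes_at_def tapes_def)

lemma heads_at: "r < K ==> p <= Lb ==> heads_le Lb (cfg st ip (tapes_at bs r p t) out)"
 by (auto simp: heads_le_def cfg_def tapes_at_def tapes_def nth_list_update)

lemma heads_tapes: "heads_le Lb (cfg st ip (tapes bs) out)"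
 by (auto simp: heads_le_def cfg_def tapes_def)

lemma step_at:
 assumes "(c # k,p) \<in> SS" "r < K" "ip <= n + 1" "i <= Lb"
  and "tr (c # k,p) (input_at n ip) (scan (tapes_at bs r i t)) = (st',Stay,(keep (scan (tapes_at bs r i t)))[r := (x,d)],None)"
  and "reach n Lb (cfg st' ip (tapes_at bs r (move d i) (t(i := x))) out) c''"
 shows "reach n Lb (cfg (c # k,p) ip (tapes_at bs r i t) out) c''"
 using assms by (intro reach_step[OF step_cfg[OF assms(1,5)]] heads_at) (auto simp: upd_at)

lemma step_done:
 assumes "(c # k,p) \<in> SS" "r < K" "ip <= n + 1" "i <= Lb"
  and "tr (c # k,p) (input_at n ip) (scan (tapes_at bs r i t)) = (st',Stay,keep (scan (tapes_at bs r i t)),None)"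
  and "reach n Lb (cfg st' ip (tapes_at bs r i t) out) c''"
 shows "reach n Lb (cfg (c # k,p) ip (tapes_at bs r i t) out) c''"
 using assms by (intro reach_step[OF step_cfg[OF assms(1,5)]] heads_at) (auto simp: upd_keep)

text \<open>Phases that walk back to the marker without changing the tape.\<close>
lemma walk_back:
 assumes SSp: "(c # k,p) \<in> SS" and r: "r < K" and ip: "ip <= n + 1" and i: "i <= Lb"
  and tr1: "!!a ss. ss ! r ~= 3 ==> tr (c # k,p) a ss = ((c # k,p),Stay,(keep ss)[r := (ss ! r,MoveLeft)],None)"
  and tr2: "!!a ss. ss ! r = 3 ==> tr (c # k,p) a ss = (st',Stay,keep ss,None)"
  and "reach n Lb (cfg st' ip (tapes (bs(r := ds))) out) c''"
 shows "reach n Lb (cfg (c # k,p) ip (tapes_at bs r i (digit ds)) out) c''"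
 using i
proof (induction i)
 case 0
 have "scan (tapes_at bs r 0 (digit ds)) ! r = 3" by (simp only: scan_at[OF r] digit_0)
 then show ?case
  by (intro step_done[OF SSp r ip _ tr2]) (use assms(7) in \<open>simp_all add: tapes_at_0[OF r]\<close>)
next
 case (Suc i)
 have sc: "scan (tapes_at bs r (Suc i) (digit ds)) ! r = digit ds (Suc i)" by (rule scan_at[OF r])
 show ?case
 proof (rule step_at[OF SSp r ip Suc.prems])
  show "tr (c # k,p) (input_at n ip) (scan (tapes_at bs r (Suc i) (digit ds)))
   = ((c # k,p),Stay,(keep (scan (tapes_at bs r (Suc i) (digit ds))))[r := (digit ds (Suc i),MoveLeft)],None)"
   using tr1[of "scan (tapes_at bs r (Suc i) (digit ds))"] digit_pos_ne_3[of "Suc i" ds] unfolding sc by simp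
  show "reach n Lb (cfg (c # k,p) ip (tapes_at bs r (move MoveLeft (Suc i)) ((digit ds)(Suc i := digit ds (Suc i)))) out) c''"
   unfolding fun_upd_triv using Suc by simp
 qed
qed

lemma step_begin:
 assumes SSp: "(c # k,P0) \<in> SS" and r: "r < K" and ip: "ip <= n + 1"
  and tr1: "!!a ss. tr (c # k,P0) a ss = ((c # k,P1),Stay,(keep ss)[r := (ss ! r,MoveRight)],None)"
  and fin: "reach n Lb (cfg (c # k,P1) ip (tapes_at bs r 1 (digit (bs r))) out) c''"
 shows "reach n Lb (cfg (c # k,P0) ip (tapes bs) out) c''"
 unfolding tapes_tapes_at[OF r,of bs]
proof (rule step_at[OF SSp r ip])
 show "tr (c # k,P0) (input_at n ip) (scan (tapes_at bs r 0 (digit (bs r))))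
   = ((c # k,P1),Stay,(keep (scan (tapes_at bs r 0 (digit (bs r)))))[r := (digit (bs r) 0,MoveRight)],None)"
  by (simp only: tr1 scan_at[OF r])
 show "reach n Lb (cfg (c # k,P1) ip (tapes_at bs r (move MoveRight 0) ((digit (bs r))(0 := digit (bs r) 0))) out) c''"
  unfolding fun_upd_triv using fin by simp
qed simp

lemma sim_Inc:
 assumes SSp: "!!p. (Inc r # k,p) \<in> SS" and r: "r < K" and ip: "ip <= n + 1" and len: "length (bs r) < Lb"
  and fin: "reach n Lb (cfg (k,P0) ip (tapes (bs(r := binc (bs r)))) out) c''"
 shows "reach n Lb (cfg (Inc r # k,P0) ip (tapes bs) out) c''"
proof -
 obtain j ds where bs: "bs r = replicate j True @ ds" "ds = [] \<or> (\<exists>cs. ds = False # cs)" by (rule split_True)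
 have jL: "Suc j <= Lb" using len bs by simp
 \<comment> \<open>Here the head stands on the first digit that is not a one, or on the blank behind
   the word; writing a one there ends the carry.\<close>
 have flip: "reach n Lb (cfg (Inc r # k,P1) ip (tapes_at bs r (Suc j) (digit (replicate j False @ ds))) out) c''"
 proof (rule step_at[OF SSp r ip jL])
  have "digit (replicate j False @ ds) (Suc j) ~= 2"
   using bs(2) digit_append[of "replicate j False" ds] by (auto split: list.splits)
  then show "tr (Inc r # k,P1) (input_at n ip) (scan (tapes_at bs r (Suc j) (digit (replicate j False @ ds))))
   = ((Inc r # k,P2),Stay,(keep (scan (tapes_at bs r (Suc j) (digit (replicate j False @ ds)))))[r := (2,MoveLeft)],None)"
   by (simp add: scan_at r)
  have "(digit (replicate j False @ ds))(Suc j := 2) = digit (replicate j False @ True # tl ds)"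
   using digit_write[of "replicate j False" ds True] by simp
  also have "replicate j False @ True # tl ds = binc (bs r)" using bs by (auto simp: binc_True)
  finally have eq: "(digit (replicate j False @ ds))(Suc j := 2) = digit (binc (bs r))" .
  show "reach n Lb (cfg (Inc r # k,P2) ip (tapes_at bs r (move MoveLeft (Suc j)) ((digit (replicate j False @ ds))(Suc j := 2))) out) c''"
   unfolding eq by (rule walk_back[OF SSp r ip _ _ _ fin]) (use jL in auto)
 qed
 \<comment> \<open>After \<open>i\<close> moves the first \<open>i\<close> ones have become zeros;
   the induction descends from \<open>i = j\<close>, where \<open>flip\<close> takes over.\<close>
 have "reach n Lb (cfg (Inc r # k,P1) ip (tapes_at bs r (Suc i) (digit (replicate i False @ replicate (j - i) True @ ds))) out) c''"
  if "i <= j" for i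
  using that
 proof (induction i rule: inc_induct)
  case base
  then show ?case using flip by simp
 next
  case (step i)
  then obtain m where m: "j - i = Suc m" "j - Suc i = m" by (metis Suc_diff_Suc)
  let ?t = "digit (replicate i False @ True # replicate m True @ ds)"
  show ?case unfolding m
  proof (simp,rule step_at[OF SSp r ip])
   show "Suc i <= Lb" using step jL by simp
   have "?t (Suc i) = 2" using digit_append[of "replicate i False" "True # replicate m True @ ds"] by simp
   then show "tr (Inc r # k,P1) (input_at n ip) (scan (tapes_at bs r (Suc i) ?t))
     = ((Inc r # k,P1),Stay,(keep (scan (tapes_at bs r (Suc i) ?t)))[r := (1,MoveRight)],None)"
    by (simp add: scan_at r)
   have "?t(Suc i := 1) = digit (replicate i False @ False # replicate m True @ ds)"
    using digit_write[of "replicate i False" "True # replicate m True @ ds" False] by simp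
   also have "replicate i False @ False # replicate m True @ ds = replicate (Suc i) False @ replicate m True @ ds"
    by (simp add: replicate_app_Cons_same)
   finally have eq: "?t(Suc i := 1) = digit (replicate (Suc i) False @ replicate m True @ ds)" .
   show "reach n Lb (cfg (Inc r # k,P1) ip (tapes_at bs r (move MoveRight (Suc i)) (?t(Suc i := 1))) out) c''"
    unfolding eq using step.IH m by simp
  qed
 qed
 from this[of 0] have "reach n Lb (cfg (Inc r # k,P1) ip (tapes_at bs r 1 (digit (bs r))) out) c''"
  by (simp add: bs(1))
 then show ?thesis
  by (intro step_begin[OF SSp r ip]) (use len in simp_all)
qed

lemma walk_right:
 assumes SSp: "(c # k,P1) \<in> SS" and r: "r < K" and ip: "ip <= n + 1" and j: "j <= Lb"
  and tr1: "!!a ss. ss ! r = 1 ==> tr (c # k,P1) a ss = ((c # k,P1),Stay,(keep ss)[r := (1,MoveRight)],None)"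
  and fin: "reach n Lb (cfg (c # k,P1) ip (tapes_at bs r (Suc j) (digit (replicate j False @ ds))) out) c''"
 shows "reach n Lb (cfg (c # k,P1) ip (tapes_at bs r 1 (digit (replicate j False @ ds))) out) c''"
proof -
 let ?t = "digit (replicate j False @ ds)"
 have "reach n Lb (cfg (c # k,P1) ip (tapes_at bs r (Suc i) ?t) out) c''" if "i <= j" for i
  using that
 proof (induction i rule: inc_induct)
  case (step i)
  have d: "?t (Suc i) = 1" using step by (simp add: digit_def nth_append)
  show ?case
  proof (rule step_at[OF SSp r ip])
   show "Suc i <= Lb" using step j by simp
   show "tr (c # k,P1) (input_at n ip) (scan (tapes_at bs r (Suc i) ?t))
    = ((c # k,P1),Stay,(keep (scan (tapes_at bs r (Suc i) ?t)))[r := (?t (Suc i),MoveRight)],None)"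
    using tr1[of "scan (tapes_at bs r (Suc i) ?t)"] d unfolding scan_at[OF r] by simp
   show "reach n Lb (cfg (c # k,P1) ip (tapes_at bs r (move MoveRight (Suc i)) (?t(Suc i := ?t (Suc i)))) out) c''"
    unfolding fun_upd_triv using step.IH by simp
  qed
 qed (use fin in simp)
 from this[of 0] show ?thesis by simp
qed

lemma bdec_zero: "bval bs = 0 ==> bdec bs = bs"
 by (induction bs rule: bdec.induct) auto

lemma sim_Dec:
 assumes SSp: "!!p. (Dec r # k,p) \<in> SS" and r: "r < K" and ip: "ip <= n + 1" and len: "length (bs r) < Lb"
  and fin: "reach n Lb (cfg (k,P0) ip (tapes (bs(r := bdec (bs r)))) out) c''"
 shows "reach n Lb (cfg (Dec r # k,P0) ip (tapes bs) out) c''"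
proof -
 obtain j ds where bs: "bs r = replicate j False @ ds" "ds = [] \<or> (\<exists>cs. ds = True # cs)" by (rule split_False)
 have jL: "Suc j <= Lb" using len bs by simp
 have sc: "scan (tapes_at bs r i t) ! r = t i" for i t by (rule scan_at[OF r])
 have "reach n Lb (cfg (Dec r # k,P1) ip (tapes_at bs r (Suc j) (digit (replicate j False @ ds))) out) c''"
 proof (cases "ds = []")
  case True
  let ?t = "digit (replicate j False @ ds)"
  have d: "?t (Suc j) = 0" using True by (simp add: digit_def)
  have "bdec (bs r) = replicate j False @ ds" using True bs(1) by (simp add: bdec_zero bval_replicate_False)
  then have fin': "reach n Lb (cfg (k,P0) ip (tapes (bs(r := replicate j False @ ds))) out) c''" using fin by simp
  show ?thesis
  proof (rule step_at[OF SSp r ip jL])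
   show "tr (Dec r # k,P1) (input_at n ip) (scan (tapes_at bs r (Suc j) ?t))
    = ((Dec r # k,P3),Stay,(keep (scan (tapes_at bs r (Suc j) ?t)))[r := (?t (Suc j),MoveLeft)],None)"
    using d by (simp add: sc)
   show "reach n Lb (cfg (Dec r # k,P3) ip (tapes_at bs r (move MoveLeft (Suc j)) (?t(Suc j := ?t (Suc j)))) out) c''"
    unfolding fun_upd_triv by (rule walk_back[OF SSp r ip _ _ _ fin']) (use jL in auto)
  qed
 next
  case False
  then obtain cs where ds: "ds = True # cs" using bs(2) by auto
  let ?t = "digit (replicate j False @ ds)"
  have d: "?t (Suc j) = 2" using ds digit_append[of "replicate j False" ds] by simp
  have nz: "bval ds ~= 0" by (simp add: ds)
  have bd: "bdec (bs r) = replicate j True @ False # cs"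
   unfolding bs(1) bdec_False[OF nz] by (simp add: ds)
  \<comment> \<open>On the way out only the lowest one has been cleared; the zeros below it turn
    into ones on the way back.\<close>
  have backw: "reach n Lb (cfg (Dec r # k,P2) ip (tapes_at bs r i (digit (replicate i False @ replicate (j - i) True @ False # cs))) out) c''"
   if "i <= j" for i
   using that
  proof (induction i)
   case 0
   have "scan (tapes_at bs r 0 (digit (bdec (bs r)))) ! r = 3" by (simp only: sc digit_0)
   then show ?case using fin unfolding bd
    by (intro step_done[OF SSp r ip,where st' = "(k,P0)"]) (simp_all add: tapes_at_0[OF r])
  next
   case (Suc i)
   obtain m where m: "j - Suc i = m" "j - i = Suc m" using Suc.prems by (metis Suc_diff_Suc Suc_le_lessD)
   let ?u = "digit (replicate (Suc i) False @ replicate m True @ False # cs)"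
   have u: "?u (Suc i) = 1" by (simp add: digit_def nth_append nth_Cons')
   show ?case unfolding m(1)
   proof (rule step_at[OF SSp r ip])
    show "Suc i <= Lb" using Suc.prems jL by simp
    show "tr (Dec r # k,P2) (input_at n ip) (scan (tapes_at bs r (Suc i) ?u))
     = ((Dec r # k,P2),Stay,(keep (scan (tapes_at bs r (Suc i) ?u)))[r := (2,MoveLeft)],None)"
     using u by (simp add: sc del: replicate.simps)
    have "replicate (Suc i) False @ replicate m True @ False # cs = replicate i False @ False # replicate m True @ False # cs"
     by (simp add: replicate_app_Cons_same)
    then have eq: "?u(Suc i := 2) = digit (replicate i False @ replicate (Suc m) True @ False # cs)"
     using digit_write[of "replicate i False" "False # replicate m True @ False # cs" True] by (simp del: replicate.simps(2)) simp
    show "reach n Lb (cfg (Dec r # k,P2) ip (tapes_at bs r (move MoveLeft (Suc i)) (?u(Suc i := 2))) out) c''"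
     unfolding eq using Suc m by simp
   qed
  qed
  show ?thesis
  proof (rule step_at[OF SSp r ip jL])
   show "tr (Dec r # k,P1) (input_at n ip) (scan (tapes_at bs r (Suc j) ?t))
    = ((Dec r # k,P2),Stay,(keep (scan (tapes_at bs r (Suc j) ?t)))[r := (1,MoveLeft)],None)"
    using d by (simp add: sc)
   have eq: "?t(Suc j := 1) = digit (replicate j False @ False # cs)"
    using digit_write[of "replicate j False" ds False] ds by simp
   show "reach n Lb (cfg (Dec r # k,P2) ip (tapes_at bs r (move MoveLeft (Suc j)) (?t(Suc j := 1))) out) c''"
    unfolding eq using backw[of j] by simp
  qed
 qed
 then have "reach n Lb (cfg (Dec r # k,P1) ip (tapes_at bs r 1 (digit (replicate j False @ ds))) out) c''"
  by (intro walk_right[OF SSp r ip]) (use jL in auto)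
 then show ?thesis
  by (intro step_begin[OF SSp r ip]) (simp_all add: bs(1))
qed

text \<open>The loop test looks for a digit one before the first blank, so leading zeros are
  harmless.\<close>

lemma sim_While:
 assumes SSp: "!!p. (While r c # k,p) \<in> SS" and r: "r < K" and ip: "ip <= n + 1" and len: "length (bs r) < Lb"
  and fin: "reach n Lb (cfg (if bval (bs r) = 0 then (k,P0) else (c # While r c # k,P0)) ip (tapes bs) out) c''"
 shows "reach n Lb (cfg (While r c # k,P0) ip (tapes bs) out) c''"
proof -
 obtain j ds where bs: "bs r = replicate j False @ ds" "ds = [] \<or> (\<exists>cs. ds = True # cs)" by (rule split_False)
 have jL: "Suc j <= Lb" using len bs by simp
 have sc: "scan (tapes_at bs r i t) ! r = t i" for i t by (rule scan_at[OF r])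
 have triv: "bs = bs(r := replicate j False @ ds)" using bs(1) by auto
 let ?t = "digit (replicate j False @ ds)"
 have "reach n Lb (cfg (While r c # k,P1) ip (tapes_at bs r (Suc j) ?t) out) c''"
 proof (cases "ds = []")
  case True
  have d: "?t (Suc j) = 0" using True by (simp add: digit_def)
  have "bval (bs r) = 0" using True bs(1) by (simp add: bval_replicate_False)
  then have fin': "reach n Lb (cfg (k,P0) ip (tapes (bs(r := replicate j False @ ds))) out) c''" using fin unfolding triv[symmetric] by simp
  show ?thesis
  proof (rule step_at[OF SSp r ip jL])
   show "tr (While r c # k,P1) (input_at n ip) (scan (tapes_at bs r (Suc j) ?t))
    = ((While r c # k,P3),Stay,(keep (scan (tapes_at bs r (Suc j) ?t)))[r := (?t (Suc j),MoveLeft)],None)"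
    using d by (simp add: sc)
   show "reach n Lb (cfg (While r c # k,P3) ip (tapes_at bs r (move MoveLeft (Suc j)) (?t(Suc j := ?t (Suc j)))) out) c''"
    unfolding fun_upd_triv by (rule walk_back[OF SSp r ip _ _ _ fin']) (use jL in auto)
  qed
 next
  case False
  then obtain cs where ds: "ds = True # cs" using bs(2) by auto
  have d: "?t (Suc j) = 2" using ds digit_append[of "replicate j False" ds] by simp
  have "bval (bs r) ~= 0" using ds bs(1) by (simp add: bval_append)
  then have fin': "reach n Lb (cfg (c # While r c # k,P0) ip (tapes (bs(r := replicate j False @ ds))) out) c''"
   using fin unfolding triv[symmetric] by simp
  show ?thesis
  proof (rule step_at[OF SSp r ip jL])
   show "tr (While r c # k,P1) (input_at n ip) (scan (tapes_at bs r (Suc j) ?t))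
    = ((While r c # k,P2),Stay,(keep (scan (tapes_at bs r (Suc j) ?t)))[r := (?t (Suc j),MoveLeft)],None)"
    using d by (simp add: sc)
   show "reach n Lb (cfg (While r c # k,P2) ip (tapes_at bs r (move MoveLeft (Suc j)) (?t(Suc j := ?t (Suc j)))) out) c''"
    unfolding fun_upd_triv by (rule walk_back[OF SSp r ip _ _ _ fin']) (use jL in auto)
  qed
 qed
 then have "reach n Lb (cfg (While r c # k,P1) ip (tapes_at bs r 1 ?t) out) c''"
  by (intro walk_right[OF SSp r ip]) (use jL in auto)
 then show ?thesis
  by (intro step_begin[OF SSp r ip]) (simp_all add: bs(1))
qed

text \<open>Steps that leave the tapes alone.\<close>
lemma step_plain:
 assumes "st \<in> SS" "ip <= n + 1" "tr st (input_at n ip) (scan (tapes bs)) = (st',d,keep (scan (tapes bs)),e)"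
  and "reach n Lb (cfg st' (min (n + 1) (move d ip)) (tapes bs) (out @ (case e of None => [] | Some x => [x]))) c''"
 shows "reach n Lb (cfg st ip (tapes bs) out) c''"
 using assms by (intro reach_step[OF step_cfg[OF assms(1,3)]] heads_tapes) (simp add: upd_keep)

definition repr :: "nat => (nat => nat) => (nat => bool list) => bool" where
 "repr B s bs \<longleftrightarrow> (\<forall>r<K. bval (bs r) = s r & lenok B (bs r))"

text \<open>Words have at most \<open>L\<close> digits and the blank behind them is inspected too,
  which gives the bound \<open>Suc L\<close> on head positions.\<close>

lemma sim:
 assumes "exec B c s s' w" "B < 2^L" "ip <= n + 1"
 shows "stacks c k \<times> UNIV \<subseteq> SS ==> regs c \<subseteq> {..<K} ==> repr B s bs ==>
  \<exists>bs'. repr B s' bs' & reach n (Suc L) (cfg (c # k,P0) ip (tapes bs) out) (cfg (k,P0) ip (tapes bs') (out @ w))"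
 using assms
proof (induction arbitrary: k bs out rule: exec.induct)
 case (Skip s)
 have "reach n (Suc L) (cfg (Skip # k,P0) ip (tapes bs) out) (cfg (k,P0) ip (tapes bs) (out @ []))"
  by (rule step_plain[where st' = "(k,P0)" and d = Stay and e = None])
   (use Skip in \<open>auto intro: reach_refl heads_tapes\<close>)
 then show ?case using Skip.prems by blast
next
 case (Inc s r)
 have r: "r < K" using Inc by auto
 have "length (bs r) <= L" using Inc lenok_length[of B "bs r" L] r by (auto simp: repr_def)
 then have len: "length (bs r) < Suc L" by simp
 have "repr B (s(r := s r + 1)) (bs(r := binc (bs r)))"
  using Inc r by (auto simp: repr_def bval_binc lenok_binc)
 moreover have "reach n (Suc L) (cfg (Inc r # k,P0) ip (tapes bs) out) (cfg (k,P0) ip (tapes (bs(r := binc (bs r)))) (out @ []))"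
  by (rule sim_Inc[where Lb = "Suc L"]) (use Inc.prems r len in \<open>auto intro: reach_refl heads_tapes\<close>)
 ultimately show ?case by blast
next
 case (Dec r s)
 have r: "r < K" using Dec by auto
 have "length (bs r) <= L" using Dec lenok_length[of B "bs r" L] r by (auto simp: repr_def)
 then have len: "length (bs r) < Suc L" by simp
 have "repr B (s(r := s r - 1)) (bs(r := bdec (bs r)))"
  using Dec r by (auto simp: repr_def bval_bdec lenok_bdec)
 moreover have "reach n (Suc L) (cfg (Dec r # k,P0) ip (tapes bs) out) (cfg (k,P0) ip (tapes (bs(r := bdec (bs r)))) (out @ []))"
  by (rule sim_Dec[where Lb = "Suc L"]) (use Dec.prems r len in \<open>auto intro: reach_refl heads_tapes\<close>)
 ultimately show ?case by blast
next
 case (Emit a s)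
 have "reach n (Suc L) (cfg (Emit a # k,P0) ip (tapes bs) out) (cfg (k,P0) ip (tapes bs) (out @ [a]))"
  by (rule step_plain[where st' = "(k,P0)" and d = Stay and e = "Some a"])
   (use Emit in \<open>auto intro: reach_refl heads_tapes\<close>)
 then show ?case using Emit.prems by blast
next
 case (Seq c s s1 w1 d s2 w2)
 have sub: "stacks c (d # k) \<times> UNIV \<subseteq> SS" "stacks d k \<times> UNIV \<subseteq> SS" "regs c \<subseteq> {..<K}" "regs d \<subseteq> {..<K}"
  using Seq.prems by auto
 obtain bs1 where 1: "repr B s1 bs1" "reach n (Suc L) (cfg (c # d # k,P0) ip (tapes bs) out) (cfg (d # k,P0) ip (tapes bs1) (out @ w1))"
  using Seq.IH(1)[OF sub(1,3) Seq.prems(3-5)] by blast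
 obtain bs2 where 2: "repr B s2 bs2" "reach n (Suc L) (cfg (d # k,P0) ip (tapes bs1) (out @ w1)) (cfg (k,P0) ip (tapes bs2) ((out @ w1) @ w2))"
  using Seq.IH(2)[OF sub(2,4) 1(1) Seq.prems(4-5)] by blast
 have "reach n (Suc L) (cfg (Seq c d # k,P0) ip (tapes bs) out) (cfg (k,P0) ip (tapes bs2) (out @ w1 @ w2))"
  by (rule step_plain[where st' = "(c # d # k,P0)" and d = Stay and e = None])
   (use Seq.prems reach_trans[OF 1(2) 2(2)] in auto)
 then show ?case using 2(1) by blast
next
 case (WhileF s r c)
 have r: "r < K" using WhileF by auto
 have "length (bs r) <= L" using WhileF lenok_length[of B "bs r" L] r by (auto simp: repr_def)
 then have len: "length (bs r) < Suc L" by simp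
 have z: "bval (bs r) = 0" using WhileF r by (auto simp: repr_def)
 have "reach n (Suc L) (cfg (While r c # k,P0) ip (tapes bs) out) (cfg (k,P0) ip (tapes bs) (out @ []))"
  by (rule sim_While[where Lb = "Suc L"]) (use WhileF.prems r len z in \<open>auto intro: reach_refl heads_tapes\<close>)
 then show ?case using WhileF.prems by blast
next
 case (WhileT s r c s1 w1 s2 w2)
 have r: "r < K" using WhileT by auto
 have "length (bs r) <= L" using WhileT lenok_length[of B "bs r" L] r by (auto simp: repr_def)
 then have len: "length (bs r) < Suc L" by simp
 have nz: "bval (bs r) ~= 0" using WhileT r by (auto simp: repr_def)
 have sub: "stacks c (While r c # k) \<times> UNIV \<subseteq> SS" "regs c \<subseteq> {..<K}"
  using WhileT.prems by auto
 obtain bs1 where 1: "repr B s1 bs1" "reach n (Suc L) (cfg (c # While r c # k,P0) ip (tapes bs) out) (cfg (While r c # k,P0) ip (tapes bs1) (out @ w1))"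
  using WhileT.IH(1)[OF sub WhileT.prems(3-5)] by blast
 obtain bs2 where 2: "repr B s2 bs2" "reach n (Suc L) (cfg (While r c # k,P0) ip (tapes bs1) (out @ w1)) (cfg (k,P0) ip (tapes bs2) ((out @ w1) @ w2))"
  using WhileT.IH(2)[OF WhileT.prems(1,2) 1(1) WhileT.prems(4-5)] by blast
 have "reach n (Suc L) (cfg (While r c # k,P0) ip (tapes bs) out) (cfg (k,P0) ip (tapes bs2) (out @ w1 @ w2))"
  by (rule sim_While[where Lb = "Suc L"]) (use WhileT.prems r len nz reach_trans[OF 1(2) 2(2)] in auto)
 then show ?case using 2(1) by blast
qed

text \<open>The input head measures the length: register 0 counts the cells passed after the left
  end marker, and cell \<open>n + 1\<close> is the right end.\<close>

lemma sim_Input: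
 assumes n: "n <= B" and B: "B < 2^L" and ip: "1 <= ip" "ip <= n + 1"
 shows "repr B s bs ==> s 0 = ip - 1 ==>
  \<exists>bs'. repr B (s(0 := n)) bs' & reach n (Suc L) (cfg ([Input,main],P0) ip (tapes bs) out) (cfg ([main],P0) (n + 1) (tapes bs') out)"
 using ip(2,1)
proof (induction ip arbitrary: s bs rule: inc_induct)
 case base
 have "s(0 := n) = s" using base by auto
 moreover have "reach n (Suc L) (cfg ([Input,main],P0) (n + 1) (tapes bs) out) (cfg ([main],P0) (n + 1) (tapes bs) out)"
  by (rule step_plain[where st' = "([main],P0)" and d = Stay and e = None])
   (auto simp: SS_def input_at_def intro: reach_refl heads_tapes)
 ultimately show ?case using base by metis
next
 case (step ip)
 have s0: "bval (bs 0) = s 0" "lenok B (bs 0)" "s 0 = ip - 1" using step.prems K0 by (auto simp: repr_def)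
 have len: "length (bs 0) < Suc L" using lenok_length[OF s0(2) B] by simp
 have "lenok B (binc (bs 0))" using s0 n step.hyps step.prems by (intro lenok_binc) auto
 then have rp: "repr B (s(0 := s 0 + 1)) (bs(0 := binc (bs 0)))"
  using step.prems by (auto simp: repr_def bval_binc)
 obtain bs' where bs': "repr B ((s(0 := s 0 + 1))(0 := n)) bs'"
   "reach n (Suc L) (cfg ([Input,main],P0) (Suc ip) (tapes (bs(0 := binc (bs 0)))) out) (cfg ([main],P0) (n + 1) (tapes bs') out)"
 proof -
  have "(s(0 := s 0 + 1)) 0 = Suc ip - 1" "1 <= Suc ip" using step.prems by auto
  from step.IH[OF rp this] show ?thesis using that by blast
 qed
 have R: "reach n (Suc L) (cfg ([Inc 0,Input,main],P0) (Suc ip) (tapes bs) out) (cfg ([main],P0) (n + 1) (tapes bs') out)"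
 proof (rule sim_Inc[OF _ K0 _ len bs'(2)])
  show "([Inc 0,Input,main],p) \<in> SS" for p by (simp add: SS_def)
  show "Suc ip <= n + 1" using step.hyps by simp
 qed
 have "reach n (Suc L) (cfg ([Input,main],P0) ip (tapes bs) out) (cfg ([main],P0) (n + 1) (tapes bs') out)"
 proof (rule step_plain[where st' = "([Inc 0,Input,main],P0)" and d = MoveRight and e = None])
  show "([Input,main],P0) \<in> SS" by (simp add: SS_def)
  show "ip <= n + 1" using step.hyps by simp
  have "input_at n ip = InputOne" using step.hyps step.prems by (simp add: input_at_def)
  then show "tr ([Input,main],P0) (input_at n ip) (scan (tapes bs)) = (([Inc 0,Input,main],P0),MoveRight,keep (scan (tapes bs)),None)"
   by simp
  have "min (n + 1) (move MoveRight ip) = Suc ip" using step.hyps by simp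
  then show "reach n (Suc L) (cfg ([Inc 0,Input,main],P0) (min (n + 1) (move MoveRight ip)) (tapes bs) (out @ (case None of None => [] | Some x => [x]))) (cfg ([main],P0) (n + 1) (tapes bs') out)"
   using R by simp
 qed
 moreover have "repr B (s(0 := n)) bs'" using bs'(1) by (simp only: fun_upd_upd)
 ultimately show ?case by blast
qed

lemma run_main:
 assumes ex: "exec B main (%r. if r = 0 then n else 0) s' w" and n: "n <= B" and B: "B < 2^L"
 obtains bs' where "reach n (Suc L) (initial_config M) (cfg ([],P0) (n + 1) (tapes bs') w)"
proof -
 have "repr B (%_. 0) (%_. [])" by (auto simp: repr_def lenok_def)
 from sim_Input[OF n B _ _ this,where ip = 1 and out = "[]"] obtain bs1 where
  1: "repr B ((%_. 0)(0 := n)) bs1" "reach n (Suc L) (cfg ([Input,main],P0) 1 (tapes (%_. [])) []) (cfg ([main],P0) (n + 1) (tapes bs1) [])"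
  by auto
 have eq: "(%_. 0)(0 := n) = (%r. if r = 0 then n else 0)" by auto
 have "stacks main [] \<times> UNIV \<subseteq> SS" by (auto simp: SS_def)
 from sim[OF ex B order_refl this regsK 1(1)[unfolded eq],where out = "[]"] obtain bs2 where
  2: "reach n (Suc L) (cfg ([main],P0) (n + 1) (tapes bs1) []) (cfg ([],P0) (n + 1) (tapes bs2) w)" by auto
 have "reach n (Suc L) (cfg ([Input,main],P0) 0 (tapes (%_. [])) []) (cfg ([],P0) (n + 1) (tapes bs2) w)"
  by (rule step_plain[where st' = "([Input,main],P0)" and d = MoveRight and e = None])
   (use reach_trans[OF 1(2) 2] in \<open>auto simp: SS_def input_at_def\<close>)
 then have "reach n (Suc L) (initial_config M) (cfg ([],P0) (n + 1) (tapes bs2) w)"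
 proof (rule reach_step[rotated 2])
  let ?W = "replicate K (0, %_. 0) :: (nat \<times> (nat => nat)) list"
  have ini: "initial_config M = cfg ([Start,Input,main],P0) 0 ?W []"
   by (simp add: initial_config_def cfg_def M_def enc_start)
  have "tr ([Start,Input,main],P0) (input_at n 0) (scan ?W) = (([Input,main],P0),Stay,map (%_. (3,Stay)) (scan ?W),None)"
   by simp
  moreover have "upd ?W (map (%_. (3,Stay)) (scan ?W)) = tapes (%_. [])"
   by (auto simp: upd_def scan_def tapes_def digit_def fun_eq_iff intro!: nth_equalityI)
  ultimately show "step M n (initial_config M) = cfg ([Input,main],P0) 0 (tapes (%_. [])) []"
   unfolding ini by (subst step_cfg) (auto simp: SS_def)
  show "heads_le (Suc L) (initial_config M)" by (simp add: heads_le_def initial_config_def M_def)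
 qed
 then show thesis by (rule that)
qed

lemma halt_stable: "(step M n ^^ t) (cfg ([],P0) ip W w) = cfg ([],P0) ip W w"
 by (induction t) (auto simp: step_def cfg_def enc_def M_def)

lemma generates_main:
 assumes "exec B main (%r. if r = 0 then n else 0) s' w" and "n <= B" and "B < 2^L"
 shows "generates M n w & space_used M n <= K*(L + 2)"
proof -
 obtain bs' where "reach n (Suc L) (initial_config M) (cfg ([],P0) (n + 1) (tapes bs') w)"
  using run_main[OF assms] .
 then obtain t where t: "config_at M n t = cfg ([],P0) (n + 1) (tapes bs') w"
   "!!u. u <= t ==> heads_le (Suc L) (config_at M n u)"
  by (auto simp: reach_def config_at_def)
 have "num_states M = length stl" by (simp add: M_def)
 then have g: "generates M n w" unfolding generates_def
  by (intro exI[of _ t]) (simp add: t cfg_def enc_def)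
 \<comment> \<open>The halting configuration is a fixed point, so the bound up to the halting time
   holds at all times.\<close>
 have h: "heads_le (Suc L) (config_at M n u)" for u
 proof (cases "u <= t")
  case False
  then obtain v where "u = v + t" by (metis add.commute le_Suc_ex nat_le_linear)
  then have "config_at M n u = config_at M n t"
   using halt_stable[of v n] t(1) by (simp add: config_at_def funpow_add)
  then show ?thesis using t(2)[of t] by simp
 qed (use t in auto)
 have "{(i,p). i < num_tapes M & (\<exists>t. p = fst (work (config_at M n t) ! i))} \<subseteq> {..<K} \<times> {..Suc L}"
  using h by (auto simp: heads_le_def M_def)
 from card_mono[OF _ this] have "space_used M n <= card ({..<K} \<times> {..Suc L})" unfolding space_used_def by simp
 then show ?thesis using g by simp
qed

end

text \<open>\<open>L n\<close> digits suffice for values up to \<open>(n + 2)^d\<close>; the shift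
  by 2 keeps the logarithm positive for all \<open>n\<close>.\<close>

theorem log_space_computable_program:
 fixes main :: "'o com"
 assumes ex: "!!n. \<exists>B s'. exec B main (%r. if r = 0 then n else 0) s' (f n) & n <= B & B <= (n + 2)^d"
  and rg: "finite (regs main)"
 shows "log_space_computable f"
proof -
 obtain K where K: "0 < K" "regs main \<subseteq> {..<K}"
 proof
  show "0 < Suc (Max (insert 0 (regs main)))" by simp
  show "regs main \<subseteq> {..<Suc (Max (insert 0 (regs main)))}" using rg by (auto simp: less_Suc_eq_le)
 qed
 interpret loop_machine main K by unfold_locales (rule K)+
 define L where "L n = nat \<lceil>d*log 2 (real n + 2)\<rceil> + 1" for n :: nat
 have gs: "generates M n (f n) & space_used M n <= K*(L n + 2)" for n
 proof -
  obtain B s' where B: "exec B main (%r. if r = 0 then n else 0) s' (f n)" "n <= B" "B <= (n + 2)^d" using ex by blast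
  have "real ((n + 2)^d) = (2 powr (log 2 (real n + 2))) powr d" by (simp add: powr_realpow add.commute)
  also have "... = 2 powr (d*log 2 (real n + 2))" by (simp only: powr_powr mult.commute)
  also have "... < 2 powr L n" unfolding L_def by (intro powr_less_mono) linarith+
  also have "... = real (2^L n)" by (simp add: powr_realpow)
  finally have "(n + 2)^d < 2^L n" by (simp only: of_nat_less_iff)
  with B show ?thesis by (intro generates_main[of B]) auto
 qed
 have "(%n. real (space_used M n)) \<in> O(%n. ln (real n))"
 proof -
  have "(%n. real (space_used M n)) \<in> O(%n. K*(d*log 2 (real n + 2) + 4))"
  proof (intro bigoI[where c = 1] always_eventually allI)
   fix n
   have "real (space_used M n) <= K*(L n + 2)" using gs[of n] by (metis of_nat_le_iff)
   also have "real (L n + 2) <= d*log 2 (real n + 2) + 4"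
   proof -
    have "0 <= d*log 2 (real n + 2)" by simp
    then show ?thesis unfolding L_def by linarith
   qed
   then have "real (K*(L n + 2)) <= K*(d*log 2 (real n + 2) + 4)" unfolding of_nat_mult by (intro mult_left_mono) auto
   finally show "norm (real (space_used M n)) <= 1*norm (K*(d*log 2 (real n + 2) + 4))" by simp
  qed
  also have "(%n. K*(d*log 2 (real n + 2) + 4)) \<in> O(%n. ln (real n))" by real_asymp
  finally show ?thesis by simp
 qed
 then show ?thesis unfolding log_space_computable_def using valid_M gs by blast
qed

section \<open>Computing with polynomially bounded registers\<close>

declare add_2_eq_Suc [simp del] add_2_eq_Suc' [simp del]

lemma exec_mono: "exec B c s s' w ==> B <= B' ==> exec B' c s s' w"
proof (induction rule: exec.induct)
 case (Inc s r)
 then show ?case by (intro exec.Inc) simp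
next
 case (Dec r s)
 show ?case by (rule exec.Dec)
qed (auto intro: exec.intros)

text \<open>\<open>S v\<close> stands for the register contents after \<open>v\<close> rounds, and
  register \<open>r\<close> counts the rounds that are left.\<close>

lemma exec_for:
 assumes "!!v. v < N ==> exec B c (S v) (S (Suc v)) (w v)" and "!!v. v <= N ==> S v r = N - v"
 shows "exec B (While r c) (S 0) (S N) (concat (map w [0..<N]))"
proof -
 have "i <= N ==> exec B (While r c) (S i) (S N) (concat (map w [i..<N]))" for i
 proof (induction i rule: inc_induct)
  case base
  then show ?case using assms(2)[of N] by (auto intro: exec.WhileF)
 next
  case (step i)
  have "exec B (While r c) (S i) (S N) (w i @ concat (map w [Suc i..<N]))"
   using assms(2)[of i] step by (intro exec.WhileT[OF _ assms(1)]) auto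
  then show ?case using step.hyps by (simp add: upt_conv_Cons)
 qed
 then show ?thesis by simp
qed

lemma concat_Nil: "concat (map (%v. []) xs) = []"
 by (induction xs) auto

lemma exec_clear: "exec B (While r (Dec r)) s (s(r := 0)) []"
proof -
 have "exec B (While r (Dec r)) (s(r := s r - 0)) (s(r := s r - s r)) (concat (map (%v. []) [0..<s r]))"
 proof (rule exec_for)
  fix v
  have "s(r := s r - Suc v) = (s(r := s r - v))(r := (s(r := s r - v)) r - 1)" by simp
  then show "exec B (Dec r) (s(r := s r - v)) (s(r := s r - Suc v)) []" using exec.Dec by metis
 qed auto
 then show ?thesis by (simp add: concat_Nil)
qed

lemma exec_Seq: "exec B c s s1 [] ==> exec B d s1 s2 w ==> exec B (Seq c d) s s2 w"
 using exec.Seq by fastforce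

lemma exec_Inc: "s r < B ==> s' = s(r := s r + 1) ==> exec B (Inc r) s s' []"
 using exec.Inc by metis

lemma exec_Dec: "s' = s(r := s r - 1) ==> exec B (Dec r) s s' []"
 using exec.Dec by metis

lemma exec_move:
 assumes "r ~= q" "s q + s r <= B"
 shows "exec B (While r (Seq (Dec r) (Inc q))) s (s(r := 0,q := s q + s r)) []"
proof -
 have "exec B (While r (Seq (Dec r) (Inc q))) (s(r := s r - 0,q := s q + 0)) (s(r := s r - s r,q := s q + s r))
   (concat (map (%v. []) [0..<s r]))"
 proof (rule exec_for)
  fix v assume "v < s r"
  show "exec B (Seq (Dec r) (Inc q)) (s(r := s r - v,q := s q + v)) (s(r := s r - Suc v,q := s q + Suc v)) []"
   by (rule exec_Seq[OF exec_Dec[OF refl] exec_Inc]) (use assms \<open>v < s r\<close> in \<open>auto simp: fun_eq_iff\<close>)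
 qed (use assms in auto)
 then show ?thesis by (simp add: concat_Nil)
qed

text \<open>A loop over \<open>r\<close> destroys \<open>r\<close>; hence two copies are made and
  one of them is moved back.\<close>

lemma exec_copy:
 assumes "r < k" "s k = 0" "s (Suc k) = 0" "s r <= B"
 shows "exec B (Seq (While r (Seq (Dec r) (Seq (Inc k) (Inc (Suc k))))) (While (Suc k) (Seq (Dec (Suc k)) (Inc r)))) s (s(k := s r)) []"
proof (rule exec_Seq)
 have "exec B (While r (Seq (Dec r) (Seq (Inc k) (Inc (Suc k))))) (s(r := s r - 0,k := 0,Suc k := 0)) (s(r := s r - s r,k := s r,Suc k := s r))
   (concat (map (%v. []) [0..<s r]))"
 proof (rule exec_for)
  fix v assume "v < s r"
  show "exec B (Seq (Dec r) (Seq (Inc k) (Inc (Suc k)))) (s(r := s r - v,k := v,Suc k := v)) (s(r := s r - Suc v,k := Suc v,Suc k := Suc v)) []"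
   by (rule exec_Seq[OF exec_Dec[OF refl] exec_Seq[OF exec_Inc[OF _ refl] exec_Inc]])
    (use assms \<open>v < s r\<close> in \<open>auto simp: fun_eq_iff\<close>)
 qed (use assms in auto)
 moreover have "s(r := s r,k := 0,Suc k := 0) = s" using assms by (auto simp: fun_eq_iff)
 ultimately show "exec B (While r (Seq (Dec r) (Seq (Inc k) (Inc (Suc k))))) s (s(r := 0,k := s r,Suc k := s r)) []"
  by (simp add: concat_Nil)
 let ?t = "s(r := 0,k := s r,Suc k := s r)"
 have "exec B (While (Suc k) (Seq (Dec (Suc k)) (Inc r))) ?t (?t(Suc k := 0,r := ?t r + ?t (Suc k))) []"
  by (rule exec_move) (use assms in auto)
 moreover have "?t(Suc k := 0,r := ?t r + ?t (Suc k)) = s(k := s r)" using assms by (auto simp: fun_eq_iff)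
 ultimately show "exec B (While (Suc k) (Seq (Dec (Suc k)) (Inc r))) ?t (s(k := s r)) []" by simp
qed

text \<open>\<open>\<Gamma>\<close> lists the quantities, functions of an environment \<open>e\<close>, which are kept in the registers \<open>rs\<close>;
 the registers from \<open>k\<close> on are free and 0.\<close>
definition agrees :: "('e => nat) list => nat list => nat => (nat => nat) => 'e => bool" where
 "agrees Gm rs k s e \<longleftrightarrow> (\<forall>r\<in>set rs. r < k) & map s rs = map (%g. g e) Gm & (\<forall>r\<ge>k. s r = 0)"

definition small_env :: "('e => nat) list => nat => 'e => bool" where
 "small_env Gm B e \<longleftrightarrow> (\<forall>g\<in>set Gm. g e <= B)"

text \<open>The bound has to exist for every exponent \<open>a\<close>, because loops extend the
  environment by larger values.\<close>

definition poly_bounded :: "('e => nat) list => ('e => nat) => bool" where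
 "poly_bounded Gm f \<longleftrightarrow> (\<forall>a. \<exists>b. \<forall>n e. small_env Gm ((n + 2)^a) e --> f e <= (n + 2)^b)"

definition computes :: "('e => nat) list => ('e => nat) => nat => nat => nat list => nat => 'o com => bool" where
 "computes Gm f a b rs k c \<longleftrightarrow> (\<forall>n e s. agrees Gm rs k s e --> small_env Gm ((n + 2)^a) e -->
   exec ((n + 2)^b) c s (s(k := f e)) [])"

definition writes :: "('e => nat) list => ('e => 'o list) => nat => nat => nat list => nat => 'o com => bool" where
 "writes Gm w a b rs k c \<longleftrightarrow> (\<forall>n e s. agrees Gm rs k s e --> small_env Gm ((n + 2)^a) e -->
   exec ((n + 2)^b) c s s (w e))"

text \<open>The exponent \<open>b\<close> must not depend on the registers \<open>rs\<close> and
  \<open>k\<close>, whereas the program may: code is generated anew for every place where it is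
  inserted. \<open>O'\<close> only fixes the output alphabet.\<close>

definition pgm :: "'o itself => ('e => nat) list => ('e => nat) => bool" where
 "pgm O' Gm f \<longleftrightarrow> poly_bounded Gm f & (\<forall>a. \<exists>b. \<forall>rs k. \<exists>c :: 'o com. computes Gm f a b rs k c)"

definition writable :: "('e => nat) list => ('e => 'o list) => bool" where
 "writable Gm w \<longleftrightarrow> (\<forall>a. \<exists>b. \<forall>rs k. \<exists>c. writes Gm w a b rs k c)"

lemma pow_mono: "a <= b ==> ((n :: nat) + 2)^a <= (n + 2)^b"
 by (rule power_increasing) auto

lemma pow_le: "x <= ((n :: nat) + 2)^a ==> a <= b ==> x <= (n + 2)^b"
 using order_trans pow_mono by blast

lemma poly_bounded_mono: "poly_bounded Gm g ==> (!!e. f e <= g e) ==> poly_bounded Gm f"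
 unfolding poly_bounded_def by (meson order_trans)

lemma poly_bounded_const: "poly_bounded Gm (%e. c)"
proof -
 have "c <= (n + 2)^c" for n :: nat
 proof -
  have "c < 2^c" by (rule less_exp)
  also have "2^c <= (n + 2)^c" by (rule power_mono) auto
  finally show ?thesis by simp
 qed
 then show ?thesis unfolding poly_bounded_def by blast
qed

lemma poly_bounded_mult: "poly_bounded Gm f ==> poly_bounded Gm g ==> poly_bounded Gm (%e. f e*g e)"
 unfolding poly_bounded_def
proof
 fix a assume *: "\<forall>a. \<exists>b. \<forall>n e. small_env Gm ((n + 2)^a) e --> f e <= (n + 2)^b"
  "\<forall>a. \<exists>b. \<forall>n e. small_env Gm ((n + 2)^a) e --> g e <= (n + 2)^b"
 obtain b c where bc: "!!n e. small_env Gm ((n + 2)^a) e ==> f e <= (n + 2)^b"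
  "!!n e. small_env Gm ((n + 2)^a) e ==> g e <= (n + 2)^c" using*by meson
 have "small_env Gm ((n + 2)^a) e ==> f e*g e <= (n + 2)^(b + c)" for n e
  unfolding power_add using bc by (intro mult_mono) auto
 then show "\<exists>b. \<forall>n e. small_env Gm ((n + 2)^a) e --> f e*g e <= (n + 2)^b" by blast
qed

lemma poly_bounded_max: "poly_bounded Gm f ==> poly_bounded Gm g ==> poly_bounded Gm (%e. max (f e) (g e))"
 unfolding poly_bounded_def
proof
 fix a assume *: "\<forall>a. \<exists>b. \<forall>n e. small_env Gm ((n + 2)^a) e --> f e <= (n + 2)^b"
  "\<forall>a. \<exists>b. \<forall>n e. small_env Gm ((n + 2)^a) e --> g e <= (n + 2)^b"
 obtain b c where bc: "!!n e. small_env Gm ((n + 2)^a) e ==> f e <= (n + 2)^b"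
  "!!n e. small_env Gm ((n + 2)^a) e ==> g e <= (n + 2)^c" using*by meson
 have "small_env Gm ((n + 2)^a) e ==> max (f e) (g e) <= (n + 2)^(max b c)" for n e
  using bc[of n e] order_trans[OF _ pow_mono[of b "max b c" n]] order_trans[OF _ pow_mono[of c "max b c" n]]
  by (intro max.boundedI) simp_all
 then show "\<exists>b. \<forall>n e. small_env Gm ((n + 2)^a) e --> max (f e) (g e) <= (n + 2)^b" by blast
qed

lemma poly_bounded_add: "poly_bounded Gm f ==> poly_bounded Gm g ==> poly_bounded Gm (%e. f e + g e)"
 by (rule poly_bounded_mono[OF poly_bounded_mult[OF poly_bounded_const[of _ 2] poly_bounded_max[of _ f g]]]) auto

lemma poly_bounded_var: "g \<in> set Gm ==> poly_bounded Gm g"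
 unfolding poly_bounded_def small_env_def by blast

lemma pgm_bounded: "pgm O' Gm f ==> poly_bounded Gm f"
 by (simp add: pgm_def)

lemma computesD: "computes Gm f a b rs k c ==> agrees Gm rs k s e ==> small_env Gm ((n + 2)^a) e ==> b <= b' ==>
   exec ((n + 2)^b') c s (s(k := f e)) []"
 unfolding computes_def using exec_mono pow_mono by metis

lemma writesD: "writes Gm f a b rs k c ==> agrees Gm rs k s e ==> small_env Gm ((n + 2)^a) e ==> b <= b' ==>
   exec ((n + 2)^b') c s s (f e)"
 unfolding writes_def using exec_mono pow_mono by metis

lemma pgm_zero: "pgm (O' :: 'o itself) Gm (%e. 0)"
proof -
 have "computes Gm (%e. 0) a 0 rs k (Skip :: 'o com)" for a rs k
 proof -
  have "s(k := 0) = s" if "agrees Gm rs k s e" for s e using that by (auto simp: agrees_def fun_eq_iff)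
  then show ?thesis unfolding computes_def using exec.Skip by metis
 qed
 then show ?thesis unfolding pgm_def using poly_bounded_const by blast
qed

lemma pgm_var:
 assumes "g \<in> set Gm"
 shows "pgm (O' :: 'o itself) Gm g"
proof -
 obtain i where i: "i < length Gm" "Gm ! i = g" using assms by (metis in_set_conv_nth)
 have "\<exists>c :: 'o com. computes Gm g a a rs k c" for a rs k
 proof (intro exI)
  show "computes Gm g a a rs k (Seq (While (rs ! i) (Seq (Dec (rs ! i)) (Seq (Inc k) (Inc (Suc k))))) (While (Suc k) (Seq (Dec (Suc k)) (Inc (rs ! i)))))"
   unfolding computes_def
  proof (intro allI impI)
   fix n e s assume *: "agrees Gm rs k s e" "small_env Gm ((n + 2)^a) e"
   have "length (map s rs) = length (map (%g. g e) Gm)" using *(1) by (simp only: agrees_def)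
   then have l: "length rs = length Gm" by simp
   then have "s (rs ! i) = g e" using *(1) i by (metis agrees_def nth_map)
   moreover have "rs ! i < k" "s k = 0" "s (Suc k) = 0" using *(1) l i by (auto simp: agrees_def)
   moreover have "g e <= (n + 2)^a" using *(2) assms by (auto simp: small_env_def)
   ultimately show "exec ((n + 2)^a) (Seq (While (rs ! i) (Seq (Dec (rs ! i)) (Seq (Inc k) (Inc (Suc k))))) (While (Suc k) (Seq (Dec (Suc k)) (Inc (rs ! i))))) s (s(k := g e)) []"
    using exec_copy[of "rs ! i" k s "(n + 2)^a"] by simp
  qed
 qed
 then show ?thesis unfolding pgm_def using poly_bounded_var[OF assms] by blast
qed

lemma pgm_Suc:
 assumes "pgm (O' :: 'o itself) Gm f"
 shows "pgm O' Gm (%e. Suc (f e))"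
proof -
 have pb: "poly_bounded Gm (%e. f e + 1)"
  using assms unfolding pgm_def by (intro poly_bounded_add poly_bounded_const) blast
 have "\<exists>b. \<forall>rs k. \<exists>c :: 'o com. computes Gm (%e. f e + 1) a b rs k c" for a
 proof -
  obtain b1 where b1: "!!rs k. \<exists>c :: 'o com. computes Gm f a b1 rs k c" using assms unfolding pgm_def by blast
  obtain b2 where b2: "!!n e. small_env Gm ((n + 2)^a) e ==> f e + 1 <= (n + 2)^b2" using pb unfolding poly_bounded_def by blast
  have "\<exists>c :: 'o com. computes Gm (%e. f e + 1) a (max b1 b2) rs k c" for rs k
  proof -
   obtain c :: "'o com" where c: "computes Gm f a b1 rs k c" using b1 by blast
   have "computes Gm (%e. f e + 1) a (max b1 b2) rs k (Seq c (Inc k))" unfolding computes_def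
   proof (intro allI impI)
    fix n e s assume *: "agrees Gm rs k s e" "small_env Gm ((n + 2)^a) e"
    have "f e + 1 <= (n + 2)^(max b1 b2)" using b2[OF *(2)] pow_mono[of b2 "max b1 b2" n] by linarith
    then show "exec ((n + 2)^(max b1 b2)) (Seq c (Inc k)) s (s(k := f e + 1)) []"
     by (intro exec_Seq[OF computesD[OF c *] exec_Inc]) auto
   qed
   then show ?thesis by blast
  qed
  then show ?thesis by blast
 qed
 then show ?thesis using pb unfolding pgm_def by simp
qed

lemma pgm_pred:
 assumes "pgm (O' :: 'o itself) Gm f"
 shows "pgm O' Gm (%e. f e - 1)"
proof -
 have pb: "poly_bounded Gm (%e. f e - 1)" using assms by (auto simp: pgm_def intro: poly_bounded_mono[of _ f])
 have "\<exists>b. \<forall>rs k. \<exists>c :: 'o com. computes Gm (%e. f e - 1) a b rs k c" for a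
 proof -
  obtain b1 where b1: "!!rs k. \<exists>c :: 'o com. computes Gm f a b1 rs k c" using assms unfolding pgm_def by blast
  have "\<exists>c :: 'o com. computes Gm (%e. f e - 1) a b1 rs k c" for rs k
  proof -
   obtain c :: "'o com" where c: "computes Gm f a b1 rs k c" using b1 by blast
   have "computes Gm (%e. f e - 1) a b1 rs k (Seq c (Dec k))" unfolding computes_def
   proof (intro allI impI)
    fix n e s assume *: "agrees Gm rs k s e" "small_env Gm ((n + 2)^a) e"
    show "exec ((n + 2)^b1) (Seq c (Dec k)) s (s(k := f e - 1)) []"
     by (intro exec_Seq[OF computesD[OF c *] exec_Dec]) auto
   qed
   then show ?thesis by blast
  qed
  then show ?thesis by blast
 qed
 then show ?thesis using pb unfolding pgm_def by simp
qed

text \<open>Inside a loop the environment is paired with the loop variable, in the manner of de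
  Bruijn indices.\<close>

definition extend :: "('e => nat) list => ('e \<times> nat => nat) list" where
 "extend Gm = snd # map (%g p. g (fst p)) Gm"

lemma agrees_extend:
 "agrees Gm rs k s e ==> k <= r ==> r < k' ==> (!!q. k' <= q ==> s' q = 0) ==> (!!q. q < k ==> s' q = s q) ==>
  agrees (extend Gm) (r # rs) k' s' (e,s' r)"
 unfolding agrees_def extend_def by (auto cong: map_cong)

lemma small_extend: "small_env Gm B e ==> v <= B ==> small_env (extend Gm) B (e,v)"
 by (auto simp: small_env_def extend_def)

lemma small_env_mono: "small_env Gm B e ==> B <= B' ==> small_env Gm B' e"
 by (force simp: small_env_def)

lemma agrees_weaken:
 "agrees Gm rs k s e ==> k <= k' ==> (!!q. k' <= q ==> s' q = 0) ==> (!!q. q < k ==> s' q = s q) ==> agrees Gm rs k' s' e"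
proof -
 assume a: "agrees Gm rs k s e" "k <= k'" "!!q. k' <= q ==> s' q = 0" "!!q. q < k ==> s' q = s q"
 have m: "map s rs = map (%g. g e) Gm" and k: "\<forall>r\<in>set rs. r < k" using a(1) unfolding agrees_def by blast+
 have "map s' rs = map s rs" using k a(4) by (intro map_cong) auto
 then show ?thesis unfolding agrees_def using m k a(2,3) order_less_le_trans by metis
qed

text \<open>Primitive recursion. The bound on the values has to be known, but it need not be computed.\<close>
lemma pgm_rec:
 fixes R :: "'e => nat => nat"
 assumes i: "pgm (O' :: 'o itself) Gm (%e. R e 0)" and cnt: "pgm O' Gm cnt"
  and st: "pgm O' (extend (extend Gm)) (%p. stp (fst (fst p)) (snd (fst p)) (snd p))"
  and R: "!!e v. v < cnt e ==> R e (Suc v) = stp e v (R e v)"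
  and bd: "poly_bounded Gm bd" "!!e v. v <= cnt e ==> R e v <= bd e"
 shows "pgm O' Gm (%e. R e (cnt e))"
proof -
 have pb: "poly_bounded Gm (%e. R e (cnt e))" using bd(2) by (intro poly_bounded_mono[OF bd(1)]) auto
 have "\<exists>b. \<forall>rs k. \<exists>c :: 'o com. computes Gm (%e. R e (cnt e)) a b rs k c" for a
 proof -
  obtain b1 where b1: "!!rs k. \<exists>c :: 'o com. computes Gm (%e. R e 0) a b1 rs k c" using i unfolding pgm_def by blast
  obtain b2 where b2: "!!rs k. \<exists>c :: 'o com. computes Gm cnt a b2 rs k c" using cnt unfolding pgm_def by blast
  obtain b3 where b3: "!!n e. small_env Gm ((n + 2)^a) e ==> bd e <= (n + 2)^b3" using bd unfolding poly_bounded_def by blast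
  obtain b4 where b4: "!!n e. small_env Gm ((n + 2)^a) e ==> cnt e <= (n + 2)^b4"
   using pgm_bounded[OF cnt] unfolding poly_bounded_def by blast
  \<comment> \<open>Inside the loop the index and the current value join the environment, so the
    step is compiled for a larger exponent.\<close>
  define a' where "a' = max a (max b3 b4)"
  obtain b5 where b5: "!!rs k. \<exists>c :: 'o com. computes (extend (extend Gm)) (%p. stp (fst (fst p)) (snd (fst p)) (snd p)) a' b5 rs k c"
   using st unfolding pgm_def by blast
  define b where "b = max (max b1 b2) (max (max b3 b4) b5)"
  have "\<exists>c :: 'o com. computes Gm (%e. R e (cnt e)) a b rs k c" for rs k
  proof -
   obtain c1 :: "'o com" where c1: "computes Gm (%e. R e 0) a b1 rs k c1" using b1 by blast
   obtain c2 :: "'o com" where c2: "computes Gm cnt a b2 rs (Suc k) c2" using b2 by blast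
   obtain c3 :: "'o com" where c3: "computes (extend (extend Gm)) (%p. stp (fst (fst p)) (snd (fst p)) (snd p)) a' b5 (k # (k + 2) # rs) (k + 3) c3"
    using b5 by blast
   \<comment> \<open>Register \<open>k\<close> holds the current value, \<open>k + 1\<close> the
     rounds left, \<open>k + 2\<close> the index, and \<open>k + 3\<close> the new value before it
     is moved to \<open>k\<close>.\<close>
   define body :: "'o com" where "body = Seq c3 (Seq (While k (Dec k)) (Seq (While (k + 3) (Seq (Dec (k + 3)) (Inc k))) (Seq (Inc (k + 2)) (Dec (k + 1)))))"
   have "computes Gm (%e. R e (cnt e)) a b rs k (Seq c1 (Seq c2 (Seq (While (k + 1) body) (While (k + 2) (Dec (k + 2))))))"
    unfolding computes_def
   proof (intro allI impI)
    fix n e s assume *: "agrees Gm rs k s e" "small_env Gm ((n + 2)^a) e"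
    let ?B = "(n + 2)^b"
    define S where "S v = s(k := R e v,k + 1 := cnt e - v,k + 2 := v)" for v
    have z: "s q = 0" if "k <= q" for q using*that by (auto simp: agrees_def)
    have le3: "R e v <= (n + 2)^b3" if "v <= cnt e" for v using bd(2)[OF that] b3[OF *(2)] by simp
    have le4: "cnt e <= (n + 2)^b4" by (rule b4[OF *(2)])
    have 1: "exec ?B c1 s (s(k := R e 0)) []" by (rule computesD[OF c1 *]) (simp add: b_def)
    have "exec ?B c2 (s(k := R e 0)) ((s(k := R e 0))(Suc k := cnt e)) []"
     by (rule computesD[OF c2 agrees_weaken[OF *(1)] *(2)]) (auto simp: b_def z)
    moreover have "(s(k := R e 0))(Suc k := cnt e) = S 0" by (auto simp: S_def z fun_eq_iff)
    ultimately have 2: "exec ?B c2 (s(k := R e 0)) (S 0) []" by simp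
    have 3: "exec ?B (While (k + 1) body) (S 0) (S (cnt e)) (concat (map (%v. []) [0..<cnt e]))"
    proof (rule exec_for)
     fix v assume v: "v < cnt e"
     have Sz: "S v q = 0" if "k + 3 <= q" for q using that by (auto simp: S_def z)
     have Sk: "S v k = R e v" "S v (k + 2) = v" by (auto simp: S_def)
     have "agrees (extend Gm) ((k + 2) # rs) (k + 3) (S v) (e,S v (k + 2))"
      by (rule agrees_extend[OF *(1)]) (auto simp: Sz,auto simp: S_def)
     then have ag: "agrees (extend (extend Gm)) (k # (k + 2) # rs) (k + 3) (S v) ((e,v),R e v)"
      using Sz unfolding Sk(2) by (auto simp: agrees_def extend_def Sk)
     have sm: "small_env (extend (extend Gm)) ((n + 2)^a') ((e,v),R e v)"
     proof (intro small_extend small_env_mono[OF *(2)])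
      show "(n + 2)^a <= (n + 2)^a'" by (rule pow_mono) (simp add: a'_def)
      show "v <= (n + 2)^a'" by (rule pow_le[of v n b4]) (use le4 v in \<open>auto simp: a'_def\<close>)
      show "R e v <= (n + 2)^a'" by (rule pow_le[OF le3]) (use v in \<open>auto simp: a'_def\<close>)
     qed
     have "R e (Suc v) = stp e v (R e v)" using R v by blast
     then have e3: "exec ?B c3 (S v) ((S v)(k + 3 := R e (Suc v))) []"
      using computesD[OF c3 ag sm,of b] by (simp add: b_def)
     let ?T = "(S v)(k + 3 := R e (Suc v))"
     have e4: "exec ?B (While (k + 3) (Seq (Dec (k + 3)) (Inc k))) (?T(k := 0)) (?T(k := R e (Suc v),k + 3 := 0)) []"
     proof -
      have "R e (Suc v) <= ?B" by (rule pow_le[OF le3]) (use v in \<open>auto simp: b_def\<close>)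
      then have "exec ?B (While (k + 3) (Seq (Dec (k + 3)) (Inc k))) (?T(k := 0))
        ((?T(k := 0))(k + 3 := 0,k := (?T(k := 0)) k + (?T(k := 0)) (k + 3))) []"
       by (intro exec_move) auto
      moreover have "(?T(k := 0))(k + 3 := 0,k := (?T(k := 0)) k + (?T(k := 0)) (k + 3)) = ?T(k := R e (Suc v),k + 3 := 0)"
       by (auto simp: fun_eq_iff)
      ultimately show ?thesis by simp
     qed
     have vB: "v < ?B" using v by (intro less_le_trans[OF v pow_le[OF le4]]) (simp add: b_def)
     show "exec ?B body (S v) (S (Suc v)) []" unfolding body_def
      by (rule exec_Seq[OF e3 exec_Seq[OF exec_clear exec_Seq[OF e4 exec_Seq[OF exec_Inc[OF _ refl] exec_Dec]]]])
       (auto simp: S_def vB z fun_eq_iff)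
    next
     fix v assume "v <= cnt e" then show "S v (k + 1) = cnt e - v" by (simp add: S_def)
    qed
    have "(S (cnt e))(k + 2 := 0) = s(k := R e (cnt e))" by (auto simp: S_def z fun_eq_iff)
    with exec_clear[of ?B "k + 2" "S (cnt e)"] have 4: "exec ?B (While (k + 2) (Dec (k + 2))) (S (cnt e)) (s(k := R e (cnt e))) []" by simp
    show "exec ?B (Seq c1 (Seq c2 (Seq (While (k + 1) body) (While (k + 2) (Dec (k + 2)))))) s (s(k := R e (cnt e))) []"
     using 3 by (intro exec_Seq[OF 1 exec_Seq[OF 2 exec_Seq[OF _ 4]]]) (simp add: concat_Nil)
   qed
   then show ?thesis by blast
  qed
  then show ?thesis by blast
 qed
 then show ?thesis using pb unfolding pgm_def by simp
qed

lemma writable_Nil: "writable Gm (%e. [])"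
 unfolding writable_def writes_def using exec.Skip by blast

lemma writable_emit: "writable Gm (%e. [x])"
 unfolding writable_def writes_def by (meson exec.Emit)

lemma writable_append:
 assumes "writable Gm v" "writable Gm w"
 shows "writable Gm (%e. v e @ w e)"
 unfolding writable_def
proof
 fix a
 obtain b1 where b1: "!!rs k. \<exists>c. writes Gm v a b1 rs k c" using assms unfolding writable_def by blast
 obtain b2 where b2: "!!rs k. \<exists>c. writes Gm w a b2 rs k c" using assms unfolding writable_def by blast
 have "\<exists>c. writes Gm (%e. v e @ w e) a (max b1 b2) rs k c" for rs k
 proof -
  obtain c d where "writes Gm v a b1 rs k c" "writes Gm w a b2 rs k d" using b1 b2 by blast
  then have "writes Gm (%e. v e @ w e) a (max b1 b2) rs k (Seq c d)" unfolding writes_def[of _ "%e. v e @ w e"]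
   by (metis exec.Seq writesD max.cobounded1 max.cobounded2 writes_def)
  then show ?thesis by blast
 qed
 then show "\<exists>b. \<forall>rs k. \<exists>c. writes Gm (%e. v e @ w e) a b rs k c" by blast
qed

lemma writable_Cons: "writable Gm w ==> writable Gm (%e. x # w e)"
 using writable_append[OF writable_emit,of Gm w x] by simp

lemma writable_concat:
 fixes w :: "'e => nat => 'o list"
 assumes cnt: "pgm (O' :: 'o itself) Gm cnt" and w: "writable (extend Gm) (%p. w (fst p) (snd p))"
 shows "writable Gm (%e. concat (map (w e) [0..<cnt e]))"
 unfolding writable_def
proof
 fix a
 obtain b2 where b2: "!!rs k. \<exists>c :: 'o com. computes Gm cnt a b2 rs k c" using cnt unfolding pgm_def by blast
 obtain b4 where b4: "!!n e. small_env Gm ((n + 2)^a) e ==> cnt e <= (n + 2)^b4"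
  using pgm_bounded[OF cnt] unfolding poly_bounded_def by blast
 define a' where "a' = max a b4"
 obtain b5 where b5: "!!rs k. \<exists>c :: 'o com. writes (extend Gm) (%p. w (fst p) (snd p)) a' b5 rs k c"
  using w unfolding writable_def by blast
 define b where "b = max b2 (max b4 b5)"
 have "\<exists>c. writes Gm (%e. concat (map (w e) [0..<cnt e])) a b rs k c" for rs k
 proof -
  obtain c2 :: "'o com" where c2: "computes Gm cnt a b2 rs k c2" using b2 by blast
  obtain c3 :: "'o com" where c3: "writes (extend Gm) (%p. w (fst p) (snd p)) a' b5 ((k + 1) # rs) (k + 2) c3" using b5 by blast
  have "writes Gm (%e. concat (map (w e) [0..<cnt e])) a b rs k
    (Seq c2 (Seq (While k (Seq c3 (Seq (Inc (k + 1)) (Dec k)))) (While (k + 1) (Dec (k + 1)))))"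
   unfolding writes_def
  proof (intro allI impI)
   fix n e s assume *: "agrees Gm rs k s e" "small_env Gm ((n + 2)^a) e"
   let ?B = "(n + 2)^b"
   define S where "S v = s(k := cnt e - v,k + 1 := v)" for v
   have z: "s q = 0" if "k <= q" for q using*that by (auto simp: agrees_def)
   have le4: "cnt e <= (n + 2)^b4" by (rule b4[OF *(2)])
   have "exec ?B c2 s (s(k := cnt e)) []" by (rule computesD[OF c2 *]) (simp add: b_def)
   moreover have "s(k := cnt e) = S 0" by (auto simp: S_def z fun_eq_iff)
   ultimately have 2: "exec ?B c2 s (S 0) []" by simp
   have 3: "exec ?B (While k (Seq c3 (Seq (Inc (k + 1)) (Dec k)))) (S 0) (S (cnt e)) (concat (map (w e) [0..<cnt e]))"
   proof (rule exec_for)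
    fix v assume v: "v < cnt e"
    have Sz: "S v q = 0" if "k + 2 <= q" for q using that by (auto simp: S_def z)
    have Sk: "S v (k + 1) = v" by (auto simp: S_def)
    have "agrees (extend Gm) ((k + 1) # rs) (k + 2) (S v) (e,S v (k + 1))"
     by (rule agrees_extend[OF *(1)]) (auto simp: Sz,auto simp: S_def)
    then have ag: "agrees (extend Gm) ((k + 1) # rs) (k + 2) (S v) (e,v)" unfolding Sk .
    have sm: "small_env (extend Gm) ((n + 2)^a') (e,v)"
    proof (intro small_extend small_env_mono[OF *(2)])
     show "(n + 2)^a <= (n + 2)^a'" by (rule pow_mono) (simp add: a'_def)
     show "v <= (n + 2)^a'" by (rule pow_le[of v n b4]) (use le4 v in \<open>auto simp: a'_def\<close>)
    qed
    have e3: "exec ?B c3 (S v) (S v) (w e v)"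
     using writesD[OF c3 ag sm,of b] by (simp add: b_def)
    have vB: "v < ?B" using v by (intro less_le_trans[OF v pow_le[OF le4]]) (simp add: b_def)
    have "exec ?B (Seq (Inc (k + 1)) (Dec k)) (S v) (S (Suc v)) []"
     by (rule exec_Seq[OF exec_Inc[OF _ refl] exec_Dec]) (auto simp: S_def vB z fun_eq_iff)
    from exec.Seq[OF e3 this] show "exec ?B (Seq c3 (Seq (Inc (k + 1)) (Dec k))) (S v) (S (Suc v)) (w e v)" by simp
   next
    fix v assume "v <= cnt e" then show "S v k = cnt e - v" by (simp add: S_def)
   qed
   have "(S (cnt e))(k + 1 := 0) = s" by (auto simp: S_def z fun_eq_iff)
   with exec_clear[of ?B "k + 1" "S (cnt e)"] have 4: "exec ?B (While (k + 1) (Dec (k + 1))) (S (cnt e)) s []" by simp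
   show "exec ?B (Seq c2 (Seq (While k (Seq c3 (Seq (Inc (k + 1)) (Dec k)))) (While (k + 1) (Dec (k + 1))))) s s (concat (map (w e) [0..<cnt e]))"
    using exec_Seq[OF 2 exec.Seq[OF 3 4]] by simp
  qed
  then show ?thesis by blast
 qed
 then show "\<exists>b. \<forall>rs k. \<exists>c. writes Gm (%e. concat (map (w e) [0..<cnt e])) a b rs k c" by blast
qed

lemma finite_regs: "finite (regs c)"
 by (induction c) auto

lemma log_space_computable_writable:
 assumes "writable [%n. n] f"
 shows "log_space_computable f"
proof -
 obtain b c where c: "writes [%n. n] f 1 b [0] 1 c" using assms unfolding writable_def by blast
 show ?thesis
 proof (rule log_space_computable_program)
  fix n :: nat
  have "agrees [%n. n] [0] 1 (%r. if r = 0 then n else 0) n" by (auto simp: agrees_def)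
  moreover have "small_env [%n. n] ((n + 2)^1) n" by (simp add: small_env_def)
  ultimately have "exec ((n + 2)^(b + 1)) c (%r. if r = 0 then n else 0) (%r. if r = 0 then n else 0) (f n)"
   by (rule writesD[OF c]) simp
  moreover have "n <= (n + 2)^(b + 1)" by (rule pow_le[of n n 1]) auto
  ultimately show "\<exists>B s'. exec B c (%r. if r = 0 then n else 0) s' (f n) & n <= B & B <= (n + 2)^(b + 1)" by blast
 qed (rule finite_regs)
qed

declare add_2_eq_Suc [simp] add_2_eq_Suc' [simp]

lemma agrees_tl: "agrees (extend Gm) rs k s p ==> agrees Gm (tl rs) k s (fst p)"
 by (cases rs) (auto simp: agrees_def extend_def)

lemma small_env_fst: "small_env (extend Gm) B p ==> small_env Gm B (fst p)"
 by (auto simp: small_env_def extend_def)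

lemma poly_bounded_extend: "poly_bounded Gm f ==> poly_bounded (extend Gm) (%p. f (fst p))"
 unfolding poly_bounded_def using small_env_fst by blast

lemma pgm_extend:
 assumes "pgm (O' :: 'o itself) Gm f"
 shows "pgm O' (extend Gm) (%p. f (fst p))"
 unfolding pgm_def
proof (intro conjI allI)
 show "poly_bounded (extend Gm) (%p. f (fst p))" using assms by (auto simp: pgm_def intro: poly_bounded_extend)
 fix a
 obtain b where b: "!!rs k. \<exists>c :: 'o com. computes Gm f a b rs k c" using assms unfolding pgm_def by blast
 have "computes Gm f a b (tl rs) k c ==> computes (extend Gm) (%p. f (fst p)) a b rs k c" for rs k and c :: "'o com"
  unfolding computes_def using agrees_tl small_env_fst by blast
 then show "\<exists>b. \<forall>rs k. \<exists>c :: 'o com. computes (extend Gm) (%p. f (fst p)) a b rs k c" using b by blast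
qed

lemma pgm_snd: "pgm O' (extend Gm) snd"
 by (rule pgm_var) (simp add: extend_def)

lemma pgm_const: "pgm O' Gm (%e. c)"
 by (induction c) (auto intro: pgm_zero pgm_Suc)

lemma pgm_add:
 assumes f: "pgm O' Gm f" and g: "pgm O' Gm g"
 shows "pgm O' Gm (%e. f e + g e)"
proof (rule pgm_rec[where R = "%e v. f e + v" and stp = "%e v x. Suc x" and bd = "%e. f e + g e"])
 show "pgm O' (extend (extend Gm)) (%p. Suc (snd p))" by (intro pgm_Suc pgm_snd)
 show "poly_bounded Gm (%e. f e + g e)" using assms by (intro poly_bounded_add pgm_bounded)
qed (use assms in auto)

lemma pgm_diff:
 assumes f: "pgm O' Gm f" and g: "pgm O' Gm g"
 shows "pgm O' Gm (%e. f e - g e)"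
proof (rule pgm_rec[where R = "%e v. f e - v" and stp = "%e v x. x - 1" and bd = f])
 show "pgm O' (extend (extend Gm)) (%p. snd p - 1)" by (intro pgm_pred pgm_snd)
 show "poly_bounded Gm f" using assms by (intro pgm_bounded)
qed (use assms in auto)

lemma pgm_mult:
 assumes f: "pgm O' Gm f" and g: "pgm O' Gm g"
 shows "pgm O' Gm (%e. f e*g e)"
proof (rule pgm_rec[where R = "%e v. f e * v" and stp = "%e v x. x + f e" and bd = "%e. f e*g e"])
 show "pgm O' (extend (extend Gm)) (%p. snd p + f (fst (fst p)))"
  by (intro pgm_add pgm_snd pgm_extend[of O' "extend Gm" "%p. f (fst p)"] pgm_extend f)
 show "poly_bounded Gm (%e. f e*g e)" using assms by (intro poly_bounded_mult pgm_bounded)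
qed (use assms in \<open>auto intro: pgm_const\<close>)

definition decidable :: "'o itself => ('e => nat) list => ('e => bool) => bool" where
 "decidable O' Gm P \<longleftrightarrow> pgm O' Gm (%e. of_bool (P e))"

lemma decidable_cong: "pgm O' Gm f ==> (!!e. f e = of_bool (P e)) ==> decidable O' Gm P"
 unfolding decidable_def by (drule HOL.ext) simp

lemma decidable_extend: "decidable O' Gm P ==> decidable O' (extend Gm) (%p. P (fst p))"
 unfolding decidable_def by (rule pgm_extend)

lemma decidable_le: "pgm O' Gm f ==> pgm O' Gm g ==> decidable O' Gm (%e. f e <= g e)"
 by (rule decidable_cong[where f = "%e. 1 - (f e - g e)"]) (auto intro: pgm_diff pgm_const)

lemma decidable_not: "decidable O' Gm P ==> decidable O' Gm (%e. \<not> P e)"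
 by (rule decidable_cong[where f = "%e. 1 - of_bool (P e)"]) (auto simp: decidable_def intro: pgm_diff pgm_const)

lemma decidable_conj: "decidable O' Gm P ==> decidable O' Gm Q ==> decidable O' Gm (%e. P e & Q e)"
 by (rule decidable_cong[where f = "%e. of_bool (P e) * of_bool (Q e)"]) (auto simp: decidable_def intro: pgm_mult)

lemma decidable_disj: "decidable O' Gm P ==> decidable O' Gm Q ==> decidable O' Gm (%e. P e \<or> Q e)"
 using decidable_not[OF decidable_conj[OF decidable_not decidable_not],of O' Gm P Q] by simp

lemma decidable_less: "pgm O' Gm f ==> pgm O' Gm g ==> decidable O' Gm (%e. f e < g e)"
 using decidable_not[OF decidable_le,of O' Gm g f] by (simp add: not_le)

lemma decidable_eq: "pgm O' Gm f ==> pgm O' Gm g ==> decidable O' Gm (%e. f e = g e)"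
 using decidable_conj[OF decidable_le decidable_le,of O' Gm f g g f] by (simp add: order_eq_iff)

lemma pgm_if:
 assumes "decidable O' Gm P" "pgm O' Gm f" "pgm O' Gm g"
 shows "pgm O' Gm (%e. if P e then f e else g e)"
proof -
 have "pgm O' Gm (%e. of_bool (P e)*f e + (1 - of_bool (P e))*g e)"
  using assms unfolding decidable_def by (intro pgm_add pgm_mult pgm_diff pgm_const)
 moreover have "(%e. of_bool (P e)*f e + (1 - of_bool (P e))*g e) = (%e. if P e then f e else g e)" by auto
 ultimately show ?thesis by simp
qed

lemma pgm_min: "pgm O' Gm f ==> pgm O' Gm g ==> pgm O' Gm (%e. min (f e) (g e))"
 using pgm_if[OF decidable_le,of O' Gm f g f g] by (simp add: min_def)

lemma poly_bounded_sum:
 assumes "poly_bounded Gm cnt" "poly_bounded (extend Gm) (%p. h (fst p) (snd p))"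
 shows "poly_bounded Gm (%e. \<Sum>u<cnt e. h e u)"
 unfolding poly_bounded_def
proof
 fix a
 obtain b where b: "!!n e. small_env Gm ((n + 2)^a) e ==> cnt e <= (n + 2)^b" using assms unfolding poly_bounded_def by blast
 obtain c where c: "!!n p. small_env (extend Gm) ((n + 2)^(max a b)) p ==> h (fst p) (snd p) <= (n + 2)^c"
  using assms unfolding poly_bounded_def by blast
 have "(\<Sum>u<cnt e. h e u) <= (n + 2)^(b + c)" if s: "small_env Gm ((n + 2)^a) e" for n e
 proof -
  have "h e u <= (n + 2)^c" if u: "u < cnt e" for u
  proof -
   have "u <= (n + 2)^b" using u b[OF s] by linarith
   then have "u <= (n + 2)^(max a b)" by (rule pow_le) simp
   moreover have "small_env Gm ((n + 2)^(max a b)) e" by (rule small_env_mono[OF s pow_mono]) simp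
   ultimately show ?thesis using c[of n "(e,u)"] small_extend by force
  qed
  then have "(\<Sum>u<cnt e. h e u) <= (\<Sum>u<cnt e. (n + 2)^c)" by (intro sum_mono) simp
  also have "... = cnt e*(n + 2)^c" by simp
  also have "... <= (n + 2)^b*(n + 2)^c" using b[OF s] by (intro mult_right_mono) auto
  finally show ?thesis by (simp add: power_add)
 qed
 then show "\<exists>b. \<forall>n e. small_env Gm ((n + 2)^a) e --> (\<Sum>u<cnt e. h e u) <= (n + 2)^b" by blast
qed

lemma pgm_sum:
 assumes c: "pgm O' Gm cnt" and h: "pgm O' (extend Gm) (%p. h (fst p) (snd p))"
 shows "pgm O' Gm (%e. \<Sum>u<cnt e. h e u)"
proof (rule pgm_rec[where R = "%e v. \<Sum>u<v. h e u" and stp = "%e v x. x + h e v" and bd = "%e. \<Sum>u<cnt e. h e u"])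
 show "pgm O' (extend (extend Gm)) (%p. snd p + h (fst (fst p)) (snd (fst p)))"
  by (intro pgm_add pgm_snd pgm_extend[of O' "extend Gm" "%p. h (fst p) (snd p)"] h)
 show "poly_bounded Gm (%e. \<Sum>u<cnt e. h e u)" using assms by (intro poly_bounded_sum pgm_bounded)
 show "(\<Sum>u<v. h e u) <= (\<Sum>u<cnt e. h e u)" if "v <= cnt e" for e v using that by (intro sum_mono2) auto
qed (use assms in \<open>auto intro: pgm_const\<close>)

lemma decidable_ex:
 assumes "pgm O' Gm cnt" "decidable O' (extend Gm) (%p. P (fst p) (snd p))"
 shows "decidable O' Gm (%e. \<exists>u<cnt e. P e u)"
proof -
 have "decidable O' Gm (%e. 0 < (\<Sum>u<cnt e. of_bool (P e u) :: nat))"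
  using assms unfolding decidable_def[of _ "extend Gm"] by (intro decidable_less pgm_const pgm_sum)
 moreover have "(0 < (\<Sum>u<cnt e. of_bool (P e u) :: nat)) = (\<exists>u<cnt e. P e u)" for e
  by (subst neq0_conv[symmetric],subst sum_eq_0_iff) auto
 ultimately show ?thesis by simp
qed

lemma decidable_all:
 assumes "pgm O' Gm cnt" "decidable O' (extend Gm) (%p. P (fst p) (snd p))"
 shows "decidable O' Gm (%e. \<forall>u<cnt e. P e u)"
 using decidable_not[OF decidable_ex[OF assms(1) decidable_not[OF assms(2)]]] by simp

text \<open>The quotient counts the positive multiples of the divisor up to the dividend; the test
  \<open>0 < g e\<close> yields 0 for the divisor 0, as in HOL.\<close>

lemma pgm_div:
 assumes f: "pgm O' Gm f" and g: "pgm O' Gm g"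
 shows "pgm O' Gm (%e. f e div g e)"
proof -
 have "pgm O' Gm (%e. \<Sum>u<f e. of_bool (0 < g e & Suc u*g e <= f e))"
  using f g by (intro pgm_sum decidable_conj[unfolded decidable_def] decidable_less[unfolded decidable_def]
   decidable_le[unfolded decidable_def] pgm_mult pgm_Suc pgm_const pgm_snd pgm_extend)
 moreover have "(\<Sum>u<a. of_bool (0 < b & Suc u*b <= a)) = a div b" for a b :: nat
 proof (cases "b = 0")
  case False
  then have "{u. u < a & 0 < b & Suc u*b <= a} = {u. u < a div b}"
  proof (intro Collect_cong)
   fix u
   have 1: "Suc u*b <= a \<longleftrightarrow> Suc u <= a div b" using False by (metis less_eq_div_iff_mult_less_eq neq0_conv)
   have 2: "a div b <= a" by simp
   show "u < a & 0 < b & Suc u*b <= a \<longleftrightarrow> u < a div b" unfolding 1 using 2 False by linarith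
  qed
  then show ?thesis by (simp add: sum.If_cases of_bool_def Int_def)
 qed auto
 ultimately show ?thesis by simp
qed

lemma pgm_mod:
 assumes "pgm O' Gm f" "pgm O' Gm g"
 shows "pgm O' Gm (%e. f e mod g e)"
 using pgm_diff[OF assms(1) pgm_mult[OF pgm_div[OF assms] assms(2)]]
 by (simp add: minus_div_mult_eq_mod)

text \<open>The alternative \<open>u = c\<close> makes the minimum exist and gives \<open>c\<close>
  as the default value of an unsuccessful search.\<close>

definition search :: "nat => (nat => bool) => nat" where
 "search c P = (LEAST u. P u \<or> u = c)"

text \<open>The first witness is the number of positions up to which no witness has occurred, and
  this count is a sum that programs can evaluate.\<close>

lemma search_sum: "search c P = (\<Sum>u<c. of_bool (\<forall>v<Suc u. \<not> P v))"
proof -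
 let ?m = "search c P"
 have m: "P ?m \<or> ?m = c" unfolding search_def by (rule LeastI[of _ c]) simp
 have le: "?m <= c" unfolding search_def by (rule Least_le) simp
 have "{u. u < c & (\<forall>v<Suc u. \<not> P v)} = {u. u < ?m}"
 proof (intro Collect_cong iffI)
  fix u assume u: "u < c & (\<forall>v<Suc u. \<not> P v)"
  show "u < ?m" using u m by (metis less_Suc_eq_le not_le)
 next
  fix u assume u: "u < ?m"
  have "\<not> P v" if "v < Suc u" for v
   using not_less_Least[of v "%u. P u \<or> u = c"] u that unfolding search_def by auto
  then show "u < c & (\<forall>v<Suc u. \<not> P v)" using u le by auto
 qed
 then show ?thesis by (simp add: sum.If_cases of_bool_def Int_def)
qed

lemma search_le: "search c P <= c"
 unfolding search_def by (rule Least_le) simp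

lemma search_props: "P u ==> u <= c ==> P (search c P) & search c P <= u"
proof -
 assume u: "P u" "u <= c"
 have 1: "search c P <= u" unfolding search_def by (rule Least_le) (simp add: u)
 have "P (search c P) \<or> search c P = c" unfolding search_def by (rule LeastI[of _ c]) simp
 then show ?thesis using 1 u by auto
qed

lemma pgm_search:
 assumes "pgm (O' :: 'o itself) Gm cnt" "decidable O' (extend Gm) (%p. P (fst p) (snd p))"
 shows "pgm O' Gm (%e. search (cnt e) (P e))"
 unfolding search_sum
proof (intro pgm_sum assms(1))
 \<comment> \<open>The predicate skips the middle variable, which \<open>pgm_extend\<close> does not
   cover; the register of that variable is dropped from the list instead.\<close>
 have "decidable O' (extend (extend Gm)) (%p. P (fst (fst p)) (snd p))"
 proof -
  have "pgm O' (extend Gm) (%p. of_bool (P (fst p) (snd p)))" using assms(2) by (simp add: decidable_def)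
  then have p: "poly_bounded (extend (extend Gm)) (%p. of_bool (P (fst (fst p)) (snd p)))"
   by (intro poly_bounded_mono[OF poly_bounded_const[of _ 1]]) simp
  have c: "computes (extend Gm) (%p. of_bool (P (fst p) (snd p))) a b (hd rs # tl (tl rs)) k c ==>
    computes (extend (extend Gm)) (%p. of_bool (P (fst (fst p)) (snd p))) a b rs k c" for a b rs k and c :: "'o com"
   unfolding computes_def
  proof (intro allI impI)
   fix n e s
   assume *: "\<forall>n e s. agrees (extend Gm) (hd rs # tl (tl rs)) k s e --> small_env (extend Gm) ((n + 2)^a) e -->
     exec ((n + 2)^b) c s (s(k := of_bool (P (fst e) (snd e)))) []"
    "agrees (extend (extend Gm)) rs k s e" "small_env (extend (extend Gm)) ((n + 2)^a) e"
   have "agrees (extend Gm) (hd rs # tl (tl rs)) k s (fst (fst e),snd e)"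
    using *(2) by (cases rs; cases "tl rs") (auto simp: agrees_def extend_def)
   moreover have "small_env (extend Gm) ((n + 2)^a) (fst (fst e),snd e)"
    using *(3) by (auto simp: small_env_def extend_def)
   ultimately show "exec ((n + 2)^b) c s (s(k := of_bool (P (fst (fst e)) (snd e)))) []" using *(1) by force
  qed
  show ?thesis unfolding decidable_def pgm_def
  proof (intro conjI allI p)
   fix a
   obtain b where "!!rs k. \<exists>c :: 'o com. computes (extend Gm) (%p. of_bool (P (fst p) (snd p))) a b rs k c"
    using assms(2) unfolding decidable_def pgm_def by blast
   then show "\<exists>b. \<forall>rs k. \<exists>c :: 'o com. computes (extend (extend Gm)) (%p. of_bool (P (fst (fst p)) (snd p))) a b rs k c"
    using c by blast
  qed
 qed
 then have "decidable O' (extend Gm) (%p. \<forall>v<Suc (snd p). \<not> P (fst p) v)"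
  by (intro decidable_all pgm_Suc pgm_snd decidable_not)
 then show "pgm O' (extend Gm) (%p. of_bool (\<forall>v<Suc (snd p). \<not> P (fst p) v))" by (simp add: decidable_def)
qed

text \<open>A power of two may leave the polynomial range, so it is computed only up to a cap that
  is itself computable.\<close>

lemma pgm_pow2_min:
 assumes f: "pgm O' Gm f" and g: "pgm O' Gm g"
 shows "pgm O' Gm (%e. min (2^f e) (g e))"
proof (rule pgm_rec[where R = "%e v. min (2^v) (g e)" and stp = "%e v x. min (2*x) (g e)" and bd = g])
 show "pgm O' (extend (extend Gm)) (%p. min (2 * snd p) (g (fst (fst p))))"
  by (intro pgm_min pgm_mult pgm_const pgm_snd pgm_extend[of O' "extend Gm" "%p. g (fst p)"] pgm_extend g)
 show "pgm O' Gm (%e. min (2^0) (g e))" using g by (simp,intro pgm_min pgm_const)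
 show "poly_bounded Gm g" using g by (rule pgm_bounded)
qed (use assms in auto)

text \<open>Capping the divisor at \<open>Suc (g e)\<close> does not matter, since the quotient is 0
  from there on.\<close>

lemma pgm_div_pow2:
 assumes f: "pgm O' Gm f" and g: "pgm O' Gm g"
 shows "pgm O' Gm (%e. g e div 2^f e)"
proof -
 have "pgm O' Gm (%e. g e div min (2^f e) (Suc (g e)))"
  using assms by (intro pgm_div pgm_pow2_min pgm_Suc)
 moreover have "a div min b (Suc a) = a div b" for a b :: nat by (auto simp: min_def)
 ultimately show ?thesis by simp
qed

lemma decidable_pow2_le:
 assumes f: "pgm O' Gm f" and g: "pgm O' Gm g"
 shows "decidable O' Gm (%e. 2^f e <= g e)"
proof -
 have "decidable O' Gm (%e. min (2^f e) (Suc (g e)) <= g e)"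
  using assms by (intro decidable_le pgm_pow2_min pgm_Suc)
 moreover have "min b (Suc a) <= a \<longleftrightarrow> b <= a" for a b :: nat by auto
 ultimately show ?thesis by simp
qed


lemma pgm_power: "pgm O' Gm f ==> pgm O' Gm (%e. f e^d)"
 by (induction d) (auto intro: pgm_mult pgm_const simp del: One_nat_def)

text \<open>A function that is only known to exist on finitely many arguments is hardwired.\<close>
lemma pgm_table:
 assumes "pgm O' Gm f" "pgm O' Gm g"
 shows "pgm O' Gm (%e. if f e < n0 then T (f e) else g e)"
proof (induction n0)
 case (Suc n0)
 have "pgm O' Gm (%e. if f e = n0 then T n0 else if f e < n0 then T (f e) else g e)"
  using assms by (intro pgm_if decidable_eq pgm_const Suc)
 moreover have "(%e. if f e = n0 then T n0 else if f e < n0 then T (f e) else g e) = (%e. if f e < Suc n0 then T (f e) else g e)"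
  by (auto simp: less_Suc_eq)
 ultimately show ?case by simp
qed (use assms in auto)


text \<open>A conditional output is made of two loops, of which one runs once and the other not at
  all.\<close>

lemma writable_if:
 assumes P: "decidable (O' :: 'o itself) Gm P" and v: "writable Gm (v :: _ => 'o list)" and w: "writable Gm w"
 shows "writable Gm (%e. if P e then v e else w e)"
proof -
 have ext: "writable (extend Gm) (%p. u (fst p))" if "writable Gm (u :: _ => 'o list)" for u
 proof -
  have "writes Gm u a b (tl rs) k c ==> writes (extend Gm) (%p. u (fst p)) a b rs k c" for a b rs k c
   unfolding writes_def using agrees_tl small_env_fst by blast
  then show ?thesis using that unfolding writable_def by meson
 qed
 have "writable Gm (%e. concat (map (%_. v e) [0..<of_bool (P e)]) @ concat (map (%_. w e) [0..<of_bool (\<not> P e)]))"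
  using decidable_not[OF P] P v w unfolding decidable_def
  by (intro writable_append writable_concat[where O' = O'] ext)
 moreover have "concat (map (%_. v e) [0..<of_bool (P e)]) @ concat (map (%_. w e) [0..<of_bool (\<not> P e)]) = (if P e then v e else w e)" for e
  by auto
 ultimately show ?thesis by simp
qed

section \<open>Operators on disjoint sets of qubits, parallel circuits and kernels\<close>

definition acts_on :: "nat set => (qstate => qstate) => bool" where
 "acts_on A T \<longleftrightarrow> (\<exists>m. \<forall>psi U. T psi U = (\<Sum>V\<in>Pow A. m (U Int A) V*psi (U - A Un V)))"

text \<open>\<open>m\<close> and \<open>k\<close> are the matrices of the operators on their own
  qubits; for disjoint qubits both compositions are the same double sum.\<close>

lemma acts_on_commute:
 assumes "A Int B = {}" "acts_on A S" "acts_on B T"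
 shows "S (T psi) = T (S psi)"
proof
 fix U
 obtain m where m: "!!psi U. S psi U = (\<Sum>V\<in>Pow A. m (U Int A) V*psi (U - A Un V))" using assms(2) unfolding acts_on_def by blast
 obtain k where k: "!!psi U. T psi U = (\<Sum>V\<in>Pow B. k (U Int B) V*psi (U - B Un V))" using assms(3) unfolding acts_on_def by blast
 have 1: "S (T psi) U = (\<Sum>V\<in>Pow A. \<Sum>W\<in>Pow B. m (U Int A) V*(k (U Int B) W*psi (U - A - B Un V Un W)))"
  unfolding m k sum_distrib_left
 proof (intro sum.cong refl)
  fix V W assume "V \<in> Pow A" "W \<in> Pow B"
  then have "(U - A Un V) Int B = U Int B" "U - A Un V - B Un W = U - A - B Un V Un W" using assms(1) by auto
  then show "m (U Int A) V*(k ((U - A Un V) Int B) W*psi (U - A Un V - B Un W)) =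
    m (U Int A) V*(k (U Int B) W*psi (U - A - B Un V Un W))" by simp
 qed
 have 2: "T (S psi) U = (\<Sum>W\<in>Pow B. \<Sum>V\<in>Pow A. m (U Int A) V*(k (U Int B) W*psi (U - A - B Un V Un W)))"
  unfolding m k sum_distrib_left
 proof (intro sum.cong refl)
  fix V W assume "V \<in> Pow A" "W \<in> Pow B"
  then have "(U - B Un W) Int A = U Int A" "U - B Un W - A Un V = U - A - B Un V Un W" using assms(1) by auto
  then show "k (U Int B) W*(m ((U - B Un W) Int A) V*psi (U - B Un W - A Un V)) =
    m (U Int A) V*(k (U Int B) W*psi (U - A - B Un V Un W))" by simp
 qed
 show "S (T psi) U = T (S psi) U" unfolding 1 2 by (rule sum.swap)
qed

lemma acts_on_map:
 assumes "finite A" "!!U. f (U Int A) \<subseteq> A" "!!U. f U = U - A Un f (U Int A)"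
 shows "acts_on A (%psi U. psi (f U))"
 unfolding acts_on_def
proof (intro exI allI)
 fix psi :: qstate and U
 have "(\<Sum>V\<in>Pow A. (if V = f (U Int A) then 1 else 0)*psi (U - A Un V)) = (\<Sum>V\<in>Pow A. if V = f (U Int A) then psi (U - A Un V) else 0)"
  by (intro sum.cong) auto
 also have "... = psi (U - A Un f (U Int A))" using assms(1,2) by (subst sum.delta) auto
 also have "... = psi (f U)" using assms(3)[of U] by simp
 finally show "psi (f U) = (\<Sum>V\<in>Pow A. (if V = f (U Int A) then 1 else 0)*psi (U - A Un V))" ..
qed

lemma sum_Pow_singleton: "(\<Sum>V\<in>Pow {q}. f V) = f {} + f {q}"
 by (simp add: Pow_insert add.commute)

lemma acts_on_gate: "acts_on (set (gate_qubits g)) (apply_gate \<theta> g)"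
proof (cases g)
 case (Had q)
 have "apply_gate \<theta> (Had q) psi U =
   (\<Sum>V\<in>Pow {q}. (if q \<in> U Int {q} then (if q \<in> V then -1 else 1) else 1)/complex_of_real (sqrt 2)*psi (U - {q} Un V))" for psi U
  by (cases "q \<in> U") (simp_all add: sum_Pow_singleton insert_absorb diff_divide_distrib add_divide_distrib)
 then show ?thesis unfolding acts_on_def Had
  by (intro exI[of _ "%u V. (if q \<in> u then (if q \<in> V then -1 else 1) else 1)/complex_of_real (sqrt 2)"]) simp
next
 case (Rot q)
 have "apply_gate \<theta> (Rot q) psi U =
   (\<Sum>V\<in>Pow {q}. (if q \<in> U Int {q} then (if q \<in> V then cis \<theta> else 0) else (if q \<in> V then 0 else 1))*psi (U - {q} Un V))" for psi U
  by (cases "q \<in> U") (simp_all add: sum_Pow_singleton insert_absorb)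
 then show ?thesis unfolding acts_on_def Rot
  by (intro exI[of _ "%u V. (if q \<in> u then (if q \<in> V then cis \<theta> else 0) else (if q \<in> V then 0 else 1))"]) simp
next
 case (CNot c t)
 have "acts_on {c,t} (%psi U. psi (if c \<in> U then sym_diff U {t} else U))" by (rule acts_on_map) auto
 also have "(%psi U. psi (if c \<in> U then sym_diff U {t} else U)) = apply_gate \<theta> (CNot c t)" by (intro ext) (simp only: apply_gate.simps)
 finally show ?thesis by (simp only: CNot gate_qubits.simps list.set)
next
 case (FanOut c ts)
 have "acts_on (insert c (set ts)) (%psi U. psi (if c \<in> U then sym_diff U (set ts) else U))" by (rule acts_on_map) auto
 also have "(%psi U. psi (if c \<in> U then sym_diff U (set ts) else U)) = apply_gate \<theta> (FanOut c ts)" by (intro ext) (simp only: apply_gate.simps)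
 finally show ?thesis by (simp only: FanOut gate_qubits.simps list.set)
qed

abbreviation run :: "real => gate list => qstate => qstate" where
 "run \<theta> gs \<equiv> fold (apply_gate \<theta>) gs"

definition qubits :: "gate list => nat set" where
 "qubits gs = set (concat (map gate_qubits gs))"

lemma qubits_simps [simp]: "qubits [] = {}" "qubits (g # gs) = set (gate_qubits g) Un qubits gs" "qubits (gs @ hs) = qubits gs Un qubits hs"
 by (auto simp: qubits_def)

lemma qubits_concat: "qubits (concat gss) = (\<Union>gs\<in>set gss. qubits gs)"
 by (auto simp: qubits_def)

lemma gate_commute:
 "set (gate_qubits g) Int set (gate_qubits h) = {} ==> apply_gate \<theta> g (apply_gate \<theta> h psi) = apply_gate \<theta> h (apply_gate \<theta> g psi)"
 by (rule acts_on_commute[OF _ acts_on_gate acts_on_gate])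

lemma run_gate_commute:
 "set (gate_qubits g) Int qubits hs = {} ==> apply_gate \<theta> g (run \<theta> hs psi) = run \<theta> hs (apply_gate \<theta> g psi)"
proof (induction hs arbitrary: psi)
 case (Cons h hs)
 then have "set (gate_qubits g) Int qubits hs = {}" "set (gate_qubits g) Int set (gate_qubits h) = {}" by auto
 then show ?case using Cons.IH gate_commute[of g h \<theta> psi] by simp
qed simp

lemma run_commute:
 "qubits gs Int qubits hs = {} ==> run \<theta> gs (run \<theta> hs psi) = run \<theta> hs (run \<theta> gs psi)"
proof (induction gs arbitrary: psi)
 case (Cons g gs)
 then have "qubits gs Int qubits hs = {}" "set (gate_qubits g) Int qubits hs = {}" by auto
 then show ?case using Cons.IH by (simp add: run_gate_commute)
qed simp

definition wf_layers :: "nat set => layer list => bool" where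
 "wf_layers A Ls \<longleftrightarrow> (\<forall>L\<in>set Ls. distinct (concat (map gate_qubits L)) & qubits L \<subseteq> A)"

lemma wf_layers_simps [simp]:
 "wf_layers A []" "wf_layers A (L # Ls) \<longleftrightarrow> distinct (concat (map gate_qubits L)) & qubits L \<subseteq> A & wf_layers A Ls"
 "wf_layers A (Ks @ Ls) \<longleftrightarrow> wf_layers A Ks & wf_layers A Ls"
 by (auto simp: wf_layers_def)

lemma wf_layers_mono: "wf_layers A Ls ==> A \<subseteq> B ==> wf_layers B Ls"
 by (auto simp: wf_layers_def)

lemma wf_layers_qubits: "wf_layers A Ls ==> qubits (concat Ls) \<subseteq> A"
 by (auto simp: wf_layers_def qubits_concat)

definition par :: "nat => ('i => layer list) => 'i list => layer list" where
 "par T f is = map (%t. concat (map (%i. f i ! t) is)) [0..<T]"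

lemma length_par [simp]: "length (par T f is) = T" by (simp add: par_def)

lemma par_Nil: "par T f [] = replicate T []"
 by (simp add: par_def map_replicate_const)

lemma par_Cons: "length (f i) = T ==> par T f (i # is) = map2 (@) (f i) (par T f is)"
 by (auto simp: par_def intro!: nth_equalityI)

lemma wf_map2: "length X = length Y ==> wf_layers A X ==> wf_layers B Y ==> A Int B = {} ==> wf_layers (A Un B) (map2 (@) X Y)"
proof (induction X Y rule: list_induct2)
 case (Cons x xs y ys)
 moreover have "set (concat (map gate_qubits x)) Int set (concat (map gate_qubits y)) = {}"
  using Cons.prems unfolding qubits_def[symmetric] by auto
 ultimately show ?case by (auto simp: distinct_append)
qed simp

lemma run_map2:
 "length X = length Y ==> wf_layers A X ==> wf_layers B Y ==> A Int B = {} ==>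
  run \<theta> (concat (map2 (@) X Y)) psi = run \<theta> (concat Y) (run \<theta> (concat X) psi)"
proof (induction X Y arbitrary: psi rule: list_induct2)
 case (Cons x xs y ys)
 have d: "qubits y Int qubits (concat xs) = {}" using Cons.prems wf_layers_qubits[of A xs] by auto
 show ?case using Cons by (simp add: run_commute[OF d])
qed simp

lemma wf_par:
 assumes "!!i. i \<in> set is ==> wf_layers (A i) (f i) & length (f i) = T" "distinct is"
  and "!!i j. i \<in> set is ==> j \<in> set is ==> i ~= j ==> A i Int A j = {}"
 shows "wf_layers (\<Union>i\<in>set is. A i) (par T f is)"
 using assms
proof (induction "is")
 case Nil
 then show ?case by (auto simp: par_Nil wf_layers_def)
next
 case (Cons i "is")
 have "wf_layers (\<Union>i\<in>set is. A i) (par T f is)" by (rule Cons.IH) (use Cons.prems in auto)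
 moreover have "A i Int (\<Union>i\<in>set is. A i) = {}"
 proof -
  have "A i Int A j = {}" if "j \<in> set is" for j using Cons.prems(3)[of i j] Cons.prems(2) that by auto
  then show ?thesis by blast
 qed
 ultimately show ?case using Cons.prems(1)[of i] by (simp add: par_Cons wf_map2)
qed

text \<open>Components on disjoint qubits commute gate by gate. So all arguments about states may
  run them one after the other, while the depth remains that of a single component.\<close>

lemma run_par:
 assumes "!!i. i \<in> set is ==> wf_layers (A i) (f i) & length (f i) = T" "distinct is"
  and "!!i j. i \<in> set is ==> j \<in> set is ==> i ~= j ==> A i Int A j = {}"
 shows "run \<theta> (concat (par T f is)) psi = run \<theta> (concat (map (%i. concat (f i)) is)) psi"
 using assms
proof (induction "is" arbitrary: psi)
 case Nil
 have "concat (replicate T []) = ([] :: gate list)" by (induction T) auto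
 then show ?case by (simp add: par_Nil)
next
 case (Cons i "is")
 have wf: "wf_layers (\<Union>i\<in>set is. A i) (par T f is)" by (rule wf_par) (use Cons.prems in auto)
 have IH: "run \<theta> (concat (par T f is)) psi = run \<theta> (concat (map (%i. concat (f i)) is)) psi" for psi
  by (rule Cons.IH) (use Cons.prems in auto)
 have "A i Int A j = {}" if "j \<in> set is" for j using Cons.prems(3)[of i j] Cons.prems(2) that by auto
 then have d: "A i Int (\<Union>i\<in>set is. A i) = {}" by blast
 show ?case using Cons.prems(1)[of i] by (simp add: par_Cons run_map2[OF _ _ wf d] IH)
qed

lemma sum_Pow_split:
 assumes "finite M" "F \<subseteq> M"
 shows "(\<Sum>U\<in>Pow M. g U) = (\<Sum>V\<in>Pow (M - F). \<Sum>f\<in>Pow F. g (V Un f))"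
proof -
 have "(\<Sum>V\<in>Pow (M - F). \<Sum>f\<in>Pow F. g (V Un f)) = (\<Sum>x\<in>Pow (M - F) \<times> Pow F. g (fst x Un snd x))"
  by (subst sum.cartesian_product) (simp add: case_prod_beta)
 also have "... = (\<Sum>U\<in>Pow M. g U)"
  by (rule sum.reindex_bij_witness[of _ "%U. (U - F,U Int F)" "%x. fst x Un snd x"]) (use assms(2) in auto)
 finally show ?thesis ..
qed

lemma gate_norm:
 assumes "finite M" "set (gate_qubits g) \<subseteq> M" "distinct (gate_qubits g)"
 shows "(\<Sum>U\<in>Pow M. (cmod (apply_gate \<theta> g psi U))\<^sup>2) = (\<Sum>U\<in>Pow M. (cmod (psi U))\<^sup>2)"
proof -
 have perm: "(\<Sum>U\<in>Pow M. (cmod (psi (f U)))\<^sup>2) = (\<Sum>U\<in>Pow M. (cmod (psi U))\<^sup>2)"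
  if "!!U. f (f U) = U" "!!U. U \<subseteq> M ==> f U \<subseteq> M" for f
  by (rule sum.reindex_bij_witness[of _ f f]) (use that in auto)
 show ?thesis
 proof (cases g)
  case (Had q)
  have q: "{q} \<subseteq> M" using assms by (simp add: Had)
  have "(cmod ((a + b)/sqrt 2))\<^sup>2 + (cmod ((a - b)/sqrt 2))\<^sup>2 = (cmod a)\<^sup>2 + (cmod b)\<^sup>2" for a b :: complex
   by (simp add: norm_divide power_divide cmod_power2) (simp add: power2_eq_square field_simps)
  moreover have "U - {q} = U" "insert q U - {q} = U" if "U \<in> Pow (M - {q})" for U using that by auto
  ultimately show ?thesis unfolding Had
   by (subst (1 2) sum_Pow_split[OF assms(1) q]) (auto simp: sum_Pow_singleton intro!: sum.cong)
 next
  case (Rot q)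
  then show ?thesis by (auto intro!: sum.cong simp: norm_mult)
 next
  case (CNot c t)
  show ?thesis unfolding CNot apply_gate.simps by (rule perm) (use assms in \<open>auto simp: CNot\<close>)
 next
  case (FanOut c ts)
  show ?thesis unfolding FanOut apply_gate.simps by (rule perm) (use assms in \<open>auto simp: FanOut\<close>)
 qed
qed

lemma run_norm:
 assumes "finite M" "qubits gs \<subseteq> M" "!!g. g \<in> set gs ==> distinct (gate_qubits g)"
 shows "(\<Sum>U\<in>Pow M. (cmod (run \<theta> gs psi U))\<^sup>2) = (\<Sum>U\<in>Pow M. (cmod (psi U))\<^sup>2)"
 using assms
proof (induction gs arbitrary: psi)
 case (Cons g gs)
 then show ?case using gate_norm[of M g] by simp
qed simp

lemma wf_layers_distinct: "wf_layers A Ls ==> g \<in> set (concat Ls) ==> distinct (gate_qubits g)"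
 unfolding wf_layers_def by (metis UN_E distinct_concat_iff in_set_conv_nth set_concat set_map image_eqI)

definition clean :: "nat set => qstate => bool" where
 "clean F psi \<longleftrightarrow> (\<forall>U. U Int F ~= {} --> psi U = 0)"

text \<open>A basis state \<open>V\<close> with \<open>F\<close> clear becomes the superposition of
  the states \<open>V Un f\<close> with amplitudes \<open>K (V Un f)\<close>: old qubits act as
  classical controls and only the fresh ones in \<open>F\<close> are written. Hence probabilities
  can be composed classically, and the fresh qubits need not be cleared at the end.\<close>

definition kern :: "real => nat set => qstate => gate list => bool" where
 "kern \<theta> F K gs \<longleftrightarrow> (\<forall>psi U. clean F psi --> run \<theta> gs psi U = psi (U - F)*K U)"

text \<open>The first kernel must not depend on the fresh qubits of the second one; then the
  amplitudes multiply.\<close>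

lemma kern_append:
 assumes "kern \<theta> F K gs" "kern \<theta> G L hs" "F Int G = {}" "!!U. K (U - G) = K U"
 shows "kern \<theta> (F Un G) (%U. K U*L U) (gs @ hs)"
 unfolding kern_def
proof (intro allI impI)
 fix psi U assume c: "clean (F Un G) psi"
 have 1: "run \<theta> gs psi U = psi (U - F)*K U" for U using assms(1) c by (auto simp: kern_def clean_def)
 have "clean G (run \<theta> gs psi)" unfolding clean_def 1
 proof (intro allI impI)
  fix U assume "U Int G ~= {}"
  then have "(U - F) Int (F Un G) ~= {}" using assms(3) by auto
  then show "psi (U - F)*K U = 0" using c by (auto simp: clean_def)
 qed
 then have "run \<theta> hs (run \<theta> gs psi) U = run \<theta> gs psi (U - G)*L U" using assms(2) by (auto simp: kern_def)
 moreover have "U - G - F = U - (F Un G)" by auto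
 ultimately show "run \<theta> (gs @ hs) psi U = psi (U - (F Un G))*(K U*L U)"
  by (simp add: 1 assms(4))
qed

lemma kern_clean: "kern \<theta> F K gs ==> clean F psi ==> clean G psi ==> F Int G = {} ==> clean G (run \<theta> gs psi)"
 unfolding kern_def clean_def
proof (intro allI impI)
 fix U assume *: "\<forall>psi U. (\<forall>U. U Int F ~= {} --> psi U = 0) --> run \<theta> gs psi U = psi (U - F)*K U"
  "\<forall>U. U Int F ~= {} --> psi U = 0" "\<forall>U. U Int G ~= {} --> psi U = 0" "F Int G = {}" "U Int G ~= {}"
 have "(U - F) Int G ~= {}" using *(4,5) by auto
 then show "run \<theta> gs psi U = 0" using*by simp
qed

definition mass :: "nat set => qstate => (nat set => bool) => real" where
 "mass M psi E = (\<Sum>U\<in>{U \<in> Pow M. E U}. (cmod (psi U))\<^sup>2)"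

lemma mass_if: "finite M ==> mass M psi E = (\<Sum>U\<in>Pow M. if E U then (cmod (psi U))\<^sup>2 else 0)"
 unfolding mass_def by (subst sum.inter_filter) auto

lemma mass_mono: "finite M ==> (!!U. U \<subseteq> M ==> psi U ~= 0 ==> E U ==> E' U) ==> mass M psi E <= mass M psi E'"
 by (simp add: mass_if) (rule sum_mono,auto)

lemma mass_disj: "finite M ==> mass M psi (%U. E U \<or> E' U) <= mass M psi E + mass M psi E'"
 by (simp add: mass_if sum.distrib[symmetric]) (rule sum_mono,auto)

lemma mass_nonneg: "0 <= mass M psi E"
 by (simp add: mass_def sum_nonneg)

text \<open>The circuit preserves the norm of the basis state \<open>V\<close>, and only basis
  states that extend \<open>V\<close> by fresh qubits occur in the result.\<close>

lemma kern_norm: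
 assumes "kern \<theta> F K gs" "finite M" "qubits gs \<subseteq> M" "!!g. g \<in> set gs ==> distinct (gate_qubits g)" "F \<subseteq> M" "V \<subseteq> M - F"
 shows "(\<Sum>f\<in>Pow F. (cmod (K (V Un f)))\<^sup>2) = 1"
proof -
 have cl: "clean F (ket V)" using assms(6) by (auto simp: clean_def ket_def)
 have "(\<Sum>U\<in>Pow M. (cmod (run \<theta> gs (ket V) U))\<^sup>2) = (\<Sum>U\<in>Pow M. (cmod (ket V U))\<^sup>2)"
  by (rule run_norm) (use assms in auto)
 also have "... = (\<Sum>U\<in>Pow M. if U = V then 1 else 0)" by (rule sum.cong) (auto simp: ket_def)
 also have "... = 1" using assms by (subst sum.delta) auto
 finally have "1 = (\<Sum>U\<in>Pow M. (cmod (run \<theta> gs (ket V) U))\<^sup>2)" ..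
 also have "... = (\<Sum>W\<in>Pow (M - F). \<Sum>f\<in>Pow F. (cmod (ket V W*K (W Un f)))\<^sup>2)"
  unfolding sum_Pow_split[OF assms(2,5)]
 proof (intro sum.cong refl)
  fix W f assume *: "W \<in> Pow (M - F)" "f \<in> Pow F"
  then have "W Un f - F = W" by auto
  then show "(cmod (run \<theta> gs (ket V) (W Un f)))\<^sup>2 = (cmod (ket V W*K (W Un f)))\<^sup>2"
   using assms(1) cl by (simp add: kern_def)
 qed
 also have "... = (\<Sum>W\<in>Pow (M - F). if W = V then \<Sum>f\<in>Pow F. (cmod (K (W Un f)))\<^sup>2 else 0)"
  by (rule sum.cong) (auto simp: ket_def)
 also have "... = (\<Sum>f\<in>Pow F. (cmod (K (V Un f)))\<^sup>2)" using assms by (subst sum.delta) auto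
 finally show ?thesis ..
qed

text \<open>A law of conditional probability: the event \<open>E\<close> is decided by the old
  qubits, and given any old basis state in it the fresh qubits satisfy \<open>B\<close> with
  probability at most \<open>\<delta>\<close>.\<close>

lemma kern_mass:
 assumes "kern \<theta> F K gs" "finite M" "F \<subseteq> M" "clean F psi" "!!U. E (U - F) \<longleftrightarrow> E U"
  and B: "!!V. V \<subseteq> M - F ==> E V ==> psi V ~= 0 ==> (\<Sum>f\<in>Pow F. if B (V Un f) then (cmod (K (V Un f)))\<^sup>2 else 0) <= \<delta>"
 shows "mass M (run \<theta> gs psi) (%U. E U & B U) <= \<delta>*mass M psi E"
proof -
 have fin: "finite F" using assms(2,3) by (rule finite_subset[rotated])
 have VF: "V Un f - F = V" if "V \<in> Pow (M - F)" "f \<in> Pow F" for V f using that by auto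
 have E: "E (V Un f) = E V" if "V \<in> Pow (M - F)" "f \<in> Pow F" for V f using assms(5)[of "V Un f"] VF[OF that] by simp
 have "mass M (run \<theta> gs psi) (%U. E U & B U) =
   (\<Sum>V\<in>Pow (M - F). \<Sum>f\<in>Pow F. if E V & B (V Un f) then (cmod (psi V*K (V Un f)))\<^sup>2 else 0)"
  unfolding mass_if[OF assms(2)] sum_Pow_split[OF assms(2,3)]
  by (intro sum.cong refl) (use assms(1,4) in \<open>simp add: E VF kern_def\<close>)
 also have "... <= (\<Sum>V\<in>Pow (M - F). \<delta>*(if E V then (cmod (psi V))\<^sup>2 else 0))"
 proof (rule sum_mono)
  fix V assume V: "V \<in> Pow (M - F)"
  show "(\<Sum>f\<in>Pow F. if E V & B (V Un f) then (cmod (psi V*K (V Un f)))\<^sup>2 else 0) <= \<delta>*(if E V then (cmod (psi V))\<^sup>2 else 0)"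
  proof (cases "E V & psi V ~= 0")
   case True
   have "(\<Sum>f\<in>Pow F. if E V & B (V Un f) then (cmod (psi V*K (V Un f)))\<^sup>2 else 0)
     = (cmod (psi V))\<^sup>2*(\<Sum>f\<in>Pow F. if B (V Un f) then (cmod (K (V Un f)))\<^sup>2 else 0)"
    unfolding sum_distrib_left by (intro sum.cong) (use True in \<open>auto simp: norm_mult power_mult_distrib\<close>)
   also have "... <= (cmod (psi V))\<^sup>2 * \<delta>" using B[of V] True V by (intro mult_left_mono) auto
   finally show ?thesis using True by (simp add: mult.commute)
  next
   case False
   then have "(\<Sum>f\<in>Pow F. if E V & B (V Un f) then (cmod (psi V*K (V Un f)))\<^sup>2 else 0) = 0"
    by (intro sum.neutral) auto
   then show ?thesis using False by auto
  qed
 qed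
 also have "... = \<delta>*(\<Sum>V\<in>Pow (M - F). if E V then (cmod (psi V))\<^sup>2 else 0)" by (rule sum_distrib_left[symmetric])
 also have "(\<Sum>V\<in>Pow (M - F). if E V then (cmod (psi V))\<^sup>2 else 0) = mass M psi E"
  unfolding mass_if[OF assms(2)]
 proof (rule sum.mono_neutral_left)
  show "\<forall>U\<in>Pow M - Pow (M - F). (if E U then (cmod (psi U))\<^sup>2 else 0) = 0"
  proof
   fix U assume "U \<in> Pow M - Pow (M - F)"
   then have "U Int F ~= {}" by auto
   then show "(if E U then (cmod (psi U))\<^sup>2 else 0) = 0" using assms(4) by (simp add: clean_def)
  qed
 qed (use assms(2) in auto)
 finally show ?thesis .
qed

lemma Had_Had: "apply_gate \<theta> (Had q) (apply_gate \<theta> (Had q) psi) = psi"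
proof
 fix U
 have s: "complex_of_real (sqrt 2)*complex_of_real (sqrt 2) = 2" by (simp flip: of_real_mult)
 have d: "((a + b)/complex_of_real (sqrt 2) + (a - b)/complex_of_real (sqrt 2))/complex_of_real (sqrt 2) = a"
  "((a + b)/complex_of_real (sqrt 2) - (a - b)/complex_of_real (sqrt 2))/complex_of_real (sqrt 2) = b" for a b
  by (simp_all add: s flip: add_divide_distrib diff_divide_distrib)
 show "apply_gate \<theta> (Had q) (apply_gate \<theta> (Had q) psi) U = psi U"
  by (cases "q \<in> U") (simp_all add: d insert_absorb)
qed

text \<open>This exchange of control and target is what turns a fan-out gate into a parity
  gate.\<close>

lemma Had_CNot_conj:
 assumes "c ~= t"
 shows "apply_gate \<theta> (Had c) (apply_gate \<theta> (Had t) (apply_gate \<theta> (CNot c t) (apply_gate \<theta> (Had t) (apply_gate \<theta> (Had c) psi))))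
  = apply_gate \<theta> (CNot t c) psi"
proof
 fix U
 define V where "V = U - {c,t}"
 have V: "c \<notin> V" "t \<notin> V" by (auto simp: V_def)
 have "complex_of_real (sqrt 2)*complex_of_real (sqrt 2) = 2" by (simp flip: of_real_mult)
 then have s4: "complex_of_real (sqrt 2)*complex_of_real (sqrt 2)*complex_of_real (sqrt 2)*complex_of_real (sqrt 2) = 4" by simp
 have i: "insert t V - {t} = V" "insert c V - {c} = V" "insert c (insert t V) - {t} = insert c V" "insert t (insert c V) - {t} = insert c V"
   "insert c (insert t V) - {c} = insert t V" "insert t (insert c V) - {c} = insert t V"
   "insert c V - {t} = insert c V" "insert t V - {c} = insert t V" "V - {c} = V" "V - {t} = V"
  using V assms by auto
 consider "U = V" | "U = insert c V" | "U = insert t V" | "U = insert c (insert t V)"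
  unfolding V_def by (cases "c \<in> U"; cases "t \<in> U") blast+
 then show "apply_gate \<theta> (Had c) (apply_gate \<theta> (Had t) (apply_gate \<theta> (CNot c t) (apply_gate \<theta> (Had t) (apply_gate \<theta> (Had c) psi)))) U
  = apply_gate \<theta> (CNot t c) psi U"
  by cases (use V assms in \<open>simp_all add: i insert_commute s4 insert_absorb flip: add_divide_distrib diff_divide_distrib\<close>)
qed

definition parity_layers :: "nat list => nat => layer list" where
 "parity_layers es g = [map Had es @ [Had g],[FanOut g es],map Had es @ [Had g]]"

lemma concat_map_Had: "concat (map (gate_qubits \<circ> Had) es) = es" "concat (map (%x. gate_qubits (Had x)) es) = es"
 by (induction es) auto

lemma wf_parity_layers: "distinct es ==> g \<notin> set es ==> wf_layers (insert g (set es)) (parity_layers es g)"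
 by (auto simp: parity_layers_def concat_map_Had qubits_def)

lemma qubits_map_Had: "qubits (map Had es) = set es"
 by (auto simp: qubits_def)

text \<open>Conjugation by Hadamard gates reverses every controlled-not of the fan-out gate.\<close>
lemma run_parity_layers:
 assumes "distinct es" "g \<notin> set es"
 shows "run \<theta> (concat (parity_layers es g)) psi = (%U. psi (if odd (card (U Int set es)) then sym_diff U {g} else U))"
 using assms
proof (induction es arbitrary: psi)
 case Nil
 have "apply_gate \<theta> (FanOut g []) psi = psi" for psi by (rule ext) simp
 then have "run \<theta> (concat (parity_layers [] g)) psi = psi" by (simp add: parity_layers_def Had_Had del: apply_gate.simps)
 then show ?case by simp
next
 case (Cons e es)
 have eg: "e \<notin> set es" "g \<notin> set es" "e ~= g" "distinct es" using Cons.prems by auto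
 let ?h = "%q. apply_gate \<theta> (Had q)"
 let ?E = "run \<theta> (map Had es)"
 let ?F = "apply_gate \<theta> (FanOut g es)"
 have F: "apply_gate \<theta> (FanOut g (e # es)) psi = apply_gate \<theta> (CNot g e) (?F psi)" for psi
 proof
  fix U
  have "sym_diff (sym_diff U {e}) (set es) = sym_diff U (set (e # es))" using eg by auto
  then show "apply_gate \<theta> (FanOut g (e # es)) psi U = apply_gate \<theta> (CNot g e) (?F psi) U" using eg by simp
 qed
 have c1: "?E (?h e psi) = ?h e (?E psi)" "?E (?h g psi) = ?h g (?E psi)" "?h g (?h e psi) = ?h e (?h g psi)" "?F (?h e psi) = ?h e (?F psi)"
   "?E (apply_gate \<theta> (CNot e g) psi) = apply_gate \<theta> (CNot e g) (?E psi)" for psi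
  by (subst run_gate_commute gate_commute,use eg in \<open>simp add: qubits_map_Had\<close>,rule refl)+
 define \<phi> where "\<phi> = ?F (?h g (?E psi))"
 have "run \<theta> (concat (parity_layers (e # es) g)) psi = ?h g (?E (?h e (apply_gate \<theta> (CNot g e) (?F (?h g (?E (?h e psi)))))))"
  by (simp add: parity_layers_def F del: apply_gate.simps)
 also have "?F (?h g (?E (?h e psi))) = ?h e \<phi>" unfolding \<phi>_def c1(1) c1(3) c1(4) ..
 \<comment> \<open>Two inserted Hadamard gates on \<open>g\<close> complete the conjugated
   controlled-not for \<open>e\<close>; one of them is left over for the circuit of the shorter
   list.\<close>
 also have "\<phi> = ?h g (?h g \<phi>)" by (rule Had_Had[symmetric])
 also have "?h g (?E (?h e (apply_gate \<theta> (CNot g e) (?h e (?h g (?h g \<phi>)))))) =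
   ?E (?h g (?h e (apply_gate \<theta> (CNot g e) (?h e (?h g (?h g \<phi>))))))" by (simp only: c1(2))
 also have "... = ?E (apply_gate \<theta> (CNot e g) (?h g \<phi>))" using eg by (subst Had_CNot_conj) auto
 also have "... = apply_gate \<theta> (CNot e g) (?h g (?E \<phi>))" by (simp only: c1)
 also have "?h g (?E \<phi>) = run \<theta> (concat (parity_layers es g)) psi"
  by (simp add: parity_layers_def \<phi>_def del: apply_gate.simps)
 also have "... = (%U. psi (if odd (card (U Int set es)) then sym_diff U {g} else U))" by (rule Cons.IH) (use eg in auto)
 finally have r: "run \<theta> (concat (parity_layers (e # es) g)) psi =
   apply_gate \<theta> (CNot e g) (%U. psi (if odd (card (U Int set es)) then sym_diff U {g} else U))" .
 show ?case
 proof
  fix U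
  have 1: "sym_diff U {g} Int set es = U Int set es" using eg by auto
  have 2: "e \<in> U ==> U Int set (e # es) = insert e (U Int set es)" "e \<notin> U ==> U Int set (e # es) = U Int set es" by auto
  have 3: "sym_diff (sym_diff U {g}) {g} = U" by auto
  have 4: "card (insert e (U Int set es)) = Suc (card (U Int set es))" using eg by simp
  show "run \<theta> (concat (parity_layers (e # es) g)) psi U = psi (if odd (card (U Int set (e # es))) then sym_diff U {g} else U)"
   unfolding r by (cases "e \<in> U") (simp_all add: 1 2 4 3 del: list.set)
 qed
qed

section \<open>The inverse rotation\<close>

text \<open>Certainty on one side needs exact cancellation, but the basis contains no inverse
  rotation. For the golden angle this word is the inverse up to the scalar
  \<open>word_phase\<close>.\<close>

definition unrot :: "nat => gate list" where
 "unrot q = [Had q,Rot q,Had q,Rot q,Had q,Rot q,Had q,Rot q,Had q]"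

definition word_phase :: complex where
 "word_phase = (4 - 2*complex_of_real (sqrt 5 - 1) + (12 - 6*complex_of_real (sqrt 5 - 1))*gph)/complex_of_real (sqrt 2)^5"

lemma gph_quadratic: "gph^2 = complex_of_real (sqrt 5 - 1)*gph - 1"
proof -
 have "gph + cnj gph = complex_of_real (sqrt 5 - 1)" by (simp add: complex_eq_iff cos_golden)
 moreover have "gph*cnj gph = 1" by (simp add: cis_mult cis_cnj)
 moreover have "gph^2 = (gph + cnj gph)*gph - gph*cnj gph" by (simp add: power2_eq_square algebra_simps)
 ultimately show ?thesis by simp
qed

text \<open>Each pair \<open>y\<close>, \<open>z\<close> is an unnormalised Hadamard step, from the
  second on preceded by the rotation. The relations reduce every coefficient to the basis 1,
  \<open>c\<close>, \<open>t\<close>, \<open>c*t\<close>, and after five steps the mixed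
  coefficients vanish.\<close>

lemma word_identity:
 fixes t c a b :: "'a :: idom"
 assumes "t^2 = c*t - 1" "c^2 = 4 - 2*c"
  and "y1 = a + b" "z1 = a - b" "y2 = y1 + t*z1" "z2 = y1 - t*z1" "y3 = y2 + t*z2" "z3 = y2 - t*z2"
  "y4 = y3 + t*z3" "z4 = y3 - t*z3" "y5 = y4 + t*z4" "z5 = y4 - t*z4"
 shows "y5 = (4 - 2*c + (12 - 6*c)*t)*a" "t*z5 = (4 - 2*c + (12 - 6*c)*t)*b"
proof -
 have m: "t*(p + q*c + (r + s*c)*t) = - r + (- s)*c + (p + 4 * s + (q + r - 2 * s)*c)*t" for p q r s
 proof -
  have "t*(p + q*c + (r + s*c)*t) = t*(p + q*c) + (r + s*c)*t^2" by (simp add: algebra_simps power2_eq_square)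
  also have "... = t*(p + q*c) + r*c*t + s*c^2*t - (r + s*c)" unfolding assms(1) by (simp add: algebra_simps power2_eq_square)
  also have "... = - r + (- s)*c + (p + 4 * s + (q + r - 2 * s)*c)*t" unfolding assms(2) by (simp add: algebra_simps)
  finally show ?thesis .
 qed
 have lin: "P*a + Q*b + t*(R*a + S*b) = (P + t * R)*a + (Q + t*S)*b"
  "P*a + Q*b - t*(R*a + S*b) = (P - t * R)*a + (Q - t*S)*b" for P Q R S
  by (simp_all add: algebra_simps)
 have ey2: "y2 = (1 + 0*c + (1 + 0*c)*t)*a + (1 + 0*c + ((- 1) + 0*c)*t)*b"
 proof -
  show ?thesis unfolding assms(3-6) by (simp add: algebra_simps)
 qed
 have ez2: "z2 = (1 + 0*c + ((- 1) + 0*c)*t)*a + (1 + 0*c + (1 + 0*c)*t)*b"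
 proof -
  show ?thesis unfolding assms(3-6) by (simp add: algebra_simps)
 qed
 have ey3: "y3 = (2 + 0*c + (2 + (- 1)*c)*t)*a + (0 + 0*c + (0 + 1*c)*t)*b"
 proof -
  have "y3 = ((1 + 0*c + (1 + 0*c)*t) + t*(1 + 0*c + ((- 1) + 0*c)*t))*a + ((1 + 0*c + ((- 1) + 0*c)*t) + t*(1 + 0*c + (1 + 0*c)*t))*b"
   unfolding assms(7) ey2 ez2 by (rule lin(1))
  then show ?thesis unfolding m by (simp add: algebra_simps)
 qed
 have ez3: "z3 = (0 + 0*c + (0 + 1*c)*t)*a + (2 + 0*c + ((- 2) + (- 1)*c)*t)*b"
 proof -
  have "z3 = ((1 + 0*c + (1 + 0*c)*t) - t*(1 + 0*c + ((- 1) + 0*c)*t))*a + ((1 + 0*c + ((- 1) + 0*c)*t) - t*(1 + 0*c + (1 + 0*c)*t))*b"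
   unfolding assms(8) ey2 ez2 by (rule lin(2))
  then show ?thesis unfolding m by (simp add: algebra_simps)
 qed
 have ey4: "y4 = (2 + (- 1)*c + (6 + (- 3)*c)*t)*a + (2 + 1*c + ((- 2) + 1*c)*t)*b"
 proof -
  have "y4 = ((2 + 0*c + (2 + (- 1)*c)*t) + t*(0 + 0*c + (0 + 1*c)*t))*a + ((0 + 0*c + (0 + 1*c)*t) + t*(2 + 0*c + ((- 2) + (- 1)*c)*t))*b"
   unfolding assms(9) ey3 ez3 by (rule lin(1))
  then show ?thesis unfolding m by (simp add: algebra_simps)
 qed
 have ez4: "z4 = (2 + 1*c + ((- 2) + 1*c)*t)*a + ((- 2) + (- 1)*c + (2 + 1*c)*t)*b"
 proof -
  have "z4 = ((2 + 0*c + (2 + (- 1)*c)*t) - t*(0 + 0*c + (0 + 1*c)*t))*a + ((0 + 0*c + (0 + 1*c)*t) - t*(2 + 0*c + ((- 2) + (- 1)*c)*t))*b"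
   unfolding assms(10) ey3 ez3 by (rule lin(2))
  then show ?thesis unfolding m by (simp add: algebra_simps)
 qed
 have ey5: "y5 = (4 + (- 2)*c + (12 + (- 6)*c)*t)*a + (0 + 0*c + (0 + 0*c)*t)*b"
 proof -
  have "y5 = ((2 + (- 1)*c + (6 + (- 3)*c)*t) + t*(2 + 1*c + ((- 2) + 1*c)*t))*a + ((2 + 1*c + ((- 2) + 1*c)*t) + t*((- 2) + (- 1)*c + (2 + 1*c)*t))*b"
   unfolding assms(11) ey4 ez4 by (rule lin(1))
  then show ?thesis unfolding m by (simp add: algebra_simps)
 qed
 have ez5: "z5 = (0 + 0*c + (0 + 0*c)*t)*a + (4 + 2*c + ((- 4) + 2*c)*t)*b"
 proof -
  have "z5 = ((2 + (- 1)*c + (6 + (- 3)*c)*t) - t*(2 + 1*c + ((- 2) + 1*c)*t))*a + ((2 + 1*c + ((- 2) + 1*c)*t) - t*((- 2) + (- 1)*c + (2 + 1*c)*t))*b"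
   unfolding assms(12) ey4 ez4 by (rule lin(2))
  then show ?thesis unfolding m by (simp add: algebra_simps)
 qed
 show "y5 = (4 - 2*c + (12 - 6*c)*t)*a" using ey5 by simp
 have "t*z5 = t*(4 + 2*c + ((- 4) + 2*c)*t)*b" using ez5 by simp
 then show "t*z5 = (4 - 2*c + (12 - 6*c)*t)*b" unfolding m by simp
qed

lemma run_unrot:
 "run golden_angle (unrot q) psi = (%U. word_phase*(if q \<in> U then cis (- golden_angle) else 1)*psi U)"
proof -
 define h where "h = (%p :: complex \<times> complex. ((fst p + snd p)/complex_of_real (sqrt 2),(fst p - snd p)/complex_of_real (sqrt 2)))"
 define r where "r = (%p :: complex \<times> complex. (fst p,gph * snd p))"
 define pr where "pr psi V = (psi V,psi (insert q V) :: complex)" for psi V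
 have H: "pr (apply_gate golden_angle (Had q) psi) V = h (pr psi V)" if "q \<notin> V" for psi V
  using that by (simp add: pr_def h_def)
 have R: "pr (apply_gate golden_angle (Rot q) psi) V = r (pr psi V)" if "q \<notin> V" for psi V
  using that by (simp add: pr_def r_def)
 have W: "h (r (h (r (h (r (h (r (h (a,b))))))))) = (word_phase*a,word_phase*cis (- golden_angle)*b)" for a b
 proof -
  let ?s = "complex_of_real (sqrt 2)"
  let ?c = "complex_of_real (sqrt 5 - 1)"
  have "(sqrt 5 - 1)^2 = 4 - 2*(sqrt 5 - 1)" by (simp add: power2_eq_square algebra_simps)
  then have c: "?c^2 = 4 - 2*?c" by (metis of_real_diff of_real_mult of_real_numeral of_real_power)
  define y1 z1 y2 z2 y3 z3 y4 z4 y5 z5 where d: "y1 = a + b" "z1 = a - b" "y2 = y1 + gph*z1" "z2 = y1 - gph*z1" "y3 = y2 + gph*z2" "z3 = y2 - gph*z2"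
   "y4 = y3 + gph*z3" "z4 = y3 - gph*z3" "y5 = y4 + gph*z4" "z5 = y4 - gph*z4"
  note w = word_identity[OF gph_quadratic c d]
  have hr: "h (r (x/k,y/k)) = ((x + gph*y)/(k*?s),(x - gph*y)/(k*?s))" for x y k
   by (simp add: h_def r_def add_divide_distrib diff_divide_distrib mult.commute)
  have "h (a,b) = (y1/?s,z1/?s)" by (simp add: h_def d)
  then have "h (r (h (r (h (r (h (r (h (a,b))))))))) = (y5/?s^5,z5/?s^5)"
   by (simp only: hr d(3-10)[symmetric]) (simp add: power_numeral_reduce mult.assoc)
  moreover have "z5 = cis (- golden_angle)*(gph*z5)" by (simp add: cis_mult flip: mult.assoc)
  ultimately show ?thesis unfolding w(2) w(1) word_phase_def by (simp add: w)
 qed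
 have P: "pr (run golden_angle (unrot q) psi) V = (word_phase*psi V,word_phase*cis (- golden_angle)*psi (insert q V))" if "q \<notin> V" for V
  using that by (simp add: unrot_def H R W del: apply_gate.simps) (simp add: pr_def W)
 show ?thesis
 proof
  fix U
  show "run golden_angle (unrot q) psi U = word_phase*(if q \<in> U then cis (- golden_angle) else 1)*psi U"
   using P[of "U - {q}"] by (cases "q \<in> U") (simp_all add: pr_def insert_absorb)
 qed
qed

text \<open>The word preserves norms, so its action on a clear qubit gives the modulus without
  evaluating \<open>word_phase\<close>.\<close>

lemma norm_word_phase: "cmod word_phase = 1"
proof -
 have "(\<Sum>U\<in>Pow {0}. (cmod (run golden_angle (unrot 0) (ket {}) U))\<^sup>2) = (\<Sum>U\<in>Pow {0 :: nat}. (cmod (ket {} U))\<^sup>2)"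
  by (rule run_norm) (auto simp: unrot_def)
 then have "(cmod word_phase)\<^sup>2 = 1" by (simp add: run_unrot sum_Pow_singleton ket_def)
 then show ?thesis by (metis norm_ge_zero power2_eq_1_iff neg_0_le_iff_le not_one_le_zero)
qed

lemma gate_scale: "apply_gate \<theta> g (%U. k*psi U) = (%U. k*apply_gate \<theta> g psi U)"
 by (cases g) (auto simp: fun_eq_iff algebra_simps)

lemma gate_add: "apply_gate \<theta> g (%U. psi U + \<phi> U) = (%U. apply_gate \<theta> g psi U + apply_gate \<theta> g \<phi> U)"
 by (cases g) (auto simp: fun_eq_iff algebra_simps add_divide_distrib diff_divide_distrib)

lemma run_scale: "run \<theta> gs (%U. k*psi U) = (%U. k*run \<theta> gs psi U)"
 by (induction gs arbitrary: psi) (simp_all add: gate_scale)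

lemma run_add: "run \<theta> gs (%U. psi U + \<phi> U) = (%U. run \<theta> gs psi U + run \<theta> gs \<phi> U)"
 by (induction gs arbitrary: psi \<phi>) (simp_all add: gate_add)

lemma run_Hads:
 "distinct qs ==> run \<theta> (map Had qs) psi U = (\<Sum>T\<in>Pow (set qs). (-1)^card (T Int U)*psi (U - set qs Un T))/complex_of_real (sqrt 2)^length qs"
proof (induction qs arbitrary: psi)
 case (Cons q qs)
 have q: "q \<notin> set qs" "distinct qs" using Cons.prems by auto
 let ?s = "complex_of_real (sqrt 2)"
 have S: "{q} \<subseteq> insert q (set qs)" "insert q (set qs) - {q} = set qs" using q by auto
 have "(\<Sum>T\<in>Pow (set (q # qs)). (-1)^card (T Int U)*psi (U - set (q # qs) Un T)) =
   (\<Sum>T\<in>Pow (set qs). (-1)^card (T Int U)*(psi (U - set (q # qs) Un T) + (if q \<in> U then -1 else 1)*psi (U - set (q # qs) Un insert q T)))"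
  unfolding list.set sum_Pow_split[OF finite_insert[THEN iffD2,OF finite_set] S(1)] S(2) sum_Pow_singleton
 proof (intro sum.cong refl)
  fix T assume T: "T \<in> Pow (set qs)"
  then have "finite T" "q \<notin> T" using q finite_subset by auto
  then have "card ((T Un {q}) Int U) = (if q \<in> U then Suc (card (T Int U)) else card (T Int U))" by (simp add: Int_insert_left)
  then show "(-1)^card ((T Un {}) Int U)*psi (U - insert q (set qs) Un (T Un {})) + (-1)^card ((T Un {q}) Int U)*psi (U - insert q (set qs) Un (T Un {q})) =
   (-1)^card (T Int U)*(psi (U - insert q (set qs) Un T) + (if q \<in> U then -1 else 1)*psi (U - insert q (set qs) Un insert q T))"
   by (simp add: algebra_simps)
 qed
 moreover have "run \<theta> (map Had (q # qs)) psi U =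
   (\<Sum>T\<in>Pow (set qs). (-1)^card (T Int U)*((psi (U - set (q # qs) Un T) + (if q \<in> U then -1 else 1)*psi (U - set (q # qs) Un insert q T))/?s))/?s^length qs"
 proof -
  have "apply_gate \<theta> (Had q) psi (U - set qs Un T) = (psi (U - set (q # qs) Un T) + (if q \<in> U then -1 else 1)*psi (U - set (q # qs) Un insert q T))/?s"
   if T: "T \<in> Pow (set qs)" for T
  proof -
   have "q \<notin> T" using T q by auto
   define W A B where W: "W = U - set qs Un T" and A: "A = U - set (q # qs) Un T" and B: "B = U - set (q # qs) Un insert q T"
   have f: "q \<in> W \<longleftrightarrow> q \<in> U" "W - {q} = A" "insert q W = B" "q \<in> U ==> W = B" "q \<notin> U ==> W = A"
    using q \<open>q \<notin> T\<close> unfolding W A B by auto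
   have "apply_gate \<theta> (Had q) psi W = (if q \<in> U then (psi A - psi W)/?s else (psi W + psi B)/?s)" by (simp add: f(1-3))
   also have "... = (psi A + (if q \<in> U then -1 else 1)*psi B)/?s" using f(4,5) by (cases "q \<in> U") auto
   finally show ?thesis unfolding W A B .
  qed
  then show ?thesis using Cons.IH[OF q(2),of "apply_gate \<theta> (Had q) psi"] by (simp del: apply_gate.simps)
 qed
 ultimately show ?case by (simp add: sum_divide_distrib)
qed simp

section \<open>Diagonal operators\<close>

definition fan_layer :: "nat => nat => (nat => nat) => (nat => nat => nat) => (nat => nat => bool) => layer" where
 "fan_layer h P u e T = map (%i. FanOut (u i) (map (%p. e p i) (filter (%p. T p i) [0..<P]))) [0..<h]"

text \<open>Plain rotations are padded to the length of the inverse word so that both kinds run side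
  by side.\<close>

definition rot_layers :: "nat => bool => layer list" where
 "rot_layers g neg = (if neg then map (%x. [x]) (unrot g) else [Rot g] # replicate 8 [])"

text \<open>Fan-out copies let all \<open>P\<close> parities be computed at once. After the parity
  bits have been rotated, parities and copies are undone, and only a diagonal phase remains.\<close>

definition phase_layers :: "nat => nat => (nat => nat) => (nat => nat => nat) => (nat => nat) => (nat => nat => bool) => (nat => bool) => layer list" where
 "phase_layers h P u e g T neg =
  [fan_layer h P u e T] @ par 3 (%p. parity_layers (map (e p) (filter (T p) [0..<h])) (g p)) [0..<P] @
  par 9 (%p. rot_layers (g p) (neg p)) [0..<P] @
  par 3 (%p. parity_layers (map (e p) (filter (T p) [0..<h])) (g p)) [0..<P] @ [fan_layer h P u e T]"

lemma length_phase_layers: "length (phase_layers h P u e g T neg) = 17"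
 by (simp add: phase_layers_def)

definition separate :: "nat => (nat => nat) => (nat => nat => nat) => (nat => nat) => bool" where
 "separate h u e g \<longleftrightarrow> inj_on u {..<h} & inj g & (\<forall>p i q j. e p i = e q j --> p = q & i = j) &
  (\<forall>p i q. e p i ~= g q) & (\<forall>i<h. \<forall>p j. u i ~= e p j) & (\<forall>i<h. \<forall>p. u i ~= g p)"

definition anc_set :: "nat => nat => (nat => nat => nat) => (nat => nat) => nat set" where
 "anc_set h P e g = {e p i | p i. p < P & i < h} Un g ` {..<P}"

lemma run_fan:
 assumes "distinct is" "!!i j. i \<in> set is ==> j \<in> set is ==> u i \<notin> set (ts j)"
  "!!i j. i \<in> set is ==> j \<in> set is ==> i ~= j ==> set (ts i) Int set (ts j) = {}"
 shows "run \<theta> (map (%i. FanOut (u i) (ts i)) is) psi = (%U. psi (sym_diff U (\<Union>i\<in>{i \<in> set is. u i \<in> U}. set (ts i))))"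
 using assms
proof (induction "is" arbitrary: psi)
 case (Cons x xs)
 let ?R = "%U xs. \<Union>i\<in>{i \<in> set xs. u i \<in> U}. set (ts i)"
 have IH: "run \<theta> (map (%i. FanOut (u i) (ts i)) xs) psi = (%U. psi (sym_diff U (?R U xs)))" for psi
  by (rule Cons.IH) (use Cons.prems in auto)
 show ?case
 proof
  fix U
  have "u x \<notin> ?R U xs" using Cons.prems(2) by auto
  moreover have "set (ts x) Int ?R U xs = {}"
  proof -
   have "set (ts x) Int set (ts i) = {}" if "i \<in> set xs" for i using Cons.prems(1,3) that by auto
   then show ?thesis by blast
  qed
  then have "sym_diff (sym_diff U (?R U xs)) (set (ts x)) = sym_diff U (set (ts x) Un ?R U xs)" by auto
  moreover have "?R U (x # xs) = (if u x \<in> U then set (ts x) Un ?R U xs else ?R U xs)" by auto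
  moreover define S where "S = sym_diff U (?R U xs)"
  ultimately have S: "u x \<in> S \<longleftrightarrow> u x \<in> U" "sym_diff S (set (ts x)) = sym_diff U (set (ts x) Un ?R U xs)"
   "?R U (x # xs) = (if u x \<in> U then set (ts x) Un ?R U xs else ?R U xs)" by blast+
  have "run \<theta> (map (%i. FanOut (u i) (ts i)) (x # xs)) psi U = psi (if u x \<in> S then sym_diff S (set (ts x)) else S)"
   by (simp only: list.map fold_simps IH S_def[symmetric] apply_gate.simps)
  also have "... = psi (sym_diff U (?R U (x # xs)))" unfolding S by (cases "u x \<in> U") (simp_all only: S_def if_True if_False)
  finally show "run \<theta> (map (%i. FanOut (u i) (ts i)) (x # xs)) psi U = psi (sym_diff U (?R U (x # xs)))" .
 qed
qed simp

lemma run_parities: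
 assumes "distinct ps" "!!p. p \<in> set ps ==> distinct (es p)" "!!p q. p \<in> set ps ==> q \<in> set ps ==> g p \<notin> set (es q)" "inj_on g (set ps)"
 shows "run \<theta> (concat (map (%p. concat (parity_layers (es p) (g p))) ps)) psi =
  (%U. psi (sym_diff U (g ` {p \<in> set ps. odd (card (U Int set (es p)))})))"
 using assms
proof (induction ps arbitrary: psi)
 case (Cons x xs)
 let ?R = "%U xs. g ` {p \<in> set xs. odd (card (U Int set (es p)))}"
 have IH: "run \<theta> (concat (map (%p. concat (parity_layers (es p) (g p))) xs)) psi = (%U. psi (sym_diff U (?R U xs)))" for psi
  by (rule Cons.IH) (use Cons.prems in auto)
 show ?case
 proof
  fix U
  have 1: "run \<theta> (concat (parity_layers (es x) (g x))) psi = (%U. psi (if odd (card (U Int set (es x))) then sym_diff U {g x} else U))"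
   by (rule run_parity_layers) (use Cons.prems in auto)
  define R where "R = ?R U xs"
  have "set (es x) Int R = {}" using Cons.prems(3) by (auto simp: R_def)
  then have 2: "sym_diff U R Int set (es x) = U Int set (es x)" by auto
  have "g x \<notin> R" using Cons.prems(1,4) by (auto simp: R_def)
  then have 3: "sym_diff (sym_diff U R) {g x} = sym_diff U (insert (g x) R)" by auto
  have 4: "?R U (x # xs) = (if odd (card (U Int set (es x))) then insert (g x) R else R)" by (auto simp: R_def)
  have "run \<theta> (concat (map (%p. concat (parity_layers (es p) (g p))) (x # xs))) psi U =
    psi (if odd (card (sym_diff U R Int set (es x))) then sym_diff (sym_diff U R) {g x} else sym_diff U R)"
   by (simp only: list.map concat.simps fold_append comp_def IH 1 R_def[symmetric])
  also have "... = psi (sym_diff U (?R U (x # xs)))" unfolding 2 3 4 by (cases "odd (card (U Int set (es x)))") (simp_all only: if_True if_False not_False_eq_True)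
  finally show "run \<theta> (concat (map (%p. concat (parity_layers (es p) (g p))) (x # xs))) psi U = psi (sym_diff U (?R U (x # xs)))" .
 qed
qed simp

definition rot_factor :: "nat => bool => nat set => complex" where
 "rot_factor g neg U = (if neg then word_phase else 1)*(if g \<in> U then cis (if neg then - golden_angle else golden_angle) else 1)"

lemma run_rot_layers: "run golden_angle (concat (rot_layers g neg)) psi = (%U. rot_factor g neg U*psi U)"
proof -
 have "concat (rot_layers g True) = unrot g" by (simp add: rot_layers_def)
 moreover have "concat (rot_layers g False) = [Rot g]" by (simp add: rot_layers_def)
 ultimately show ?thesis by (cases neg) (auto simp: run_unrot rot_factor_def fun_eq_iff)
qed

lemma run_rots: "run golden_angle (concat (map (%p. concat (rot_layers (g p) (neg p))) ps)) psi = (%U. (\<Prod>p\<leftarrow>ps. rot_factor (g p) (neg p) U)*psi U)"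
 by (induction ps arbitrary: psi) (simp_all add: run_rot_layers fun_eq_iff mult_ac)

lemma wf_rot_layers: "wf_layers {g} (rot_layers g neg) & length (rot_layers g neg) = 9"
 by (auto simp: rot_layers_def unrot_def wf_layers_def qubits_def)

lemma distinct_concat_map:
 "distinct xs ==> (!!x. x \<in> set xs ==> distinct (f x)) ==>
  (!!x y. x \<in> set xs ==> y \<in> set xs ==> x ~= y ==> set (f x) Int set (f y) = {}) ==> distinct (concat (map f xs))"
proof (induction xs)
 case (Cons x xs)
 have "set (f x) Int set (f y) = {}" if "y \<in> set xs" for y using Cons.prems(1,3) that by auto
 then have "set (f x) Int (\<Union>y\<in>set xs. set (f y)) = {}" by blast
 then show ?case using Cons by auto
qed simp

lemma phase_circuit:
 fixes u e g h P
 assumes sep: "separate h u e g"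
 defines "A \<equiv> anc_set h P e g"
 shows "wf_layers (u ` {..<h} Un A) (phase_layers h P u e g T neg)"
  and "clean A psi ==> run golden_angle (concat (phase_layers h P u e g T neg)) psi =
   (%U. (\<Prod>p<P. (if neg p then word_phase else 1)*(if odd (card {i. i < h & T p i & u i \<in> U}) then cis (if neg p then - golden_angle else golden_angle) else 1))*psi U)"
proof -
 define ts where "ts i = map (%p. e p i) (filter (%p. T p i) [0..<P])" for i
 define es where "es p = map (e p) (filter (T p) [0..<h])" for p
 have e_inj: "e p i = e q j \<longleftrightarrow> p = q & i = j" for p i q j using sep unfolding separate_def by blast
 have eg: "e p i ~= g q" for p i q using sep unfolding separate_def by blast
 have ue: "i < h ==> u i ~= e p j" "i < h ==> u i ~= g p" for i p j using sep unfolding separate_def by blast+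
 have gi: "g p = g q \<longleftrightarrow> p = q" for p q using sep unfolding separate_def by (metis injD)
 have ui: "i < h ==> j < h ==> u i = u j \<longleftrightarrow> i = j" for i j using sep unfolding separate_def by (metis inj_on_def lessThan_iff)
 have set_ts: "set (ts i) = {e p i | p. p < P & T p i}" for i by (auto simp: ts_def)
 have set_es: "set (es p) = {e p i | i. i < h & T p i}" for p by (auto simp: es_def)
 have dis: "distinct (ts i)" "distinct (es p)" for i p by (auto simp: ts_def es_def distinct_map inj_on_def e_inj)
 have gn: "g p \<notin> set (es q)" for p q 
 proof
  assume "g p \<in> set (es q)"
  then obtain i where "g p = e q i" unfolding set_es by blast
  then show False using eg[of q i p] by simp
 qed
 have fan: "fan_layer h P u e T = map (%i. FanOut (u i) (ts i)) [0..<h]" by (simp add: fan_layer_def ts_def)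
 have wf_fan: "wf_layers (u ` {..<h} Un A) [fan_layer h P u e T]"
 proof -
  have "concat (map gate_qubits (fan_layer h P u e T)) = concat (map (%i. u i # ts i) [0..<h])" by (simp add: fan comp_def)
  moreover have "distinct (concat (map (%i. u i # ts i) [0..<h]))"
  proof (rule distinct_concat_map)
   fix x assume x: "x \<in> set [0..<h]"
   then have "u x \<notin> set (ts x)" using ue(1)[of x] by (auto simp: set_ts)
   then show "distinct (u x # ts x)" using dis by simp
   fix y assume y: "y \<in> set [0..<h]" "x ~= y"
   then have "u x ~= u y" "u x \<notin> set (ts y)" "u y \<notin> set (ts x)" using ue(1)[of x] ue(1)[of y] ui[of x y] x by (auto simp: set_ts)
   moreover have "set (ts x) Int set (ts y) = {}" using y(2) by (auto simp: set_ts e_inj)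
   ultimately show "set (u x # ts x) Int set (u y # ts y) = {}" by auto
  qed simp
  moreover have "qubits (fan_layer h P u e T) \<subseteq> u ` {..<h} Un A" by (auto simp: fan qubits_def set_ts A_def anc_set_def)
  ultimately show ?thesis by simp
 qed
 define B where "B p = insert (g p) (set (es p))" for p
 have Bd: "B p Int B q = {}" if "p ~= q" for p q
  using that by (auto simp: B_def set_es gi e_inj eg eg[symmetric])
 have BA: "(\<Union>p\<in>set [0..<P]. B p) \<subseteq> A" by (auto simp: B_def set_es A_def anc_set_def)
 have wp: "wf_layers (B p) (parity_layers (es p) (g p)) & length (parity_layers (es p) (g p)) = 3" for p
  using wf_parity_layers[OF dis(2) gn,of p p] by (simp add: B_def parity_layers_def)
 have wr: "wf_layers (B p) (rot_layers (g p) (neg p)) & length (rot_layers (g p) (neg p)) = 9" for p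
  using wf_rot_layers[of "g p" "neg p"] wf_layers_mono by (fastforce simp: B_def)
 have wf1: "wf_layers A (par 3 (%p. parity_layers (es p) (g p)) [0..<P])"
  by (rule wf_layers_mono[OF wf_par[of _ B] BA]) (use wp Bd in auto)
 have wf2: "wf_layers A (par 9 (%p. rot_layers (g p) (neg p)) [0..<P])"
  by (rule wf_layers_mono[OF wf_par[of _ B] BA]) (use wr Bd in auto)
 show "wf_layers (u ` {..<h} Un A) (phase_layers h P u e g T neg)"
  using wf_fan wf_layers_mono[OF wf1] wf_layers_mono[OF wf2] unfolding phase_layers_def es_def by auto
 define F where "F U = sym_diff U (\<Union>i\<in>{i \<in> set [0..<h]. u i \<in> U}. set (ts i))" for U
 define G where "G U = sym_diff U (g ` {p \<in> set [0..<P]. odd (card (U Int set (es p)))})" for U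
 have rF: "run golden_angle (fan_layer h P u e T) psi = (%U. psi (F U))" for psi
  unfolding fan F_def by (rule run_fan) (use ue e_inj in \<open>auto simp: set_ts\<close>)
 have rG: "run golden_angle (concat (par 3 (%p. parity_layers (es p) (g p)) [0..<P])) psi = (%U. psi (G U))" for psi
 proof -
  have "run golden_angle (concat (par 3 (%p. parity_layers (es p) (g p)) [0..<P])) psi =
    run golden_angle (concat (map (%p. concat (parity_layers (es p) (g p))) [0..<P])) psi"
   by (rule run_par[of _ B]) (use wp Bd in auto)
  also have "... = (%U. psi (G U))" unfolding G_def
   by (rule run_parities) (use dis gn gi in \<open>auto simp: inj_on_def\<close>)
  finally show ?thesis .
 qed
 have rR: "run golden_angle (concat (par 9 (%p. rot_layers (g p) (neg p)) [0..<P])) psi =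
   (%U. (\<Prod>p\<leftarrow>[0..<P]. rot_factor (g p) (neg p) U)*psi U)" for psi
 proof -
  have "run golden_angle (concat (par 9 (%p. rot_layers (g p) (neg p)) [0..<P])) psi =
    run golden_angle (concat (map (%p. concat (rot_layers (g p) (neg p))) [0..<P])) psi"
   by (rule run_par[of _ B]) (use wr Bd in auto)
  then show ?thesis by (simp only: run_rots)
 qed
 have FF: "F (F U) = U" for U
 proof -
  have "u i \<in> F U \<longleftrightarrow> u i \<in> U" if "i < h" for i using ue(1)[OF that] that by (auto simp: F_def set_ts)
  then have "{i \<in> set [0..<h]. u i \<in> F U} = {i \<in> set [0..<h]. u i \<in> U}" by auto
  then show ?thesis unfolding F_def[of "F U"] by (auto simp: F_def)
 qed
 have Ges: "G U Int set (es p) = U Int set (es p)" for U p using gn by (auto simp: G_def)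
 have GG: "G (G U) = U" for U unfolding G_def[of "G U"] Ges by (auto simp: G_def)
 show "run golden_angle (concat (phase_layers h P u e g T neg)) psi =
   (%U. (\<Prod>p<P. (if neg p then word_phase else 1)*(if odd (card {i. i < h & T p i & u i \<in> U}) then cis (if neg p then - golden_angle else golden_angle) else 1))*psi U)"
  if c: "clean A psi"
 proof
  fix U
  have r: "run golden_angle (concat (phase_layers h P u e g T neg)) psi U = (\<Prod>p\<leftarrow>[0..<P]. rot_factor (g p) (neg p) (G (F U)))*psi U"
   unfolding phase_layers_def es_def[symmetric] by (simp add: rF rG rR GG FF)
  show "run golden_angle (concat (phase_layers h P u e g T neg)) psi U =
   (\<Prod>p<P. (if neg p then word_phase else 1)*(if odd (card {i. i < h & T p i & u i \<in> U}) then cis (if neg p then - golden_angle else golden_angle) else 1))*psi U"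
  \<comment> \<open>Amplitudes that touch the ancillas vanish on both sides, so the phase matters
    only where copies and parity bits start from 0.\<close>
  proof (cases "U Int A = {}")
   case False
   then show ?thesis using c unfolding r by (simp add: clean_def)
  next
   case True
   have "rot_factor (g p) (neg p) (G (F U)) = (if neg p then word_phase else 1)*(if odd (card {i. i < h & T p i & u i \<in> U}) then cis (if neg p then - golden_angle else golden_angle) else 1)"
    if p: "p < P" for p
   proof -
    have "F U Int set (es p) = e p ` {i. i < h & T p i & u i \<in> U}"
     using True p by (auto simp: F_def set_es set_ts A_def anc_set_def e_inj)
    then have "card (F U Int set (es p)) = card {i. i < h & T p i & u i \<in> U}"
     by (simp add: card_image inj_on_def e_inj)
    moreover have "g p \<notin> F U" using True p eg by (auto simp: F_def set_ts A_def anc_set_def) (metis eg)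
    then have "g p \<in> G (F U) \<longleftrightarrow> odd (card (F U Int set (es p)))" using p by (auto simp: G_def gi)
    ultimately show ?thesis by (simp add: rot_factor_def)
   qed
   then have "(\<Prod>p\<leftarrow>[0..<P]. rot_factor (g p) (neg p) (G (F U))) =
    (\<Prod>p<P. (if neg p then word_phase else 1)*(if odd (card {i. i < h & T p i & u i \<in> U}) then cis (if neg p then - golden_angle else golden_angle) else 1))"
    by (subst prod.distinct_set_conv_list[symmetric]) (simp_all add: atLeast0LessThan)
   then show ?thesis unfolding r by simp
  qed
 qed
qed

lemma sum_double: "(\<Sum>S<2*n. F S) = (\<Sum>S<n. F (2*S) + F (2*S + 1 :: nat) :: 'a :: comm_monoid_add)"
 by (induction n) (simp_all add: add.assoc)

lemma sum_bits: "(\<Sum>S<2^h. \<Prod>i<h. f i (bit (S :: nat) i)) = (\<Prod>i<h. f i False + f i True :: int)"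
proof (induction h arbitrary: f)
 case (Suc h)
 have "(\<Sum>S<(2 :: nat)^Suc h. \<Prod>i<Suc h. f i (bit S i)) =
   (\<Sum>S<(2 :: nat)^h. f 0 False*(\<Prod>i<h. f (Suc i) (bit S i)) + f 0 True*(\<Prod>i<h. f (Suc i) (bit S i)))"
  unfolding power_Suc sum_double by (intro sum.cong refl) (simp add: prod.lessThan_Suc_shift bit_Suc bit_0 del: prod.lessThan_Suc)
 also have "... = (f 0 False + f 0 True)*(\<Prod>i<h. f (Suc i) False + f (Suc i) True)"
  by (simp add: sum.distrib Suc[of "%i. f (Suc i)"] flip: sum_distrib_left) (simp add: algebra_simps)
 finally show ?case by (simp add: prod.lessThan_Suc_shift del: prod.lessThan_Suc)
qed simp

definition odd_overlap :: "nat => nat => nat => bool" where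
 "odd_overlap h S v \<longleftrightarrow> odd (\<Sum>i<h. of_bool (bit S i & bit v i) :: nat)"

text \<open>The characters of the group (\<int>/2)^h, with vectors coded by the bits of
  numbers.\<close>

definition chi :: "nat => nat => nat => int" where
 "chi h S v = (if odd_overlap h S v then -1 else 1)"

lemma chi_prod: "chi h S v = (\<Prod>i<h. if bit S i & bit v i then -1 else 1)"
 unfolding chi_def odd_overlap_def by (induction h) auto

lemma bit_less: "v < 2^h ==> bit (v :: nat) i ==> i < h"
 using take_bit_nat_eq_self_iff[of h v] bit_take_bit_iff[of h v i] by metis

lemma sum_chi:
 assumes "v < 2^h" "w < 2^h"
 shows "(\<Sum>S<2^h. chi h S w*chi h S v) = (if w = v then 2^h else 0)"
proof -
 have "(\<Sum>S<2^h. chi h S w*chi h S v) =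
   (\<Sum>S<(2 :: nat)^h. \<Prod>i<h. (%i b. (if b & bit w i then -1 else 1)*(if b & bit v i then -1 else 1)) i (bit S i))"
  unfolding chi_prod by (simp add: prod.distrib)
 also have "... = (\<Prod>i<h. (%i b. (if b & bit w i then -1 else 1)*(if b & bit v i then -1 else 1)) i False + (%i b. (if b & bit w i then -1 else 1)*(if b & bit v i then -1 else 1)) i True)"
  by (rule sum_bits[where f = "%i b. (if b & bit w i then -1 else 1)*(if b & bit v i then -1 else 1)"])
 also have "... = (\<Prod>i<h. if bit w i = bit v i then 2 else 0)" by (intro prod.cong) auto
 also have "... = (if w = v then 2^h else 0)"
 proof (cases "w = v")
  case False
  then obtain i where "bit w i ~= bit v i" using bit_eqI by blast
  moreover from this have "i < h" using bit_less assms by blast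
  ultimately show ?thesis using False by (auto intro!: prod_zero)
 qed simp
 finally show ?thesis .
qed

text \<open>\<open>evens - odds\<close> is the unnormalised Walsh coefficient of \<open>G\<close> at
  \<open>S\<close>. It is kept as two counts of natural numbers because programs have to compute
  it.\<close>

definition evens :: "(nat => bool) => nat => nat => nat" where
 "evens G h S = (\<Sum>v<2^h. of_bool (G v & \<not> odd_overlap h S v))"

definition odds :: "(nat => bool) => nat => nat => nat" where
 "odds G h S = (\<Sum>v<2^h. of_bool (G v & odd_overlap h S v))"

text \<open>The index \<open>p\<close> codes a parity set as \<open>p mod 2^h\<close> and a copy
  number as \<open>p div 2^h\<close>. The two truncated differences add up to the absolute value of
  the Walsh coefficient, and \<open>2*c\<close> times this many copies take part.\<close>

definition active :: "nat => (nat => bool) => nat => nat => nat => bool" where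
 "active c G h p i \<longleftrightarrow> bit (p mod 2^h) i &
   p div 2^h < 2*c*((evens G h (p mod 2^h) - odds G h (p mod 2^h)) + (odds G h (p mod 2^h) - evens G h (p mod 2^h)))"

definition negative :: "bool => (nat => bool) => nat => nat => bool" where
 "negative sg G h p \<longleftrightarrow>
   (if sg then odds G h (p mod 2^h) < evens G h (p mod 2^h) else evens G h (p mod 2^h) < odds G h (p mod 2^h))"

lemma chi_sum: "int (odds G h S) - int (evens G h S) = - (\<Sum>w<2^h. of_bool (G w)*chi h S w)"
 unfolding odds_def evens_def of_nat_sum sum_subtractf[symmetric] sum_negf[symmetric]
 by (intro sum.cong) (auto simp: chi_def)

text \<open>Expansion of \<open>G\<close> in parities; only the value at 0 is lost.\<close>
lemma parity_expansion:
 assumes "v < 2^h" "\<not> G 0"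
 shows "(\<Sum>S<2^h. 2*(int (odds G h S) - int (evens G h S)) * of_bool (odd_overlap h S v)) = 2^h * of_bool (G v)"
proof -
 have chi0: "chi h S 0 = 1" for S by (simp add: chi_def odd_overlap_def)
 have "(\<Sum>S<2^h. 2*(int (odds G h S) - int (evens G h S)) * of_bool (odd_overlap h S v)) =
  (\<Sum>S<2^h. \<Sum>w<2^h. of_bool (G w)*(chi h S w*chi h S v - chi h S w*chi h S 0))"
 proof (intro sum.cong refl)
  fix S
  have o: "2 * of_bool (odd_overlap h S v) = 1 - chi h S v" by (simp add: chi_def)
  have "2*(int (odds G h S) - int (evens G h S)) * of_bool (odd_overlap h S v) = (int (odds G h S) - int (evens G h S))*(1 - chi h S v)"
   unfolding o[symmetric] by simp
  also have "... = (\<Sum>w<2^h. of_bool (G w)*chi h S w)*(chi h S v - 1)" unfolding chi_sum by (simp add: algebra_simps)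
  also have "... = (\<Sum>w<2^h. of_bool (G w)*(chi h S w*chi h S v - chi h S w*chi h S 0))"
   unfolding sum_distrib_right chi0 by (intro sum.cong) (auto simp: algebra_simps)
  finally show "2*(int (odds G h S) - int (evens G h S)) * of_bool (odd_overlap h S v) =
    (\<Sum>w<2^h. of_bool (G w)*(chi h S w*chi h S v - chi h S w*chi h S 0))" .
 qed
 \<comment> \<open>By orthogonality of the characters the inner sums pick out \<open>w = v\<close>
   and \<open>w = 0\<close>; the second contribution vanishes because \<open>G 0\<close> is
   false.\<close>
 also have "... = (\<Sum>w<2^h. of_bool (G w)*((\<Sum>S<2^h. chi h S w*chi h S v) - (\<Sum>S<2^h. chi h S w*chi h S 0)))"
  by (subst sum.swap) (simp add: sum_subtractf flip: sum_distrib_left)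
 also have "... = (\<Sum>w<2^h. if w = v then 2^h * of_bool (G v) else 0)"
  by (intro sum.cong refl) (use assms in \<open>auto simp: sum_chi\<close>)
 also have "... = 2^h * of_bool (G v)" using assms by (subst sum.delta) auto
 finally show ?thesis .
qed

lemma sum_mod_div: "(\<Sum>p<a*b. f (p mod a) (p div a)) = (\<Sum>S<a. \<Sum>w<b. f S w :: int)" for a b :: nat
proof (cases "a = 0")
 case False
 have "(\<Sum>S<a. \<Sum>w<b. f S w) = (\<Sum>x\<in>{..<a} \<times> {..<b}. f (fst x) (snd x))" by (subst sum.cartesian_product) (simp add: case_prod_beta)
 also have "... = (\<Sum>p<a*b. f (p mod a) (p div a))"
 proof (rule sum.reindex_bij_witness[of _ "%p. (p mod a,p div a)" "%x. fst x + a * snd x"])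
  fix x assume "x \<in> {..<a} \<times> {..<b}"
  then obtain S w where x: "x = (S,w)" "S < a" "w < b" by auto
  then have "a*Suc w <= a*b" by (intro mult_le_mono2) simp
  then show "fst x + a * snd x \<in> {..<a*b}" using x by simp
  show "((fst x + a * snd x) mod a,(fst x + a * snd x) div a) = x" using x by simp
  show "f ((fst x + a * snd x) mod a) ((fst x + a * snd x) div a) = f (fst x) (snd x)" using x by simp
 qed (use False in \<open>auto simp: less_mult_imp_div_less mult.commute\<close>)
 finally show ?thesis ..
qed simp

lemma prod_cis: "(\<Prod>p\<in>A. cis (f p)) = cis (\<Sum>p\<in>A. f p)"
 by (induction A rule: infinite_finite_induct) (simp_all add: cis_mult)

lemma evens_odds_le: "evens G h S + odds G h S <= 2^h"
proof -
 have "evens G h S + odds G h S <= (\<Sum>v<(2 :: nat)^h. 1)" unfolding evens_def odds_def sum.distrib[symmetric] by (intro sum_mono) auto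
 then show ?thesis by simp
qed

text \<open>The signed rotations of all copies add up to \<open>c\<close> times the parity expansion
  of \<open>G\<close>. With integer coefficients this expansion represents \<open>2^h*G\<close>,
  which is why the phase is a multiple of \<open>2^h*golden_angle\<close>.\<close>

lemma phase_value:
 fixes u :: "nat => nat" and c :: nat
 assumes v: "v < 2^h" "!!i. i < h ==> bit v i \<longleftrightarrow> u i \<in> U" and G0: "\<not> G 0"
 defines "P \<equiv> 2^h*(2*c*2^h)"
 shows "(\<Prod>p<P. (if negative sg G h p then word_phase else 1) *
   (if odd (card {i. i < h & active c G h p i & u i \<in> U}) then cis (if negative sg G h p then - golden_angle else golden_angle) else 1))
  = word_phase^card {p. p < P & negative sg G h p} * (if G v then cis ((if sg then 1 else -1)*(real (c*2^h)*golden_angle)) else 1)"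
proof -
 let ?od = "odds G h" and ?ev = "evens G h"
 define bd where "bd S = 2*c*((?ev S - ?od S) + (?od S - ?ev S))" for S
 define \<sigma> where "\<sigma> S w = (if (if sg then ?od S < ?ev S else ?ev S < ?od S) then -1 else 1)*(of_bool (w < bd S & odd_overlap h S v) :: int)" for S w :: nat
 have card: "odd (card {i. i < h & active c G h p i & u i \<in> U}) \<longleftrightarrow> p div 2^h < bd (p mod 2^h) & odd_overlap h (p mod 2^h) v" for p
 proof -
  have "{i. i < h & active c G h p i & u i \<in> U} = (if p div 2^h < bd (p mod 2^h) then {i \<in> {..<h}. bit (p mod 2^h) i & bit v i} else {})"
   using v(2) by (auto simp: active_def bd_def)
  moreover have "card {i \<in> {..<h}. bit (p mod 2^h) i & bit v i} = (\<Sum>i<h. of_bool (bit (p mod 2^h) i & bit v i))"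
   by (simp only: card_eq_sum sum.inter_filter[OF finite_lessThan] of_bool_def)
  ultimately show ?thesis by (simp add: odd_overlap_def)
 qed
 have "(\<Prod>p<P. (if negative sg G h p then word_phase else 1) *
   (if odd (card {i. i < h & active c G h p i & u i \<in> U}) then cis (if negative sg G h p then - golden_angle else golden_angle) else 1))
  = (\<Prod>p<P. if negative sg G h p then word_phase else 1)*(\<Prod>p<P. cis (golden_angle*real_of_int (\<sigma> (p mod 2^h) (p div 2^h))))"
  unfolding prod.distrib[symmetric] card by (intro prod.cong refl) (auto simp: \<sigma>_def negative_def)
 also have "(\<Prod>p<P. if negative sg G h p then word_phase else 1) = word_phase^card {p. p < P & negative sg G h p}"
  by (simp add: prod.If_cases Int_def)
 also have "(\<Prod>p<P. cis (golden_angle*real_of_int (\<sigma> (p mod 2^h) (p div 2^h)))) = cis (golden_angle*real_of_int (\<Sum>S<2^h. \<Sum>w<2*c*2^h. \<sigma> S w))"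
  unfolding prod_cis sum_distrib_left[symmetric] of_int_sum[symmetric] P_def sum_mod_div ..
 also have "(\<Sum>S<2^h. \<Sum>w<2*c*2^h. \<sigma> S w) = (\<Sum>S<2^h. (if sg then 1 else -1)*int c*(2*(int (?od S) - int (?ev S)) * of_bool (odd_overlap h S v)))"
 proof (intro sum.cong refl)
  fix S
  have "bd S <= 2*c*2^h" unfolding bd_def using evens_odds_le[of G h S] by (intro mult_le_mono2) auto
  then have "{w. w < 2*c*2^h & w < bd S} = {..<bd S}" by auto
  then have n: "(\<Sum>w<2*c*2^h. of_bool (w < bd S)) = int (bd S)" by (simp add: of_bool_def sum.If_cases Int_def)
  have "(\<Sum>w<2*c*2^h. \<sigma> S w) = (if (if sg then ?od S < ?ev S else ?ev S < ?od S) then -1 else 1) * of_bool (odd_overlap h S v)*(\<Sum>w<2*c*2^h. of_bool (w < bd S))"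
   unfolding sum_distrib_left by (intro sum.cong) (auto simp: \<sigma>_def)
  also have "... = (if sg then 1 else -1)*int c*(2*(int (?od S) - int (?ev S)) * of_bool (odd_overlap h S v))"
   unfolding n unfolding bd_def by (auto simp: of_nat_diff algebra_simps)
  finally show "(\<Sum>w<2*c*2^h. \<sigma> S w) = (if sg then 1 else -1)*int c*(2*(int (?od S) - int (?ev S)) * of_bool (odd_overlap h S v))" .
 qed
 also have "... = (if sg then 1 else -1)*int c*(2^h * of_bool (G v))"
  unfolding sum_distrib_left[symmetric] parity_expansion[where G = G,OF v(1) G0] ..
 finally show ?thesis by (cases "G v"; cases sg) (simp_all add: mult_ac)
qed

section \<open>The or of few bits\<close>

text \<open>Of the bits of \<open>v\<close>, the lowest \<open>m\<close> are the inputs, bit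
  \<open>m\<close> is the flag, and those above form a selector. Marking for \<open>F\<close> of the
  \<open>2^L\<close> selectors makes the probability of the flag tunable.\<close>

definition good_mark :: "nat => nat => nat => bool" where
 "good_mark m F v \<longleftrightarrow> v mod 2^m ~= 0 & bit v m & v div 2^Suc m < F"

definition flag_mark :: "nat => nat => bool" where
 "flag_mark m v \<longleftrightarrow> v mod 2^m ~= 0 & bit v m"

definition zero_mark :: "nat => nat => bool" where
 "zero_mark m v \<longleftrightarrow> v mod 2^m ~= 0 & v div 2^m = 0"

definition mark_layers :: "nat => nat => (nat => nat) => (nat => nat => nat) => (nat => nat) => bool => (nat => bool) => layer list" where
 "mark_layers h c u e g sg G = phase_layers h (2^h*(2*c*2^h)) u e g (active c G h) (negative sg G h)"

text \<open>One round of amplitude amplification with the phase \<open>e0\<close> in place of -1: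
  prepare, mark the flag, unprepare, mark the clear state, prepare again. Every mark also tests that
  some input is set, so that on zero inputs the whole circuit cancels up to a scalar.\<close>

definition or_layers :: "nat => nat => nat => nat => (nat => nat) => (nat => nat => nat) => (nat => nat) => layer list" where
 "or_layers m L F c u e g = (let h = m + L + 1 in
  [map Had (map u [m..<h])] @ mark_layers h c u e g True (good_mark m F) @ [[Had (u m)]] @
  mark_layers h c u e g True (flag_mark m) @
  [[Had (u m)]] @ mark_layers h c u e g False (good_mark m F) @ [map Had (map u [m..<h])] @
  mark_layers h c u e g True (zero_mark m) @
  [map Had (map u [m..<h])] @ mark_layers h c u e g True (good_mark m F) @ [[Had (u m)]])"

lemma length_or_layers: "length (or_layers m L F c u e g) = 91"
 by (simp add: or_layers_def mark_layers_def length_phase_layers Let_def)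

lemma Hads_Hads: "distinct qs ==> run \<theta> (map Had qs) (run \<theta> (map Had qs) psi) = psi"
proof (induction qs arbitrary: psi)
 case (Cons q qs)
 have "apply_gate \<theta> (Had q) (run \<theta> (map Had qs) psi) = run \<theta> (map Had qs) (apply_gate \<theta> (Had q) psi)" for psi
  by (rule run_gate_commute) (use Cons.prems in \<open>simp add: qubits_map_Had\<close>)
 then show ?case using Cons by (simp add: Had_Had del: apply_gate.simps)
qed simp

lemma clean_Hads: "distinct qs ==> set qs Int A = {} ==> clean A psi ==> clean A (run \<theta> (map Had qs) psi)"
 unfolding clean_def run_Hads
proof (intro allI impI)
 fix U assume a: "set qs Int A = {}" "\<forall>U. U Int A ~= {} --> psi U = 0" "U Int A ~= {}"
 then have "(U - set qs Un T) Int A ~= {}" for T by auto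
 then show "(\<Sum>T\<in>Pow (set qs). (- 1)^card (T Int U)*psi (U - set qs Un T))/complex_of_real (sqrt 2)^length qs = 0"
  using a(2) by simp
qed

locale or_gate =
 fixes m L F c :: nat and u :: "nat => nat" and e :: "nat => nat => nat" and g :: "nat => nat"
 assumes sep: "separate (m + L + 1) u e g" and FL: "F <= 2^L"
begin

definition "h = m + L + 1"
definition "q = u m"
definition "E = u ` {m..<h}"
definition "A = anc_set h (2^h*(2*c*2^h)) e g"
definition "e0 = cis (real (c*2^h)*golden_angle)"
definition vn :: "nat set => nat" where "vn U = horner_sum of_bool 2 (map (%i. u i \<in> U) [0..<h])"
definition eps :: "nat set => complex" where "eps U = (if \<exists>i<m. u i \<in> U then e0 else 1)"
definition sv :: "nat set => nat" where "sv U = vn U div 2^Suc m"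
definition a1 :: "nat set => complex" where "a1 U = (if sv U < F then eps U else 1)"
definition r2 :: complex where "r2 = complex_of_real (sqrt 2)"
definition w :: complex where "w = 1/r2^(L + 1)"
text \<open>The amplitude that the preparation gives to the flag and selector bits in
  \<open>U\<close>, up to a unit scalar.\<close>

definition amp :: "nat set => complex" where "amp U = w*(if q \<in> U then (1 - a1 U)/r2 else (1 + a1 U)/r2)"

lemma r2: "r2*r2 = 2" "r2 ~= 0" "cnj r2 = r2" "w*w = 1/2^(L + 1)" "cmod r2 = sqrt 2"
proof -
 show *: "r2*r2 = 2" unfolding r2_def by (simp flip: of_real_mult)
 show "r2 ~= 0" "cnj r2 = r2" "cmod r2 = sqrt 2" by (simp_all add: r2_def)
 have "w*w = 1/(r2*r2)^(L + 1)" unfolding w_def power_mult_distrib by simp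
 then show "w*w = 1/2^(L + 1)" unfolding * .
qed

lemma inj_u: "i < h ==> j < h ==> u i = u j \<longleftrightarrow> i = j"
 using sep unfolding separate_def h_def by (metis inj_on_def lessThan_iff)

lemma bit_vn: "bit (vn U) i \<longleftrightarrow> i < h & u i \<in> U"
 unfolding vn_def bit_horner_sum_bit_iff by auto

lemma vn_less: "vn U < 2^h"
 unfolding vn_def using horner_sum_of_bool_2_less[of "map (%i. u i \<in> U) [0..<h]"] by simp

lemma disj: "E Int A = {}" "u i \<in> A ==> \<not> i < h"
proof -
 have ue: "\<forall>i<h. \<forall>p j. u i ~= e p j" "\<forall>i<h. \<forall>p. u i ~= g p"
  using sep unfolding separate_def h_def by blast+
 show *: "u i \<in> A ==> \<not> i < h" for i using ue unfolding A_def anc_set_def by blast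
 show "E Int A = {}" using*unfolding E_def by fastforce
qed

lemma qE: "q \<in> E" "m < h" by (auto simp: q_def E_def h_def)

lemma E_split: "E = insert q (E - {q})" using qE by auto

lemma b_notin: "i < m ==> u i \<notin> E"
 using inj_u by (force simp: E_def h_def)

lemma eps_cong: "eps (U - E) = eps U" "eps (U - {q}) = eps U" "eps (insert q U) = eps U" "T \<subseteq> E ==> eps (V Un T) = eps V"
proof -
 have "u i ~= q" if "i < m" for i using b_notin[OF that] qE by auto
 then show "eps (U - E) = eps U" "eps (U - {q}) = eps U" "eps (insert q U) = eps U" "T \<subseteq> E ==> eps (V Un T) = eps V"
  using b_notin by (auto simp: eps_def)
qed

lemma eps_vn: "vn U mod 2^m ~= 0 \<longleftrightarrow> (\<exists>i<m. u i \<in> U)"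
proof -
 have "vn U mod 2^m = 0 \<longleftrightarrow> (\<forall>i. \<not> bit (vn U mod 2^m) i)" using bit_eqI[of "vn U mod 2^m" 0] by auto
 also have "... \<longleftrightarrow> (\<forall>i<m. u i \<notin> U)" unfolding take_bit_eq_mod[symmetric] bit_take_bit_iff bit_vn h_def by auto
 finally show ?thesis by auto
qed

lemma bit_sv: "bit (sv U) k \<longleftrightarrow> k < L & u (Suc m + k) \<in> U"
 unfolding sv_def drop_bit_eq_div[symmetric] bit_drop_bit_eq comp_def bit_vn by (auto simp: h_def)

lemma sv_cong: "(!!k. k < L ==> u (Suc m + k) \<in> U \<longleftrightarrow> u (Suc m + k) \<in> V) ==> sv U = sv V"
 by (rule bit_eqI) (auto simp: bit_sv)

lemma s_ne_q: "k < L ==> u (Suc m + k) ~= q"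
 using inj_u[of "Suc m + k" m] by (auto simp: q_def h_def)

lemma sv_q: "sv (U - {q}) = sv U" "sv (insert q U) = sv U"
 by (rule sv_cong,use s_ne_q in auto)+

lemma a1_q: "a1 (U - {q}) = a1 U" "a1 (insert q U) = a1 U"
 by (simp_all add: a1_def sv_q eps_cong)

lemma marks: "good_mark m F (vn U) \<longleftrightarrow> (\<exists>i<m. u i \<in> U) & q \<in> U & sv U < F"
 "flag_mark m (vn U) \<longleftrightarrow> (\<exists>i<m. u i \<in> U) & q \<in> U"
 "zero_mark m (vn U) \<longleftrightarrow> (\<exists>i<m. u i \<in> U) & U Int E = {}"
proof -
 show "good_mark m F (vn U) \<longleftrightarrow> (\<exists>i<m. u i \<in> U) & q \<in> U & sv U < F" "flag_mark m (vn U) \<longleftrightarrow> (\<exists>i<m. u i \<in> U) & q \<in> U"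
  unfolding good_mark_def flag_mark_def eps_vn bit_vn sv_def q_def using qE(2) by auto
 have "vn U div 2^m = 0 \<longleftrightarrow> (\<forall>i. \<not> bit (vn U div 2^m) i)" using bit_eqI[of "vn U div 2^m" 0] by auto
 also have "... \<longleftrightarrow> (\<forall>i. \<not> (m + i < h & u (m + i) \<in> U))" unfolding drop_bit_eq_div[symmetric] bit_drop_bit_eq comp_def bit_vn ..
 also have "... \<longleftrightarrow> U Int E = {}" by (auto simp: E_def) (metis atLeastLessThan_iff le_Suc_ex)
 finally show "zero_mark m (vn U) \<longleftrightarrow> (\<exists>i<m. u i \<in> U) & U Int E = {}" unfolding zero_mark_def eps_vn by simp
qed

lemma sum_sv:
 assumes "V Int E = {}"
 shows "(\<Sum>T\<in>Pow (E - {q}). f (sv (V Un T))) = (\<Sum>v<2^L. f v :: complex)"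
proof (rule sum.reindex_bij_witness[of _ "%v. {u (Suc m + k) | k. k < L & bit v k}" "%T. sv (V Un T)"])
 have S: "E - {q} = {u (Suc m + k) | k. k < L}"
 proof -
  have "{m..<h} = insert m {Suc m + k | k. k < L}" unfolding h_def by (auto simp: le_Suc_ex) (metis Suc_leI add.commute add_Suc_right le_add_diff_inverse less_diff_conv2 nat_less_le add_less_cancel_left le_Suc_ex)
  then show ?thesis using s_ne_q by (auto simp: E_def q_def)
 qed
 have Vn: "u (Suc m + k) \<notin> V" if "k < L" for k using assms S that by blast
 have ui: "u (Suc m + k) = u (Suc m + k') \<longleftrightarrow> k = k'" if "k < L" "k' < L" for k k' using inj_u[of "Suc m + k" "Suc m + k'"] that by (auto simp: h_def)
 fix T assume T: "T \<in> Pow (E - {q})"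
 show "{u (Suc m + k) | k. k < L & bit (sv (V Un T)) k} = T"
  using T unfolding S bit_sv using Vn by auto
 have "sv (V Un T) = take_bit L (sv (V Un T))" by (rule bit_eqI) (auto simp: bit_take_bit_iff bit_sv)
 then show "sv (V Un T) \<in> {..<2^L}" by (metis lessThan_iff take_bit_nat_less_exp)
next
 have Vn: "u (Suc m + k) \<notin> V" if "k < L" for k using assms that unfolding E_def h_def by force
 have ui: "u (Suc m + k) = u (Suc m + k') \<longleftrightarrow> k = k'" if "k < L" "k' < L" for k k' using inj_u[of "Suc m + k" "Suc m + k'"] that by (auto simp: h_def)
 fix v :: nat assume v: "v \<in> {..<2^L}"
 show "{u (Suc m + k) | k. k < L & bit v k} \<in> Pow (E - {q})" using s_ne_q by (auto simp: E_def h_def)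
 show "sv (V Un {u (Suc m + k) | k. k < L & bit v k}) = v"
 proof (rule bit_eqI)
  fix k
  have "bit v k ==> k < L" using v bit_less[of v L k] by simp
  then show "bit (sv (V Un {u (Suc m + k) | k. k < L & bit v k})) k = bit v k" unfolding bit_sv using Vn ui by auto
 qed
qed auto

lemma mark:
 fixes G assumes "\<not> G 0"
 shows "wf_layers (u ` {..<h} Un A) (mark_layers h c u e g sg G)"
  and "\<exists>k. cmod k = 1 & (\<forall>psi. clean A psi --> run golden_angle (concat (mark_layers h c u e g sg G)) psi =
   (%U. k*((if G (vn U) then (if sg then e0 else cnj e0) else 1)*psi U)))"
proof -
 have s: "separate h u e g" using sep by (simp add: h_def)
 show "wf_layers (u ` {..<h} Un A) (mark_layers h c u e g sg G)"
  unfolding mark_layers_def A_def by (rule phase_circuit(1)[OF s])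
 show "\<exists>k. cmod k = 1 & (\<forall>psi. clean A psi --> run golden_angle (concat (mark_layers h c u e g sg G)) psi =
   (%U. k*((if G (vn U) then (if sg then e0 else cnj e0) else 1)*psi U)))"
 proof (intro exI conjI allI impI)
  let ?k = "word_phase^card {p. p < 2^h*(2*c*2^h) & negative sg G h p}"
  show "cmod ?k = 1" by (simp add: norm_power norm_word_phase)
  fix psi assume "clean A psi"
  have b: "bit (vn U) i \<longleftrightarrow> u i \<in> U" if "i < h" for i U using that by (simp add: bit_vn)
  have pv: "(\<Prod>p<2^h*(2*c*2^h). (if negative sg G h p then word_phase else 1) *
    (if odd (card {i. i < h & active c G h p i & u i \<in> U}) then cis (if negative sg G h p then - golden_angle else golden_angle) else 1))
   = ?k*(if G (vn U) then (if sg then e0 else cnj e0) else 1)" for U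
   by (subst phase_value[where G = G and v = "vn U"]) (use vn_less b assms in \<open>auto simp: e0_def cis_cnj\<close>)
  show "run golden_angle (concat (mark_layers h c u e g sg G)) psi = (%U. ?k*((if G (vn U) then (if sg then e0 else cnj e0) else 1)*psi U))"
   unfolding mark_layers_def phase_circuit(2)[OF s \<open>clean A psi\<close>[unfolded A_def]] by (subst pv) (rule ext,rule mult.assoc)
 qed
qed

lemma run_Hads_E: "run golden_angle (map Had (map u [m..<h])) psi U = w*(\<Sum>T\<in>Pow E. (-1)^card (T Int U)*psi (U - E Un T))"
proof -
 have d: "distinct (map u [m..<h])" unfolding distinct_map inj_on_def by (auto simp: inj_u)
 have l: "length (map u [m..<h]) = L + 1" by (simp add: h_def)
 have "set (map u [m..<h]) = E" by (simp add: E_def)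
 then show ?thesis using run_Hads[OF d,of golden_angle psi U] unfolding l by (simp add: w_def r2_def)
qed

lemma finite_E: "finite E" by (simp add: E_def)

lemma Hads_clean_E: "clean E psi ==> run golden_angle (map Had (map u [m..<h])) psi = (%U. w*psi (U - E))"
proof
 fix U assume c: "clean E psi"
 have "(\<Sum>T\<in>Pow E. (-1)^card (T Int U)*psi (U - E Un T)) = (\<Sum>T\<in>Pow E. if T = {} then psi (U - E) else 0)"
 proof (intro sum.cong refl)
  fix T assume "T \<in> Pow E"
  then have "T ~= {} ==> (U - E Un T) Int E ~= {}" by blast
  then have "T ~= {} ==> psi (U - E Un T) = 0" using c unfolding clean_def by blast
  then show "(-1)^card (T Int U)*psi (U - E Un T) = (if T = {} then psi (U - E) else 0)" by auto
 qed
 also have "... = psi (U - E)" using finite_E by (subst sum.delta) auto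
 finally show "run golden_angle (map Had (map u [m..<h])) psi U = w*psi (U - E)" unfolding run_Hads_E by simp
qed

lemma run_Had_q: "apply_gate golden_angle (Had q) psi U = (if q \<in> U then (psi (U - {q}) - psi U)/r2 else (psi U + psi (insert q U))/r2)"
 by (simp add: r2_def)

lemma clean_Had_q: "clean A psi ==> clean A (apply_gate golden_angle (Had q) psi)"
 using clean_Hads[of "[q]" A psi golden_angle] disj qE by auto

lemma clean_Hads_E: "clean A psi ==> clean A (run golden_angle (map Had (map u [m..<h])) psi)"
 by (rule clean_Hads) (use disj in \<open>auto simp: distinct_map inj_on_def inj_u E_def\<close>)

lemma clean_mult: "clean A psi ==> clean A (%U. f U*psi U)"
 by (auto simp: clean_def)

definition "z = 2 - 2*cos (real (c*2^h)*golden_angle)"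

text \<open>Up to unit scalars, the amplitude with which flag and selector return to 0 when the flag
  is marked and the preparation undone. It is \<open>1 + p*(eps U - 1)\<close>, where for nonzero
  inputs \<open>p = F*z/(4*2^L)\<close> is the probability of the flag after one
  preparation.\<close>

definition mu :: "nat set => complex" where
 "mu U = 1 + of_real (real F/2^L)*(eps U - 1) * of_real z/4"

text \<open>Marking the clear state is the identity plus \<open>eps - 1\<close> times a projection.
  The first summand is the prepared state with its flag marked, the second a multiple of the
  prepared state.\<close>

definition kernel :: "complex => nat set => complex" where
 "kernel k U = (if U Int A = {} then k*amp U*((if q \<in> U then eps U else 1) + (eps U - 1)*mu U) else 0)"

lemma e0: "cmod e0 = 1" "e0*cnj e0 = 1" "e0 * of_real z = - ((e0 - 1)^2)" "e0 + cnj e0 = 2 - of_real z"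
proof -
 show n: "cmod e0 = 1" by (simp add: e0_def)
 show i: "e0*cnj e0 = 1" using n by (simp add: complex_norm_square[symmetric])
 show s: "e0 + cnj e0 = 2 - of_real z" by (simp add: e0_def z_def complex_eq_iff)
 have "e0 * of_real z = e0*(2 - (e0 + cnj e0))" unfolding s by simp
 also have "... = 2*e0 - e0*e0 - e0*cnj e0" by (simp add: algebra_simps)
 finally show "e0 * of_real z = - ((e0 - 1)^2)" unfolding i by (simp add: power2_eq_square algebra_simps)
qed

lemma kern_or:
 obtains k where "cmod k = 1" "kern golden_angle (E Un A) (kernel k) (concat (or_layers m L F c u e g))"
proof -
 have nG: "\<not> good_mark m F 0" "\<not> flag_mark m 0" "\<not> zero_mark m 0" by (auto simp: good_mark_def flag_mark_def zero_mark_def)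
 obtain k1 where k1: "cmod k1 = 1" "!!psi. clean A psi ==> run golden_angle (concat (mark_layers h c u e g True (good_mark m F))) psi =
   (%U. k1*((if q \<in> U then a1 U else 1)*psi U))"
 proof -
  have "(if good_mark m F (vn U) then if True then e0 else cnj e0 else 1) = (if q \<in> U then a1 U else 1)" for U
   by (auto simp: marks a1_def eps_def)
  then show ?thesis using mark(2)[where G = "good_mark m F",OF nG(1),of True] that by auto
 qed
 obtain k2 where k2: "cmod k2 = 1" "!!psi. clean A psi ==> run golden_angle (concat (mark_layers h c u e g False (good_mark m F))) psi =
   (%U. k2*((if q \<in> U then cnj (a1 U) else 1)*psi U))"
 proof -
  have "(if good_mark m F (vn U) then if False then e0 else cnj e0 else 1) = (if q \<in> U then cnj (a1 U) else 1)" for U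
   by (auto simp: marks a1_def eps_def)
  then show ?thesis using mark(2)[where G = "good_mark m F",OF nG(1),of False] that by auto
 qed
 obtain kq where kq: "cmod kq = 1" "!!psi. clean A psi ==> run golden_angle (concat (mark_layers h c u e g True (flag_mark m))) psi =
   (%U. kq*((if q \<in> U then eps U else 1)*psi U))"
 proof -
  have "(if flag_mark m (vn U) then if True then e0 else cnj e0 else 1) = (if q \<in> U then eps U else 1)" for U
   by (auto simp: marks eps_def)
  then show ?thesis using mark(2)[where G = "flag_mark m",OF nG(2),of True] that by auto
 qed
 obtain k0 where k0: "cmod k0 = 1" "!!psi. clean A psi ==> run golden_angle (concat (mark_layers h c u e g True (zero_mark m))) psi =
   (%U. k0*((if U Int E = {} then eps U else 1)*psi U))"
 proof -
  have "(if zero_mark m (vn U) then if True then e0 else cnj e0 else 1) = (if U Int E = {} then eps U else 1)" for U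
   by (auto simp: marks eps_def)
  then show ?thesis using mark(2)[where G = "zero_mark m",OF nG(3),of True] that by auto
 qed
 define HE where "HE = run golden_angle (map Had (map u [m..<h]))"
 define Hq where "Hq = apply_gate golden_angle (Had q)"
 define D1 where "D1 = run golden_angle (concat (mark_layers h c u e g True (good_mark m F)))"
 define D2 where "D2 = run golden_angle (concat (mark_layers h c u e g False (good_mark m F)))"
 define prep where "prep psi = Hq (D1 (HE psi))" for psi
 define unprep where "unprep psi = HE (D2 (Hq psi))" for psi
 have prep: "prep psi = (%U. k1*amp U*psi (U - E))" if c: "clean E psi" "clean A psi" for psi
 proof
  fix U
  have cA: "clean A (%U. w*psi (U - E))" using clean_Hads_E[OF c(2)] unfolding Hads_clean_E[OF c(1)] .
  have "D1 (HE psi) = (%U. k1*((if q \<in> U then a1 U else 1)*(w*psi (U - E))))"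
   unfolding D1_def HE_def Hads_clean_E[OF c(1)] k1(2)[OF cA] ..
  moreover have "U - {q} - E = U - E" "insert q U - E = U - E" using qE by auto
  ultimately show "prep psi U = k1*amp U*psi (U - E)"
   unfolding prep_def Hq_def run_Had_q amp_def by (simp add: a1_q algebra_simps add_divide_distrib diff_divide_distrib)
 qed
 have cinv: "clean A (unprep psi)" if "clean A psi" for psi
  unfolding unprep_def HE_def D2_def Hq_def k2(2)[OF clean_Had_q[OF that]]
  by (intro clean_Hads_E clean_mult clean_Had_q that)
 have inv: "prep (unprep psi) = (%U. k1 * k2*psi U)" if c: "clean A psi" for psi
 proof -
  have d: "distinct (map u [m..<h])" unfolding distinct_map inj_on_def by (auto simp: inj_u)
  have 1: "HE (HE \<phi>) = \<phi>" for \<phi> unfolding HE_def by (rule Hads_Hads[OF d])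
  have 2: "Hq (Hq \<phi>) = \<phi>" for \<phi> unfolding Hq_def by (rule Had_Had)
  have cq: "clean A (Hq psi)" unfolding Hq_def by (rule clean_Had_q[OF c])
  have cd: "clean A (%U. k2*((if q \<in> U then cnj (a1 U) else 1)*Hq psi U))" by (intro clean_mult cq)
  have a: "a1 U*cnj (a1 U) = 1" for U using e0(2) by (auto simp: a1_def eps_def)
  have "D1 (D2 (Hq psi)) = (%U. k1 * k2*Hq psi U)"
  proof
   fix U
   have "D1 (D2 (Hq psi)) U = k1*((if q \<in> U then a1 U else 1)*(k2*((if q \<in> U then cnj (a1 U) else 1)*Hq psi U)))"
    unfolding D2_def k2(2)[OF cq] unfolding D1_def k1(2)[OF cd] ..
   then show "D1 (D2 (Hq psi)) U = k1 * k2*Hq psi U" using a[of U] by (simp add: mult_ac)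
  qed
  then have "prep (unprep psi) = Hq (%U. k1 * k2*Hq psi U)" unfolding prep_def unprep_def 1 by simp
  also have "... = (%U. k1 * k2*Hq (Hq psi) U)" unfolding Hq_def by (rule gate_scale)
  finally show ?thesis unfolding 2 .
 qed
 define kk where "kk = k0 * k1 * k2 * kq * k1"
 have "kern golden_angle (E Un A) (kernel kk) (concat (or_layers m L F c u e g))"
  unfolding kern_def
 proof (intro allI impI)
  fix psi U assume c: "clean (E Un A) psi"
  then have cE: "clean E psi" and cA: "clean A psi" by (auto simp: clean_def)
  define \<phi>1 where "\<phi>1 = (%U. kq*((if q \<in> U then eps U else 1)*(k1*amp U*psi (U - E))))"
  define \<phi>2 where "\<phi>2 = unprep \<phi>1"
  \<comment> \<open>What the mark of the clear state adds to \<open>\<phi>2\<close>; the last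
    preparation turns \<open>\<phi>2\<close> itself back into \<open>\<phi>1\<close> up to
    scalars.\<close>
  define psi' where "psi' = (%U. if U Int E = {} then (eps U - 1) * \<phi>2 U else 0)"
  have c0: "clean A (%U. k1*amp U*psi (U - E))"
   unfolding clean_def
  proof (intro allI impI)
   fix U assume "U Int A ~= {}"
   then have "(U - E) Int A ~= {}" using disj(1) by auto
   then show "k1*amp U*psi (U - E) = 0" using cA by (simp add: clean_def)
  qed
  have c1: "clean A \<phi>1" unfolding \<phi>1_def by (intro clean_mult c0[unfolded mult.assoc[symmetric]])
  have c2: "clean A \<phi>2" unfolding \<phi>2_def by (rule cinv[OF c1])
  have c': "clean A psi'" "clean E psi'" using c2 by (auto simp: psi'_def clean_def)
  have split: "(%U. k0*((if U Int E = {} then eps U else 1) * \<phi>2 U)) = (%U. k0*(\<phi>2 U + psi' U))"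
   by (auto simp: psi'_def fun_eq_iff algebra_simps)
  have lin: "prep (%U. k0*(\<phi>2 U + psi' U)) = (%U. k0*(prep \<phi>2 U + prep psi' U))"
   unfolding prep_def HE_def D1_def Hq_def run_scale run_add gate_scale gate_add ..
  have "run golden_angle (concat (or_layers m L F c u e g)) psi =
   prep (run golden_angle (concat (mark_layers h c u e g True (zero_mark m))) (unprep (run golden_angle (concat (mark_layers h c u e g True (flag_mark m))) (prep psi))))"
   unfolding prep_def unprep_def HE_def D1_def D2_def Hq_def or_layers_def Let_def h_def[symmetric] q_def[symmetric]
   by (simp del: apply_gate.simps map_map)
  also have "... = (%U. k0*(prep \<phi>2 U + prep psi' U))"
   unfolding prep[OF cE cA] kq(2)[OF c0] \<phi>1_def[symmetric] \<phi>2_def[symmetric] k0(2)[OF c2] split lin ..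
  also have "... = (%U. k0*(k1 * k2 * \<phi>1 U + k1*amp U*psi' (U - E)))"
   unfolding \<phi>2_def inv[OF c1] unfolding prep[OF c'(2,1)] ..
  finally have r: "run golden_angle (concat (or_layers m L F c u e g)) psi U = k0*(k1 * k2 * \<phi>1 U + k1*amp U*psi' (U - E))" by simp
  have "\<phi>2 V = k2 * kq * k1*psi V*mu V" if V: "V Int E = {}" for V
  proof -
   define X where "X = D2 (Hq \<phi>1)"
   have X: "X U = k2*((if q \<in> U then cnj (a1 U) else 1)*Hq \<phi>1 U)" for U
    unfolding X_def D2_def Hq_def k2(2)[OF clean_Had_q[OF c1]] ..
   have qV: "q \<notin> V" using V qE by auto
   \<comment> \<open>The contribution of one selector value to the amplitude of return, summed over
     the flag; \<open>a\<close> is the phase that the preparation used for this selector.\<close>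
   define Y where "Y a = ((1 + a) + eps V*(1 - a))/2 + cnj a*((1 + a) - eps V*(1 - a))/2" for a
   have XX: "X (V Un T) + X (V Un insert q T) = k2 * kq * k1*w*psi V*Y (a1 (V Un T))" if T: "T \<in> Pow (E - {q})" for T
   proof -
    have s: "q \<notin> V Un T" "V Un insert q T = insert q (V Un T)" "V Un T - E = V" "insert q (V Un T) - E = V" "insert q (V Un T) - {q} = V Un T"
     "eps (V Un T) = eps V" "T \<subseteq> E" using T qV V qE by (auto intro: eps_cong(4))
    define a where "a = a1 (V Un T)"
    have p: "\<phi>1 (V Un T) = kq * k1*w*psi V*((1 + a)/r2)" "\<phi>1 (insert q (V Un T)) = kq * k1*w*psi V*(eps V*((1 - a)/r2))"
     using s by (simp_all add: \<phi>1_def amp_def a1_q a_def eps_cong)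
    have H: "Hq \<phi>1 (V Un T) = kq * k1*w*psi V*(((1 + a) + eps V*(1 - a))/(r2*r2))"
     "Hq \<phi>1 (insert q (V Un T)) = kq * k1*w*psi V*(((1 + a) - eps V*(1 - a))/(r2*r2))"
     unfolding Hq_def run_Had_q using s(1,5) by (simp_all add: p add_divide_distrib diff_divide_distrib distrib_left right_diff_distrib)
    show ?thesis unfolding s(2) X H r2(1) Y_def using s(1) by (simp add: a1_q a_def algebra_simps)
   qed
   have Yv: "Y (a1 (V Un T)) = 2 + (if sv (V Un T) < F then (eps V - 1) * of_real z/2 else 0)" if T: "T \<in> Pow (E - {q})" for T
   proof -
    have "eps (V Un T) = eps V" using T by (intro eps_cong(4)) auto
    then have "a1 (V Un T) = (if sv (V Un T) < F then eps V else 1)" by (simp add: a1_def)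
    moreover have "Y (eps V) = 2 + (eps V - 1) * of_real z/2"
    proof (cases "\<exists>i<m. u i \<in> V")
     case True
     then have ee: "eps V = e0" by (simp add: eps_def)
     have "Y e0 = (1 + 2*e0 - e0*e0 + cnj e0*1 + (e0*cnj e0)*e0)/2 + (e0*cnj e0 - e0*cnj e0)/2"
      unfolding Y_def ee by (simp add: algebra_simps add_divide_distrib diff_divide_distrib)
     then have y1: "Y e0 = (1 + 3*e0 - e0*e0 + cnj e0)/2" unfolding e0(2) by simp
     have zz: "of_real z = 2 - e0 - cnj e0" using e0(4) by (simp add: algebra_simps)
     have "2 + (e0 - 1) * of_real z/2 = (4 + (2*e0 - e0*e0 - e0*cnj e0 - 2 + e0 + cnj e0))/2"
      unfolding zz by (simp add: algebra_simps add_divide_distrib diff_divide_distrib)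
     then have y2: "2 + (e0 - 1) * of_real z/2 = (1 + 3*e0 - e0*e0 + cnj e0)/2" unfolding e0(2) by simp
     show ?thesis unfolding ee y1 y2 ..
    qed (auto simp: Y_def eps_def)
    ultimately show ?thesis by (auto simp: Y_def)
   qed
   have "\<phi>2 V = w*(\<Sum>T\<in>Pow E. (-1)^card (T Int V)*X (V - E Un T))"
    unfolding \<phi>2_def unprep_def X_def[symmetric] HE_def by (rule run_Hads_E)
   also have "(\<Sum>T\<in>Pow E. (-1)^card (T Int V)*X (V - E Un T)) = (\<Sum>T\<in>Pow E. X (V Un T))"
   proof (intro sum.cong refl)
    fix T assume "T \<in> Pow E"
    then have "T Int V = {}" "V - E = V" using V by auto
    then show "(-1)^card (T Int V)*X (V - E Un T) = X (V Un T)" by simp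
   qed
   also have "... = (\<Sum>T\<in>Pow (E - {q}). X (V Un T) + X (V Un insert q T))"
    using qE(1) by (subst sum_Pow_split[OF finite_E,of "{q}"]) (auto simp: sum_Pow_singleton)
   also have "... = (\<Sum>T\<in>Pow (E - {q}). k2 * kq * k1*w*psi V*(2 + (if sv (V Un T) < F then (eps V - 1) * of_real z/2 else 0)))"
   proof (intro sum.cong refl)
    fix T assume T: "T \<in> Pow (E - {q})"
    show "X (V Un T) + X (V Un insert q T) = k2 * kq * k1*w*psi V*(2 + (if sv (V Un T) < F then (eps V - 1) * of_real z/2 else 0))"
     unfolding XX[OF T] Yv[OF T] ..
   qed
   also have "... = k2 * kq * k1*w*psi V*(\<Sum>v<2^L. 2 + (if v < F then (eps V - 1) * of_real z/2 else 0))"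
    unfolding sum_distrib_left[symmetric] sum_sv[OF V,of "%v. 2 + (if v < F then (eps V - 1) * of_real z/2 else 0)"] ..
   also have "(\<Sum>v<2^L. 2 + (if v < F then (eps V - 1) * of_real z/2 else 0)) = 2^(L + 1) + of_nat F*((eps V - 1) * of_real z/2)"
   proof -
    have "{v. v < 2^L & v < F} = {..<F}" using FL by auto
    then show ?thesis by (simp add: sum.distrib sum.If_cases Int_def)
   qed
   finally have "\<phi>2 V = k2 * kq * k1*psi V*((w*w)*(2^(L + 1) + of_nat F*((eps V - 1) * of_real z/2)))" by (simp add: mult_ac)
   also have "(w*w)*(2^(L + 1) + of_nat F*((eps V - 1) * of_real z/2)) = mu V"
    unfolding r2(4) mu_def by (simp add: field_simps)
   finally show ?thesis .
  qed
  from this[of "U - E"] have p': "psi' (U - E) = (eps U - 1)*(k2 * kq * k1*psi (U - E)*mu U)"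
   by (auto simp: psi'_def eps_cong mu_def)
  show "run golden_angle (concat (or_layers m L F c u e g)) psi U = psi (U - (E Un A)) * kernel kk U"
  proof (cases "U Int A = {}")
   case True
   then have "U - (E Un A) = U - E" by auto
   then show ?thesis unfolding r p' \<phi>1_def using True by (simp add: kernel_def kk_def algebra_simps)
  next
   case False
   then have "(U - E) Int A ~= {}" using disj(1) by auto
   then have "psi (U - E) = 0" using cA by (simp add: clean_def)
   then show ?thesis unfolding r p' \<phi>1_def using False by (simp add: kernel_def)
  qed
 qed
 moreover have "cmod kk = 1" by (simp add: kk_def norm_mult k0 k1 k2 kq)
 ultimately show thesis using that by blast
qed

text \<open>The certain side of the error: without a set input the phases \<open>eps\<close> and
  \<open>a1\<close> are 1, and the flag has amplitude 0.\<close>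

lemma kernel_zero: "\<not> (\<exists>i<m. u i \<in> U) ==> q \<in> U ==> kernel k U = 0"
 by (auto simp: kernel_def amp_def a1_def eps_def)

text \<open>With the flag unset the amplitude is that of the preparation times
  \<open>1 + (e0 - 1)*mu = e0*(1 - F*z^2/(4*2^L))\<close>, by \<open>(e0 - 1)^2 = - e0*z\<close>.
  The parameters will be chosen so that \<open>F*z^2\<close> is close to
  \<open>4*2^L\<close>.\<close>

lemma kernel_fail:
 assumes k: "cmod k = 1" and V: "V Int (E Un A) = {}" "\<exists>i<m. u i \<in> V"
 shows "(\<Sum>f\<in>Pow (E Un A). if q \<notin> V Un f then (cmod (kernel k (V Un f)))\<^sup>2 else 0) <= (1 - real F*z\<^sup>2/(4*2^L))\<^sup>2"
proof -
 have finA: "finite A"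
 proof -
  have "A \<subseteq> (%(p,i). e p i) ` ({..<2^h*(2*c*2^h)} \<times> {..<h}) Un g ` {..<2^h*(2*c*2^h)}"
   by (auto simp: A_def anc_set_def)
  then show ?thesis by (rule finite_subset) auto
 qed
 have eV: "eps (V Un T) = e0" if "T \<subseteq> E" for T using eps_cong(4)[OF that,of V] V(2) by (simp add: eps_def)
 have "(\<Sum>f\<in>Pow (E Un A). if q \<notin> V Un f then (cmod (kernel k (V Un f)))\<^sup>2 else 0) =
   (\<Sum>f\<in>Pow (E - {q}). if q \<notin> V Un f then (cmod (kernel k (V Un f)))\<^sup>2 else 0)"
 proof (rule sum.mono_neutral_right)
  show "\<forall>f\<in>Pow (E Un A) - Pow (E - {q}). (if q \<notin> V Un f then (cmod (kernel k (V Un f)))\<^sup>2 else 0) = 0"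
  proof
   fix f assume "f \<in> Pow (E Un A) - Pow (E - {q})"
   then have "q \<in> f \<or> f Int A ~= {}" by auto
   then show "(if q \<notin> V Un f then (cmod (kernel k (V Un f)))\<^sup>2 else 0) = 0" by (auto simp: kernel_def)
  qed
 qed (use finite_E finA in auto)
 also have "... <= (\<Sum>f\<in>Pow (E - {q}). 1/2^L*(1 - real F*z\<^sup>2/(4*2^L))\<^sup>2)"
 proof (rule sum_mono)
  fix f assume f: "f \<in> Pow (E - {q})"
  then have fE: "f \<subseteq> E" by auto
  have q: "q \<notin> V Un f" using V f qE by auto
  have fA: "(V Un f) Int A = {}" using V fE disj(1) by auto
  define y :: complex where "y = of_real (real F/(4*2^L))"
  have mu_y: "mu (V Un f) = 1 + y*(e0 - 1) * of_real z" unfolding mu_def eV[OF fE] y_def by simp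
  have "1 + (e0 - 1)*mu (V Un f) = e0 + y * of_real z*(e0 - 1)^2"
   unfolding mu_y by (simp add: algebra_simps power2_eq_square)
  also have "(e0 - 1)^2 = - (e0 * of_real z)" using e0(3) by simp
  also have "e0 + y * of_real z * - (e0 * of_real z) = e0*(1 - y * of_real z^2)" by (simp add: algebra_simps power2_eq_square)
  also have "... = e0 * of_real (1 - real F*z\<^sup>2/(4*2^L))" by (simp add: y_def)
  finally have "cmod (1 + (e0 - 1)*mu (V Un f)) = \<bar>1 - real F*z\<^sup>2/(4*2^L)\<bar>" by (simp only: norm_mult e0(1) norm_of_real mult_1)
  moreover have "kernel k (V Un f) = k*amp (V Un f)*(1 + (e0 - 1)*mu (V Un f))" using q fA eV[OF fE] by (simp add: kernel_def)
  ultimately have "(cmod (kernel k (V Un f)))\<^sup>2 = (cmod (amp (V Un f)))\<^sup>2*(1 - real F*z\<^sup>2/(4*2^L))\<^sup>2"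
   by (simp add: norm_mult k power_mult_distrib)
  moreover have "(cmod (amp (V Un f)))\<^sup>2 <= 1/2^L"
  proof -
   have "cmod (1 + a1 (V Un f)) <= 2" using norm_triangle_ineq[of 1 "a1 (V Un f)"] e0(1) by (auto simp: a1_def eV[OF fE])
   then have "(cmod (1 + a1 (V Un f)))\<^sup>2 <= 2\<^sup>2" by (intro power_mono) auto
   moreover have "(cmod w)\<^sup>2 = 1/2^(L + 1)"
    using r2(4) by (metis norm_divide norm_mult norm_numeral norm_one norm_power power2_eq_square)
   moreover have "(cmod (amp (V Un f)))\<^sup>2 = (cmod w)\<^sup>2*((cmod (1 + a1 (V Un f)))\<^sup>2/2)"
    using q by (simp add: amp_def norm_mult norm_divide r2(5) power_mult_distrib power_divide)
   ultimately have "(cmod (amp (V Un f)))\<^sup>2 = 1/2^(L + 1)*((cmod (1 + a1 (V Un f)))\<^sup>2/2)" by simp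
   also have "... <= 1/2^(L + 1)*(2\<^sup>2/2)"
    using \<open>(cmod (1 + a1 (V Un f)))\<^sup>2 <= 2\<^sup>2\<close> by (intro mult_left_mono) auto
   also have "... = 1/2^L" by simp
   finally show ?thesis .
  qed
  ultimately show "(if q \<notin> V Un f then (cmod (kernel k (V Un f)))\<^sup>2 else 0) <= 1/2^L*(1 - real F*z\<^sup>2/(4*2^L))\<^sup>2"
   using q by (simp only: if_True not_False_eq_True) (intro mult_right_mono,auto)
 qed
 also have "... = (1 - real F*z\<^sup>2/(4*2^L))\<^sup>2"
 proof -
  have "card E = L + 1" unfolding E_def by (subst card_image) (auto simp: inj_on_def inj_u h_def)
  then have "card (E - {q}) = L" using qE finite_E by simp
  then show ?thesis using finite_E by (simp add: card_Pow)
 qed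
 finally show ?thesis .
qed

lemma wf_or: "wf_layers (u ` {..<h} Un A) (or_layers m L F c u e g)"
proof -
 have nG: "\<not> good_mark m F 0" "\<not> flag_mark m 0" "\<not> zero_mark m 0" by (auto simp: good_mark_def flag_mark_def zero_mark_def)
 have "distinct (map u [m..<h])" unfolding distinct_map inj_on_def by (auto simp: inj_u)
 then have "distinct (concat (map gate_qubits (map Had (map u [m..<h]))))" by (subst map_map) (simp only: concat_map_Had)
 moreover have "qubits (map Had (map u [m..<h])) \<subseteq> u ` {..<h} Un A" unfolding qubits_map_Had by auto
 moreover have "u m \<in> u ` {..<h}" using qE(2) by auto
 ultimately show ?thesis
  unfolding or_layers_def Let_def h_def[symmetric] using mark(1)[where G = "good_mark m F",OF nG(1)] mark(1)[where G = "flag_mark m",OF nG(2)] mark(1)[where G = "zero_mark m",OF nG(3)] by simp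
qed

end

section \<open>Chains of kernels and their failure probabilities\<close>

lemma invariant_Union:
 "(!!j U. j \<in> set js ==> K (U - F j) = K U) ==> K (U - (\<Union>j\<in>set js. F j)) = K U"
proof (induction js arbitrary: U)
 case (Cons j js)
 have "U - (\<Union>j\<in>set (j # js). F j) = (U - F j) - (\<Union>j\<in>set js. F j)" by auto
 then show ?case using Cons by simp
qed simp

lemma kern_list:
 assumes "distinct is" "!!i. i \<in> set is ==> kern \<theta> (F i) (K i) (gs i)"
  "!!i j. i \<in> set is ==> j \<in> set is ==> i ~= j ==> F i Int F j = {}"
  "!!i j U. i \<in> set is ==> j \<in> set is ==> i ~= j ==> K i (U - F j) = K i U"
 shows "kern \<theta> (\<Union>i\<in>set is. F i) (%U. \<Prod>i\<in>set is. K i U) (concat (map gs is))"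
 using assms
proof (induction "is")
 case Nil
 then show ?case by (simp add: kern_def)
next
 case (Cons i "is")
 have IH: "kern \<theta> (\<Union>i\<in>set is. F i) (%U. \<Prod>i\<in>set is. K i U) (concat (map gs is))"
  by (rule Cons.IH) (use Cons.prems in auto)
 have ne: "j \<in> set is ==> i ~= j" for j using Cons.prems(1) by auto
 have "F i Int F j = {}" if "j \<in> set is" for j using Cons.prems(3)[of i j] ne[OF that] that by simp
 then have d: "F i Int (\<Union>i\<in>set is. F i) = {}" by blast
 have "K i (U - (\<Union>i\<in>set is. F i)) = K i U" for U
  by (rule invariant_Union) (use Cons.prems(4)[of i] ne in simp)
 from kern_append[OF Cons.prems(2)[of i] IH d this] show ?case using Cons.prems(1) by simp
qed

lemma kern_keep:
 assumes "kern \<theta> F K gs" "finite M" "qubits gs \<subseteq> M" "!!g. g \<in> set gs ==> distinct (gate_qubits g)" "F \<subseteq> M" "clean F psi"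
  "!!U. E (U - F) \<longleftrightarrow> E U"
 shows "mass M (run \<theta> gs psi) E <= mass M psi E"
proof -
 have "mass M (run \<theta> gs psi) (%U. E U & True) <= 1*mass M psi E"
  by (rule kern_mass[where B = "%_. True",OF assms(1,2,5,6)]) (use assms(7) kern_norm[OF assms(1-5)] in simp_all)
 then show ?thesis by simp
qed

text \<open>Kernels on disjoint fresh qubits, applied one after the other. The repeated trials will
  use the product bound \<open>mass_conj\<close>, the or gates the union bound
  \<open>mass_disj_chain\<close>.\<close>

locale chain =
 fixes \<theta> J and F :: "nat => nat set" and K gs M psi
 assumes k: "!!j. j < J ==> kern \<theta> (F j) (K j) (gs j)" and fin: "finite M" and FM: "!!j. j < J ==> F j \<subseteq> M"
  and qM: "!!j. j < J ==> qubits (gs j) \<subseteq> M" and dg: "!!j g. j < J ==> g \<in> set (gs j) ==> distinct (gate_qubits g)"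
  and disj: "!!i j. i < J ==> j < J ==> i ~= j ==> F i Int F j = {}"
  and cl: "!!j. j < J ==> clean (F j) psi"
begin

definition "S t = run \<theta> (concat (map gs [0..<t])) psi"

lemma S_simps: "S 0 = psi" "S (Suc t) = run \<theta> (gs t) (S t)"
 by (simp_all add: S_def)

lemma clean_S: "t <= J ==> clean G psi ==> (!!j. j < t ==> F j Int G = {}) ==> clean G (S t)"
proof (induction t arbitrary: G)
 case (Suc t)
 have "clean (F t) (S t)" by (rule Suc.IH) (use Suc.prems cl disj in auto)
 moreover have "clean G (S t)" by (rule Suc.IH) (use Suc.prems in auto)
 ultimately show ?case unfolding S_simps using kern_clean[OF k[of t]] Suc.prems by auto
qed (simp add: S_simps)

lemma clean_next: "t < J ==> clean (F t) (S t)"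
 by (rule clean_S) (use cl disj in auto)

text \<open>A basis state that occurs in the end has occurred, with the later fresh qubits removed,
  after every block, so no kernel on its way vanishes. This carries the statements that hold with
  certainty.\<close>

lemma supp: "t <= J ==> S t U ~= 0 ==> psi (U - (\<Union>j<t. F j)) ~= 0 & (\<forall>j<t. K j (U - (\<Union>i\<in>{j<..<t}. F i)) ~= 0)"
proof (induction t arbitrary: U)
 case (Suc t)
 have "S (Suc t) U = S t (U - F t)*K t U" unfolding S_simps using k[of t] clean_next[of t] Suc.prems by (simp add: kern_def)
 then have *: "S t (U - F t) ~= 0" "K t U ~= 0" using Suc.prems by auto
 have IH: "psi (U - F t - (\<Union>j<t. F j)) ~= 0" "!!j. j < t ==> K j (U - F t - (\<Union>i\<in>{j<..<t}. F i)) ~= 0"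
  using Suc.IH[OF _ *(1)] Suc.prems by auto
 have 1: "U - (\<Union>j<Suc t. F j) = U - F t - (\<Union>j<t. F j)" by (auto simp: lessThan_Suc)
 have 2: "U - (\<Union>i\<in>{j<..<Suc t}. F i) = U - F t - (\<Union>i\<in>{j<..<t}. F i)" if "j < t" for j
 proof -
  have "{j<..<Suc t} = insert t {j<..<t}" using that by auto
  then show ?thesis by auto
 qed
 have "K j (U - (\<Union>i\<in>{j<..<Suc t}. F i)) ~= 0" if "j < Suc t" for j
 proof (cases "j = t")
  case True
  then have "{j<..<Suc t} = {}" by auto
  then show ?thesis using *(2) True by simp
 next
  case False
  then show ?thesis using IH(2)[of j] 2[of j] that by simp
 qed
 then show ?case using IH(1) 1 by simp
qed (simp add: S_simps)

lemma keep: "t < J ==> (!!U. E (U - F t) \<longleftrightarrow> E U) ==> mass M (S (Suc t)) E <= mass M (S t) E"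
 unfolding S_simps by (rule kern_keep[OF k fin qM dg FM clean_next]) auto

text \<open>Given that the old qubits satisfy \<open>Good\<close>, each block has the event
  \<open>B\<close> with its own bound whatever the earlier blocks did; so the bounds for all of them
  together multiply.\<close>

lemma mass_conj:
 assumes E: "!!j U. j < J ==> E (U - F j) \<longleftrightarrow> E U" and B: "!!i j U. i < j ==> j < J ==> B i (U - F j) \<longleftrightarrow> B i U"
  and bd: "!!j V. j < J ==> V \<subseteq> M - F j ==> Good V ==> (\<Sum>f\<in>Pow (F j). if B j (V Un f) then (cmod (K j (V Un f)))\<^sup>2 else 0) <= \<delta> j"
  and Good: "!!t V. t <= J ==> psi (V - (\<Union>j<t. F j)) ~= 0 ==> Good V" and d0: "!!j. 0 <= \<delta> j"
 shows "t <= J ==> mass M (S t) (%U. E U & (\<forall>j<t. B j U)) <= (\<Prod>j<t. \<delta> j)*mass M psi E"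
proof (induction t)
 case (Suc t)
 have "mass M (S (Suc t)) (%U. (E U & (\<forall>j<t. B j U)) & B t U) <= \<delta> t*mass M (S t) (%U. E U & (\<forall>j<t. B j U))"
  unfolding S_simps
 proof (rule kern_mass[OF k fin FM clean_next])
  show "(E (U - F t) & (\<forall>j<t. B j (U - F t))) \<longleftrightarrow> (E U & (\<forall>j<t. B j U))" for U using E[of t] B[of _ t] Suc.prems by auto
  fix V assume "V \<subseteq> M - F t" "S t V ~= 0"
  then show "(\<Sum>f\<in>Pow (F t). if B t (V Un f) then (cmod (K t (V Un f)))\<^sup>2 else 0) <= \<delta> t"
   using bd[of t V] Good[of t V] supp[of t V] Suc.prems by auto
 qed (use Suc.prems in auto)
 also have "... <= \<delta> t*((\<Prod>j<t. \<delta> j)*mass M psi E)" by (rule mult_left_mono[OF Suc.IH d0]) (use Suc.prems in simp)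
 also have "(%U. (E U & (\<forall>j<t. B j U)) & B t U) = (%U. E U & (\<forall>j<Suc t. B j U))" by (auto simp: less_Suc_eq)
 finally show ?case by (simp add: mult_ac)
qed (simp add: S_simps)

lemma mass_disj_chain:
 assumes E: "!!j U. j < J ==> E (U - F j) \<longleftrightarrow> E U" and B: "!!i j U. i < j ==> j < J ==> B i (U - F j) \<longleftrightarrow> B i U"
  and bd: "!!j V. j < J ==> V \<subseteq> M - F j ==> (\<Sum>f\<in>Pow (F j). if B j (V Un f) then (cmod (K j (V Un f)))\<^sup>2 else 0) <= \<delta>"
  and one: "mass M psi (%_. True) <= 1" and d0: "0 <= \<delta>"
 shows "t <= J ==> mass M (S t) (%U. E U \<or> (\<exists>j<t. B j U)) <= mass M psi E + real t * \<delta>"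
proof (induction t)
 case (Suc t)
 have tot: "s <= J ==> mass M (S s) (%_. True) <= 1" for s
 proof (induction s)
  case (Suc s)
  then show ?case using keep[of s "%_. True"] by simp
 qed (simp add: S_simps one)
 have "mass M (S (Suc t)) (%U. True & B t U) <= \<delta>*mass M (S t) (%_. True)"
  unfolding S_simps by (rule kern_mass[OF k fin FM clean_next]) (use Suc.prems bd in auto)
 also have "... <= \<delta>" using tot[of t] Suc.prems d0 mult_left_mono[of _ 1 \<delta>] by simp
 finally have 1: "mass M (S (Suc t)) (%U. True & B t U) <= \<delta>" .
 have 2: "mass M (S (Suc t)) (%U. E U \<or> (\<exists>j<t. B j U)) <= mass M (S t) (%U. E U \<or> (\<exists>j<t. B j U))"
  by (rule keep) (use Suc.prems E[of t] B[of _ t] in auto)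
 have eq: "(%U. E U \<or> (\<exists>j<Suc t. B j U)) = (%U. (E U \<or> (\<exists>j<t. B j U)) \<or> (True & B t U))" by (auto simp: less_Suc_eq)
 have "mass M (S (Suc t)) (%U. E U \<or> (\<exists>j<Suc t. B j U)) <=
   mass M (S (Suc t)) (%U. E U \<or> (\<exists>j<t. B j U)) + mass M (S (Suc t)) (%U. True & B t U)"
  unfolding eq by (rule mass_disj[OF fin])
 then show ?case using 1 2 Suc by (simp add: algebra_simps)
qed (simp add: S_simps)

end

section \<open>Randomised parities and the layout of the circuit\<close>

definition gadget :: "nat => nat => layer list" where
 "gadget x a = [[Had a],[Rot a],[CNot x a]] @ map (%y. [y]) (unrot a) @ [[Had a]]"

text \<open>The rotation and its inverse cancel when \<open>x\<close> is 0, and the coin stays 0.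
  Otherwise the controlled-not between them prevents this, and the coin is 1 with probability
  \<open>sin golden_angle\<close> squared.\<close>

definition gadget_kernel :: "nat => nat => qstate" where
 "gadget_kernel x a U = word_phase*(if x \<in> U then (if a \<in> U then \<i> * of_real (sin golden_angle) else of_real (cos golden_angle))
   else (if a \<in> U then 0 else 1))"

lemma wf_gadget: "x ~= a ==> wf_layers {x,a} (gadget x a) & length (gadget x a) = 13"
 by (auto simp: gadget_def unrot_def)

lemma kern_gadget:
 assumes "x ~= a"
 shows "kern golden_angle {a} (gadget_kernel x a) (concat (gadget x a))"
 unfolding kern_def
proof (intro allI impI)
 fix psi U assume c: "clean {a} psi"
 have z: "psi V = 0" if "a \<in> V" for V using c that by (auto simp: clean_def)
 let ?s = "complex_of_real (sqrt 2)"
 have 1: "apply_gate golden_angle (Had a) psi = (%U. psi (U - {a})/?s)" by (auto simp: fun_eq_iff z)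
 have 2: "apply_gate golden_angle (Rot a) (apply_gate golden_angle (Had a) psi) = (%U. psi (U - {a})/?s*(if a \<in> U then gph else 1))"
  unfolding 1 by (auto simp: fun_eq_iff)
 have 3: "apply_gate golden_angle (CNot x a) (apply_gate golden_angle (Rot a) (apply_gate golden_angle (Had a) psi)) =
   (%U. psi (U - {a})/?s*(if (a \<in> U) ~= (x \<in> U) then gph else 1))"
 proof
  fix U
  have s: "a \<in> sym_diff U {a} \<longleftrightarrow> a \<notin> U" "sym_diff U {a} - {a} = U - {a}" by auto
  show "apply_gate golden_angle (CNot x a) (apply_gate golden_angle (Rot a) (apply_gate golden_angle (Had a) psi)) U =
   psi (U - {a})/?s*(if (a \<in> U) ~= (x \<in> U) then gph else 1)"
   unfolding 2 unfolding apply_gate.simps by (cases "x \<in> U"; cases "a \<in> U") (simp_all only: s if_True if_False simp_thms)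
 qed
 define \<phi> where "\<phi> = (%U. word_phase*(if a \<in> U then cis (- golden_angle) else 1)*(psi (U - {a})/?s*(if (a \<in> U) ~= (x \<in> U) then gph else 1)))"
 have "concat (map (%y. [y]) (unrot a)) = unrot a" by (simp add: unrot_def)
 then have r: "run golden_angle (concat (gadget x a)) psi = apply_gate golden_angle (Had a) \<phi>"
  unfolding gadget_def \<phi>_def run_unrot[symmetric] 3[symmetric] by (simp del: apply_gate.simps)
 have ss: "?s*?s = 2" by (simp flip: of_real_mult)
 have cs: "gph + cis (- golden_angle) = 2 * of_real (cos golden_angle)" "gph - cis (- golden_angle) = 2*(\<i> * of_real (sin golden_angle))"
  by (simp_all add: complex_eq_iff)
 have x: "x \<in> U - {a} \<longleftrightarrow> x \<in> U" "x \<in> insert a U \<longleftrightarrow> x \<in> U" "insert a U - {a} = U - {a}" using assms by auto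
 show "run golden_angle (concat (gadget x a)) psi U = psi (U - {a})*gadget_kernel x a U"
 proof (cases "a \<in> U")
  case True
  have "apply_gate golden_angle (Had a) \<phi> U = (\<phi> (U - {a}) - \<phi> U)/?s" using True by simp
  also have "... = psi (U - {a})*word_phase*((if x \<in> U then gph else 1) - (if x \<in> U then cis (- golden_angle) else cis (- golden_angle)*gph))/(?s*?s)"
   using True x by (simp add: \<phi>_def field_simps)
  also have "... = psi (U - {a})*gadget_kernel x a U" unfolding ss gadget_kernel_def using True by (simp add: cs cis_mult)
  finally show ?thesis unfolding r .
 next
  case False
  have "apply_gate golden_angle (Had a) \<phi> U = (\<phi> U + \<phi> (insert a U))/?s" using False by simp
  also have "... = psi (U - {a})*word_phase*((if x \<in> U then gph else 1) + (if x \<in> U then cis (- golden_angle) else cis (- golden_angle)*gph))/(?s*?s)"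
   using False x by (simp add: \<phi>_def field_simps)
  also have "... = psi (U - {a})*gadget_kernel x a U" unfolding ss gadget_kernel_def using False by (simp add: cs cis_mult)
  finally show ?thesis unfolding r .
 qed
qed

lemma kern_parity:
 assumes "distinct es" "g \<notin> set es"
 shows "kern \<theta> {g} (%U. if g \<in> U \<longleftrightarrow> odd (card (U Int set es)) then 1 else 0) (concat (parity_layers es g))"
 unfolding kern_def run_parity_layers[OF assms]
proof (intro allI impI)
 fix psi U assume c: "clean {g} psi"
 have z: "psi V = 0" if "g \<in> V" for V using c that by (auto simp: clean_def)
 have "g \<in> U ==> sym_diff U {g} = U - {g}" "g \<notin> U ==> g \<in> sym_diff U {g}" "g \<notin> U ==> U - {g} = U" by auto
 then show "psi (if odd (card (U Int set es)) then sym_diff U {g} else U) = psi (U - {g})*(if g \<in> U \<longleftrightarrow> odd (card (U Int set es)) then 1 else 0)"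
  using z by (cases "g \<in> U"; cases "odd (card (U Int set es))") (simp_all only: simp_thms if_True if_False mult_1_right mult_zero_right)
qed

lemma sum_prod_subsets:
 "finite I ==> (\<Sum>T\<in>Pow I. \<Prod>i\<in>I. if i \<in> T then f i else g i) = (\<Prod>i\<in>I. f i + g i :: real)"
proof (induction I rule: finite_induct)
 case (insert x I)
 have x: "{x} \<subseteq> insert x I" "insert x I - {x} = I" using insert by auto
 have "(\<Sum>T\<in>Pow (insert x I). \<Prod>i\<in>insert x I. if i \<in> T then f i else g i) = (\<Sum>T\<in>Pow I. g x*(\<Prod>i\<in>I. if i \<in> T then f i else g i) + f x*(\<Prod>i\<in>I. if i \<in> T then f i else g i))"
  unfolding sum_Pow_split[OF finite.insertI[OF insert(1)] x(1)] x(2) sum_Pow_singleton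
 proof (intro sum.cong refl)
  fix T assume T: "T \<in> Pow I"
  have "(\<Prod>i\<in>I. if i \<in> T Un {x} then f i else g i) = (\<Prod>i\<in>I. if i \<in> T then f i else g i)"
   using insert by (intro prod.cong) auto
  moreover have "x \<notin> T" using T insert by auto
  ultimately show "(\<Prod>i\<in>insert x I. if i \<in> T Un {} then f i else g i) + (\<Prod>i\<in>insert x I. if i \<in> T Un {x} then f i else g i) =
    g x*(\<Prod>i\<in>I. if i \<in> T then f i else g i) + f x*(\<Prod>i\<in>I. if i \<in> T then f i else g i)"
   using insert by simp
 qed
 also have "... = (\<Prod>i\<in>insert x I. f i + g i)" using insert by (simp add: sum.distrib flip: sum_distrib_left) (simp add: algebra_simps)
 finally show ?case .
qed simp

text \<open>The sum with the signs \<open>(-1)^card T\<close> factorises, and its average with the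
  total mass 1 keeps exactly the even sets.\<close>

lemma even_mass:
 assumes "finite I" "!!i. i \<in> I ==> f i + g i = 1"
 shows "(\<Sum>T\<in>Pow I. if even (card T) then (\<Prod>i\<in>I. if i \<in> T then f i else g i) else 0) = (1 + (\<Prod>i\<in>I. g i - f i))/(2 :: real)"
proof -
 have "(\<Sum>T\<in>Pow I. if even (card T) then (\<Prod>i\<in>I. if i \<in> T then f i else g i) else 0) =
   (\<Sum>T\<in>Pow I. ((\<Prod>i\<in>I. if i \<in> T then f i else g i) + (\<Prod>i\<in>I. if i \<in> T then - f i else g i))/2)"
 proof (intro sum.cong refl)
  fix T assume T: "T \<in> Pow I"
  have "(\<Prod>i\<in>I. if i \<in> T then - f i else g i) = (\<Prod>i\<in>I. if i \<in> T then - 1 else 1)*(\<Prod>i\<in>I. if i \<in> T then f i else g i)"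
   unfolding prod.distrib[symmetric] by (intro prod.cong) auto
  also have "(\<Prod>i\<in>I. if i \<in> T then - 1 else 1 :: real) = (-1)^card T"
   using T assms(1) by (simp add: prod.If_cases Int_absorb1)
  finally show "(if even (card T) then (\<Prod>i\<in>I. if i \<in> T then f i else g i) else 0) =
    ((\<Prod>i\<in>I. if i \<in> T then f i else g i) + (\<Prod>i\<in>I. if i \<in> T then - f i else g i))/2" by simp
 qed
 also have "... = ((\<Prod>i\<in>I. f i + g i) + (\<Prod>i\<in>I. - f i + g i))/2"
  unfolding sum_divide_distrib[symmetric] sum.distrib sum_prod_subsets[OF assms(1)] ..
 also have "(\<Prod>i\<in>I. f i + g i) = 1" using assms(2) by simp
 finally show ?thesis by simp
qed

lemma golden_square_diff: "(cos golden_angle)\<^sup>2 - (sin golden_angle)\<^sup>2 = 2 - sqrt 5"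
proof -
 have "(sin golden_angle)\<^sup>2 = 1 - (cos golden_angle)\<^sup>2" by (rule sin_squared_eq)
 then show ?thesis unfolding cos_golden by (simp add: power2_eq_square field_simps)
qed

lemma prod_encode_mono: "a <= a' ==> b <= b' ==> prod_encode (a,b) <= prod_encode (a',b')"
proof -
 assume *: "a <= a'" "b <= b'"
 then have "(a + b)*Suc (a + b) <= (a' + b')*Suc (a' + b')" by (intro mult_le_mono) auto
 then have "triangle (a + b) <= triangle (a' + b')" unfolding triangle_def by (rule div_le_mono)
 then show ?thesis using*by (simp add: prod_encode_def)
qed

text \<open>Pairing makes ancilla addresses with different tags or indices distinct at once. The
  addresses are sparse, but the size of a circuit counts only the qubits that its gates
  touch.\<close>

definition anc :: "nat => nat => nat => nat => nat => nat" where
 "anc n t a b d = n + 1 + prod_encode (t,prod_encode (a,prod_encode (b,d)))"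

lemma anc_eq [simp]: "anc n t a b d = anc n t' a' b' d' \<longleftrightarrow> t = t' & a = a' & b = b' & d = d'"
 by (auto simp: anc_def prod_encode_eq)

lemma anc_gt: "n < anc n t a b d" by (simp add: anc_def)

definition "xcopy n i k = anc n 0 i k 0"
definition "coin n i k = anc n 1 i k 0"
definition "obit n l k = anc n 2 l k 0"
text \<open>Gate \<open>j\<close> on level \<open>l\<close> reads the outputs \<open>j*m + i\<close>
  of level \<open>l - 1\<close>; its flag at position \<open>m\<close> is its own output bit, and
  the positions above are selector bits.\<close>

definition "or_in n m l j i = (if i < m then obit n (l - 1) (j*m + i) else if i = m then obit n l j else anc n 3 l j i)"
definition "or_e n l j p i = anc n 4 (prod_encode (l,j)) p i"
definition "or_g n l j p = anc n 5 (prod_encode (l,j)) p 0"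

definition in_layer :: "nat => nat => layer" where
 "in_layer n K = map (%i. FanOut i (map (%k. xcopy n i k) [0..<K])) [0..<n]"

definition trial :: "nat => nat => layer list" where
 "trial n k = par 13 (%i. gadget (xcopy n i k) (coin n i k)) [0..<n] @ parity_layers (map (%i. coin n i k) [0..<n]) (obit n 0 k)"

definition level :: "nat => nat => nat => nat => nat => nat => layer list" where
 "level n m L F c l = par 91 (%j. or_layers m L F c (or_in n m l j) (or_e n l j) (or_g n l j)) [0..<m^(3 - l)]"

text \<open>Three levels of fan-in \<open>m\<close> bring the \<open>m^3\<close> trial bits down to
  one, which is added onto the qubit \<open>n\<close> that holds \<open>y\<close>.\<close>

definition or_circuit_layers :: "nat => nat => nat => nat => nat => layer list" where
 "or_circuit_layers n m L F c = [in_layer n (m^3)] @ par 16 (trial n) [0..<m^3] @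
   level n m L F c 1 @ level n m L F c 2 @ level n m L F c 3 @ [[CNot (obit n 3 0) n]]"

definition copies :: "nat => nat => nat => nat" where
 "copies m L c = 2^(m + L + 1)*(2*c*2^(m + L + 1))"

text \<open>A common bound for the tags and indices of all addresses in use, so that a single
  address bounds the others.\<close>

definition width :: "nat => nat => nat => nat => nat" where
 "width n m L c = n + m^3 + (m + L + 1) + copies m L c + prod_encode (3,m^3) + 6"

definition or_circuit :: "nat => nat => nat => nat => nat => circuit" where
 "or_circuit n m L F c = \<lparr>num_qubits = anc n (width n m L c) (width n m L c) (width n m L c) (width n m L c) + 1,
   layers = or_circuit_layers n m L F c\<rparr>"

section \<open>Correctness, depth and size of the circuit for given parameters\<close>

locale or_params =
 fixes n m L F c :: nat
 assumes FL: "F <= 2^L" and m: "1 <= m"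
begin

abbreviation "N \<equiv> num_qubits (or_circuit n m L F c)"
definition "h = m + L + 1"
definition "P = copies m L c"
definition "used = {..n} Un (%(t,a,b,d). anc n t a b d) ` (({0,1} \<times> {..<n} \<times> {..<m^3} \<times> {0}) Un ({2} \<times> {..3} \<times> {..<m^3} \<times> {0}) Un
  ({3} \<times> {..3} \<times> {..<m^3} \<times> {..<h}) Un ({4} \<times> prod_encode ` ({..3} \<times> {..<m^3}) \<times> {..<P} \<times> {..<h}) Un
  ({5} \<times> prod_encode ` ({..3} \<times> {..<m^3}) \<times> {..<P} \<times> {0}))"
definition "z = 2 - 2*cos (real (c*2^h)*golden_angle)"
definition "\<delta> = (1 - real F*z\<^sup>2/(4*2^L))\<^sup>2"

lemma used_N: "used \<subseteq> {..<N}"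
proof -
 define w where "w = width n m L c"
 have an: "anc n t a b d < N" if "t <= w" "a <= w" "b <= w" "d <= w" for t a b d
  unfolding or_circuit_def w_def[symmetric] using that by (simp add: anc_def less_Suc_eq_le prod_encode_mono)
 have pe: "prod_encode x <= w" if "x \<in> {..3} \<times> {..<m^3}" for x
 proof -
  have "prod_encode x <= prod_encode (3,m^3)" using that by (cases x) (auto intro: prod_encode_mono)
  then show ?thesis by (simp add: w_def width_def)
 qed
 have b: "i < n ==> i <= w" "k < m^3 ==> k <= w" "p < P ==> p <= w" "i < h ==> i <= w" "5 <= w" for i k p
  by (simp_all add: w_def width_def P_def h_def)
 have "n < N" using an[of 0 0 0 0] anc_gt[of n 0 0 0 0] by simp
 then show ?thesis unfolding used_def using b pe by (auto intro!: an)
qed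

lemma card_used: "card used <= (n + 1) + 2*n*m^3 + 4*m^3 + 4*m^3*h + 4*m^3*P*h + 4*m^3*P"
proof -
 have f: "finite (prod_encode ` ({..3 :: nat} \<times> {..<m^3}))" "card (prod_encode ` ({..3 :: nat} \<times> {..<m^3})) <= 4*m^3"
  using card_image_le[of "{..3 :: nat} \<times> {..<m^3}" prod_encode] by simp_all
 have "card used <= card {..n} + card (({0,1 :: nat} \<times> {..<n} \<times> {..<m^3} \<times> {0 :: nat}) Un ({2} \<times> {..3} \<times> {..<m^3} \<times> {0}) Un
  ({3} \<times> {..3} \<times> {..<m^3} \<times> {..<h}) Un ({4} \<times> prod_encode ` ({..3} \<times> {..<m^3}) \<times> {..<P} \<times> {..<h}) Un
  ({5} \<times> prod_encode ` ({..3} \<times> {..<m^3}) \<times> {..<P} \<times> {0}))"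
  unfolding used_def by (rule order_trans[OF card_Un_le add_left_mono[OF card_image_le]]) auto
 also have "... <= card {..n} + (card ({0,1 :: nat} \<times> {..<n} \<times> {..<m^3} \<times> {0 :: nat}) + card ({2 :: nat} \<times> {..3 :: nat} \<times> {..<m^3} \<times> {0 :: nat}) +
  card ({3 :: nat} \<times> {..3 :: nat} \<times> {..<m^3} \<times> {..<h}) + card ({4 :: nat} \<times> prod_encode ` ({..3} \<times> {..<m^3}) \<times> {..<P} \<times> {..<h}) +
  card ({5 :: nat} \<times> prod_encode ` ({..3} \<times> {..<m^3}) \<times> {..<P} \<times> {0 :: nat}))"
  by (intro add_left_mono order_trans[OF card_Un_le] add_right_mono) auto
 also have "... <= (n + 1) + (2*n*m^3 + 4*m^3 + 4*m^3*h + 4*m^3*(P*h) + 4*m^3*P)"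
  unfolding card_cartesian_product using f(2) by (intro add_mono) (simp_all add: mult_right_mono)
 finally show ?thesis by (simp add: mult.assoc)
qed

lemma or_gate: "or_gate m L F (or_in n m l j) (or_e n l j) (or_g n l j)" if "1 <= l"
proof
 have "inj_on (or_in n m l j) {..<m + L + 1}" using that by (auto simp: inj_on_def or_in_def obit_def split: if_splits)
 moreover have "or_in n m l j i ~= or_e n l j' p q" "or_in n m l j i ~= or_g n l j' p" for i j' p q
  by (auto simp: or_in_def or_e_def or_g_def obit_def)
 ultimately show "separate (m + L + 1) (or_in n m l j) (or_e n l j) (or_g n l j)"
  unfolding separate_def by (auto simp: or_e_def or_g_def inj_def)
qed (rule FL)

definition "fresh l j = or_gate.E m L (or_in n m l j) Un or_gate.A m L c (or_e n l j) (or_g n l j)"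
definition "block l j = concat (or_layers m L F c (or_in n m l j) (or_e n l j) (or_g n l j))"
definition "inputs l j = (%i. obit n (l - 1) (j*m + i)) ` {..<m}"

lemma fresh_cases:
 assumes "x \<in> fresh l j" "1 <= l"
 shows "x = obit n l j \<or> (\<exists>i<h. x = anc n 3 l j i) \<or> (\<exists>p<P. \<exists>i<h. x = anc n 4 (prod_encode (l,j)) p i) \<or> (\<exists>p<P. x = anc n 5 (prod_encode (l,j)) p 0)"
proof -
 interpret og: or_gate m L F c "or_in n m l j" "or_e n l j" "or_g n l j" by (rule or_gate[OF assms(2)])
 show ?thesis using assms(1) unfolding fresh_def og.E_def og.A_def og.h_def anc_set_def h_def P_def copies_def
  by (auto simp: or_in_def or_e_def or_g_def)
qed

lemma obit_fresh: "obit n l j \<in> fresh l j" if "1 <= l"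
proof -
 interpret og: or_gate m L F c "or_in n m l j" "or_e n l j" "or_g n l j" by (rule or_gate[OF that])
 show ?thesis using og.qE(1) by (simp add: fresh_def og.q_def or_in_def)
qed

lemma fresh_disjoint: "1 <= l ==> 1 <= l' ==> (l,j) ~= (l',j') ==> fresh l j Int fresh l' j' = {}"
proof (rule ccontr)
 assume a: "1 <= l" "1 <= l'" "(l,j) ~= (l',j')" "fresh l j Int fresh l' j' ~= {}"
 then obtain x where "x \<in> fresh l j" "x \<in> fresh l' j'" by auto
 from fresh_cases[OF this(1) a(1)] fresh_cases[OF this(2) a(2)] a(3) show False
  by (auto simp: obit_def prod_encode_eq)
qed

lemma obit_not_fresh: "1 <= l ==> (l',k) ~= (l,j) ==> obit n l' k \<notin> fresh l j"
 using fresh_cases[of "obit n l' k" l j] by (auto simp: obit_def)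

lemma inputs_not_fresh: "1 <= l ==> inputs l a Int fresh l b = {}"
proof -
 assume l: "1 <= l"
 have "obit n (l - 1) k \<notin> fresh l b" for k by (rule obit_not_fresh) (use l in auto)
 then show ?thesis by (auto simp: inputs_def)
qed

lemma low_not_fresh: "1 <= l ==> x <= n ==> x \<notin> fresh l j"
 using fresh_cases[of x l j] anc_gt by (auto simp: obit_def) (metis not_le)+

lemma lt_cube: "1 <= l ==> j < m^(3 - l) ==> j < m^3"
 using power_increasing[of "3 - l" 3 m] m by (meson diff_le_self less_le_trans)

lemma lt_cube': "1 <= l ==> l <= 3 ==> j < m^(3 - l) ==> i < m ==> j*m + i < m^(3 - (l - 1))"
proof -
 assume a: "1 <= l" "l <= 3" "j < m^(3 - l)" "i < m"
 have "3 - (l - 1) = Suc (3 - l)" using a by simp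
 moreover have "j*m + i < Suc j*m" using a by simp
 moreover have "Suc j*m <= m^(3 - l)*m" using a by (intro mult_right_mono) auto
 ultimately show ?thesis by (simp add: mult.commute)
qed

lemma in_used: "i < n ==> k < m^3 ==> xcopy n i k \<in> used" "i < n ==> k < m^3 ==> coin n i k \<in> used"
 "l <= 3 ==> k < m^3 ==> obit n l k \<in> used" "i <= n ==> i \<in> used"
proof -
 show "i < n ==> k < m^3 ==> xcopy n i k \<in> used" unfolding used_def xcopy_def
  by (rule UnI2,rule image_eqI[of _ _ "(0,i,k,0)"],auto)
 show "i < n ==> k < m^3 ==> coin n i k \<in> used" unfolding used_def coin_def
  by (rule UnI2,rule image_eqI[of _ _ "(1,i,k,0)"],auto)
 show "l <= 3 ==> k < m^3 ==> obit n l k \<in> used" unfolding used_def obit_def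
  by (rule UnI2,rule image_eqI[of _ _ "(2,l,k,0)"],auto)
 show "i <= n ==> i \<in> used" by (simp add: used_def)
qed

lemma fresh_used: "1 <= l ==> l <= 3 ==> j < m^3 ==> fresh l j \<subseteq> used"
proof
 fix x assume a: "1 <= l" "l <= 3" "j < m^3" "x \<in> fresh l j"
 from fresh_cases[OF a(4,1)] show "x \<in> used"
 proof (elim disjE exE conjE)
  assume "x = obit n l j" then show ?thesis using in_used(3) a by simp
 next
  fix i assume "i < h" "x = anc n 3 l j i"
  then show ?thesis unfolding used_def using a by - (rule UnI2,rule image_eqI[of _ _ "(3,l,j,i)"],auto)
 next
  fix p i assume "p < P" "i < h" "x = anc n 4 (prod_encode (l,j)) p i"
  then show ?thesis unfolding used_def using a by - (rule UnI2,rule image_eqI[of _ _ "(4,prod_encode (l,j),p,i)"],auto)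
 next
  fix p assume "p < P" "x = anc n 5 (prod_encode (l,j)) p 0"
  then show ?thesis unfolding used_def using a by - (rule UnI2,rule image_eqI[of _ _ "(5,prod_encode (l,j),p,0)"],auto)
 qed
qed

lemma wf_block:
 assumes "1 <= l"
 shows "wf_layers (inputs l j Un fresh l j) (or_layers m L F c (or_in n m l j) (or_e n l j) (or_g n l j))"
proof -
 interpret og: or_gate m L F c "or_in n m l j" "or_e n l j" "or_g n l j" by (rule or_gate[OF assms])
 have "or_in n m l j ` {..<og.h} = inputs l j Un og.E"
 proof -
  have "{..<og.h} = {..<m} Un {m..<og.h}" using og.qE(2) by auto
  moreover have "or_in n m l j ` {..<m} = inputs l j" unfolding inputs_def by (intro image_cong) (auto simp: or_in_def)
  ultimately show ?thesis by (simp add: image_Un og.E_def)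
 qed
 then show ?thesis using og.wf_or by (simp add: fresh_def Un_assoc)
qed

lemma block:
 assumes "1 <= l"
 obtains K where "kern golden_angle (fresh l j) K (block l j)"
  "!!U. inputs l j Int U = {} ==> obit n l j \<in> U ==> K U = 0"
  "!!V. V Int fresh l j = {} ==> (\<Sum>f\<in>Pow (fresh l j). if inputs l j Int (V Un f) ~= {} & obit n l j \<notin> V Un f then (cmod (K (V Un f)))\<^sup>2 else 0) <= \<delta>"
proof -
 interpret og: or_gate m L F c "or_in n m l j" "or_e n l j" "or_g n l j" by (rule or_gate[OF assms])
 obtain k where k: "cmod k = 1" "kern golden_angle (og.E Un og.A) (og.kernel k) (concat (or_layers m L F c (or_in n m l j) (or_e n l j) (or_g n l j)))"
  by (rule og.kern_or)
 have q: "og.q = obit n l j" by (simp add: og.q_def or_in_def)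
 have inp: "(\<exists>i<m. or_in n m l j i \<in> U) \<longleftrightarrow> inputs l j Int U ~= {}" for U by (auto simp: inputs_def or_in_def)
 have nf: "inputs l j Int fresh l j = {}" by (rule inputs_not_fresh[OF assms])
 have dd: "\<delta> = (1 - real F * og.z\<^sup>2/(4*2^L))\<^sup>2" by (simp add: \<delta>_def z_def og.z_def h_def og.h_def)
 show thesis
 proof (rule that[of "og.kernel k"])
  show "kern golden_angle (fresh l j) (og.kernel k) (block l j)" unfolding fresh_def block_def by (rule k(2))
  show "og.kernel k U = 0" if "inputs l j Int U = {}" "obit n l j \<in> U" for U
   using og.kernel_zero[of U k] that unfolding inp q by simp
  fix V assume V: "V Int fresh l j = {}"
  have iff: "inputs l j Int (V Un f) ~= {} \<longleftrightarrow> inputs l j Int V ~= {}" if "f \<in> Pow (fresh l j)" for f using nf that by auto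
  show "(\<Sum>f\<in>Pow (fresh l j). if inputs l j Int (V Un f) ~= {} & obit n l j \<notin> V Un f then (cmod (og.kernel k (V Un f)))\<^sup>2 else 0) <= \<delta>"
  proof (cases "inputs l j Int V = {}")
   case True
   have "(\<Sum>f\<in>Pow (fresh l j). if inputs l j Int (V Un f) ~= {} & obit n l j \<notin> V Un f then (cmod (og.kernel k (V Un f)))\<^sup>2 else 0) = 0"
    by (intro sum.neutral ballI) (simp only: iff True simp_thms if_False)
   then show ?thesis by (simp add: \<delta>_def)
  next
   case False
   have "(\<Sum>f\<in>Pow (fresh l j). if inputs l j Int (V Un f) ~= {} & obit n l j \<notin> V Un f then (cmod (og.kernel k (V Un f)))\<^sup>2 else 0) =
    (\<Sum>f\<in>Pow (og.E Un og.A). if og.q \<notin> V Un f then (cmod (og.kernel k (V Un f)))\<^sup>2 else 0)"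
    unfolding fresh_def[symmetric] q by (intro sum.cong refl) (simp only: iff False simp_thms)
   also have "... <= \<delta>" unfolding dd by (rule og.kernel_fail) (use k V False inp in \<open>auto simp: fresh_def\<close>)
   finally show ?thesis .
  qed
 qed
qed

definition "fails l j U \<longleftrightarrow> inputs l j Int U ~= {} & obit n l j \<notin> U"

lemma level_layers:
 assumes l: "1 <= l" "l <= 3"
 shows "wf_layers used (level n m L F c l)"
  and "run golden_angle (concat (level n m L F c l)) psi = run golden_angle (concat (map (block l) [0..<m^(3 - l)])) psi"
proof -
 have w: "wf_layers (inputs l j Un fresh l j) (or_layers m L F c (or_in n m l j) (or_e n l j) (or_g n l j)) &
   length (or_layers m L F c (or_in n m l j) (or_e n l j) (or_g n l j)) = 91" for j
  using wf_block[OF l(1)] length_or_layers by blast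
 have d: "(inputs l i Un fresh l i) Int (inputs l j Un fresh l j) = {}" if "i ~= j" for i j
 proof -
  have "i*m + a = j*m + b ==> a < m ==> b < m ==> i = j" for a b
   by (metis add.commute div_mult_self3 div_less add_0 mult.commute nat_less_le not_less_zero)
  then have "inputs l i Int inputs l j = {}" using that by (auto simp: inputs_def obit_def)
  moreover have "inputs l a Int fresh l b = {}" for a b by (rule inputs_not_fresh[OF l(1)])
  ultimately show ?thesis using fresh_disjoint[of l l i j] l that by blast
 qed
 have "(\<Union>j\<in>set [0..<m^(3 - l)]. inputs l j Un fresh l j) \<subseteq> used"
 proof
  fix x assume "x \<in> (\<Union>j\<in>set [0..<m^(3 - l)]. inputs l j Un fresh l j)"
  then obtain j where j: "j < m^(3 - l)" "x \<in> inputs l j \<or> x \<in> fresh l j" by auto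
  have "inputs l j \<subseteq> used"
  proof
   fix x assume "x \<in> inputs l j"
   then obtain i where i: "i < m" "x = obit n (l - 1) (j*m + i)" by (auto simp: inputs_def)
   have "m^(3 - (l - 1)) <= m^3" using m by (intro power_increasing) auto
   then show "x \<in> used" using lt_cube'[OF l j(1) i(1)] i(2) l by (auto intro: in_used)
  qed
  then show "x \<in> used" using j fresh_used[OF l lt_cube[OF l(1) j(1)]] by auto
 qed
 from wf_layers_mono[OF wf_par[OF w _ d] this] show "wf_layers used (level n m L F c l)" unfolding level_def by auto
 show "run golden_angle (concat (level n m L F c l)) psi = run golden_angle (concat (map (block l) [0..<m^(3 - l)])) psi"
  unfolding level_def block_def by (rule run_par[OF w _ d]) auto
qed

text \<open>The gates of a level run in parallel but are analysed as a chain: qubits outside the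
  level stay clear, each gate adds at most \<open>\<delta>\<close> to the failure mass, and a gate
  without set inputs leaves its output at 0.\<close>

lemma level_run:
 assumes l: "1 <= l" "l <= 3" and cl: "!!j. clean (fresh l j) psi" and one: "mass {..<N} psi (%_. True) <= 1"
 defines "\<phi> \<equiv> run golden_angle (concat (level n m L F c l)) psi" and "J \<equiv> m^(3 - l)"
 shows "(!!j. j < J ==> fresh l j Int G = {}) ==> clean G psi ==> clean G \<phi>"
  and "mass {..<N} \<phi> (%_. True) <= 1"
  and "(!!j U. E (U - fresh l j) \<longleftrightarrow> E U) ==> mass {..<N} \<phi> (%U. E U \<or> (\<exists>j<J. fails l j U)) <= mass {..<N} psi E + real J * \<delta>"
  and "\<phi> U ~= 0 ==> psi (U - (\<Union>j<J. fresh l j)) ~= 0 & (\<forall>j<J. inputs l j Int U = {} --> obit n l j \<notin> U)"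
proof -
 \<comment> \<open>A gate provides its kernel only as an existence statement, with an unknown unit
   scalar; the kernels of the whole level are therefore chosen by their properties.\<close>
 define Q where "Q j K \<longleftrightarrow> kern golden_angle (fresh l j) K (block l j) & (\<forall>U. inputs l j Int U = {} --> obit n l j \<in> U --> K U = 0) &
  (\<forall>V. V Int fresh l j = {} --> (\<Sum>f\<in>Pow (fresh l j). if fails l j (V Un f) then (cmod (K (V Un f)))\<^sup>2 else 0) <= \<delta>)" for j K
 have "\<forall>j. \<exists>K. Q j K"
 proof
  fix j
  show "\<exists>K. Q j K" unfolding Q_def fails_def by (rule block[OF l(1),of j]) blast
 qed
 from choice[OF this] obtain K where "\<forall>j. Q j (K j)" ..
 then have KQ: "Q j (K j)" for j by simp
 have K1: "kern golden_angle (fresh l j) (K j) (block l j)" for j using KQ[of j] unfolding Q_def by (rule conjunct1)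
 have K2: "inputs l j Int U = {} ==> obit n l j \<in> U ==> K j U = 0" for j U using KQ[of j] unfolding Q_def by simp
 have K3: "V Int fresh l j = {} ==> (\<Sum>f\<in>Pow (fresh l j). if fails l j (V Un f) then (cmod (K j (V Un f)))\<^sup>2 else 0) <= \<delta>" for j V
  using KQ[of j] unfolding Q_def by simp
 note K = K1 K2 K3
 have io: "inputs l j \<subseteq> used" "fresh l j \<subseteq> used" if j: "j < J" for j
 proof -
  show "fresh l j \<subseteq> used" using fresh_used[OF l lt_cube[OF l(1)]] j by (simp add: J_def)
  show "inputs l j \<subseteq> used"
  proof
   fix x assume "x \<in> inputs l j"
   then obtain i where i: "i < m" "x = obit n (l - 1) (j*m + i)" by (auto simp: inputs_def)
   have "m^(3 - (l - 1)) <= m^3" using m by (intro power_increasing) auto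
   then show "x \<in> used" using lt_cube'[OF l j[unfolded J_def] i(1)] i(2) l by (auto intro: in_used)
  qed
 qed
 interpret ch: chain golden_angle J "fresh l" K "block l" "{..<N}" psi
 proof
  fix j assume j: "j < J"
  show "kern golden_angle (fresh l j) (K j) (block l j)" by (rule K)
  show "fresh l j \<subseteq> {..<N}" using io[OF j] used_N by blast
  show "qubits (block l j) \<subseteq> {..<N}" unfolding block_def using wf_layers_qubits[OF wf_block[OF l(1)]] io[OF j] used_N by blast
  show "distinct (gate_qubits g)" if "g \<in> set (block l j)" for g
   using wf_layers_distinct[OF wf_block[OF l(1)]] that unfolding block_def by blast
  show "clean (fresh l j) psi" by (rule cl)
  show "fresh l i Int fresh l j = {}" if "i < J" "i ~= j" for i using fresh_disjoint[of l l i j] l that by simp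
 qed simp
 have S: "\<phi> = ch.S J" unfolding \<phi>_def ch.S_def J_def level_layers(2)[OF l] ..
 have ind: "inputs l i Int (U - fresh l j) = inputs l i Int U" for i j U using inputs_not_fresh[OF l(1),of i j] by blast
 have ind2: "obit n l i \<in> U - fresh l j \<longleftrightarrow> obit n l i \<in> U" if "i ~= j" for i j U using obit_not_fresh[OF l(1)] that by auto
 show "clean G \<phi>" if "!!j. j < J ==> fresh l j Int G = {}" "clean G psi" unfolding S by (rule ch.clean_S) (use that in auto)
 show b: "mass {..<N} \<phi> (%U. E U \<or> (\<exists>j<J. fails l j U)) <= mass {..<N} psi E + real J * \<delta>"
  if "!!j U. E (U - fresh l j) \<longleftrightarrow> E U" for E unfolding S
 proof (rule ch.mass_disj_chain)
  show "fails l i (U - fresh l j) \<longleftrightarrow> fails l i U" if "i < j" for i j U unfolding fails_def ind using ind2[of i j U] that by simp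
  show "(\<Sum>f\<in>Pow (fresh l j). if fails l j (V Un f) then (cmod (K j (V Un f)))\<^sup>2 else 0) <= \<delta>" if "V \<subseteq> {..<N} - fresh l j" for j V
   by (rule K(3)) (use that in auto)
 qed (use that one in \<open>auto simp: \<delta>_def\<close>)
 have "t <= J ==> mass {..<N} (ch.S t) (%_. True) <= 1" for t
 proof (induction t)
  case (Suc t)
  then show ?case using ch.keep[of t "%_. True"] by simp
 qed (simp add: ch.S_simps one)
 then show "mass {..<N} \<phi> (%_. True) <= 1" unfolding S by simp
 show "psi (U - (\<Union>j<J. fresh l j)) ~= 0 & (\<forall>j<J. inputs l j Int U = {} --> obit n l j \<notin> U)" if "\<phi> U ~= 0"
 proof (intro conjI allI impI)
  note s = ch.supp[OF order_refl that[unfolded S]]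
  show "psi (U - (\<Union>j<J. fresh l j)) ~= 0" using s by simp
  fix j assume j: "j < J" "inputs l j Int U = {}"
  let ?U = "U - (\<Union>i\<in>{j<..<J}. fresh l i)"
  have "K j ?U ~= 0" using s j by simp
  moreover have "inputs l j Int ?U = {}" using j by auto
  ultimately have "obit n l j \<notin> ?U" using K(2) by blast
  moreover have "obit n l j \<notin> fresh l i" if "i \<in> {j<..<J}" for i using obit_not_fresh[OF l(1)] that by simp
  ultimately show "obit n l j \<notin> U" by blast
 qed
qed

end

context or_params
begin

definition "tset k = (%i. coin n i k) ` {..<n} Un {obit n 0 k}"
definition "coins k = (%i. coin n i k) ` {..<n}"
definition "trial_kernel k U = (\<Prod>i<n. gadget_kernel (xcopy n i k) (coin n i k) U)*(if obit n 0 k \<in> U \<longleftrightarrow> odd (card (U Int coins k)) then 1 else 0)"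

lemma addr [simp]: "xcopy n i k ~= coin n i' k'" "coin n i' k' ~= xcopy n i k" "coin n i k = coin n i' k' \<longleftrightarrow> i = i' & k = k'" "xcopy n i k = xcopy n i' k' \<longleftrightarrow> i = i' & k = k'"
 "obit n l a ~= coin n i k" "obit n l a ~= xcopy n i k" "coin n i k ~= obit n l a" "xcopy n i k ~= obit n l a" "obit n l a = obit n l' a' \<longleftrightarrow> l = l' & a = a'"
 by (simp_all add: xcopy_def coin_def obit_def)

lemma addr_gt: "n < xcopy n i k" "n < coin n i k" "n < obit n l a"
 by (simp_all add: xcopy_def coin_def obit_def anc_gt)

lemma wf_trial: "wf_layers ((%i. xcopy n i k) ` {..<n} Un tset k) (trial n k)" "length (trial n k) = 16"
proof -
 have g: "wf_layers {xcopy n i k,coin n i k} (gadget (xcopy n i k) (coin n i k)) & length (gadget (xcopy n i k) (coin n i k)) = 13" for i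
  by (rule wf_gadget) simp
 have "wf_layers (\<Union>i\<in>set [0..<n]. {xcopy n i k,coin n i k}) (par 13 (%i. gadget (xcopy n i k) (coin n i k)) [0..<n])"
  by (rule wf_par) (use g in auto)
 then have 1: "wf_layers ((%i. xcopy n i k) ` {..<n} Un tset k) (par 13 (%i. gadget (xcopy n i k) (coin n i k)) [0..<n])"
  by (rule wf_layers_mono) (auto simp: tset_def)
 have "wf_layers (insert (obit n 0 k) (set (map (%i. coin n i k) [0..<n]))) (parity_layers (map (%i. coin n i k) [0..<n]) (obit n 0 k))"
  by (rule wf_parity_layers) (auto simp: distinct_map inj_on_def)
 then have 2: "wf_layers ((%i. xcopy n i k) ` {..<n} Un tset k) (parity_layers (map (%i. coin n i k) [0..<n]) (obit n 0 k))"
  by (rule wf_layers_mono) (auto simp: tset_def)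
 show "wf_layers ((%i. xcopy n i k) ` {..<n} Un tset k) (trial n k)" unfolding trial_def using 1 2 by simp
 show "length (trial n k) = 16" by (simp add: trial_def parity_layers_def)
qed

lemma kern_trial: "kern golden_angle (tset k) (trial_kernel k) (concat (trial n k))"
proof -
 have g: "wf_layers {xcopy n i k,coin n i k} (gadget (xcopy n i k) (coin n i k)) & length (gadget (xcopy n i k) (coin n i k)) = 13" for i
  by (rule wf_gadget) simp
 have r: "run golden_angle (concat (par 13 (%i. gadget (xcopy n i k) (coin n i k)) [0..<n])) psi =
   run golden_angle (concat (map (%i. concat (gadget (xcopy n i k) (coin n i k))) [0..<n])) psi" for psi
  by (rule run_par[where A = "%i. {xcopy n i k,coin n i k}"]) (use g in auto)
 have "kern golden_angle (\<Union>i\<in>set [0..<n]. {coin n i k}) (%U. \<Prod>i\<in>set [0..<n]. gadget_kernel (xcopy n i k) (coin n i k) U)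
   (concat (map (%i. concat (gadget (xcopy n i k) (coin n i k))) [0..<n]))"
 proof (rule kern_list)
  show "kern golden_angle {coin n i k} (gadget_kernel (xcopy n i k) (coin n i k)) (concat (gadget (xcopy n i k) (coin n i k)))" for i
   by (rule kern_gadget) simp
 qed (auto simp: gadget_kernel_def)
 moreover have "set [0..<n] = {..<n}" by auto
 ultimately have 1: "kern golden_angle (coins k) (%U. \<Prod>i<n. gadget_kernel (xcopy n i k) (coin n i k) U)
   (concat (map (%i. concat (gadget (xcopy n i k) (coin n i k))) [0..<n]))"
  by (simp add: coins_def UNION_singleton_eq_range)
 have s: "set (map (%i. coin n i k) [0..<n]) = coins k" by (auto simp: coins_def)
 have ku: "gadget_kernel (xcopy n i k) (coin n i k) (U - {obit n 0 k}) = gadget_kernel (xcopy n i k) (coin n i k) U" for i U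
  by (auto simp: gadget_kernel_def)
 have 2: "kern golden_angle {obit n 0 k} (%U. if obit n 0 k \<in> U \<longleftrightarrow> odd (card (U Int coins k)) then 1 else 0)
   (concat (parity_layers (map (%i. coin n i k) [0..<n]) (obit n 0 k)))"
  unfolding s[symmetric] by (rule kern_parity) (auto simp: distinct_map inj_on_def)
 have "kern golden_angle (coins k Un {obit n 0 k}) (%U. (\<Prod>i<n. gadget_kernel (xcopy n i k) (coin n i k) U)*(if obit n 0 k \<in> U \<longleftrightarrow> odd (card (U Int coins k)) then 1 else 0))
   (concat (map (%i. concat (gadget (xcopy n i k) (coin n i k))) [0..<n]) @ concat (parity_layers (map (%i. coin n i k) [0..<n]) (obit n 0 k)))"
  by (rule kern_append[OF 1 2]) (auto simp: coins_def ku)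
 then show ?thesis unfolding kern_def trial_kernel_def tset_def coins_def[symmetric] trial_def by (simp add: r)
qed

text \<open>In the signed mass of the coins every set input contributes the factor
  \<open>cos^2 - sin^2 = 2 - sqrt 5\<close>, of modulus below 3/10, and every unset one the factor
  1. One set input thus bounds the mass of even parity by (1 + 3/10)/2.\<close>

lemma trial_fail:
 assumes w: "i0 \<in> w" "i0 < n" and V: "V Int tset k = {}" "!!i. i < n ==> xcopy n i k \<in> V \<longleftrightarrow> i \<in> w"
 shows "(\<Sum>f\<in>Pow (tset k). if obit n 0 k \<notin> V Un f then (cmod (trial_kernel k (V Un f)))\<^sup>2 else 0) <= 65/100"
proof -
 let ?f = "%i. if i \<in> w then (sin golden_angle)\<^sup>2 else 0" and ?g = "%i. if i \<in> w then (cos golden_angle)\<^sup>2 else 1"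
 have inj: "inj_on (%i. coin n i k) A" for A by (simp add: inj_on_def)
 have "(\<Sum>f\<in>Pow (tset k). if obit n 0 k \<notin> V Un f then (cmod (trial_kernel k (V Un f)))\<^sup>2 else 0) =
   (\<Sum>f\<in>Pow (coins k). if obit n 0 k \<notin> V Un f then (cmod (trial_kernel k (V Un f)))\<^sup>2 else 0)"
  by (rule sum.mono_neutral_right) (auto simp: tset_def coins_def)
 also have "Pow (coins k) = (`) (%i. coin n i k) ` Pow {..<n}" unfolding coins_def by (rule image_Pow_surj[OF refl,symmetric])
 also have "(\<Sum>f\<in>(`) (%i. coin n i k) ` Pow {..<n}. if obit n 0 k \<notin> V Un f then (cmod (trial_kernel k (V Un f)))\<^sup>2 else 0) =
   (\<Sum>T\<in>Pow {..<n}. if obit n 0 k \<notin> V Un (%i. coin n i k) ` T then (cmod (trial_kernel k (V Un (%i. coin n i k) ` T)))\<^sup>2 else 0)"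
  by (subst sum.reindex) (auto intro: inj_on_image_Pow inj)
 also have "... = (\<Sum>T\<in>Pow {..<n}. if even (card T) then (\<Prod>i<n. if i \<in> T then ?f i else ?g i) else 0)"
 proof (intro sum.cong refl)
  fix T assume T: "T \<in> Pow {..<n}"
  let ?U = "V Un (%i. coin n i k) ` T"
  have a: "coin n i k \<in> ?U \<longleftrightarrow> i \<in> T" if "i < n" for i using V(1) that by (auto simp: tset_def)
  have b: "xcopy n i k \<in> ?U \<longleftrightarrow> i \<in> w" if "i < n" for i using V(2)[OF that] by auto
  have o: "obit n 0 k \<notin> ?U" using V(1) by (auto simp: tset_def)
  have "?U Int coins k = (%i. coin n i k) ` T" using V(1) T by (auto simp: tset_def coins_def)
  then have c: "card (?U Int coins k) = card T" by (simp add: card_image inj)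
  have p: "(\<Prod>i<n. (cmod (gadget_kernel (xcopy n i k) (coin n i k) ?U))\<^sup>2) = (\<Prod>i<n. if i \<in> T then ?f i else ?g i)"
  proof (intro prod.cong refl)
   fix i assume "i \<in> {..<n}"
   then have ab: "coin n i k \<in> ?U \<longleftrightarrow> i \<in> T" "xcopy n i k \<in> ?U \<longleftrightarrow> i \<in> w" using a b by blast+
   show "(cmod (gadget_kernel (xcopy n i k) (coin n i k) ?U))\<^sup>2 = (if i \<in> T then ?f i else ?g i)"
    unfolding gadget_kernel_def ab by (auto simp: norm_mult norm_word_phase)
  qed
  have "(cmod (trial_kernel k ?U))\<^sup>2 = (if even (card T) then (\<Prod>i<n. if i \<in> T then ?f i else ?g i) else 0)"
   unfolding trial_kernel_def norm_mult power_mult_distrib p[symmetric] prod_norm[symmetric] prod_power_distrib using o c by simp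
  then show "(if obit n 0 k \<notin> ?U then (cmod (trial_kernel k ?U))\<^sup>2 else 0) = (if even (card T) then (\<Prod>i<n. if i \<in> T then ?f i else ?g i) else 0)"
   using o by simp
 qed
 also have "... = (1 + (\<Prod>i<n. ?g i - ?f i))/2" by (rule even_mass) auto
 also have "... <= 65/100"
 proof -
  have d: "\<bar>?g i - ?f i\<bar> <= 1" for i using golden_square_diff sqrt5_bounds by auto
  have "(\<Prod>i<n. ?g i - ?f i) <= \<bar>\<Prod>i<n. ?g i - ?f i\<bar>" by simp
  also have "... = (\<Prod>i<n. \<bar>?g i - ?f i\<bar>)" by (rule abs_prod)
  also have "... = \<bar>?g i0 - ?f i0\<bar>*(\<Prod>i\<in>{..<n} - {i0}. \<bar>?g i - ?f i\<bar>)" by (rule prod.remove) (use w in auto)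
  also have "... <= (3/10)*1"
  proof (intro mult_mono)
   show "\<bar>?g i0 - ?f i0\<bar> <= 3/10" using w golden_square_diff sqrt5_bounds by auto
   show "(\<Prod>i\<in>{..<n} - {i0}. \<bar>?g i - ?f i\<bar>) <= 1" by (rule prod_le_1) (use d in auto)
  qed (auto intro: prod_nonneg)
  finally show ?thesis by simp
 qed
 finally show ?thesis .
qed

text \<open>This holds after the input layer and persists, since the trials write only fresh
  qubits.\<close>

definition "good w U \<longleftrightarrow> U Int {..n} = w & (\<forall>i<n. \<forall>k<m^3. xcopy n i k \<in> U \<longleftrightarrow> i \<in> w)"
definition "start w = run golden_angle (in_layer n (m^3)) (ket w)"
definition "after0 w = run golden_angle (concat (par 16 (trial n) [0..<m^3])) (start w)"

lemma wf_in_layer: "wf_layers used [in_layer n (m^3)]"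
proof -
 have "concat (map gate_qubits (in_layer n (m^3))) = concat (map (%i. i # map (%k. xcopy n i k) [0..<m^3]) [0..<n])"
  by (simp add: in_layer_def comp_def)
 moreover have "distinct (concat (map (%i. i # map (%k. xcopy n i k) [0..<m^3]) [0..<n]))"
 proof (rule distinct_concat_map)
  have x: "x < n ==> x ~= xcopy n i k" for x i k using addr_gt(1)[of i k] by auto
  show "distinct (x # map (%k. xcopy n x k) [0..<m^3])" if "x \<in> set [0..<n]" for x
   using that x by (auto simp: distinct_map inj_on_def)
  show "set (x # map (%k. xcopy n x k) [0..<m^3]) Int set (y # map (%k. xcopy n y k) [0..<m^3]) = {}"
   if "x \<in> set [0..<n]" "y \<in> set [0..<n]" "x ~= y" for x y
   using that x[of x] x[of y] by auto
 qed simp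
 moreover have "qubits (in_layer n (m^3)) \<subseteq> used" by (auto simp: in_layer_def qubits_def intro: in_used)
 ultimately show ?thesis by simp
qed

lemma start:
 assumes w: "w \<subseteq> {..n}"
 shows "start w U ~= 0 ==> good w U" and "(!!i k. xcopy n i k \<notin> G) ==> (!!i. i <= n ==> i \<notin> G) ==> clean G (start w)"
proof -
 have x: "x <= n ==> x ~= xcopy n i k" for x i k using addr_gt(1)[of i k] by auto
 have x': "\<not> xcopy n i k < n" for i k using addr_gt(1)[of i k] by auto
 let ?R = "%U. \<Union>i\<in>{i \<in> set [0..<n]. i \<in> U}. set (map (%k. xcopy n i k) [0..<m^3])"
 have r: "start w = (%U. ket w (sym_diff U (?R U)))"
  unfolding start_def in_layer_def by (rule run_fan) (auto simp: x')
 have R: "x \<in> ?R U \<longleftrightarrow> (\<exists>i<n. \<exists>k<m^3. i \<in> U & x = xcopy n i k)" for x U by auto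
 have s: "sym_diff U (?R U) = w" if "start w U ~= 0" for U using that unfolding r ket_def by (auto split: if_splits)
 have m: "x \<in> w \<longleftrightarrow> (x \<in> U) ~= (x \<in> ?R U)" if "start w U ~= 0" for x U unfolding s[OF that,symmetric] by auto
 show g: "good w U" if st: "start w U ~= 0" for U
  unfolding good_def
 proof (intro conjI allI impI)
  have low: "x \<in> U \<longleftrightarrow> x \<in> w" if "x <= n" for x using m[OF st,of x] R[of x U] x[OF that] by auto
  show "U Int {..n} = w" using low w by auto
  fix i k assume ik: "i < n" "k < m^3"
  have "xcopy n i k \<notin> w" using w addr_gt(1)[of i k] by auto
  then have "xcopy n i k \<in> U \<longleftrightarrow> xcopy n i k \<in> ?R U" using m[OF st] by blast
  also have "... \<longleftrightarrow> i \<in> U" unfolding R using ik by auto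
  finally show "xcopy n i k \<in> U \<longleftrightarrow> i \<in> w" using low[of i] ik by simp
 qed
 show "clean G (start w)" if "!!i k. xcopy n i k \<notin> G" "!!i. i <= n ==> i \<notin> G"
  unfolding clean_def
 proof (intro allI impI,rule ccontr)
  fix U assume U: "U Int G ~= {}" "start w U ~= 0"
  then obtain y where y: "y \<in> U" "y \<in> G" by auto
  then have "y \<notin> w" using w that(2) by auto
  then have "y \<in> ?R U" using m[OF U(2),of y] y(1) by blast
  then show False using R that(1) y(2) by auto
 qed
qed

lemma norm_ket: "w \<subseteq> {..<N} ==> (\<Sum>U\<in>Pow {..<N}. (cmod (ket w U))\<^sup>2) = 1"
proof -
 assume w: "w \<subseteq> {..<N}"
 have "(\<Sum>U\<in>Pow {..<N}. (cmod (ket w U))\<^sup>2) = (\<Sum>U\<in>Pow {..<N}. if U = w then 1 else 0)" by (intro sum.cong) (auto simp: ket_def)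
 then show ?thesis using w by simp
qed

lemma wN: "w \<subseteq> {..n} ==> w \<subseteq> {..<N}" using used_N in_used(4) by blast

lemma trials_wf: "wf_layers used (par 16 (trial n) [0..<m^3])"
 and trials_run: "run golden_angle (concat (par 16 (trial n) [0..<m^3])) psi = run golden_angle (concat (map (%k. concat (trial n k)) [0..<m^3])) psi"
proof -
 let ?A = "%k. (%i. xcopy n i k) ` {..<n} Un tset k"
 have d: "?A k Int ?A k' = {}" if "k ~= k'" for k k' using that by (auto simp: tset_def)
 have "(\<Union>k\<in>set [0..<m^3]. ?A k) \<subseteq> used" by (auto simp: tset_def intro: in_used)
 moreover have "wf_layers (\<Union>k\<in>set [0..<m^3]. ?A k) (par 16 (trial n) [0..<m^3])"
  by (rule wf_par) (use wf_trial d in auto)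
 ultimately show "wf_layers used (par 16 (trial n) [0..<m^3])" using wf_layers_mono by blast
 show "run golden_angle (concat (par 16 (trial n) [0..<m^3])) psi = run golden_angle (concat (map (%k. concat (trial n k)) [0..<m^3])) psi"
  by (rule run_par[where A = ?A]) (use wf_trial d in auto)
qed

lemma after0:
 assumes w: "w \<subseteq> {..n}"
 shows "1 <= l ==> clean (fresh l j) (after0 w)"
  and "mass {..<N} (after0 w) (%_. True) <= 1"
  and "after0 w U ~= 0 ==> U Int {..n} = w"
  and "w Int {..<n} ~= {} ==> mass {..<N} (after0 w) (%U. \<forall>k<m^3. obit n 0 k \<notin> U) <= (65/100)^(m^3)"
  and "w Int {..<n} = {} ==> after0 w U ~= 0 ==> k < m^3 ==> obit n 0 k \<notin> U"
proof -
 have tu: "(%i. xcopy n i k) ` {..<n} Un tset k \<subseteq> used" if "k < m^3" for k using that by (auto simp: tset_def intro: in_used)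
 have ct: "clean (tset k) (start w)" for k
  by (rule start(2)[OF w]) (use addr_gt in \<open>auto simp: tset_def\<close>,(metis not_le)+)
 interpret ch: chain golden_angle "m^3" tset trial_kernel "%k. concat (trial n k)" "{..<N}" "start w"
 proof
  fix k assume k: "k < m^3"
  show "kern golden_angle (tset k) (trial_kernel k) (concat (trial n k))" by (rule kern_trial)
  show "tset k \<subseteq> {..<N}" using tu[OF k] used_N by blast
  show "qubits (concat (trial n k)) \<subseteq> {..<N}" using wf_layers_qubits[OF wf_trial(1)] tu[OF k] used_N by blast
  show "distinct (gate_qubits g)" if "g \<in> set (concat (trial n k))" for g using wf_layers_distinct[OF wf_trial(1)] that by blast
  show "tset i Int tset k = {}" if "i < m^3" "i ~= k" for i using that by (auto simp: tset_def)
  show "clean (tset k) (start w)" by (rule ct)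
 qed simp
 have S: "after0 w = ch.S (m^3)" unfolding after0_def ch.S_def trials_run ..
 have "(\<Sum>U\<in>Pow {..<N}. (cmod (start w U))\<^sup>2) = (\<Sum>U\<in>Pow {..<N}. (cmod (ket w U))\<^sup>2)"
  unfolding start_def
 proof (rule run_norm)
  show "qubits (in_layer n (m^3)) \<subseteq> {..<N}" using wf_in_layer used_N by auto
  show "distinct (gate_qubits g)" if "g \<in> set (in_layer n (m^3))" for g using wf_layers_distinct[OF wf_in_layer] that by simp
 qed simp
 then have one: "mass {..<N} (start w) (%_. True) = 1" using norm_ket[OF wN[OF w]] by (simp add: mass_def Pow_def)
 have gd: "start w (V - (\<Union>j<t. tset j)) ~= 0 ==> good w V" for t V
 proof -
  assume "start w (V - (\<Union>j<t. tset j)) ~= 0"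
  then have "good w (V - (\<Union>j<t. tset j))" by (rule start(1)[OF w])
  moreover have "x \<notin> (\<Union>j<t. tset j)" if "x <= n" for x using that addr_gt by (auto simp: tset_def) (metis not_le)+
  moreover have "xcopy n i k \<notin> (\<Union>j<t. tset j)" for i k by (auto simp: tset_def)
  ultimately show "good w V" unfolding good_def by blast
 qed
 show "clean (fresh l j) (after0 w)" if "1 <= l" for l j
  unfolding S
 proof (rule ch.clean_S)
  have f: "xcopy n i k \<notin> fresh l j" "coin n i k \<notin> fresh l j" for i k
   using fresh_cases[OF _ that] by (auto simp: xcopy_def coin_def obit_def dest!: fresh_cases[OF _ that])
  show "clean (fresh l j) (start w)" by (rule start(2)[OF w]) (use f low_not_fresh that in auto)
  have "obit n 0 k \<notin> fresh l j" for k by (rule obit_not_fresh[OF that]) (use that in auto)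
  then show "tset k Int fresh l j = {}" for k using f by (auto simp: tset_def)
 qed simp
 have "t <= m^3 ==> mass {..<N} (ch.S t) (%_. True) <= 1" for t
 proof (induction t)
  case (Suc t)
  then show ?case using ch.keep[of t "%_. True"] by simp
 qed (simp add: ch.S_simps one)
 then show "mass {..<N} (after0 w) (%_. True) <= 1" unfolding S by simp
 show "U Int {..n} = w" if "after0 w U ~= 0" using gd ch.supp[OF order_refl that[unfolded S]] unfolding good_def by blast
 show "mass {..<N} (after0 w) (%U. \<forall>k<m^3. obit n 0 k \<notin> U) <= (65/100)^(m^3)" if ne: "w Int {..<n} ~= {}"
 proof -
  obtain i0 where i0: "i0 \<in> w" "i0 < n" using ne by auto
  have "mass {..<N} (ch.S (m^3)) (%U. True & (\<forall>k<m^3. obit n 0 k \<notin> U)) <= (\<Prod>k<m^3. 65/100)*mass {..<N} (start w) (%_. True)"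
  proof (rule ch.mass_conj[where Good = "good w"])
   show "(\<Sum>f\<in>Pow (tset k). if obit n 0 k \<notin> V Un f then (cmod (trial_kernel k (V Un f)))\<^sup>2 else 0) <= 65/100"
    if "k < m^3" "V \<subseteq> {..<N} - tset k" "good w V" for k V
   proof (rule trial_fail[OF i0])
    show "V Int tset k = {}" using that(2) by blast
    show "xcopy n i k \<in> V \<longleftrightarrow> i \<in> w" if "i < n" for i
     using that \<open>k < m^3\<close> \<open>good w V\<close> unfolding good_def by blast
   qed
   show "obit n 0 i \<notin> U - tset j \<longleftrightarrow> obit n 0 i \<notin> U" if "i < j" for i j U
   proof -
    have "obit n 0 i \<notin> tset j" using that by (auto simp: tset_def)
    then show ?thesis by blast
   qed
  qed ((fact gd | (rule gd; assumption) | (simp; fail) | (use gd in blast) | (use gd in fastforce))+)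
  then show ?thesis unfolding S one by simp
 qed
 show "obit n 0 k \<notin> U" if "w Int {..<n} = {}" "after0 w U ~= 0" "k < m^3" for k
 proof -
  note s = ch.supp[OF order_refl that(2)[unfolded S]]
  let ?U = "U - (\<Union>i\<in>{k<..<m^3}. tset i)"
  have T: "trial_kernel k ?U ~= 0" using s that(3) by blast
  have g: "good w U" using gd s by blast
  \<comment> \<open>A coin of an unset input never shows 1, so without set inputs the parity is 0
    with certainty.\<close>
  have nc: "coin n i k \<notin> ?U" if i: "i < n" for i
  proof -
   have "gadget_kernel (xcopy n i k) (coin n i k) V = 0 ==> trial_kernel k V = 0" for V
    using i by (auto simp: trial_kernel_def)
   then have nz: "gadget_kernel (xcopy n i k) (coin n i k) ?U ~= 0" using T by blast
   have "i \<notin> w" using \<open>w Int {..<n} = {}\<close> i by blast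
   then have x: "xcopy n i k \<notin> ?U" using g i \<open>k < m^3\<close> unfolding good_def by blast
   have z: "gadget_kernel (xcopy n i k) (coin n i k) V = 0" if "xcopy n i k \<notin> V" "coin n i k \<in> V" for V
    using that by (simp add: gadget_kernel_def)
   show ?thesis
   proof
    assume "coin n i k \<in> ?U"
    from nz z[OF x this] show False by (rule notE)
   qed
  qed
  have z: "trial_kernel k V = 0" if "!!i. i < n ==> coin n i k \<notin> V" "obit n 0 k \<in> V" for V
  proof -
   have "V Int coins k = {}" using that(1) by (auto simp: coins_def)
   then show ?thesis using that(2) by (simp add: trial_kernel_def)
  qed
  have "obit n 0 k \<notin> ?U"
  proof
   assume "obit n 0 k \<in> ?U"
   from T z[OF nc this] show False by (rule notE)
  qed
  moreover have "obit n 0 k \<notin> tset i" if "i \<in> {k<..<m^3}" for i using that by (auto simp: tset_def)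
  ultimately show ?thesis by blast
 qed
qed

definition "after l w = (if l = 0 then after0 w else run golden_angle (concat (level n m L F c l)) (if l = 1 then after0 w else
  run golden_angle (concat (level n m L F c (l - 1))) (if l = 2 then after0 w else run golden_angle (concat (level n m L F c 1)) (after0 w))))"

lemma after_simps: "after 0 w = after0 w" "after 1 w = run golden_angle (concat (level n m L F c 1)) (after 0 w)"
 "after 2 w = run golden_angle (concat (level n m L F c 2)) (after 1 w)" "after 3 w = run golden_angle (concat (level n m L F c 3)) (after 2 w)"
 by (simp_all add: after_def)

lemma final_state:
 assumes w: "w \<subseteq> {..n}"
 shows "w Int {..<n} ~= {} ==> mass {..<N} (after 3 w) (%U. obit n 3 0 \<notin> U) <= (65/100)^(m^3) + 3*real m^2 * \<delta>"
  and "w Int {..<n} = {} ==> after 3 w U ~= 0 ==> obit n 3 0 \<notin> U"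
  and "after 3 w U ~= 0 ==> U Int {..n} = w"
proof -
 have c0: "clean (fresh l j) (after 0 w)" if "1 <= l" for l j unfolding after_simps by (rule after0(1)[OF w that])
 have m0: "mass {..<N} (after 0 w) (%_. True) <= 1" unfolding after_simps by (rule after0(2)[OF w])
 have le: "1 <= (1 :: nat)" "1 <= (3 :: nat)" "1 <= (2 :: nat)" "2 <= (3 :: nat)" "3 <= (3 :: nat)" "2 <= (2 :: nat)" by simp_all
 have sub: "3 - 1 = (2 :: nat)" "3 - 2 = (1 :: nat)" "3 - 3 = (0 :: nat)" by simp_all
 note L1 = level_run[of 1 "after 0 w",OF le(1,2) c0[OF le(1)] m0,folded after_simps(2),unfolded sub]
 have c1: "clean (fresh l j) (after 1 w)" if "2 <= l" for l j
  by (rule L1(1)) (use that c0 fresh_disjoint[of 1 l] in auto)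
 note L2 = level_run[of 2 "after 1 w",OF le(3,4) c1[OF le(6)] L1(2),folded after_simps(3),unfolded sub power_one_right]
 have c2: "clean (fresh l j) (after 2 w)" if "3 <= l" for l j
  by (rule L2(1)) (use that c1 fresh_disjoint[of 2 l] in auto)
 note L3 = level_run[of 3 "after 2 w",OF le(2,5) c2[OF le(5)] L2(2),folded after_simps(4),unfolded sub power_0]
 have of: "obit n l' k \<notin> fresh l j" if "1 <= l" "l' < l" for l l' k j by (rule obit_not_fresh) (use that in auto)
 have ind: "obit n l' k \<in> U - fresh l j \<longleftrightarrow> obit n l' k \<in> U" if "1 <= l" "l' < l" for l l' k j U using of[OF that] by blast
 have indf: "fails l' k (U - fresh l j) \<longleftrightarrow> fails l' k U" if "1 <= l" "l' < l" for l l' k j U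
 proof -
  have "l' - 1 < l" using that by linarith
  then have "inputs l' k Int fresh l j = {}" unfolding inputs_def using of[OF that(1)] by blast
  then show ?thesis unfolding fails_def using of[OF that] by blast
 qed
 let ?E1 = "%U. \<forall>k<m^3. obit n 0 k \<notin> U"
 let ?E2 = "%U. ?E1 U \<or> (\<exists>j<m^2. fails 1 j U)"
 let ?E3 = "%U. ?E2 U \<or> (\<exists>j<m. fails 2 j U)"
 let ?E4 = "%U. ?E3 U \<or> (\<exists>j<1. fails 3 j U)"
 show "mass {..<N} (after 3 w) (%U. obit n 3 0 \<notin> U) <= (65/100)^(m^3) + 3*real m^2 * \<delta>" if ne: "w Int {..<n} ~= {}"
 proof -
  have 1: "mass {..<N} (after 0 w) ?E1 <= (65/100)^(m^3)" unfolding after_simps by (rule after0(4)[OF w ne])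
  have 2: "mass {..<N} (after 1 w) ?E2 <= mass {..<N} (after 0 w) ?E1 + real (m^2) * \<delta>"
   by (rule L1(3)) (simp add: ind del: Diff_iff)
  have 3: "mass {..<N} (after 2 w) ?E3 <= mass {..<N} (after 1 w) ?E2 + real m * \<delta>"
   by (rule L2(3)) (simp add: ind indf del: Diff_iff)
  have 4: "mass {..<N} (after 3 w) ?E4 <= mass {..<N} (after 2 w) ?E3 + real 1 * \<delta>"
   by (rule L3(3)) (simp add: ind indf del: Diff_iff)
  \<comment> \<open>Unless a gate fails, a set trial bit \<open>k\<close> sets the outputs
    \<open>k div m\<close>, \<open>k div m div m\<close> and finally 0 on the three levels.\<close>
  have imp: "?E4 U" if "obit n 3 0 \<notin> U" for U
  proof (rule ccontr)
   assume n: "\<not> ?E4 U"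
   then obtain k where k: "k < m^3" "obit n 0 k \<in> U" by blast
   have step: "obit n l (k div m) \<in> U" if "1 <= l" "\<not> fails l (k div m) U" "obit n (l - 1) k \<in> U" for l k
   proof -
    have "obit n (l - 1) ((k div m)*m + k mod m) \<in> inputs l (k div m)" unfolding inputs_def using m by (intro imageI) simp
    then show ?thesis using that by (auto simp: fails_def)
   qed
   have d1: "k div m < m^2" using k m by (simp add: less_mult_imp_div_less power_numeral_reduce mult.commute)
   have d2: "k div m div m < m" using d1 m by (simp add: less_mult_imp_div_less power2_eq_square)
   have d3: "k div m div m div m = 0" using d2 by simp
   have "obit n 1 (k div m) \<in> U" using step[of 1 k] n d1 k by simp
   then have "obit n 2 (k div m div m) \<in> U" using step[of 2 "k div m"] n d2 by simp
   then have "obit n 3 (k div m div m div m) \<in> U" using step[of 3 "k div m div m"] n d3 by simp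
   then show False using that d3 by simp
  qed
  have "mass {..<N} (after 3 w) (%U. obit n 3 0 \<notin> U) <= mass {..<N} (after 3 w) ?E4" by (rule mass_mono) (use imp in auto)
  moreover have "0 <= \<delta>" by (simp add: \<delta>_def)
  have "real (m^2) + real m + 1 <= 3*real m^2"
  proof -
   have "real m*1 <= real m*real m" "1*1 <= real m*real m" using m by (intro mult_mono; simp)+
   then show ?thesis by (simp add: power2_eq_square)
  qed
  then have "(real (m^2) + real m + 1) * \<delta> <= 3*real m^2 * \<delta>" using \<open>0 <= \<delta>\<close> by (intro mult_right_mono)
  ultimately show ?thesis using 1 2 3 4 by (simp add: algebra_simps)
 qed
 \<comment> \<open>The support is followed backwards: removing the fresh qubits of a level leads to
   a basis state that occurred before this level.\<close>
 have sup: "\<exists>U0 U1 U2. after 0 w U0 ~= 0 & U0 = U1 - (\<Union>j<m^2. fresh 1 j) & U1 = U2 - (\<Union>j<m. fresh 2 j) & U2 = U - (\<Union>j<1. fresh 3 j) &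
   (\<forall>j<m^2. inputs 1 j Int U1 = {} --> obit n 1 j \<notin> U1) & (\<forall>j<m. inputs 2 j Int U2 = {} --> obit n 2 j \<notin> U2) & (\<forall>j<1. inputs 3 j Int U = {} --> obit n 3 j \<notin> U)"
  if U: "after 3 w U ~= 0"
 proof -
  have a: "after 2 w (U - (\<Union>j<1. fresh 3 j)) ~= 0 & (\<forall>j<1. inputs 3 j Int U = {} --> obit n 3 j \<notin> U)" using L3(4)[OF U] by simp
  have b: "after 1 w (U - (\<Union>j<1. fresh 3 j) - (\<Union>j<m. fresh 2 j)) ~= 0 & (\<forall>j<m. inputs 2 j Int (U - (\<Union>j<1. fresh 3 j)) = {} --> obit n 2 j \<notin> U - (\<Union>j<1. fresh 3 j))"
   using L2(4)[of "U - (\<Union>j<1. fresh 3 j)"] a by simp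
  have c: "after 0 w (U - (\<Union>j<1. fresh 3 j) - (\<Union>j<m. fresh 2 j) - (\<Union>j<m^2. fresh 1 j)) ~= 0 &
    (\<forall>j<m^2. inputs 1 j Int (U - (\<Union>j<1. fresh 3 j) - (\<Union>j<m. fresh 2 j)) = {} --> obit n 1 j \<notin> U - (\<Union>j<1. fresh 3 j) - (\<Union>j<m. fresh 2 j))"
   using L1(4)[of "U - (\<Union>j<1. fresh 3 j) - (\<Union>j<m. fresh 2 j)"] b by simp
  let ?U2 = "U - (\<Union>j<1. fresh 3 j)"
  let ?U1 = "?U2 - (\<Union>j<m. fresh 2 j)"
  let ?U0 = "?U1 - (\<Union>j<m^2. fresh 1 j)"
  show ?thesis
  proof (rule exI[of _ ?U0],rule exI[of _ ?U1],rule exI[of _ ?U2],intro conjI refl)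
  qed ((rule conjunct1[OF c] conjunct2[OF c] conjunct2[OF b] conjunct2[OF a])+)
 qed
 show "U Int {..n} = w" if U: "after 3 w U ~= 0"
 proof -
  obtain U0 U1 U2 where s: "after 0 w U0 ~= 0" "U0 = U1 - (\<Union>j<m^2. fresh 1 j)" "U1 = U2 - (\<Union>j<m. fresh 2 j)" "U2 = U - (\<Union>j<1. fresh 3 j)"
   using sup[OF U] by (elim exE conjE) (rule that; assumption)
  have "U0 Int {..n} = w" using after0(3)[OF w] s(1) unfolding after_simps .
  moreover have "x \<in> U \<longleftrightarrow> x \<in> U0" if "x <= n" for x using low_not_fresh[OF _ that] unfolding s(2-4) by auto
  ultimately show ?thesis by auto
 qed
 show "obit n 3 0 \<notin> U" if e: "w Int {..<n} = {}" and U: "after 3 w U ~= 0"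
 proof -
  obtain U0 U1 U2 where s: "after 0 w U0 ~= 0" "U0 = U1 - (\<Union>j<m^2. fresh 1 j)" "U1 = U2 - (\<Union>j<m. fresh 2 j)" "U2 = U - (\<Union>j<1. fresh 3 j)"
   and i0: "\<forall>j<m^2. inputs 1 j Int U1 = {} --> obit n 1 j \<notin> U1" "\<forall>j<m. inputs 2 j Int U2 = {} --> obit n 2 j \<notin> U2"
    "\<forall>j<1. inputs 3 j Int U = {} --> obit n 3 j \<notin> U"
   using sup[OF U] by (elim exE conjE) (rule that; assumption)
  have i3: "inputs 3 0 Int U = {} ==> obit n 3 0 \<notin> U" using i0(3)[rule_format,of 0] by simp
  note i = i0(1)[rule_format] i0(2)[rule_format] i3
  have 0: "obit n 0 k \<notin> U1" if "k < m^3" for k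
  proof -
   have nf: "obit n 0 k \<notin> fresh 1 j" for j by (rule of) simp_all
   have "obit n 0 k \<notin> U0" by (rule after0(5)[OF w e s(1)[unfolded after_simps] that])
   then show ?thesis unfolding s(2) using nf by simp
  qed
  have 1: "obit n 1 j \<notin> U2" if j: "j < m^2" for j
  proof -
   have "inputs 1 j Int U1 = {}" using 0 lt_cube'[of 1 j] j by (auto simp: inputs_def)
   then have "obit n 1 j \<notin> U1" by (rule i(1)[OF j])
   then show ?thesis using of[of 2 1 j] unfolding s(3) by auto
  qed
  have 2: "obit n 2 j \<notin> U" if j: "j < m" for j
  proof -
   have "inputs 2 j Int U2 = {}" using 1 lt_cube'[of 2 j] j by (auto simp: inputs_def)
   then have "obit n 2 j \<notin> U2" by (rule i(2)[OF j])
   then show ?thesis using of[of 3 2 j] unfolding s(4) by auto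
  qed
  have "inputs 3 0 Int U = {}" using 2 by (auto simp: inputs_def)
  then show ?thesis by (rule i(3))
 qed
qed

lemma layers_wf: "wf_layers used (or_circuit_layers n m L F c)"
proof -
 have "0 < m^3" using m by simp
 then have "{obit n 3 0,n} \<subseteq> used" "obit n 3 0 ~= n" using in_used(3)[of 3 0] in_used(4)[of n] addr_gt(3)[of 3 0] by auto
 then show ?thesis unfolding or_circuit_layers_def using wf_in_layer trials_wf level_layers(1)[of 1] level_layers(1)[of 2] level_layers(1)[of 3] by simp
qed

lemma valid_or_circuit: "valid_circuit n (or_circuit n m L F c)"
proof -
 have "wf_layers {..<N} (or_circuit_layers n m L F c)" by (rule wf_layers_mono[OF layers_wf used_N])
 moreover have "n + 1 <= N" by (simp add: or_circuit_def anc_def)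
 ultimately show ?thesis by (auto simp: valid_circuit_def valid_layer_def wf_layers_def qubits_def or_circuit_def)
qed

text \<open>One fan-out layer, 16 layers of trials, three levels of 91 layers each, and the final
  controlled-not.\<close>

lemma depth_or_circuit: "depth (or_circuit n m L F c) = 291"
 by (simp add: depth_def or_circuit_def or_circuit_layers_def level_def)

text \<open>A layer touches each used qubit at most once, so the size of a layer is at most the
  number of used qubits.\<close>

lemma size_or_circuit: "circuit_size (or_circuit n m L F c) <= 291*card used"
proof -
 have fin: "finite used" using used_N finite_subset by blast
 have "wf_layers used Ls ==> (\<Sum>g\<leftarrow>concat Ls. length (gate_qubits g)) <= length Ls*card used" for Ls
 proof (induction Ls)
  case (Cons X Ls)
  have d: "distinct (concat (map gate_qubits X))" using Cons.prems by simp
  have "(\<Sum>g\<leftarrow>X. length (gate_qubits g)) = length (concat (map gate_qubits X))" by (simp add: length_concat comp_def)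
  also have "... = card (set (concat (map gate_qubits X)))" by (rule distinct_card[OF d,symmetric])
  also have "... <= card used" using Cons.prems fin unfolding qubits_def[symmetric] by (intro card_mono) auto
  finally show ?case using Cons by simp
 qed simp
 from this[OF layers_wf] show ?thesis using depth_or_circuit by (simp add: circuit_size_def depth_def or_circuit_def)
qed

lemma outcome:
 assumes w: "w \<subseteq> {..n}"
 shows "\<not> or_fun n (w Int {..<n}) ==> outcome_prob golden_angle (or_circuit n m L F c) n w (xor_value or_fun n w) = 1"
  and "or_fun n (w Int {..<n}) ==> outcome_prob golden_angle (or_circuit n m L F c) n w (xor_value or_fun n w) \<ge> 1 - ((65/100)^(m^3) + 3*real m^2 * \<delta>)"
proof -
 let ?b = "obit n 3 0"
 have bn: "n < ?b" by (rule addr_gt)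
 have wN': "w \<subseteq> {..<N}" by (rule wN[OF w])
 define pre where "pre = concat ([in_layer n (m^3)] @ par 16 (trial n) [0..<m^3] @ level n m L F c 1 @ level n m L F c 2 @ level n m L F c 3)"
 have pre: "run golden_angle pre (ket w) = after 3 w" unfolding pre_def after_simps after0_def start_def by simp
 have wfp: "wf_layers used ([in_layer n (m^3)] @ par 16 (trial n) [0..<m^3] @ level n m L F c 1 @ level n m L F c 2 @ level n m L F c 3)"
  using layers_wf unfolding or_circuit_layers_def by simp
 have "(\<Sum>U\<in>Pow {..<N}. (cmod (run golden_angle pre (ket w) U))\<^sup>2) = (\<Sum>U\<in>Pow {..<N}. (cmod (ket w U))\<^sup>2)"
 proof (rule run_norm)
  show "qubits pre \<subseteq> {..<N}" unfolding pre_def using wf_layers_qubits[OF wfp] used_N by blast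
  show "distinct (gate_qubits g)" if "g \<in> set pre" for g using wf_layers_distinct[OF wfp] that unfolding pre_def by blast
 qed simp
 then have tot: "(\<Sum>U\<in>Pow {..<N}. (cmod (after 3 w U))\<^sup>2) = 1" unfolding pre using norm_ket[OF wN'] by simp
 \<comment> \<open>The last controlled-not only permutes basis states; an outcome after it has the
   mass of the permuted event before it.\<close>
 define \<pi> where "\<pi> U = (if ?b \<in> U then sym_diff U {n} else U)" for U
 have run: "run_circuit golden_angle (or_circuit n m L F c) (ket w) = (%U. after 3 w (\<pi> U))"
 proof -
  have "concat (layers (or_circuit n m L F c)) = pre @ [CNot ?b n]" by (simp add: or_circuit_def or_circuit_layers_def pre_def)
  then show ?thesis by (simp only: run_circuit_def fold_append fold_simps comp_def pre apply_gate.simps \<pi>_def)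
 qed
 have pp: "\<pi> (\<pi> U) = U" for U using bn by (auto simp: \<pi>_def)
 have "n < N" using used_N in_used(4)[of n] by auto
 then have pM: "U \<subseteq> {..<N} ==> \<pi> U \<subseteq> {..<N}" for U by (auto simp: \<pi>_def)
 define X where "X = xor_value or_fun n w"
 have out: "outcome_prob golden_angle (or_circuit n m L F c) n w X = mass {..<N} (after 3 w) (%U. \<pi> U Int {..n} = X)"
  unfolding outcome_prob_def mass_def run
  by (rule sum.reindex_bij_witness[of _ \<pi> \<pi>]) (use pp pM in auto)
 have or: "or_fun n (w Int {..<n}) \<longleftrightarrow> w Int {..<n} ~= {}" by (simp add: or_fun_def card_gt_0_iff)
 have low: "\<pi> U Int {..n} = (if ?b \<in> U then sym_diff w {n} else w)" if "after 3 w U ~= 0" for U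
  using final_state(3)[OF w that] by (auto simp: \<pi>_def)
 have tm: "mass {..<N} (after 3 w) (%_. True) = 1" using tot by (simp add: mass_def Pow_def)
 show "outcome_prob golden_angle (or_circuit n m L F c) n w (xor_value or_fun n w) = 1" if no: "\<not> or_fun n (w Int {..<n})"
 proof -
  have "mass {..<N} (after 3 w) (%_. True) <= mass {..<N} (after 3 w) (%U. \<pi> U Int {..n} = X)"
   by (rule mass_mono) (use low final_state(2)[OF w] no or in \<open>auto simp: X_def xor_value_def\<close>)
  moreover have "mass {..<N} (after 3 w) (%U. \<pi> U Int {..n} = X) <= mass {..<N} (after 3 w) (%_. True)" by (rule mass_mono) auto
  ultimately show ?thesis using tm out by (simp add: X_def)
 qed
 show "outcome_prob golden_angle (or_circuit n m L F c) n w (xor_value or_fun n w) \<ge> 1 - ((65/100)^(m^3) + 3*real m^2 * \<delta>)" if yes: "or_fun n (w Int {..<n})"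
 proof -
  have "mass {..<N} (after 3 w) (%_. True) <= mass {..<N} (after 3 w) (%U. \<pi> U Int {..n} = X \<or> ?b \<notin> U)"
   by (rule mass_mono) (use low yes in \<open>auto simp: X_def xor_value_def\<close>)
  also have "... <= mass {..<N} (after 3 w) (%U. \<pi> U Int {..n} = X) + mass {..<N} (after 3 w) (%U. ?b \<notin> U)" by (rule mass_disj) simp
  finally have "1 <= outcome_prob golden_angle (or_circuit n m L F c) n w X + mass {..<N} (after 3 w) (%U. ?b \<notin> U)" unfolding tm out .
  moreover have "w Int {..<n} ~= {}" using yes or by blast
  moreover have "1 <= p + b ==> b <= e ==> 1 - e <= p" for p b e :: real by linarith
  ultimately show ?thesis using final_state(1)[OF w] unfolding X_def by blast
 qed
qed

end

section \<open>The orbit of the angle under doubling and the choice of parameters\<close>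

definition zz :: "nat => real" where "zz j = 2 - 2*cos (2^j*golden_angle)"

lemma zz_0: "zz 0 = 3 - sqrt 5" by (simp add: zz_def cos_golden field_simps)

text \<open>Doubling the angle acts on the squared distance of \<open>gph^(2^j)\<close> from 1 as a
  logistic map. When \<open>c\<close> is a power of two, the \<open>z\<close> of an or gate is a
  point of this orbit.\<close>

lemma zz_Suc: "zz (Suc j) = zz j*(4 - zz j)"
proof -
 have "cos (2^Suc j*golden_angle) = 2*(cos (2^j*golden_angle))\<^sup>2 - 1"
  using cos_double_cos[of "2^j*golden_angle"] by (simp add: mult.assoc)
 then show ?thesis by (simp add: zz_def power2_eq_square algebra_simps)
qed

lemma zz_bounds: "0 <= zz j" "zz j <= 4"
 using cos_le_one[of "2^j*golden_angle"] cos_ge_minus_one[of "2^j*golden_angle"] unfolding zz_def by linarith+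

lemma zz_cis: "zz j = (cmod (gph^(2^j) - 1))\<^sup>2"
proof -
 have "gph^(2^j) = cis (2^j*golden_angle)" by (simp add: Complex.DeMoivre)
 moreover have "(cmod (cis x - 1))\<^sup>2 = 2 - 2*cos x" for x
  using sin_cos_squared_add[of x] unfolding cmod_power2 by (simp add: power2_eq_square algebra_simps)
 ultimately show ?thesis by (simp add: zz_def)
qed

text \<open>The orbit in fixed-point arithmetic with denominator \<open>P\<close>, which lets a
  program find suitable indices.\<close>

fun approx :: "nat => nat => nat => nat" where
 "approx P z0 0 = z0"
| "approx P z0 (Suc j) = approx P z0 j*(4*P - approx P z0 j) div P"

text \<open>By \<open>(x - 2*P)^2 \<ge> 0\<close>. The bound keeps the subtraction
  \<open>4*P - x\<close> from being truncated.\<close>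

lemma approx_le: "0 < P ==> z0 <= 4*P ==> approx P z0 j <= 4*P"
proof (induction j)
 case (Suc j)
 let ?a = "approx P z0 j"
 have "int ?a*(4*int P - int ?a) <= 4*int P*int P"
  using zero_le_power2[of "int ?a - 2*int P"] by (simp add: power2_eq_square algebra_simps)
 then have "int (?a*(4*P - ?a)) <= int (4*P*P)" using Suc by (simp add: of_nat_diff)
 then have "?a*(4*P - ?a) <= (4*P)*P" by linarith
 then have "?a*(4*P - ?a) div P <= (4*P)*P div P" by (rule div_le_mono)
 then show ?case using Suc.prems by simp
qed simp

text \<open>The map has slope at most 4 in modulus between 0 and 4, and rounding adds
  \<open>1/P\<close>. The term \<open>1/(3*P)\<close> is chosen to reproduce itself: 1 - 4/3 =
  -1/3.\<close>

lemma approx_error: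
 assumes P: "0 < P" "z0 <= 4*P" and z0: "\<bar>real z0/real P - zz 0\<bar> <= 1/real P"
 shows "\<bar>real (approx P z0 j)/real P - zz j\<bar> <= 2*4^j/real P - 1/(3*real P)"
proof (induction j)
 case 0
 have "1/real P <= 2/real P - 1/(3*real P)" using P by (simp add: field_simps)
 then show ?case using z0 by simp
next
 case (Suc j)
 let ?Z = "approx P z0 j"
 define a where "a = real ?Z/real P"
 have Z: "?Z <= 4*P" by (rule approx_le[OF P])
 have aP: "real ?Z = a*real P" using P by (simp add: a_def)
 have a: "0 <= a" "a <= 4" using Z P unfolding a_def by (simp_all add: divide_le_eq flip: of_nat_mult of_nat_le_iff)
 define X where "X = ?Z*(4*P - ?Z)"
 have rX: "real X/real P/real P = a*(4 - a)" unfolding X_def using Z P by (simp add: of_nat_diff aP field_simps)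
 have q1: "real (X div P) <= real X/real P" by (rule of_nat_div_le_of_nat)
 have "real X/real P < real (X div P) + 1"
 proof -
  have "X < (X div P + 1)*P" using P by (metis Suc_eq_plus1 div_less_iff_less_mult lessI)
  then have "real X < real ((X div P + 1)*P)" by (simp only: of_nat_less_iff)
  then show ?thesis using P by (simp add: divide_less_eq algebra_simps)
 qed
 then have q2: "\<bar>real (X div P) - real X/real P\<bar> <= 1" using q1 by simp
 have 1: "\<bar>real (X div P)/real P - a*(4 - a)\<bar> <= 1/real P"
 proof -
  have "real (X div P)/real P - a*(4 - a) = (real (X div P) - real X/real P)/real P"
   unfolding rX[symmetric] by (simp add: diff_divide_distrib)
  then show ?thesis using q2 P by (simp add: abs_divide divide_right_mono)
 qed
 have "\<bar>a*(4 - a) - zz j*(4 - zz j)\<bar> = \<bar>a - zz j\<bar> * \<bar>4 - a - zz j\<bar>"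
  by (simp add: algebra_simps flip: abs_mult)
 also have "... <= \<bar>a - zz j\<bar>*4" using a zz_bounds[of j] by (intro mult_left_mono) auto
 also have "... <= (2*4^j/real P - 1/(3*real P))*4" using Suc by (simp add: a_def)
 finally have "\<bar>real (X div P)/real P - zz (Suc j)\<bar> <= 1/real P + (2*4^j/real P - 1/(3*real P))*4"
  using 1 unfolding zz_Suc by linarith
 also have "... = 2*4^Suc j/real P - 1/(3*real P)" using P by (simp add: field_simps)
 finally show ?case by (simp add: X_def)
qed

lemma zz_grow: "zz j <= 2 ==> 2*zz j <= zz (Suc j)"
proof -
 assume "zz j <= 2"
 then have "zz j*2 <= zz j*(4 - zz j)" using zz_bounds[of j] by (intro mult_left_mono) auto
 then show ?thesis by (simp add: zz_Suc)
qed

text \<open>A value between 2 and 2 + 1/10 is followed by one of at least 38/10, so all values but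
  the last are at most 2, and from such values each step at least doubles. The margin 1/10 leaves
  room for the approximation.\<close>

lemma small_run:
 assumes "!!j. j < J ==> zz (h + j) < 2 + 1/10" "1 <= J"
 shows "zz h*2^(J - 1) <= 2 + 1/10"
proof -
 have s: "zz (h + j) <= 2" if "j + 1 < J" for j
 proof (rule ccontr)
  assume "\<not> zz (h + j) <= 2"
  then have z: "2 < zz (h + j)" "zz (h + j) < 2 + 1/10" using assms(1)[of j] that by auto
  then have "zz (h + j)*(4 - zz (h + j)) \<ge> 2*(19/10)" by (intro mult_mono) auto
  then have "zz (h + Suc j) \<ge> 2*(19/10)" by (simp add: zz_Suc)
  moreover have "zz (h + Suc j) < 2 + 1/10" using assms(1)[of "Suc j"] that by simp
  ultimately show False by simp
 qed
 have "i < J ==> zz h*2^i <= zz (h + i)" for i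
 proof (induction i)
  case (Suc i)
  then show ?case using zz_grow[of "h + i"] s[of i] by simp
 qed simp
 from this[of "J - 1"] show ?thesis using assms(1)[of "J - 1"] assms(2) by simp
qed

text \<open>Read backwards, a small value of the logistic map comes from a value at most half as
  large or from one close to 4; values close to 4 are as welcome as what was sought.\<close>

lemma descend:
 assumes "zz (j0 + k) <= \<tau>" "\<tau> <= 2 * \<eta>" "0 < \<eta>"
 shows "(\<exists>i<k. 4 - zz (j0 + i) <= \<eta>) \<or> zz j0*2^k <= \<tau>"
 using assms(1,2)
proof (induction k arbitrary: \<tau>)
 case (Suc k)
 have Z: "zz (Suc (j0 + k)) = zz (j0 + k)*(4 - zz (j0 + k))" by (rule zz_Suc)
 show ?case
 proof (cases "zz (j0 + k) <= 2")
  case True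
  then have "zz (j0 + k) <= \<tau>/2" using zz_grow[OF True] Suc.prems by simp
  moreover have "\<tau>/2 <= 2 * \<eta>" using Suc.prems assms(3) by simp
  ultimately have "(\<exists>i<k. 4 - zz (j0 + i) <= \<eta>) \<or> zz j0*2^k <= \<tau>/2" by (rule Suc.IH)
  then show ?thesis by (auto simp: less_Suc_eq)
 next
  case False
  have "2*(4 - zz (j0 + k)) <= zz (j0 + k)*(4 - zz (j0 + k))" using False zz_bounds[of "j0 + k"] by (intro mult_right_mono) auto
  then have "4 - zz (j0 + k) <= \<eta>" using Z Suc.prems by simp
  then show ?thesis by blast
 qed
qed simp

text \<open>The integer part of the binary logarithm, written as a bounded count because programs
  can evaluate this form; \<open>ll 0 = 0\<close>.\<close>

definition ll :: "nat => nat" where "ll n = (\<Sum>u<n. of_bool (2^Suc u <= n))"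

lemma ll: "1 <= n ==> 2^ll n <= n & n < 2^Suc (ll n)"
proof -
 assume "1 <= n"
 then obtain l where l: "2^l <= n" "n < 2^(l + 1)" using ex_power_ivl1[of 2 n] by auto
 have "{u. u < n & 2^Suc u <= n} = {..<l}"
 proof (rule Set.set_eqI)
  fix u
  have "2^Suc u <= n \<longleftrightarrow> u < l"
  proof
   assume "2^Suc u <= n"
   then have "(2 :: nat)^Suc u < 2^(l + 1)" using l(2) by linarith
   then have "Suc u < l + 1" by (rule power_less_imp_less_exp[rotated]) simp
   then show "u < l" by simp
  next
   assume "u < l"
   then have "(2 :: nat)^Suc u <= 2^l" by (intro power_increasing) auto
   then show "2^Suc u <= n" using l(1) by linarith
  qed
  moreover have "u < 2^Suc u" using less_exp[of "Suc u"] by linarith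
  ultimately show "u \<in> {u. u < n & 2^Suc u <= n} \<longleftrightarrow> u \<in> {..<l}" by fastforce
 qed
 then have "ll n = l" by (simp add: ll_def of_bool_def sum.If_cases Int_def)
 then show ?thesis using l by simp
qed

text \<open>The fan-in, about the cube root of four times the binary logarithm of \<open>n\<close>.
  So \<open>m^3\<close> trials push their error below 1/(2n), while \<open>m^2\<close> is of smaller
  order than the logarithm, as the measure \<open>exp(- K*j^2)\<close> at \<open>j = m + 3\<close>
  requires.\<close>

definition mm :: "nat => nat" where "mm n = search (ll n + 4) (%k. 4*(ll n + 2) <= k^3)"

lemma mm: "4*(ll n + 2) <= mm n^3" "mm n <= ll n + 4" "2 <= mm n" "(mm n - 1)^3 < 4*(ll n + 2)"
proof -
 have "4*(ll n + 2) <= (ll n + 4)^3"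
 proof -
  have "4*(ll n + 2) <= (ll n + 4)*(ll n + 4)" by (simp add: algebra_simps)
  also have "... <= (ll n + 4)*(ll n + 4)*(ll n + 4)" by simp
  finally show ?thesis by (simp add: power3_eq_cube)
 qed
 from search_props[of "%k. 4*(ll n + 2) <= k^3",OF this order_refl]
 show 1: "4*(ll n + 2) <= mm n^3" and 2: "mm n <= ll n + 4" by (simp_all add: mm_def)
 have "mm n ~= 0" "mm n ~= 1" using 1 by (auto intro: gr0I)
 then show 3: "2 <= mm n" by simp
 show "(mm n - 1)^3 < 4*(ll n + 2)"
 proof (rule ccontr)
  assume "\<not> ?thesis"
  then have "4*(ll n + 2) <= (mm n - 1)^3" by simp
  moreover have "mm n - 1 <= ll n + 4" using 2 by simp
  ultimately have "mm n <= mm n - 1" using search_props[of "%k. 4*(ll n + 2) <= k^3" "mm n - 1" "ll n + 4"] unfolding mm_def[symmetric] by blast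
  then show False using 3 by simp
 qed
qed

text \<open>The number of selector bits: rounding the fraction \<open>F/2^L\<close> leaves a failure
  amplitude of order \<open>1/2^LA\<close>, and \<open>3*m^2\<close> times its square must stay
  below 1/(2n).\<close>

definition "LA n = ll n div 2 + mm n"
definition "hA n = mm n + LA n + 1"
definition "JJ n = ll n div 2 + 2*mm n"
text \<open>The precision: errors grow fourfold in each of up to \<open>hA n + JJ n\<close> steps,
  which the twelfth power absorbs.\<close>

definition "PP n = (n + 2 :: nat)^12"
definition "sq5 n = search (3*PP n) (%w. 5*PP n^2 <= w^2)"
definition "ZZ n j = approx (PP n) (3*PP n - sq5 n) j"
text \<open>For \<open>z \<ge> 2\<close> some \<open>F \<le> 2^L\<close> solves
  \<open>F*z^2 = 4*2^L\<close> up to rounding. Such a \<open>z\<close> is sought among the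
  multipliers \<open>c = 2^i\<close> with \<open>i < JJ n\<close>.\<close>

definition "caseA n \<longleftrightarrow> (\<exists>i<JJ n. 2*PP n <= ZZ n (hA n + i))"
definition "iA n = search (JJ n) (%i. 2*PP n <= ZZ n (hA n + i))"
text \<open>The other way to succeed is \<open>z\<close> close to 4 with \<open>F/2^L = 1/4\<close>.
  Taking \<open>F = 2^i\<close> and \<open>L = i + 2\<close> gives \<open>h = m + 3 + i\<close>, so
  that with \<open>c = 1\<close> the index \<open>i\<close> itself moves along the orbit.\<close>

definition "iB n = search (hA n - (mm n + 3)) (%i. (4*PP n - ZZ n (mm n + 3 + i))*2^LA n <= 8*PP n)"

lemma PP_pos: "0 < PP n" by (simp add: PP_def)

text \<open>\<open>sq5 n\<close> is \<open>sqrt 5*PP n\<close> rounded up, so the starting value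
  \<open>3 - sqrt 5\<close> is met up to \<open>1/PP n\<close>.\<close>

lemma start_error: "\<bar>real (3*PP n - sq5 n)/real (PP n) - zz 0\<bar> <= 1/real (PP n)" and start_le: "3*PP n - sq5 n <= 4*PP n"
proof -
 let ?P = "real (PP n)"
 have P: "0 < ?P" using PP_pos by simp
 have "5*PP n^2 <= (3*PP n)^2" by (simp add: power_mult_distrib)
 from search_props[of "%w. 5*PP n^2 <= w^2",OF this order_refl]
 have 1: "5*PP n^2 <= sq5 n^2" "sq5 n <= 3*PP n" by (simp_all add: sq5_def)
 have "sq5 n ~= 0"
 proof
  assume "sq5 n = 0"
  then show False using 1(1) PP_pos[of n] by simp
 qed
 have 2: "(sq5 n - 1)^2 < 5*PP n^2"
 proof (rule ccontr)
  assume "\<not> ?thesis"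
  then have "5*PP n^2 <= (sq5 n - 1)^2" by simp
  moreover have "sq5 n - 1 <= 3*PP n" using 1(2) by simp
  ultimately have "sq5 n <= sq5 n - 1" using search_props[of "%w. 5*PP n^2 <= w^2" "sq5 n - 1" "3*PP n"] unfolding sq5_def[symmetric] by blast
  then show False using \<open>sq5 n ~= 0\<close> by simp
 qed
 have s: "(sqrt 5*?P)\<^sup>2 = 5*?P^2" by (simp add: power_mult_distrib)
 have "real (5*PP n^2) <= real (sq5 n^2)" using 1(1) by (simp only: of_nat_le_iff)
 then have "(sqrt 5*?P)\<^sup>2 <= (real (sq5 n))\<^sup>2" unfolding s by simp
 then have a: "sqrt 5*?P <= real (sq5 n)" by (rule power2_le_imp_le) simp
 have "real ((sq5 n - 1)^2) < real (5*PP n^2)" using 2 by (simp only: of_nat_less_iff)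
 then have "(real (sq5 n - 1))\<^sup>2 < (sqrt 5*?P)\<^sup>2" unfolding s by (simp only: of_nat_power of_nat_mult of_nat_numeral)
 then have "real (sq5 n - 1) < sqrt 5*?P" by (rule power2_less_imp_less) (use P in simp)
 then have b: "real (sq5 n) <= sqrt 5*?P + 1" using \<open>sq5 n ~= 0\<close> by (simp add: of_nat_diff)
 have "real (3*PP n - sq5 n)/?P - zz 0 = (sqrt 5*?P - real (sq5 n))/?P"
  using 1(2) P by (simp add: of_nat_diff zz_0 field_simps)
 moreover have "\<bar>sqrt 5*?P - real (sq5 n)\<bar> <= 1" using a b by simp
 ultimately show "\<bar>real (3*PP n - sq5 n)/?P - zz 0\<bar> <= 1/?P" using P by (simp add: abs_divide divide_right_mono)
 show "3*PP n - sq5 n <= 4*PP n" by simp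
qed

lemma ZZ_le: "ZZ n j <= 4*PP n"
 unfolding ZZ_def by (rule approx_le[OF PP_pos start_le])

text \<open>The precision suffices for all indices that are ever inspected.\<close>
lemma ZZ_error:
 assumes "1 <= n" "j <= hA n + JJ n"
 shows "\<bar>real (ZZ n j)/real (PP n) - zz j\<bar> <= 2*4^(hA n + JJ n)/real (PP n)"
proof -
 have "\<bar>real (ZZ n j)/real (PP n) - zz j\<bar> <= 2*4^j/real (PP n) - 1/(3*real (PP n))"
  unfolding ZZ_def by (rule approx_error[OF PP_pos start_le start_error])
 also have "... <= 2*4^j/real (PP n)" by simp
 also have "... <= 2*4^(hA n + JJ n)/real (PP n)" using assms(2) by (intro divide_right_mono mult_left_mono power_increasing) auto
 finally show ?thesis .
qed

definition gate_error :: "nat => nat => nat => nat => real" where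
 "gate_error m L F c = (1 - real F*(2 - 2*cos (real (c*2^(m + L + 1))*golden_angle))\<^sup>2/(4*2^L))\<^sup>2"

lemma square_le: "\<bar>x\<bar> <= y ==> x\<^sup>2 <= (y :: real)\<^sup>2"
 by (metis abs_ge_zero power2_abs power_mono)

text \<open>Rounding \<open>F\<close> down loses at most \<open>a^2 \<le> 16\<close> of
  \<open>4*2^L\<close>, and passing from the approximation \<open>a\<close> to the true
  \<open>z\<close> costs at most 2 more; 20 over \<open>4*2^L\<close> gives the bound.\<close>

lemma gate_error_A:
 assumes n: "1 <= n" and A: "caseA n" and \<epsilon>: "4*(2*4^(hA n + JJ n)/real (PP n)) <= 1/2^LA n"
 defines "Z \<equiv> ZZ n (hA n + iA n)"
 shows "4*2^LA n*PP n^2 div Z^2 <= 2^LA n"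
  and "gate_error (mm n) (LA n) (4*2^LA n*PP n^2 div Z^2) (2^iA n) <= (5/2^LA n)\<^sup>2"
proof -
 let ?P = "real (PP n)"
 have P: "0 < PP n" by (rule PP_pos)
 obtain i where i: "i < JJ n" "2*PP n <= ZZ n (hA n + i)" using A by (auto simp: caseA_def)
 have I: "2*PP n <= Z" "iA n <= i"
  using search_props[of "%i. 2*PP n <= ZZ n (hA n + i)" i "JJ n"] i by (simp_all add: iA_def Z_def)
 define a where "a = real Z/?P"
 define F where "F = 4*2^LA n*PP n^2 div Z^2"
 have "4*PP n^2 <= Z^2" using power_mono[OF I(1),of 2] by (simp add: power_mult_distrib)
 then have "2^LA n*(4*PP n^2) <= 2^LA n*Z^2" by (intro mult_left_mono) auto
 then have "4*2^LA n*PP n^2 <= 2^LA n*Z^2" by (simp add: mult_ac)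
 then have "4*2^LA n*PP n^2 div Z^2 <= 2^LA n*Z^2 div Z^2" by (rule div_le_mono)
 also have "... = 2^LA n" using I(1) P by simp
 finally show FL: "4*2^LA n*PP n^2 div Z^2 <= 2^LA n" .
 have Zp: "0 < real Z^2" using I(1) P by simp
 have aP: "real Z = a*?P" using P by (simp add: a_def)
 have a: "2 <= a" "a <= 4" using I(1) ZZ_le[of n "hA n + iA n"] P unfolding a_def Z_def[symmetric]
  by (simp_all add: le_divide_eq divide_le_eq flip: of_nat_mult of_nat_le_iff)
 have "F*Z^2 <= 4*2^LA n*PP n^2" unfolding F_def by (rule div_times_less_eq_dividend)
 then have "real (F*Z^2) <= real (4*2^LA n*PP n^2)" by (simp only: of_nat_le_iff)
 then have "real F*(a*?P)^2 <= 4*2^LA n*?P^2" by (simp add: aP)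
 then have u: "real F*a^2 <= 4*2^LA n" using P by (simp add: power_mult_distrib flip: mult.assoc)
 have "4*2^LA n*PP n^2 < (F + 1)*Z^2" 
 proof -
  have "0 < Z^2" using I(1) P by simp
  then have "4*2^LA n*PP n^2 < Z^2 + F*Z^2" unfolding F_def by (rule dividend_less_div_times)
  then show ?thesis by (simp add: algebra_simps)
 qed
 then have "real (4*2^LA n*PP n^2) < real ((F + 1)*Z^2)" by (simp only: of_nat_less_iff)
 then have "4*2^LA n*?P^2 < (real F + 1)*(a*?P)^2" by (simp add: aP algebra_simps)
 then have "4*2^LA n < (real F + 1)*a^2" using P by (simp add: power_mult_distrib flip: mult.assoc)
 moreover have "a^2 <= 16" using power_mono[of a 4 2] a by simp
 ultimately have l: "4*2^LA n - 16 < real F*a^2" by (simp add: algebra_simps)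
 define z where "z = zz (hA n + iA n)"
 have err: "\<bar>a - z\<bar> <= 1/(4*2^LA n)"
  using ZZ_error[OF n,of "hA n + iA n"] I(2) i(1) \<epsilon> unfolding a_def Z_def z_def by simp
 have "\<bar>a^2 - z^2\<bar> = \<bar>a - z\<bar> * \<bar>a + z\<bar>" by (simp add: power2_eq_square algebra_simps flip: abs_mult)
 also have "... <= 1/(4*2^LA n)*8" using err a zz_bounds[of "hA n + iA n"] by (intro mult_mono) (auto simp: z_def)
 finally have sq: "\<bar>a^2 - z^2\<bar> <= 2/2^LA n" by simp
 have F2: "real F <= 2^LA n" 
 proof -
  have "real F <= real (2^LA n)" using FL unfolding F_def[symmetric] by (simp only: of_nat_le_iff)
  then show ?thesis by simp
 qed
 have "\<bar>real F*a^2 - real F*z^2\<bar> = real F * \<bar>a^2 - z^2\<bar>" by (simp add: abs_mult flip: right_diff_distrib)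
 also have "... <= 2^LA n*(2/2^LA n)" using F2 sq by (intro mult_mono) auto
 finally have "\<bar>real F*a^2 - real F*z^2\<bar> <= 2" by simp
 then have "\<bar>4*2^LA n - real F*z^2\<bar> <= 20" using u l by linarith
 then have "\<bar>4*2^LA n - real F*z^2\<bar>/(4*2^LA n) <= 20/(4*2^LA n)" by (rule divide_right_mono) simp
 moreover have eq: "1 - real F*z^2/(4*2^LA n) = (4*2^LA n - real F*z^2)/(4*2^LA n)" by (simp add: field_simps)
 moreover have "\<bar>(4*2^LA n - real F*z^2)/(4*2^LA n)\<bar> = \<bar>4*2^LA n - real F*z^2\<bar>/(4*2^LA n)" by (simp add: abs_divide)
 ultimately have "\<bar>1 - real F*z^2/(4*2^LA n)\<bar> <= 20/(4*2^LA n)" by simp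
 then have e: "\<bar>1 - real F*z^2/(4*2^LA n)\<bar> <= 5/2^LA n" by simp
 have "real (2^iA n*2^(mm n + LA n + 1)) = 2^(hA n + iA n)" by (simp add: hA_def power_add)
 then have ge: "gate_error (mm n) (LA n) F (2^iA n) = (1 - real F*z^2/(4*2^LA n))\<^sup>2"
  unfolding gate_error_def z_def zz_def by simp
 show "gate_error (mm n) (LA n) (4*2^LA n*PP n^2 div Z^2) (2^iA n) <= (5/2^LA n)\<^sup>2"
  unfolding F_def[symmetric] ge by (rule square_le[OF e])
qed

text \<open>Outside case A the orbit stays low for \<open>JJ n\<close> steps from
  \<open>hA n\<close> on, so \<open>zz (hA n)\<close> is tiny. The descent from there to
  \<open>m + 3\<close> meets a value close to 4, since otherwise \<open>zz (m + 3)\<close> would be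
  smaller than \<open>meas\<close> allows.\<close>

lemma gate_error_B:
 assumes n: "1 <= n" and A: "\<not> caseA n" and \<epsilon>: "4*(2*4^(hA n + JJ n)/real (PP n)) <= 1/2^LA n"
  and big: "(3 :: real)/2^(ll n div 2 + 2*mm n - 1)*2^LA n <= 7" and meas: "3/2^(JJ n - 1) < zz (mm n + 3)*2^(hA n - (mm n + 3))"
  and mm4: "4 <= mm n"
 shows "gate_error (mm n) (iB n + 2) (2^iB n) 1 <= (5/2^LA n)\<^sup>2" "iB n < hA n - (mm n + 3)"
proof -
 let ?P = "real (PP n)"
 have P: "0 < PP n" by (rule PP_pos)
 have LA1: "(1 :: real) <= 2^LA n" by simp
 have e1: "2*4^(hA n + JJ n)/?P <= 1/(4*2^LA n)" using \<epsilon> by simp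
 also have "... <= 1/10"
 proof -
  have "(2 :: real)^4 <= 2^LA n" using mm4 by (intro power_increasing) (auto simp: LA_def)
  then show ?thesis by (intro divide_left_mono) auto
 qed
 finally have e2: "2*4^(hA n + JJ n)/?P <= 1/10" .
 have "zz (hA n + j) < 2 + 1/10" if "j < JJ n" for j
 proof -
  have "ZZ n (hA n + j) < 2*PP n" using A that by (auto simp: caseA_def not_le)
  then have "real (ZZ n (hA n + j))/?P < 2" using P by (simp add: divide_less_eq flip: of_nat_mult of_nat_less_iff)
  then show ?thesis using ZZ_error[OF n,of "hA n + j"] that e2 by linarith
 qed
 then have "zz (hA n)*2^(JJ n - 1) <= 2 + 1/10" by (rule small_run) (use mm4 in \<open>auto simp: JJ_def\<close>)
 then have "zz (hA n)*2^(JJ n - 1) <= 3" by simp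
 then have t: "zz (hA n) <= 3/2^(JJ n - 1)" by (simp add: le_divide_eq)
 have hk: "mm n + 3 + (hA n - (mm n + 3)) = hA n" using mm4 by (simp add: hA_def LA_def)
 have "\<tau> <= 2*(7/2^LA n)" if "\<tau> = 3/2^(JJ n - 1)" for \<tau> :: real
 proof -
  have "\<tau>*2^LA n <= 7" using big that by (simp add: JJ_def)
  then have "\<tau> <= 7/2^LA n" by (simp add: le_divide_eq)
  then show ?thesis by (simp add: field_simps)
 qed
 from descend[of "mm n + 3" "hA n - (mm n + 3)" "3/2^(JJ n - 1)" "7/2^LA n",unfolded hk,OF t this[OF refl]] meas
 obtain i where i: "i < hA n - (mm n + 3)" "4 - zz (mm n + 3 + i) <= 7/2^LA n" by auto
 have er: "\<bar>real (ZZ n (mm n + 3 + i))/?P - zz (mm n + 3 + i)\<bar> <= 1/(4*2^LA n)" if "i <= hA n - (mm n + 3)" for i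
  using ZZ_error[OF n,of "mm n + 3 + i"] that e1 hk by (simp add: JJ_def)
 have test: "(4*PP n - ZZ n (mm n + 3 + i))*2^LA n <= 8*PP n \<longleftrightarrow> 4 - real (ZZ n (mm n + 3 + i))/?P <= 8/2^LA n" for i
 proof -
  have "(4*PP n - ZZ n (mm n + 3 + i))*2^LA n <= 8*PP n \<longleftrightarrow> real ((4*PP n - ZZ n (mm n + 3 + i))*2^LA n) <= real (8*PP n)" by (simp only: of_nat_le_iff)
  also have "... \<longleftrightarrow> (4*?P - real (ZZ n (mm n + 3 + i)))*2^LA n <= 8*?P" using ZZ_le[of n "mm n + 3 + i"] by (simp add: of_nat_diff)
  also have "... \<longleftrightarrow> (4 - real (ZZ n (mm n + 3 + i))/?P)*2^LA n*?P <= 8*?P" using P by (simp add: algebra_simps)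
  also have "... \<longleftrightarrow> (4 - real (ZZ n (mm n + 3 + i))/?P)*2^LA n <= 8" using P by simp
  also have "... \<longleftrightarrow> 4 - real (ZZ n (mm n + 3 + i))/?P <= 8/2^LA n" by (simp add: le_divide_eq)
  finally show ?thesis .
 qed
 have "4 - real (ZZ n (mm n + 3 + i))/?P <= 7/2^LA n + 1/(4*2^LA n)" using i(2) er[of i] i(1) by linarith
 also have "... <= 8/2^LA n" by (simp add: field_simps)
 finally have "(4*PP n - ZZ n (mm n + 3 + i))*2^LA n <= 8*PP n" unfolding test .
 from search_props[of "%i. (4*PP n - ZZ n (mm n + 3 + i))*2^LA n <= 8*PP n",OF this,of "hA n - (mm n + 3)"] i(1)
 have I: "(4*PP n - ZZ n (mm n + 3 + iB n))*2^LA n <= 8*PP n" "iB n <= i" by (simp_all add: iB_def)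
 show "iB n < hA n - (mm n + 3)" using I i by simp
 define z where "z = zz (mm n + 3 + iB n)"
 have "4 - z <= 8/2^LA n + 1/(4*2^LA n)" using I(1)[unfolded test] er[of "iB n"] I(2) i(1) unfolding z_def by linarith
 also have "... <= 10/2^LA n" by (simp add: field_simps)
 finally have z4: "4 - z <= 10/2^LA n" .
 have zb: "0 <= z" "z <= 4" using zz_bounds by (auto simp: z_def)
 have "16 - z^2 = (4 - z)*(4 + z)" by (simp add: power2_eq_square algebra_simps)
 also have "... <= (10/2^LA n)*8" using z4 zb by (intro mult_mono) auto
 finally have "\<bar>1 - z^2/16\<bar> <= 5/2^LA n" using zb power_mono[of z 4 2] by (simp add: field_simps)
 moreover have "gate_error (mm n) (iB n + 2) (2^iB n) 1 = (1 - z^2/16)\<^sup>2"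
 proof -
  have r1: "real (1*2^(mm n + (iB n + 2) + 1)) = 2^(mm n + 3 + iB n)" by (simp add: power_add)
  have r2: "real (2^iB n)*z^2/(4*2^(iB n + 2)) = z^2/16" by (simp add: power_add)
  show ?thesis unfolding gate_error_def r1 zz_def[symmetric] z_def[symmetric] r2 ..
 qed
 ultimately show "gate_error (mm n) (iB n + 2) (2^iB n) 1 <= (5/2^LA n)\<^sup>2" by (simp only: square_le)
qed

lemma ll_ge: "2^k <= n ==> k <= ll n"
proof -
 assume k: "2^k <= n"
 then have "1 <= n" using one_le_power[of "2 :: nat" k] by linarith
 then have "n < 2^Suc (ll n)" using ll by blast
 then have "(2 :: nat)^k < 2^Suc (ll n)" using k by linarith
 then have "k < Suc (ll n)" by (rule power_less_imp_less_exp[rotated]) simp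
 then show ?thesis by simp
qed

lemma mm_large: "\<forall>\<^sub>F n in sequentially. k <= mm n"
proof -
 have "k <= mm n" if n: "2^(k^3) <= n" for n
 proof (rule ccontr)
  assume "\<not> k <= mm n"
  then have "mm n^3 <= k^3" by (intro power_mono) auto
  moreover have "k^3 <= ll n" by (rule ll_ge[OF n])
  ultimately have "4*(ll n + 2) <= ll n" using mm(1)[of n] order_trans by blast
  then show False by simp
 qed
 then show ?thesis unfolding eventually_sequentially by blast
qed

text \<open>\<open>ll n\<close> is of order \<open>m^3\<close>, so it dominates every linear term in
  \<open>m\<close>. The constants are those that keep \<open>P\<close> below
  \<open>n powr (7/4)\<close> in \<open>size_bound\<close>.\<close>

lemma ll_lower: assumes "12 <= mm n" shows "24*mm n + 12 <= ll n"
proof -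
 define k where "k = mm n - 12"
 have k: "mm n = k + 12" using assms by (simp add: k_def)
 have "96 * k + 1208 <= (k + 11)^3" by (simp add: power3_eq_cube algebra_simps)
 moreover have "(k + 11)^3 < 4*(ll n + 2)" using mm(4)[of n] by (simp add: k add.commute)
 ultimately have "96 * k + 1208 < 4*(ll n + 2)" by (rule le_less_trans)
 then show ?thesis unfolding k by simp
qed

lemma accuracy:
 assumes "1 <= n" "12 <= mm n"
 shows "4*(2*4^(hA n + JJ n)/real (PP n)) <= 1/2^LA n"
proof -
 have e: "3 + 2*(hA n + JJ n) + LA n <= 12*ll n"
  using ll_lower[OF assms(2)] by (simp add: hA_def JJ_def LA_def)
 have "4*(2*4^(hA n + JJ n))*2^LA n = (2 :: real)^(3 + 2*(hA n + JJ n) + LA n)"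
  by (simp add: power_add power_mult)
 also have "... <= 2^(12*ll n)" using e by (intro power_increasing) auto
 also have "... = (2^ll n)^12" by (simp add: power_mult mult.commute)
 also have "... <= real n^12"
 proof (rule power_mono)
  have "real (2^ll n) <= real n" using ll[OF assms(1)] by (simp only: of_nat_le_iff)
  then show "2^ll n <= real n" by simp
 qed simp
 also have "... <= real (PP n)" unfolding PP_def by (simp add: power_mono)
 finally have "4*(2*4^(hA n + JJ n))*2^LA n <= real (PP n)" .
 then show ?thesis using PP_pos[of n] by (simp add: field_simps)
qed

text \<open>The cubic growth of \<open>ll n\<close> in terms of \<open>m\<close> beats the quadratic
  exponent of the measure at \<open>j = m + 3\<close>.\<close>

lemma meas_large: "\<forall>\<^sub>F n in sequentially. 3/2^(JJ n - 1) < zz (mm n + 3)*2^(hA n - (mm n + 3))"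
proof -
 obtain K where K: "K > 0" "\<forall>\<^sub>F j in sequentially. exp (- (K*real j^2)) <= cmod (gph^(2^j) - 1)"
  using golden_measure by blast
 then obtain j0 where j0: "!!j. j0 <= j ==> exp (- (K*real j^2)) <= cmod (gph^(2^j) - 1)"
  unfolding eventually_sequentially by blast
 \<comment> \<open>384 is \<open>3*2^7\<close>, a generous allowance for the constants in the
   exponents that are compared below.\<close>
 have "filterlim (%k :: nat. (real k - 1)^3/4*ln 2 - 2*K*(real k + 3)^2) at_top sequentially"
  using K(1) by real_asymp
 then have "\<forall>\<^sub>F k :: nat in sequentially. ln 384 < (real k - 1)^3/4*ln 2 - 2*K*(real k + 3)^2"
  by (simp add: filterlim_at_top_dense)
 then obtain k0 where k0: "!!k :: nat. k0 <= k ==> ln 384 < (real k - 1)^3/4*ln 2 - 2*K*(real k + 3)^2"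
  unfolding eventually_sequentially by blast
 have "\<forall>\<^sub>F n in sequentially. max (max j0 k0) 12 <= mm n" by (rule mm_large)
 then show ?thesis
 proof (rule eventually_mono)
  fix n assume "max (max j0 k0) 12 <= mm n"
  then have m: "j0 <= mm n + 3" "k0 <= mm n" "12 <= mm n" by auto
  have "(exp (- (K*real (mm n + 3)^2)))\<^sup>2 <= zz (mm n + 3)" unfolding zz_cis using j0[OF m(1)] by (intro power_mono) auto
  then have z: "exp (- (2*K*(real (mm n) + 3)^2)) <= zz (mm n + 3)" by (simp add: power2_eq_square mult_ac flip: exp_add)
  have "real ((mm n - 1)^3) < real (4*(ll n + 2))" using mm(4)[of n] by (simp only: of_nat_less_iff)
  then have l: "(real (mm n) - 1)^3/4 < real (ll n) + 2" using m(3) by (simp add: of_nat_diff)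
  have "(real (mm n) - 1)^3/4*ln 2 <= (real (ll n) + 2)*ln 2" using l by (intro mult_right_mono) auto
  then have "ln 384 - (real (ll n) + 2)*ln 2 < - (2*K*(real (mm n) + 3)^2)" using k0[OF m(2)] by linarith
  then have "exp (ln 384 - (real (ll n) + 2)*ln 2) < exp (- (2*K*(real (mm n) + 3)^2))" by simp
  also have "exp (ln 384 - (real (ll n) + 2)*ln 2) = 384/2 powr (real (ll n) + 2)" by (simp add: exp_diff powr_def)
  also have "2 powr (real (ll n) + 2) = 2^(ll n + 2)" using powr_realpow[of 2 "ll n + 2"] by (simp add: add.commute)
  finally have "384/2^(ll n + 2) < zz (mm n + 3)" using z by linarith
  moreover have "3/2^(JJ n - 1)/2^(hA n - (mm n + 3)) <= (384 :: real)/2^(ll n + 2)"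
  proof -
   have "ll n + 2 <= 7 + ((JJ n - 1) + (hA n - (mm n + 3)))" using m(3) by (simp add: JJ_def hA_def LA_def)
   then have "(2 :: real)^(ll n + 2) <= 2^(7 + ((JJ n - 1) + (hA n - (mm n + 3))))" by (intro power_increasing) auto
   also have "... = 128*(2^(JJ n - 1)*2^(hA n - (mm n + 3)))" by (simp add: power_add)
   finally show ?thesis by (simp add: field_simps)
  qed
  ultimately have "3/2^(JJ n - 1)/2^(hA n - (mm n + 3)) < zz (mm n + 3)" by linarith
  then show "3/2^(JJ n - 1) < zz (mm n + 3)*2^(hA n - (mm n + 3))" by (simp add: divide_less_eq mult_ac)
 qed
qed

text \<open>Here the factor 4 in \<open>mm\<close> enters: (65/100)^4 \<le> 1/2, so
  \<open>m^3\<close> trials fail with probability at most \<open>1/2^(ll n + 2)\<close>.\<close>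

lemma trial_error: "1 <= n ==> (65/100)^(mm n^3) <= 1/(2*real n)"
proof -
 assume n: "1 <= n"
 have "(65/100 :: real)^(mm n^3) <= (65/100)^(4*(ll n + 2))" using mm(1)[of n] by (intro power_decreasing) auto
 also have "... = ((65/100)^4)^(ll n + 2)" by (rule power_mult)
 also have "... <= (1/2)^(ll n + 2)" by (intro power_mono) (auto simp: power_numeral_reduce)
 also have "... = 1/(2*2^Suc (ll n))" by (simp add: power_divide)
 also have "... <= 1/(2*real n)"
 proof -
  have "real n < real (2^Suc (ll n))" using ll[OF n] by (simp only: of_nat_less_iff)
  then have "real n <= 2^Suc (ll n)" by simp
  then show ?thesis using n by (intro divide_left_mono mult_left_mono mult_pos_pos) auto
 qed
 finally show ?thesis .
qed

text \<open>The part \<open>ll n div 2\<close> of \<open>LA n\<close> accounts for the factor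
  \<open>n\<close> and the part \<open>mm n\<close> for \<open>m^2\<close>, because
  \<open>600*k^2 \<le> 4^k\<close> from \<open>k = 8\<close> on.\<close>

lemma large_error:
 assumes n: "1 <= n" and m: "12 <= mm n"
 shows "3*real (mm n)^2*(5/2^LA n)\<^sup>2 <= 1/(2*real n)"
proof -
 have k: "8 <= k ==> 600 * k^2 <= (4 :: nat)^k" for k
 proof (induction k rule: nat_induct_at_least)
  case (Suc k)
  have "8 * k <= k * k" using Suc.hyps by simp
  moreover have "Suc k^2 = k * k + 2 * k + 1" "4 * k^2 = 4*(k * k)" by (simp_all add: power2_eq_square)
  ultimately have "Suc k^2 <= 4 * k^2" using Suc.hyps by linarith
  then show ?case using Suc by simp
 qed simp
 have "real (600*mm n^2) <= real (4^mm n)" using k[of "mm n"] m by (simp only: of_nat_le_iff)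
 then have k': "600*real (mm n)^2 <= 4^mm n" by simp
 have "real n < real (2^Suc (ll n))" using ll[OF n] by (simp only: of_nat_less_iff)
 then have n2: "real n <= 2*2^ll n" by simp
 have "(2 :: real)^ll n <= 2^(2*(ll n div 2) + 1)" by (intro power_increasing) auto
 then have l2: "(2 :: real)^ll n <= 2*4^(ll n div 2)" by (simp add: power_mult)
 have "150*real (mm n)^2*real n <= 150*real (mm n)^2*(4*4^(ll n div 2))" using n2 l2 by (intro mult_left_mono) auto
 also have "... = (600*real (mm n)^2)*4^(ll n div 2)" by simp
 also have "... <= 4^mm n*4^(ll n div 2)" using k' by (intro mult_right_mono) auto
 also have "... = (2^LA n)\<^sup>2"
 proof -
  have "(2^LA n :: real)\<^sup>2 = 4^LA n" by (simp add: power2_eq_square flip: power_mult_distrib)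
  then show ?thesis by (simp add: LA_def power_add)
 qed
 finally have "150*real (mm n)^2*real n <= (2^LA n)\<^sup>2" .
 moreover have "3*real (mm n)^2*(5/2^LA n)\<^sup>2 = 75*real (mm n)^2/(2^LA n)\<^sup>2" by (simp add: power_divide)
 ultimately show ?thesis using n by (simp add: field_simps)
qed

text \<open>With \<open>F/2^L = 1/4\<close> the error vanishes at \<open>z = 4\<close>, that is, at
  the angle \<open>pi\<close>, and by Kronecker's theorem the multiples of an irrational angle come
  arbitrarily close to it. No size of \<open>c\<close> is controlled, so this serves only the
  finitely many small \<open>n\<close>.\<close>

lemma small_error:
 assumes "0 < \<eta>"
 obtains c where "gate_error m 2 1 c < \<eta>"
proof -
 define f where "f x = (1 - (2 - 2*cos (2*pi*x))\<^sup>2/16)\<^sup>2" for x :: real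
 have "continuous (at (1/2)) f" unfolding f_def by (intro continuous_intros) auto
 moreover have "f (1/2) = 0" by (simp add: f_def)
 ultimately obtain d where d: "0 < d" "!!x. \<bar>x - 1/2\<bar> < d ==> \<bar>f x\<bar> < \<eta>"
  using assms unfolding continuous_at_eps_delta dist_real_def by (metis diff_zero)
 define \<beta> where "\<beta> = 2^(m + 3)*golden_angle/(2*pi)"
 have "\<beta> \<notin> \<rat>"
 proof
  assume "\<beta> \<in> \<rat>"
  moreover have "golden_angle/pi = \<beta>*2/2^(m + 3)" by (simp add: \<beta>_def field_simps)
  ultimately have "golden_angle/pi \<in> \<rat>" by simp
  then show False using golden_irrational by blast
 qed
 then obtain c :: nat where c: "\<bar>frac (real c * \<beta>) - 1/2\<bar> < d" using Kronecker_approx_1_explicit[of \<beta> "1/2" d] d(1) by auto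
 have "cos (2*pi*frac (real c * \<beta>)) = cos (2*pi*(real c * \<beta>))"
 proof -
  have "2*pi*(real c * \<beta>) = 2*pi*frac (real c * \<beta>) + 2*pi * of_int \<lfloor>real c * \<beta>\<rfloor>" by (simp add: frac_def algebra_simps)
  then show ?thesis using cos.plus_of_int[of "2*pi*frac (real c * \<beta>)" "\<lfloor>real c * \<beta>\<rfloor>"] by (simp add: cos_add mult.commute)
 qed
 moreover have "2*pi*(real c * \<beta>) = real (c*2^(m + 2 + 1))*golden_angle" by (simp add: \<beta>_def power_add)
 ultimately have g: "gate_error m 2 1 c = f (frac (real c * \<beta>))" by (simp add: gate_error_def f_def)
 show thesis by (rule that[of c]) (use d(2)[OF c] g in linarith)
qed

text \<open>Below \<open>n0\<close> the parameters are hardwired, with the multiplier taken from the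
  table \<open>T\<close>; from \<open>n0\<close> on the two cases decide.\<close>

definition pL :: "nat => nat => nat" where "pL n0 n = (if n < n0 then 2 else if caseA n then LA n else iB n + 2)"
definition pF :: "nat => nat => nat" where
 "pF n0 n = (if n < n0 then 1 else if caseA n then 4*2^LA n*PP n^2 div ZZ n (hA n + iA n)^2 else 2^iB n)"
definition pc :: "nat => (nat => nat) => nat => nat" where
 "pc n0 T n = (if n < n0 then T n else if caseA n then 2^iA n else 1)"

theorem parameters:
 obtains n0 T where "!!n. pF n0 n <= 2^pL n0 n"
  "!!n. 1 <= n ==> (65/100)^(mm n^3) + 3*real (mm n)^2*gate_error (mm n) (pL n0 n) (pF n0 n) (pc n0 T n) <= 1/real n"
  "!!n. n0 <= n ==> 12 <= mm n & 1 <= n & pL n0 n <= LA n & pc n0 T n*2^(pL n0 n) <= 2^(LA n + JJ n)"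
proof -
 have "\<forall>\<^sub>F n in sequentially. 12 <= mm n & 1 <= n & 3/2^(JJ n - 1) < zz (mm n + 3)*2^(hA n - (mm n + 3))"
  using mm_large[of 12] meas_large eventually_ge_at_top[of 1] by eventually_elim auto
 \<comment> \<open>\<open>n0\<close> is not computed, since it depends on the constant of the
   measure; below it a table of multipliers takes over.\<close>
 then obtain n0 where n0: "!!n. n0 <= n ==> 12 <= mm n" "!!n. n0 <= n ==> 1 <= n"
   "!!n. n0 <= n ==> 3/2^(JJ n - 1) < zz (mm n + 3)*2^(hA n - (mm n + 3))"
  unfolding eventually_sequentially by blast
 have "\<exists>c. 1 <= n --> gate_error (mm n) 2 1 c < 1/(6*real (mm n)^2*real n)" for n
 proof (cases "1 <= n")
  case True
  then have "0 < 1/(6*real (mm n)^2*real n)" using mm(3)[of n] by simp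
  then show ?thesis by (rule small_error[of _ "mm n"]) blast
 qed simp
 then obtain T where T: "!!n. 1 <= n ==> gate_error (mm n) 2 1 (T n) < 1/(6*real (mm n)^2*real n)" by metis
 have big: "3/2^(ll n div 2 + 2*mm n - 1)*2^LA n <= (7 :: real)" if "12 <= mm n" for n
 proof -
  have "LA n <= ll n div 2 + 2*mm n - 1" using that by (simp add: LA_def)
  then have "(2 :: real)^LA n <= 2^(ll n div 2 + 2*mm n - 1)" by (intro power_increasing) auto
  then have "3/2^(ll n div 2 + 2*mm n - 1)*2^LA n <= 3/2^(ll n div 2 + 2*mm n - 1)*(2 :: real)^(ll n div 2 + 2*mm n - 1)"
   by (intro mult_left_mono) auto
  then show ?thesis by simp
 qed
 have A: "n0 <= n ==> caseA n ==> 4*2^LA n*PP n^2 div ZZ n (hA n + iA n)^2 <= 2^LA n &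
   gate_error (mm n) (LA n) (4*2^LA n*PP n^2 div ZZ n (hA n + iA n)^2) (2^iA n) <= (5/2^LA n)\<^sup>2" for n
  using gate_error_A[OF n0(2) _ accuracy[OF n0(2) n0(1)]] by blast
 have B: "n0 <= n ==> \<not> caseA n ==> gate_error (mm n) (iB n + 2) (2^iB n) 1 <= (5/2^LA n)\<^sup>2 & iB n < hA n - (mm n + 3)" for n
  using gate_error_B[OF n0(2) _ accuracy[OF n0(2) n0(1)] big[OF n0(1)] n0(3)] n0(1)[of n] by auto
 show thesis
 proof (rule that[of n0 T])
  show "pF n0 n <= 2^pL n0 n" for n
   using A[of n] power_increasing[of "iB n" "iB n + 2" "2 :: nat"] by (auto simp: pF_def pL_def)
  show "(65/100)^(mm n^3) + 3*real (mm n)^2*gate_error (mm n) (pL n0 n) (pF n0 n) (pc n0 T n) <= 1/real n" if n: "1 <= n" for n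
  proof -
   have "3*real (mm n)^2*gate_error (mm n) (pL n0 n) (pF n0 n) (pc n0 T n) <= 1/(2*real n)"
   proof (cases "n < n0")
    case True
    have "3*real (mm n)^2*gate_error (mm n) 2 1 (T n) <= 3*real (mm n)^2*(1/(6*real (mm n)^2*real n))"
     using T[OF n] by (intro mult_left_mono) auto
    also have "... = 1/(2*real n)" using mm(3)[of n] by (simp add: field_simps)
    finally show ?thesis using True by (simp add: pL_def pF_def pc_def)
   next
    case False
    then have g: "gate_error (mm n) (pL n0 n) (pF n0 n) (pc n0 T n) <= (5/2^LA n)\<^sup>2"
     using A[of n] B[of n] by (auto simp: pL_def pF_def pc_def)
    have "3*real (mm n)^2*gate_error (mm n) (pL n0 n) (pF n0 n) (pc n0 T n) <= 3*real (mm n)^2*(5/2^LA n)\<^sup>2"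
     using g by (intro mult_left_mono) auto
    also have "... <= 1/(2*real n)" by (rule large_error[OF n n0(1)]) (use False in simp)
    finally show ?thesis .
   qed
   then have "(65/100)^(mm n^3) + 3*real (mm n)^2*gate_error (mm n) (pL n0 n) (pF n0 n) (pc n0 T n) <= 1/(2*real n) + 1/(2*real n)"
    using trial_error[OF n] by linarith
   also have "... = 1/real n" by (simp add: field_simps)
   finally show ?thesis .
  qed
  fix n assume n: "n0 <= n"
  have iA: "iA n <= JJ n" unfolding iA_def by (rule search_le)
  have "pL n0 n <= LA n" using n B[OF n] by (auto simp: pL_def hA_def)
  moreover have "pc n0 T n*2^(pL n0 n) <= 2^(LA n + JJ n)"
  proof (cases "caseA n")
   case True
   have "(2 :: nat)^(iA n + LA n) <= 2^(LA n + JJ n)" using iA by (intro power_increasing) auto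
   then show ?thesis using True n by (simp add: pL_def pc_def power_add)
  next
   case False
   have "(2 :: nat)^pL n0 n <= 2^(LA n + JJ n)" using \<open>pL n0 n <= LA n\<close> by (intro power_increasing) auto
   then show ?thesis using False n by (simp add: pc_def)
  qed
  ultimately show "12 <= mm n & 1 <= n & pL n0 n <= LA n & pc n0 T n*2^(pL n0 n) <= 2^(LA n + JJ n)" using n0[OF n] by simp
 qed
qed

section \<open>Generating the circuits in logarithmic space\<close>

lemma pgm_pow2_le:
 assumes "pgm O' Gm f" "pgm O' Gm g" "!!e. 2^f e <= g e"
 shows "pgm O' Gm (%e. 2^f e)"
proof -
 have "min (2^f e) (g e) = 2^f e" for e using assms(3)[of e] by simp
 then show ?thesis using pgm_pow2_min[OF assms(1,2)] by simp
qed

lemma decidable_odd: "pgm O' Gm f ==> decidable O' Gm (%e. odd (f e))"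
 unfolding odd_iff_mod_2_eq_one by (intro decidable_eq pgm_mod pgm_const)

lemma decidable_bit: "pgm O' Gm f ==> pgm O' Gm g ==> decidable O' Gm (%e. bit (f e) (g e))"
 unfolding bit_iff_odd by (intro decidable_odd pgm_div_pow2)

lemma pgm_of_bool: "decidable O' Gm P ==> pgm O' Gm (%e. of_bool (P e))"
 by (simp add: decidable_def)

lemma pgm_triangle: "pgm O' Gm f ==> pgm O' Gm (%e. triangle (f e))"
 unfolding triangle_def by (intro pgm_div pgm_mult pgm_Suc pgm_const)

lemma pgm_prod_encode: "pgm O' Gm f ==> pgm O' Gm g ==> pgm O' Gm (%e. prod_encode (f e,g e))"
 unfolding prod_encode_def by (simp,intro pgm_add pgm_triangle)

lemma decidable_cond:
 "decidable O' Gm P ==> decidable O' Gm Q ==> decidable O' Gm R ==> decidable O' Gm (%e. if P e then Q e else R e)"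
proof -
 assume a: "decidable O' Gm P" "decidable O' Gm Q" "decidable O' Gm R"
 have "decidable O' Gm (%e. (P e & Q e) \<or> (\<not> P e & R e))" by (intro decidable_disj decidable_conj decidable_not a)
 moreover have "(%e. (P e & Q e) \<or> (\<not> P e & R e)) = (%e. if P e then Q e else R e)" by auto
 ultimately show ?thesis by simp
qed


definition gates_writable :: "('e => nat) list => ('e => gate list) => bool" where
 "gates_writable Gm G \<longleftrightarrow> writable Gm (%e. concat (map describe_gate (G e)))"

text \<open>A description lists the layers in order, and parallel composition merges the layers of
  its components. So each of the constantly many layers has to be writable by itself.\<close>

definition layers_writable :: "('e => nat) list => nat => ('e => layer list) => bool" where
 "layers_writable Gm T f \<longleftrightarrow> (\<forall>e. length (f e) = T) & (\<forall>t<T. gates_writable Gm (%e. f e ! t))"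

abbreviation prog :: "('e => nat) list => ('e => nat) => bool" where "prog \<equiv> pgm TYPE(token)"
abbreviation dec :: "('e => nat) list => ('e => bool) => bool" where "dec \<equiv> decidable TYPE(token)"

lemma writable_nat: "prog Gm f ==> writable Gm (%e. describe_nat (f e))"
proof -
 assume f: "prog Gm f"
 have "writable Gm (%e. concat (map (%_. [Tally]) [0..<f e]) @ [EndNumber])"
  by (intro writable_append writable_concat[OF f] writable_emit)
 moreover have "concat (map (%_. [Tally]) [0..<k]) = replicate k Tally" for k by (induction k) (auto simp: replicate_append_same)
 ultimately show ?thesis by (simp add: describe_nat_def)
qed

lemma gates_Had: "prog Gm q ==> gates_writable Gm (%e. [Had (q e)])"
 unfolding gates_writable_def by (simp,intro writable_Cons writable_nat)

lemma gates_Rot: "prog Gm q ==> gates_writable Gm (%e. [Rot (q e)])"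
 unfolding gates_writable_def by (simp,intro writable_Cons writable_nat)

lemma gates_CNot: "prog Gm q ==> prog Gm r ==> gates_writable Gm (%e. [CNot (q e) (r e)])"
 unfolding gates_writable_def by (simp,intro writable_Cons writable_append writable_nat)

lemma gates_Nil: "gates_writable Gm (%e. [])"
 unfolding gates_writable_def by (simp add: writable_Nil)

lemma gates_append: "gates_writable Gm G ==> gates_writable Gm H ==> gates_writable Gm (%e. G e @ H e)"
 unfolding gates_writable_def by (simp add: writable_append)

lemma gates_if: "dec Gm P ==> gates_writable Gm G ==> gates_writable Gm H ==> gates_writable Gm (%e. if P e then G e else H e)"
 unfolding gates_writable_def using writable_if[of "TYPE(token)" Gm P "%e. concat (map describe_gate (G e))" "%e. concat (map describe_gate (H e))"]
 by (simp add: if_distrib[of "%x. concat (map describe_gate x)"])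

lemma describe_concat: "concat (map describe_gate (concat (map h xs))) = concat (map (%i. concat (map describe_gate (h i))) xs)"
 by (induction xs) auto

lemma gates_concat:
 "prog Gm cnt ==> gates_writable (extend Gm) (%p. G (fst p) (snd p)) ==> gates_writable Gm (%e. concat (map (G e) [0..<cnt e]))"
 unfolding gates_writable_def describe_concat by (rule writable_concat)

lemma Hads_filter: "map Had (map f (filter P xs)) = concat (map (%i. if P i then [Had (f i)] else []) xs)"
 by (induction xs) auto

lemma gates_Hads_filter:
 assumes "prog Gm cnt" "dec (extend Gm) (%p. P (fst p) (snd p))" "prog (extend Gm) (%p. f (fst p) (snd p))"
 shows "gates_writable Gm (%e. map Had (map (f e) (filter (P e) [0..<cnt e])))"
 unfolding Hads_filter by (intro gates_concat gates_if gates_Had gates_Nil assms)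

lemma gates_Hads_upt:
 assumes "prog Gm lo" "prog Gm hi" "prog (extend Gm) (%p. f (fst p) (snd p + lo (fst p)))"
 shows "gates_writable Gm (%e. map Had (map (f e) [lo e..<hi e]))"
proof -
 have "map g [a..<b] = map (%i. g (i + a)) (filter (%_. True) [0..<b - a])" for g :: "nat => nat" and a b :: nat
  by (cases "a <= b") (auto intro!: nth_equalityI simp: add.commute)
 then have "(%e. map Had (map (f e) [lo e..<hi e])) = (%e. map Had (map (%i. f e (i + lo e)) (filter (%_. True) [0..<hi e - lo e])))" by simp
 moreover have "gates_writable Gm (%e. map Had (map (%i. f e (i + lo e)) (filter (%_. True) [0..<hi e - lo e])))"
 proof (rule gates_Hads_filter)
  have "dec (extend Gm) (%p. (0 :: nat) = 0)" by (intro decidable_eq pgm_const)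
  then show "dec (extend Gm) (%p. True)" by simp
 qed (use assms in \<open>auto intro: pgm_diff\<close>)
 ultimately show ?thesis by simp
qed

lemma gates_FanOut_filter:
 assumes "prog Gm q" "prog Gm cnt" "dec (extend Gm) (%p. P (fst p) (snd p))" "prog (extend Gm) (%p. f (fst p) (snd p))"
 shows "gates_writable Gm (%e. [FanOut (q e) (map (f e) (filter (P e) [0..<cnt e]))])"
proof -
 have "concat (map describe_nat (map g (filter Q xs))) = concat (map (%i. if Q i then describe_nat (g i) else []) xs)" for g Q and xs :: "nat list"
  by (induction xs) auto
 moreover have "writable Gm (%e. FanOutT # describe_nat (q e) @ concat (map (%i. if P e i then describe_nat (f e i) else []) [0..<cnt e]))"
  by (intro writable_Cons writable_append writable_nat writable_concat[where O' = "TYPE(token)"] writable_if[where O' = "TYPE(token)"] writable_Nil assms)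
 ultimately show ?thesis unfolding gates_writable_def by simp
qed

lemma layers_single: "gates_writable Gm G ==> layers_writable Gm (Suc 0) (%e. [G e])"
 by (simp add: layers_writable_def)

lemma layers_append:
 "layers_writable Gm S f ==> layers_writable Gm T g ==> layers_writable Gm (S + T) (%e. f e @ g e)"
 unfolding layers_writable_def
proof (intro conjI allI impI)
 fix t assume a: "(\<forall>e. length (f e) = S) & (\<forall>t<S. gates_writable Gm (%e. f e ! t))" "(\<forall>e. length (g e) = T) & (\<forall>t<T. gates_writable Gm (%e. g e ! t))" "t < S + T"
 show "gates_writable Gm (%e. (f e @ g e) ! t)"
 proof (cases "t < S")
  case True
  then show ?thesis using a by (simp add: nth_append)
 next
  case False
  then have "gates_writable Gm (%e. g e ! (t - S))" using a by auto
  then show ?thesis using False a by (simp add: nth_append)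
 qed
qed simp

lemma layers_Cons: "gates_writable Gm G ==> layers_writable Gm T f ==> layers_writable Gm (Suc T) (%e. G e # f e)"
 using layers_append[OF layers_single,of Gm G T f] by simp

lemma layers_par:
 assumes "prog Gm cnt" "layers_writable (extend Gm) T (%p. f (fst p) (snd p))"
 shows "layers_writable Gm T (%e. par T (f e) [0..<cnt e])"
 unfolding layers_writable_def
proof (intro conjI allI impI)
 fix t assume t: "t < T"
 have "gates_writable Gm (%e. concat (map (%i. f e i ! t) [0..<cnt e]))"
  by (rule gates_concat[OF assms(1)]) (use assms(2) t in \<open>auto simp: layers_writable_def\<close>)
 then show "gates_writable Gm (%e. par T (f e) [0..<cnt e] ! t)" using t by (simp add: par_def)
qed simp

lemma layers_if:
 "dec Gm P ==> layers_writable Gm T f ==> layers_writable Gm T g ==> layers_writable Gm T (%e. if P e then f e else g e)"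
 unfolding layers_writable_def by (auto simp: if_distrib[of "%x. x ! _"] intro!: gates_if)

lemma writable_layers:
 assumes "layers_writable Gm T f"
 shows "writable Gm (%e. concat (map describe_layer (f e)))"
proof -
 have "k <= T ==> writable Gm (%e. concat (map (%t. describe_layer (f e ! t)) [0..<k]))" for k
 proof (induction k)
  case (Suc k)
  have "writable Gm (%e. describe_layer (f e ! k))" unfolding describe_layer_def
   using assms Suc.prems by (intro writable_append writable_emit) (simp add: layers_writable_def gates_writable_def)
  then show ?case using writable_append[OF Suc.IH] Suc.prems by simp
 qed (simp add: writable_Nil)
 from this[of T] have "writable Gm (%e. concat (map (%t. describe_layer (f e ! t)) [0..<T]))" by simp
 moreover have "map (%t. describe_layer (f e ! t)) [0..<T] = map describe_layer (f e)" for e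
  using assms by (intro nth_equalityI) (auto simp: layers_writable_def)
 ultimately show ?thesis by simp
qed

text \<open>One indexed family lets the three kinds of marks be treated together in
  \<open>layers_mark\<close>.\<close>

definition mark :: "nat => nat => nat => nat => bool" where
 "mark k m F = (if k = 0 then good_mark m F else if k = 1 then flag_mark m else zero_mark m)"

lemma dec_mark:
 assumes "prog Gm m" "prog Gm F" "prog Gm v"
 shows "dec Gm (%e. mark k (m e) (F e) (v e))"
proof -
 have r: "v mod 2^m = v - (v div 2^m)*2^m" for v m :: nat by (simp add: minus_div_mult_eq_mod)
 have z: "dec Gm (%e. v e mod 2^m e ~= 0)"
 proof -
  \<comment> \<open>Testing single bits avoids computing \<open>2^m\<close>.\<close>
  have "v mod 2^m ~= 0 \<longleftrightarrow> (\<exists>i<m. bit v i)" for v m :: nat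
  proof -
   have "v mod 2^m = 0 \<longleftrightarrow> (\<forall>i. \<not> bit (v mod 2^m) i)" using bit_eqI[of "v mod 2^m" 0] by auto
   also have "... \<longleftrightarrow> (\<forall>i<m. \<not> bit v i)" unfolding take_bit_eq_mod[symmetric] bit_take_bit_iff by auto
   finally show ?thesis by auto
  qed
  moreover have "dec Gm (%e. \<exists>i<m e. bit (v e) i)" by (intro decidable_ex decidable_bit pgm_snd pgm_extend assms)
  ultimately show ?thesis by simp
 qed
 have "dec Gm (%e. good_mark (m e) (F e) (v e))" unfolding good_mark_def
  by (intro decidable_conj z decidable_bit decidable_less pgm_div_pow2 pgm_Suc assms)
 moreover have "dec Gm (%e. flag_mark (m e) (v e))" unfolding flag_mark_def by (intro decidable_conj z decidable_bit assms)
 moreover have "dec Gm (%e. zero_mark (m e) (v e))" unfolding zero_mark_def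
  by (intro decidable_conj z decidable_eq pgm_div_pow2 pgm_const assms)
 ultimately show ?thesis unfolding mark_def by (cases "k = 0"; cases "k = 1") simp_all
qed

lemma dec_odd_overlap: "prog Gm h ==> prog Gm S ==> prog Gm v ==> dec Gm (%e. odd_overlap (h e) (S e) (v e))"
 unfolding odd_overlap_def
 by (intro decidable_odd pgm_sum pgm_of_bool decidable_conj decidable_bit pgm_snd pgm_extend)

lemma prog_evens_odds:
 assumes "prog Gm m" "prog Gm F" "prog Gm h" "prog Gm (%e. 2^h e)" "prog Gm S"
 shows "prog Gm (%e. evens (mark k (m e) (F e)) (h e) (S e))" "prog Gm (%e. odds (mark k (m e) (F e)) (h e) (S e))"
 unfolding evens_def odds_def
 by (intro pgm_sum pgm_of_bool decidable_conj decidable_not dec_mark dec_odd_overlap pgm_snd pgm_extend assms)+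

lemma dec_active_negative:
 assumes a: "prog Gm m" "prog Gm F" "prog Gm h" "prog Gm (%e. 2^h e)" and c: "prog Gm c" "prog Gm p" and i: "prog Gm i"
 shows "dec Gm (%e. active (c e) (mark k (m e) (F e)) (h e) (p e) (i e))" "dec Gm (%e. negative sg (mark k (m e) (F e)) (h e) (p e))"
proof -
 have S: "prog Gm (%e. p e mod 2^h e)" by (intro pgm_mod c a)
 show "dec Gm (%e. active (c e) (mark k (m e) (F e)) (h e) (p e) (i e))"
  unfolding active_def
  by (intro decidable_conj decidable_bit S i decidable_less pgm_div_pow2 pgm_mult pgm_const pgm_add pgm_diff
   prog_evens_odds a c)
 show "dec Gm (%e. negative sg (mark k (m e) (F e)) (h e) (p e))"
  unfolding negative_def by (cases sg) (simp_all,(intro decidable_less prog_evens_odds a S)+)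
qed

lemma map_single: "map f xs = concat (map (%i. [f i]) xs)"
 by (induction xs) auto

lemma layers_eq: "layers_writable Gm S f ==> S = T ==> layers_writable Gm T f"
 by simp

lemma layers_parity:
 assumes "prog Gm cnt" "dec (extend Gm) (%p. P (fst p) (snd p))" "prog (extend Gm) (%p. f (fst p) (snd p))" "prog Gm g"
 shows "layers_writable Gm 3 (%e. parity_layers (map (f e) (filter (P e) [0..<cnt e])) (g e))"
proof -
 have "layers_writable Gm (Suc (Suc (Suc 0))) (%e. parity_layers (map (f e) (filter (P e) [0..<cnt e])) (g e))"
  unfolding parity_layers_def
  by (intro layers_Cons layers_single gates_append gates_Hads_filter gates_FanOut_filter gates_Had assms)
 then show ?thesis by (simp add: numeral_3_eq_3)
qed

lemma layers_parity_all:
 assumes "prog Gm cnt" "prog (extend Gm) (%p. f (fst p) (snd p))" "prog Gm g"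
 shows "layers_writable Gm 3 (%e. parity_layers (map (f e) [0..<cnt e]) (g e))"
proof -
 have "dec (extend Gm) (%p. (0 :: nat) = 0)" by (intro decidable_eq pgm_const)
 then show ?thesis using layers_parity[of Gm cnt "%_ _. True" f g] assms by simp
qed

lemma layers_unrot: "prog Gm g ==> layers_writable Gm 9 (%e. map (%x. [x]) (unrot (g e)))"
proof -
 assume g: "prog Gm g"
 have "layers_writable Gm (Suc (Suc (Suc (Suc (Suc (Suc (Suc (Suc (Suc 0))))))))) (%e. map (%x. [x]) (unrot (g e)))"
  unfolding unrot_def list.map by (intro layers_Cons layers_single gates_Had gates_Rot g)
 then show ?thesis by (simp add: eval_nat_numeral)
qed

lemma layers_rot: "prog Gm g ==> dec Gm N ==> layers_writable Gm 9 (%e. rot_layers (g e) (N e))"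
proof -
 assume g: "prog Gm g" and N: "dec Gm N"
 have "layers_writable Gm 9 (%e. [Rot (g e)] # replicate 8 [])"
  unfolding layers_writable_def
 proof (intro conjI allI impI)
  fix t assume "t < (9 :: nat)"
  then show "gates_writable Gm (%e. ([Rot (g e)] # replicate 8 []) ! t)"
   using gates_Rot[OF g] gates_Nil by (cases t) auto
 qed simp
 then show ?thesis unfolding rot_layers_def by (intro layers_if N layers_unrot g)
qed

lemma layers_mark:
 assumes a: "prog Gm m" "prog Gm F" "prog Gm h" "prog Gm (%e. 2^h e)" "prog Gm c"
  and u: "prog (extend Gm) (%p. u (fst p) (snd p))"
  and x: "prog (extend (extend Gm)) (%p. x (fst (fst p)) (snd (fst p)) (snd p))" "prog (extend (extend Gm)) (%p. x (fst (fst p)) (snd p) (snd (fst p)))"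
  and g: "prog (extend Gm) (%p. g (fst p) (snd p))"
 shows "layers_writable Gm 17 (%e. mark_layers (h e) (c e) (u e) (x e) (g e) sg (mark k (m e) (F e)))"
proof -
 have P: "prog Gm (%e. 2^h e*(2*c e*2^h e))" by (intro pgm_mult pgm_const a)
 have fan: "layers_writable Gm (Suc 0) (%e. [fan_layer (h e) (2^h e*(2*c e*2^h e)) (u e) (x e) (active (c e) (mark k (m e) (F e)) (h e))])"
  unfolding fan_layer_def map_single[of "%i. FanOut _ _"]
  by (subst map_single) (intro layers_single gates_concat gates_FanOut_filter a u x pgm_extend[OF P] dec_active_negative(1)
   pgm_extend[of _ "extend Gm" "%p. m (fst p)"] pgm_extend[of _ "extend Gm" "%p. F (fst p)"] pgm_extend[of _ "extend Gm" "%p. h (fst p)"]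
   pgm_extend[of _ "extend Gm" "%p. 2^h (fst p)"] pgm_extend[of _ "extend Gm" "%p. c (fst p)"] pgm_extend[of _ "extend Gm" snd]
   pgm_extend pgm_snd)
 have par: "layers_writable Gm 3 (%e. par 3 (%p. parity_layers (map (x e p) (filter (active (c e) (mark k (m e) (F e)) (h e) p) [0..<h e])) (g e p)) [0..<2^h e*(2*c e*2^h e)])"
  by (intro layers_par layers_parity a u x g P dec_active_negative(1)
   pgm_extend[of _ "extend Gm" "%p. m (fst p)"] pgm_extend[of _ "extend Gm" "%p. F (fst p)"] pgm_extend[of _ "extend Gm" "%p. h (fst p)"]
   pgm_extend[of _ "extend Gm" "%p. 2^h (fst p)"] pgm_extend[of _ "extend Gm" "%p. c (fst p)"] pgm_extend[of _ "extend Gm" snd]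
   pgm_extend pgm_snd)
 have rot: "layers_writable Gm 9 (%e. par 9 (%p. rot_layers (g e p) (negative sg (mark k (m e) (F e)) (h e) p)) [0..<2^h e*(2*c e*2^h e)])"
  by (intro layers_par layers_rot g P dec_active_negative(2)[where c = "%_. 0" and i = "%_. 0"] a pgm_extend pgm_snd pgm_const)
 have "layers_writable Gm (Suc 0 + (3 + (9 + (3 + Suc 0)))) (%e. mark_layers (h e) (c e) (u e) (x e) (g e) sg (mark k (m e) (F e)))"
  unfolding mark_layers_def phase_layers_def by (intro layers_append fan par rot)
 then show ?thesis by simp
qed

lemma prog_anc:
 "prog Gm n ==> prog Gm a ==> prog Gm b ==> prog Gm d ==> prog Gm t ==> prog Gm (%e. anc (n e) (t e) (a e) (b e) (d e))"
 unfolding anc_def by (intro pgm_add pgm_prod_encode pgm_const)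

lemma layers_or:
 assumes a: "prog Gm n" "prog Gm j" "prog Gm m" "prog Gm L" "prog Gm F" "prog Gm (%e. 2^(m e + L e + 1))" "prog Gm c"
 shows "layers_writable Gm 91 (%e. or_layers (m e) (L e) (F e) (c e) (or_in (n e) (m e) l (j e)) (or_e (n e) l (j e)) (or_g (n e) l (j e)))"
proof -
 have h: "prog Gm (%e. m e + L e + 1)" by (intro pgm_add pgm_const a)
 have ex: "prog (extend Gm) (%p. n (fst p))" "prog (extend Gm) (%p. j (fst p))" "prog (extend Gm) (%p. m (fst p))"
  by (intro pgm_extend a)+
 have ex2: "prog (extend (extend Gm)) (%p. n (fst (fst p)))" "prog (extend (extend Gm)) (%p. j (fst (fst p)))" "prog (extend (extend Gm)) (%p. snd (fst p))"
  using pgm_extend[OF ex(1)] pgm_extend[OF ex(2)] pgm_extend[OF pgm_snd] by simp_all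
 have or_in: "prog \<Delta> (%p. or_in (n' p) (m' p) l (j' p) (i' p))"
  if "prog \<Delta> n'" "prog \<Delta> m'" "prog \<Delta> j'" "prog \<Delta> i'" for \<Delta> :: "('x => nat) list" and n' m' j' i'
  unfolding or_in_def obit_def
  by (intro pgm_if decidable_less decidable_eq prog_anc pgm_add pgm_mult pgm_const that)
 have u: "prog (extend Gm) (%p. or_in (n (fst p)) (m (fst p)) l (j (fst p)) (snd p))"
  "prog (extend Gm) (%p. or_in (n (fst p)) (m (fst p)) l (j (fst p)) (snd p + m (fst p)))"
  unfolding or_in_def obit_def
  by (intro pgm_if decidable_less decidable_eq prog_anc pgm_add pgm_mult pgm_const ex pgm_snd)+
 have q: "prog Gm (%e. or_in (n e) (m e) l (j e) (m e))"
  unfolding or_in_def obit_def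
  by (intro pgm_if decidable_less decidable_eq prog_anc pgm_add pgm_mult pgm_const a)
 have x: "prog (extend (extend Gm)) (%p. or_e (n (fst (fst p))) l (j (fst (fst p))) (snd (fst p)) (snd p))"
  "prog (extend (extend Gm)) (%p. or_e (n (fst (fst p))) l (j (fst (fst p))) (snd p) (snd (fst p)))"
  unfolding or_e_def by (intro prog_anc pgm_prod_encode pgm_const ex2 pgm_snd)+
 have g: "prog (extend Gm) (%p. or_g (n (fst p)) l (j (fst p)) (snd p))"
  unfolding or_g_def by (intro prog_anc pgm_prod_encode pgm_const ex pgm_snd)
 have mk: "layers_writable Gm 17 (%e. mark_layers (m e + L e + 1) (c e) (or_in (n e) (m e) l (j e)) (or_e (n e) l (j e)) (or_g (n e) l (j e)) sg (mark k (m e) (F e)))" for sg k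
  by (rule layers_mark[OF a(3,5) h a(6,7) u(1) x g])
 have H: "layers_writable Gm (Suc 0) (%e. [map Had (map (or_in (n e) (m e) l (j e)) [m e..<m e + L e + 1])])"
  by (intro layers_single gates_Hads_upt a h u(2))
 have Q: "layers_writable Gm (Suc 0) (%e. [[Had (or_in (n e) (m e) l (j e) (m e))]])" by (intro layers_single gates_Had q)
 have "layers_writable Gm (Suc 0 + (17 + (Suc 0 + (17 + (Suc 0 + (17 + (Suc 0 + (17 + (Suc 0 + (17 + Suc 0))))))))))
  (%e. or_layers (m e) (L e) (F e) (c e) (or_in (n e) (m e) l (j e)) (or_e (n e) l (j e)) (or_g (n e) l (j e)))"
  unfolding or_layers_def Let_def
  using mk[of True 0] mk[of True 1] mk[of False 0] mk[of True 2] by (intro layers_append H Q) (simp_all add: mark_def)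
 then show ?thesis by simp
qed

lemma describe_or_circuit:
 fixes m L F c :: "nat => nat"
 assumes a: "prog [%n. n] m" "prog [%n. n] L" "prog [%n. n] F" "prog [%n. n] (%n. 2^(m n + L n + 1))" "prog [%n. n] c"
 shows "log_space_computable (%n. describe_circuit (or_circuit n (m n) (L n) (F n) (c n)))"
proof (rule log_space_computable_writable)
 let ?G = "[%n :: nat. n]"
 have n: "prog ?G (%n. n)" by (rule pgm_var) simp
 have ex: "prog (extend ?G) (%p. f (fst p))" if "prog ?G f" for f by (rule pgm_extend[OF that])
 have ex2: "prog (extend (extend ?G)) (%p. f (fst (fst p)))" if "prog ?G f" for f using pgm_extend[OF ex[OF that]] by simp
 have sf: "prog (extend (extend ?G)) (%p. snd (fst p))" by (rule pgm_extend[OF pgm_snd])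
 have K: "prog ?G (%n. m n^3)" by (intro pgm_power a)
 have w: "prog ?G (%n. width n (m n) (L n) (c n))"
  unfolding width_def copies_def by (intro pgm_add pgm_mult pgm_prod_encode pgm_const pgm_power n a)
 have N: "prog ?G (%n. num_qubits (or_circuit n (m n) (L n) (F n) (c n)))"
  unfolding or_circuit_def circuit.simps by (intro pgm_add prog_anc w n pgm_const)
 have l0: "layers_writable ?G (Suc 0) (%n. [in_layer n (m n^3)])"
 proof -
  have "gates_writable (extend ?G) (%p. [FanOut (snd p) (map (%k. xcopy (fst p) (snd p) k) (filter (%_. True) [0..<m (fst p)^3]))])"
  proof (rule gates_FanOut_filter)
   have "dec (extend (extend ?G)) (%p. (0 :: nat) = 0)" by (intro decidable_eq pgm_const)
   then show "dec (extend (extend ?G)) (%p. True)" by simp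
   show "prog (extend (extend ?G)) (%p. xcopy (fst (fst p)) (snd (fst p)) (snd p))"
    unfolding xcopy_def by (intro prog_anc ex2[OF n] sf pgm_snd pgm_const)
  qed (intro pgm_snd ex[OF K])+
  then have "gates_writable (extend ?G) (%p. [FanOut (snd p) (map (%k. xcopy (fst p) (snd p) k) [0..<m (fst p)^3])])" by simp
  then show ?thesis unfolding in_layer_def by (subst map_single) (intro layers_single gates_concat n)
 qed
 have t: "layers_writable ?G 16 (%n. par 16 (trial n) [0..<m n^3])"
 proof (rule layers_par[OF K])
  have g: "layers_writable (extend (extend ?G)) 13 (%p. gadget (xcopy (fst (fst p)) (snd p) (snd (fst p))) (coin (fst (fst p)) (snd p) (snd (fst p))))"
  proof -
   have x: "prog (extend (extend ?G)) (%p. xcopy (fst (fst p)) (snd p) (snd (fst p)))" "prog (extend (extend ?G)) (%p. coin (fst (fst p)) (snd p) (snd (fst p)))"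
    unfolding xcopy_def coin_def by (intro prog_anc ex2[OF n] sf pgm_snd pgm_const)+
   have "layers_writable (extend (extend ?G)) (Suc (Suc (Suc 0)) + (9 + Suc 0)) (%p. gadget (xcopy (fst (fst p)) (snd p) (snd (fst p))) (coin (fst (fst p)) (snd p) (snd (fst p))))"
    unfolding gadget_def by (intro layers_append layers_Cons layers_single gates_Had gates_Rot gates_CNot layers_unrot x)
   then show ?thesis by simp
  qed
  have "layers_writable (extend ?G) (13 + 3) (%p. trial (fst p) (snd p))"
   unfolding trial_def
  proof (intro layers_append layers_par layers_parity_all)
   show "prog (extend ?G) (%p. fst p)" using ex[OF n] by simp
   show "prog (extend ?G) (%p. fst p)" using ex[OF n] by simp
   show "layers_writable (extend (extend ?G)) 13 (%p. gadget (xcopy (fst (fst p)) (snd p) (snd (fst p))) (coin (fst (fst p)) (snd p) (snd (fst p))))" by (rule g)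
   show "prog (extend (extend ?G)) (%p. coin (fst (fst p)) (snd p) (snd (fst p)))"
    unfolding coin_def by (intro prog_anc ex2[OF n] sf pgm_snd pgm_const)
   show "prog (extend ?G) (%p. obit (fst p) 0 (snd p))"
    unfolding obit_def by (intro prog_anc ex[OF n] pgm_snd pgm_const)
  qed
  then show "layers_writable (extend ?G) 16 (%p. trial (fst p) (snd p))" by simp
 qed
 have lev: "layers_writable ?G 91 (%n. level n (m n) (L n) (F n) (c n) l)" for l
  unfolding level_def
 proof (rule layers_par)
  show "prog ?G (%n. m n^(3 - l))" by (intro pgm_power a)
  show "layers_writable (extend ?G) 91 (%p. or_layers (m (fst p)) (L (fst p)) (F (fst p)) (c (fst p)) (or_in (fst p) (m (fst p)) l (snd p)) (or_e (fst p) l (snd p)) (or_g (fst p) l (snd p)))"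
   by (rule layers_or[OF ex[OF n] pgm_snd ex[OF a(1)] ex[OF a(2)] ex[OF a(3)] ex[OF a(4)] ex[OF a(5)]])
 qed
 have fin: "layers_writable ?G (Suc 0) (%n. [[CNot (obit n 3 0) n]])"
  unfolding obit_def by (intro layers_single gates_CNot prog_anc n pgm_const)
 have "layers_writable ?G (Suc 0 + (16 + (91 + (91 + (91 + Suc 0))))) (%n. or_circuit_layers n (m n) (L n) (F n) (c n))"
  unfolding or_circuit_layers_def by (intro layers_append l0 t lev fin)
 then have "writable ?G (%n. describe_nat (num_qubits (or_circuit n (m n) (L n) (F n) (c n))) @ concat (map describe_layer (or_circuit_layers n (m n) (L n) (F n) (c n))))"
  by (intro writable_append writable_nat N writable_layers)
 then show "writable ?G (%n. describe_circuit (or_circuit n (m n) (L n) (F n) (c n)))"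
  by (simp add: describe_circuit_def or_circuit_def)
qed

lemma two_ll: "2^ll n <= Suc n"
proof (cases "n = 0")
 case False
 then show ?thesis using ll[of n] by simp
qed (simp add: ll_def)

lemma prog_ll: "prog Gm N ==> prog Gm (%e. ll (N e))"
 unfolding ll_def by (intro pgm_sum pgm_of_bool decidable_pow2_le pgm_Suc pgm_snd pgm_extend)

lemma prog_mm: "prog Gm N ==> prog Gm (%e. mm (N e))"
 unfolding mm_def
 by (intro pgm_search decidable_le pgm_add pgm_mult pgm_power pgm_const pgm_snd pgm_extend prog_ll)

lemma prog_LA: "prog Gm N ==> prog Gm (%e. LA (N e))"
 unfolding LA_def by (intro pgm_add pgm_div prog_ll prog_mm pgm_const)

lemma prog_hA: "prog Gm N ==> prog Gm (%e. hA (N e))"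
 unfolding hA_def by (intro pgm_add prog_mm prog_LA pgm_const)

lemma prog_JJ: "prog Gm N ==> prog Gm (%e. JJ (N e))"
 unfolding JJ_def by (intro pgm_add pgm_div pgm_mult prog_ll prog_mm pgm_const)

lemma prog_PP: "prog Gm N ==> prog Gm (%e. PP (N e))"
 unfolding PP_def by (intro pgm_add pgm_power pgm_const)

lemma prog_sq5: "prog Gm N ==> prog Gm (%e. sq5 (N e))"
 unfolding sq5_def
 by (intro pgm_search decidable_le pgm_mult pgm_power pgm_const pgm_snd pgm_extend prog_PP)

lemma prog_ZZ:
 assumes N: "prog Gm N" and j: "prog Gm j"
 shows "prog Gm (%e. ZZ (N e) (j e))"
proof (rule pgm_rec[where R = "%e v. ZZ (N e) v" and cnt = j and stp = "%e v x. x*(4*PP (N e) - x) div PP (N e)" and bd = "%e. 4*PP (N e)"])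
 show "prog Gm (%e. ZZ (N e) 0)"
  unfolding ZZ_def approx.simps by (intro pgm_diff pgm_mult pgm_const prog_PP prog_sq5 N)
 have "prog (extend (extend Gm)) (%p. PP (N (fst (fst p))))"
  using pgm_extend[OF pgm_extend[OF prog_PP[OF N]]] by simp
 then show "prog (extend (extend Gm)) (%p. snd p*(4*PP (N (fst (fst p))) - snd p) div PP (N (fst (fst p))))"
  by (intro pgm_div pgm_mult pgm_diff pgm_const pgm_snd)
 show "poly_bounded Gm (%e. 4*PP (N e))" by (intro pgm_bounded[of "TYPE(token)"] pgm_mult pgm_const prog_PP N)
qed (auto simp: ZZ_def ZZ_le[unfolded ZZ_def] j)

text \<open>All exponents are logarithmic in \<open>n\<close>. Explicit polynomial bounds are wanted
  because a program computes a power of two only below a computable cap.\<close>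

lemma bounds: "2^mm n <= 16*Suc n" "2^LA n <= (16*Suc n)^2" "2^JJ n <= (16*Suc n)^3" "2^hA n <= 2*(16*Suc n)^3"
proof -
 have "(2 :: nat)^mm n <= 2^(ll n + 4)" using mm(2)[of n] by (intro power_increasing) auto
 also have "... <= 16*Suc n" using two_ll[of n] by (simp add: power_add)
 finally show 1: "2^mm n <= 16*Suc n" .
 have "(2 :: nat)^(ll n div 2) <= 2^ll n" by (intro power_increasing) auto
 then have "(2 :: nat)^(ll n div 2) <= Suc n" using two_ll[of n] by (rule order_trans)
 then have 2: "(2 :: nat)^(ll n div 2) <= 16*Suc n" by (rule order_trans) simp
 show 3: "2^LA n <= (16*Suc n)^2" unfolding LA_def power_add power2_eq_square by (intro mult_mono 1 2) auto
 have "(2 :: nat)^JJ n = 2^(ll n div 2)*(2^mm n*2^mm n)" unfolding JJ_def by (simp add: power_add mult_2)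
 also have "... <= (16*Suc n)*((16*Suc n)*(16*Suc n))" by (intro mult_mono 1 2) auto
 also have "... = (16*Suc n)^3" by (simp only: power3_eq_cube mult.assoc)
 finally show "2^JJ n <= (16*Suc n)^3" .
 have "(2 :: nat)^hA n = 2*(2^mm n*2^LA n)" unfolding hA_def by (simp add: power_add)
 also have "... <= 2*(16*Suc n*(16*Suc n)^2)" by (intro mult_left_mono mult_mono 1 3) auto
 finally show "2^hA n <= 2*(16*Suc n)^3" by (simp add: power3_eq_cube power2_eq_square mult.assoc)
qed

lemma prog_B: "prog Gm N ==> prog Gm (%e. 16*(16*Suc (N e))^k)"
 by (intro pgm_mult pgm_power pgm_Suc pgm_const)

lemma prog_pow_small:
 assumes "prog Gm f" "prog Gm N" "!!e. 2^f e <= 16*(16*Suc (N e))^k"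
 shows "prog Gm (%e. 2^f e)"
 by (rule pgm_pow2_le[OF assms(1) prog_B[OF assms(2),of k] assms(3)])

lemma prog_2LA: "prog Gm N ==> prog Gm (%e. 2^LA (N e))"
 by (rule prog_pow_small[of _ _ N 2]) (auto intro: prog_LA order_trans[OF bounds(2)])

lemma prog_iA: "prog Gm N ==> prog Gm (%e. iA (N e))"
 unfolding iA_def
 by (intro pgm_search decidable_le pgm_add pgm_mult pgm_const pgm_snd pgm_extend[of _ _ N] prog_PP prog_ZZ prog_hA prog_JJ)

lemma dec_caseA: "prog Gm N ==> dec Gm (%e. caseA (N e))"
 unfolding caseA_def
 by (intro decidable_ex decidable_le pgm_add pgm_mult pgm_const pgm_snd pgm_extend[of _ _ N] prog_PP prog_ZZ prog_hA prog_JJ)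

lemma prog_iB: "prog Gm N ==> prog Gm (%e. iB (N e))"
 unfolding iB_def
 by (intro pgm_search decidable_le pgm_diff pgm_add pgm_mult pgm_const pgm_snd pgm_extend[of _ _ N] prog_PP prog_ZZ prog_hA prog_mm prog_2LA)

lemma iAB_le: "iA n <= JJ n" "iB n <= hA n"
 unfolding iA_def iB_def by (rule search_le) (rule order_trans[OF search_le],simp)

lemma pow_iAB: "2^iA n <= 16*(16*Suc n)^3" "2^iB n <= 16*(16*Suc n)^3"
proof -
 have "(2 :: nat)^iA n <= 2^JJ n" "(2 :: nat)^iB n <= 2^hA n" using iAB_le[of n] by (intro power_increasing; simp)+
 then show "2^iA n <= 16*(16*Suc n)^3" "2^iB n <= 16*(16*Suc n)^3" using bounds(3,4)[of n] by linarith+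
qed

lemma prog_table:
 fixes g :: "nat => nat"
 assumes "prog [%n. n] g"
 shows "prog [%n. n] (%n. if n < n0 then T n else g n)"
 by (rule pgm_table[OF pgm_var assms]) simp

lemma prog_parameters:
 shows "prog [%n. n] mm" "prog [%n. n] (pL n0)" "prog [%n. n] (pF n0)" "prog [%n. n] (pc n0 T)" "prog [%n. n] (%n. 2^(mm n + pL n0 n + 1))"
proof -
 have n: "prog [%n :: nat. n] (%n. n)" by (rule pgm_var) simp
 show m: "prog [%n. n] mm" by (rule prog_mm[OF n])
 show L: "prog [%n. n] (pL n0)" unfolding pL_def[abs_def]
  by (intro prog_table pgm_if dec_caseA prog_LA pgm_add prog_iB pgm_const n)
 have 2: "prog [%n. n] (%n. 2^iA n)" "prog [%n. n] (%n. 2^iB n)"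
  by (rule prog_pow_small[OF prog_iA[OF n] n pow_iAB(1)],rule prog_pow_small[OF prog_iB[OF n] n pow_iAB(2)])
 show "prog [%n. n] (pF n0)" unfolding pF_def[abs_def]
  by (intro prog_table pgm_if dec_caseA pgm_div pgm_mult pgm_power pgm_const prog_2LA prog_PP prog_ZZ pgm_add prog_hA prog_iA 2 n)
 show "prog [%n. n] (pc n0 T)" unfolding pc_def[abs_def]
  by (intro prog_table pgm_if dec_caseA 2 pgm_const n)
 show "prog [%n. n] (%n. 2^(mm n + pL n0 n + 1))"
 proof (rule prog_pow_small[where N = "%n. n" and k = 4])
  show "prog [%n. n] (%n. mm n + pL n0 n + 1)" by (intro pgm_add m L pgm_const)
  fix n
  have "pL n0 n <= hA n + 2" using iAB_le(2)[of n] by (simp add: pL_def hA_def)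
  then have "(2 :: nat)^(mm n + pL n0 n + 1) <= 2^(mm n + hA n + 3)" by (intro power_increasing) auto
  also have "... = 8*(2^mm n*2^hA n)" by (simp add: power_add)
  also have "... <= 8*(16*Suc n*(2*(16*Suc n)^3))" by (intro mult_left_mono mult_mono bounds) auto
  also have "... = 16*(16*Suc n)^4" by (simp add: power_numeral_reduce)
  finally show "2^(mm n + pL n0 n + 1) <= 16*(16*Suc n)^4" .
 qed (rule n)
qed

text \<open>The number of parities \<open>P = 2^(2*h + 1)*c\<close> has an exponent of at most
  \<open>7/4*ll n\<close> by \<open>ll_lower\<close>; the numbers of gates and of their inputs
  contribute only powers of \<open>ln n\<close>.\<close>

lemma size_bound:
 assumes n: "1 <= n" "12 <= mm n" and L: "L <= LA n" and c: "c*2^L <= 2^(LA n + JJ n)" and F: "F <= 2^L"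
 shows "real (circuit_size (or_circuit n (mm n) L F c)) <= 291*((real n + 1) + 384*real n*ln n + 768*ln n + 3072*(ln n)\<^sup>2 +
   3072*(ln n)\<^sup>2*n powr (7/4) + 768*ln n*n powr (7/4))"
proof -
 interpret or_params n "mm n" L F c by unfold_locales (use F n in auto)
 have l24: "24*mm n + 12 <= ll n" by (rule ll_lower[OF n(2)])
 have "real (2^ll n) <= real n" using ll[OF n(1)] by (simp only: of_nat_le_iff)
 then have p: "2^ll n <= real n" by simp
 have "ln (2^ll n) <= ln (real n)" using p n by (subst ln_le_cancel_iff) auto
 then have "real (ll n)*ln 2 <= ln n" by (simp add: ln_realpow)
 moreover have "1/2 <= ln (2 :: real)" using ln2_ge_two_thirds by simp
 then have "real (ll n)*(1/2) <= real (ll n)*ln 2" by (intro mult_left_mono) auto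
 ultimately have l: "real (ll n) <= 2*ln n" by linarith
 have m3: "mm n^3 <= 96*ll n"
 proof -
  have "mm n <= 2*(mm n - 1)" using n by simp
  then have "mm n^3 <= (2*(mm n - 1))^3" by (rule power_mono) simp
  also have "... = 8*(mm n - 1)^3" by (simp add: power_mult_distrib)
  also have "... <= 8*(4*(ll n + 2))" using mm(4)[of n] by (intro mult_left_mono) auto
  also have "... <= 96*ll n" using l24 by simp
  finally show ?thesis .
 qed
 then have "real (mm n^3) <= real (96*ll n)" by (simp only: of_nat_le_iff)
 then have m3': "real (mm n)^3 <= 192*ln n" using l by simp
 have hl: "h <= hA n" using L by (simp add: h_def hA_def)
 also have "... <= 2*ll n" using l24 by (simp add: hA_def LA_def)
 finally have h': "real h <= 4*ln n" using l by linarith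
 \<comment> \<open>Splitting a factor \<open>2^h\<close> brings out \<open>c*2^L\<close>, for which
   the parameters provide a joint bound.\<close>
 have "P = 2^h*(2*(c*2^L)*2^(mm n + 1))" by (simp add: P_def copies_def h_def power_add)
 also have "... <= 2^hA n*(2*2^(LA n + JJ n)*2^(mm n + 1))"
  using hl c by (intro mult_mono mult_left_mono mult_right_mono power_increasing) auto
 also have "... = 2^(hA n + (1 + (LA n + JJ n) + (mm n + 1)))" by (simp add: power_add)
 finally have "real P <= real (2^(hA n + (1 + (LA n + JJ n) + (mm n + 1))))" by (simp only: of_nat_le_iff)
 then have "real P <= 2 powr (real (hA n + (1 + (LA n + JJ n) + (mm n + 1))))" by (simp only: powr_realpow[OF zero_less_numeral] of_nat_power of_nat_numeral)
 also have "... <= 2 powr (7/4*ll n)"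
 proof (rule powr_mono)
  have "4*(hA n + (1 + (LA n + JJ n) + (mm n + 1))) <= 7*ll n" using l24 by (simp add: hA_def LA_def JJ_def)
  then have "real (4*(hA n + (1 + (LA n + JJ n) + (mm n + 1)))) <= real (7*ll n)" by (simp only: of_nat_le_iff)
  then show "real (hA n + (1 + (LA n + JJ n) + (mm n + 1))) <= 7/4*ll n" by simp
 qed simp
 also have "... = (2^ll n) powr (7/4)" by (simp add: powr_powr mult.commute flip: powr_realpow)
 also have "... <= n powr (7/4)" using p by (intro powr_mono2) auto
 finally have P': "real P <= n powr (7/4)" .
 have ln0: "0 <= ln (real n)" using n by simp
 have "real (circuit_size (or_circuit n (mm n) L F c)) <= real (291*card used)" using size_or_circuit by (simp only: of_nat_le_iff)
 also have "... <= real (291*((n + 1) + 2*n*mm n^3 + 4*mm n^3 + 4*mm n^3*h + 4*mm n^3*P*h + 4*mm n^3*P))"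
  using card_used by (intro of_nat_mono mult_left_mono) auto
 also have "... = 291*((real n + 1) + 2*real n*real (mm n)^3 + 4*real (mm n)^3 + 4*(real (mm n)^3*real h) + 4*(real (mm n)^3*(real P*real h)) + 4*(real (mm n)^3*real P))"
  by simp
 also have "... <= 291*((real n + 1) + 2*real n*(192*ln n) + 4*(192*ln n) + 4*((192*ln n)*(4*ln n)) +
   4*((192*ln n)*(n powr (7/4)*(4*ln n))) + 4*((192*ln n)*n powr (7/4)))"
  using m3' h' P' ln0 by (intro mult_left_mono add_mono mult_mono) auto
 also have "... = 291*((real n + 1) + 384*real n*ln n + 768*ln n + 3072*(ln n)\<^sup>2 +
   3072*(ln n)\<^sup>2*n powr (7/4) + 768*ln n*n powr (7/4))" by (simp add: power2_eq_square)
 finally show ?thesis .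
qed

theorem theorem4:
 shows "\<exists>\<theta>::real. \<theta> / pi \<notin> \<rat> \<and>
  Or \<in> R_QNC_f0 \<theta> \<and>
  (\<exists>C. uniform_family C \<and> constant_depth C \<and>
         (\<lambda>n. real (circuit_size (C n))) \<in> O(\<lambda>n. real n ^ 2 * ln (real n)) \<and>
     one_sided_error \<theta> C or_fun (\<lambda>n. 1 / real n))"
proof -
 obtain n0 T where F: "!!n. pF n0 n <= 2^pL n0 n"
  and err: "!!n. 1 <= n ==> (65/100)^(mm n^3) + 3*real (mm n)^2*gate_error (mm n) (pL n0 n) (pF n0 n) (pc n0 T n) <= 1/real n"
  and large: "!!n. n0 <= n ==> 12 <= mm n & 1 <= n & pL n0 n <= LA n & pc n0 T n*2^(pL n0 n) <= 2^(LA n + JJ n)"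
  using parameters by metis
 define C where "C n = or_circuit n (mm n) (pL n0 n) (pF n0 n) (pc n0 T n)" for n
 have par: "or_params (mm n) (pL n0 n) (pF n0 n)" for n by unfold_locales (use F mm(3)[of n] in auto)
 have uni: "uniform_family C"
  unfolding uniform_family_def C_def
  using or_params.valid_or_circuit[OF par] describe_or_circuit[OF prog_parameters(1) prog_parameters(2)[of n0] prog_parameters(3)[of n0] prog_parameters(5)[of n0] prog_parameters(4)[of n0 T]] by (intro conjI allI)
 have depth: "constant_depth C"
  unfolding constant_depth_def C_def using or_params.depth_or_circuit[OF par] by (metis order_refl)
 have size: "(%n. real (circuit_size (C n))) \<in> O(%n. real n^2*ln (real n))"
 proof (rule landau_o.big_trans)
  let ?g = "%n :: nat. 291*((real n + 1) + 384*real n*ln n + 768*ln n + 3072*(ln n)\<^sup>2 + 3072*(ln n)\<^sup>2*n powr (7/4) + 768*ln n*n powr (7/4))"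
  show "(%n. real (circuit_size (C n))) \<in> O(?g)"
  proof (rule bigoI[where c = 1])
   show "\<forall>\<^sub>F n in sequentially. norm (real (circuit_size (C n))) <= 1*norm (?g n)"
    unfolding eventually_sequentially
   proof (intro exI allI impI)
    fix n assume "n0 <= n"
    then have "real (circuit_size (C n)) <= ?g n"
     unfolding C_def using large[of n] F[of n] by (intro size_bound) auto
    then show "norm (real (circuit_size (C n))) <= 1*norm (?g n)" by simp
   qed
  qed
  \<comment> \<open>The exponent 7/4 leaves enough room for the squared logarithm.\<close>
  show "?g \<in> O(%n. real n^2*ln (real n))" by real_asymp
 qed
 have one: "one_sided_error golden_angle C or_fun (%n. 1/real n)"
  unfolding one_sided_error_def
 \<comment> \<open>The circuits never err when the or is \<open>False\<close>: zero inputs leave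
   every trial bit and every gate output at 0.\<close>
 proof (intro exI[of _ False] allI impI conjI)
  fix n :: nat and w :: "nat set" assume n: "1 <= n" and w: "w \<subseteq> {..n}"
  interpret or_params n "mm n" "pL n0 n" "pF n0 n" "pc n0 T n" by (rule par)
  have d: "\<delta> = gate_error (mm n) (pL n0 n) (pF n0 n) (pc n0 T n)" by (simp add: \<delta>_def z_def h_def gate_error_def)
  show "outcome_prob golden_angle (C n) n w (xor_value or_fun n w) = 1" if "or_fun n (w Int {..<n}) = False"
   unfolding C_def by (rule outcome(1)[OF w]) (use that in simp)
  show "1 - 1/real n <= outcome_prob golden_angle (C n) n w (xor_value or_fun n w)" if "or_fun n (w Int {..<n}) ~= False"
  proof -
   have "or_fun n (w Int {..<n})" using that by simp
   then show ?thesis unfolding C_def by (rule order_trans[OF diff_left_mono[OF err[OF n]] outcome(2)[OF w,unfolded d]])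
  qed
 qed
 have small: "polynomially_small (%n. 1/real n)"
  unfolding polynomially_small_def by (intro exI[of _ 1]) simp
 have "(%n. real n^2*ln (real n)) \<in> O(%n. real n^3)" by real_asymp
 then have "polynomial_size C" unfolding polynomial_size_def using landau_o.big_trans[OF size] by blast
 then have "Or \<in> R_QNC_f0 golden_angle" unfolding R_QNC_f0_def Or_def using uni depth small one by blast
 then show ?thesis using golden_irrational uni depth size one by blast
qed

end
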